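(* Let $\nu>0$, $m\in\mathbb{N}$ and $a=-2$. Let $m_*\in\mathbb{N}$ be such that $m_*>m$. Assume that $B_{m_*}<+\infty$ and that $\omega_0$ is an $\mathcal{F}_0$-measurable $\dot H^m$-valued random variable. Then the equation $$\omega_t+a u\omega_x-u_x\omega-\nu\omega_{xx}=\xi_t,\qquad u_x=\mathcal{H}(\omega),\qquad\omega(0)=\omega_0$$ has a unique $(\mathcal{F}_t)_{t\ge0}$-adapted solution $\omega\in X_\infty^m$ a.s. Moreover, for each $N\in\mathbb{N}$ there exists a unique solution $\omega^N$ to the projected equation $$\partial_t\omega-\nu\omega_{xx}-P_N\big((P_Nu)_xP_N\omega-a\,P_Nu\,(P_N\omega)_x\big)=P_N\xi_t,\qquad(P_Nu)_x=\mathcal{H}(P_N\omega),\qquad\omega(0)=P_N\omega_0 .$$ In addition, for every $T>0$, $\omega^N$ converges to $\omega$ in $X_T^m$ almost surely as $N\to\infty$.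
   Context: Notation: $\mathbb{N}=\{1,2,\dots\}$, $\mathbb{S}^1=\mathbb{R}/2\pi\mathbb{Z}$, $\mathbb{Z}^*=\mathbb{Z}\setminus\{0\}$. $H$ is the real Hilbert space of $u\in L^2(\mathbb{S}^1)$ with $\int_0^{2\pi}u\,dx=0$, with inner product $\langle u,v\rangle_H=\int_0^{2\pi}uv\,dx$ and orthonormal basis $e_k(x)=\pi^{-1/2}\cos(kx)$ for $k\ge1$, $e_k(x)=\pi^{-1/2}\sin(-kx)$ for $k\le-1$; $u_k=\langle u,e_k\rangle_H$. For $m\in\mathbb{N}$, $\dot H^m=\{u\in H:\|u\|_{\dot H^m}^2:=\sum_{k\in\mathbb{Z}^*}|k|^{2m}u_k^2<\infty\}$. $X_T^m=C([0,T];\dot H^m)$ with norm $\sup_{0\le t\le T}\|f(t)\|_{\dot H^m}$, $X_\infty^m=C([0,\infty);\dot H^m)$. $P_Nf=\sum_{0<|k|\le N}f_ke_k$. Hilbert transform: with complex Fourier coefficients $\hat u(k)=\frac1{2\pi}\int_0^{2\pi}u(x)e^{-ikx}dx$, $\widehat{\mathcal{H}(u)}(k)=-i\,\mathrm{sgn}(k)\hat u(k)$, $\mathrm{sgn}(0)=0$. In the equation, $u$ is the mean-zero function with $u_x=\mathcal{H}(\omega)$, i.e. $u=-(-\partial_x^2)^{-1/2}\omega$. Noise: $(\Omega,\mathcal{F},\mathbb{P},(\mathcal{F}_t)_{t\ge0})$ is a filtered probability space, $\{\beta_k\}_{k\in\mathbb{Z}^*}$ are independent real Brownian motions adapted to $(\mathcal{F}_t)$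 with increments $\beta_k(t)-\beta_k(s)$ independent of $\mathcal{F}_s$ for $s\le t$; $\{b_k\}_{k\in\mathbb{Z}^*}$ is a fixed real sequence, $\xi(t,x)=\sum_{k\in\mathbb{Z}^*}b_k\beta_k(t)e_k(x)$, and $B_m=\sum_{k\in\mathbb{Z}^*}|k|^{2m}b_k^2$. Solution: $\omega\in X_T^m$ is a solution of the first equation on $[0,T]$ if, $\mathbb{P}$-a.s., for all $t\in[0,T]$, in $\dot H^m$, $$\omega(t)=e^{\nu t\partial_x^2}\omega_0+\int_0^te^{\nu(t-s)\partial_x^2}\{-a(u\omega)_x(s)+(1+a)(u_x\omega)(s)\}ds+\int_0^te^{\nu(t-s)\partial_x^2}d\xi(s),$$ where $e^{\nu t\partial_x^2}$ is the heat semigroup; $\omega\in X_\infty^m$ is a solution if it is one on $[0,T]$ for every $T>0$. The projected equation is a finite-dimensional stochastic differential equation on $\mathrm{span}\{e_k:0<|k|\le N\}$. *)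

theory Defs
  imports "HOL-Probability.Probability"
begin

section \<open>Functions on the circle\<close>

text \<open>
  Functions on \<open>\<real>/2\<pi>\<int>\<close> are represented by \<open>2\<pi>\<close>-periodic Borel functions on the reals. Elements of
  \<open>L\<^sup>2\<close> are represented by functions, not by equivalence classes, so equality in \<open>H_circle\<close> or in
  \<open>Hdot m\<close> is equality almost everywhere.
\<close>

definition L2_circle :: "(real \<Rightarrow> real) set" where
  "L2_circle = {f. f \<in> borel_measurable borel \<and> (\<forall>x. f (x + 2 * pi) = f x) \<and>
     set_integrable lborel {0..2*pi} (\<lambda>x. (f x)\<^sup>2)}"

definition H_circle :: "(real \<Rightarrow> real) set" where
  "H_circle = {f \<in> L2_circle. (LBINT x:{0..2*pi}. f x) = 0}"

definition inner_H :: "(real \<Rightarrow> real) \<Rightarrow> (real \<Rightarrow> real) \<Rightarrow> real" where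
  "inner_H u v = (LBINT x:{0..2*pi}. u x * v x)"

definition Zstar :: "int set" where
  "Zstar = {k. k \<noteq> 0}"

definition modes :: "nat \<Rightarrow> int set" where
  "modes N = {k. 0 < \<bar>k\<bar> \<and> \<bar>k\<bar> \<le> int N}"

definition ebasis :: "int \<Rightarrow> real \<Rightarrow> real" where
  "ebasis k x = (if k > 0 then cos (of_int k * x) else sin (- of_int k * x)) / sqrt pi"

definition coef :: "(real \<Rightarrow> real) \<Rightarrow> int \<Rightarrow> real" where
  "coef u k = inner_H u (ebasis k)"

definition Hdot :: "nat \<Rightarrow> (real \<Rightarrow> real) set" where
  "Hdot m = {u \<in> H_circle. (\<lambda>k. real_of_int \<bar>k\<bar> ^ (2 * m) * (coef u k)\<^sup>2) summable_on Zstar}"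

definition Hdot_norm :: "nat \<Rightarrow> (real \<Rightarrow> real) \<Rightarrow> real" where
  "Hdot_norm m u = sqrt (\<Sum>\<^sub>\<infinity>k\<in>Zstar. real_of_int \<bar>k\<bar> ^ (2 * m) * (coef u k)\<^sup>2)"

definition Hdot_borel :: "nat \<Rightarrow> (real \<Rightarrow> real) measure" where
  "Hdot_borel m = sigma (Hdot m)
     {U. U \<subseteq> Hdot m \<and>
         (\<forall>u\<in>U. \<exists>r>0. \<forall>v\<in>Hdot m. Hdot_norm m (\<lambda>x. v x - u x) < r \<longrightarrow> v \<in> U)}"

definition Hdot_continuous_on :: "nat \<Rightarrow> real set \<Rightarrow> (real \<Rightarrow> real \<Rightarrow> real) \<Rightarrow> bool" where
  "Hdot_continuous_on m S f \<longleftrightarrow>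
     (\<forall>t\<in>S. f t \<in> Hdot m \<and>
        ((\<lambda>s. Hdot_norm m (\<lambda>x. f s x - f t x)) \<longlongrightarrow> 0) (at t within S))"

text \<open>The norm of \<open>X_T^m\<close>, taken in the extended nonnegative reals so that the supremum is meaningful
  for every path.\<close>

definition X_norm :: "nat \<Rightarrow> real \<Rightarrow> (real \<Rightarrow> real \<Rightarrow> real) \<Rightarrow> ennreal" where
  "X_norm m T f = (SUP t\<in>{0..T}. ennreal (Hdot_norm m (f t)))"

definition proj :: "nat \<Rightarrow> (real \<Rightarrow> real) \<Rightarrow> real \<Rightarrow> real" where
  "proj N f = (\<lambda>x. \<Sum>k\<in>modes N. coef f k * ebasis k x)"

definition trig_span :: "nat \<Rightarrow> (real \<Rightarrow> real) set" where
  "trig_span N = range (\<lambda>c x. \<Sum>k\<in>modes N. c k * ebasis k x)"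

text \<open>The Bochner integral over \<open>S\<close> of an \<open>Hdot m\<close>-valued function, following
  \<^const>\<open>has_bochner_integral\<close>; that constant needs a normed vector space as a type.
  The \<open>j\<close>-th simple function is \<open>\<Sum>i<n j. indicator (A j i) \<cdot> h j i\<close>.\<close>

definition Hdot_has_integral ::
  "nat \<Rightarrow> real set \<Rightarrow> (real \<Rightarrow> real \<Rightarrow> real) \<Rightarrow> (real \<Rightarrow> real) \<Rightarrow> bool" where
  "Hdot_has_integral m S g J \<longleftrightarrow>
     g \<in> measurable (restrict_space lborel S) (Hdot_borel m) \<and> J \<in> Hdot m \<and>
     (\<exists>(n :: nat \<Rightarrow> nat) (A :: nat \<Rightarrow> nat \<Rightarrow> real set) (h :: nat \<Rightarrow> nat \<Rightarrow> real \<Rightarrow> real).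
        (\<forall>j. \<forall>i<n j. A j i \<in> sets lborel \<and> A j i \<subseteq> S \<and> emeasure lborel (A j i) < \<infinity> \<and>
                      h j i \<in> Hdot m) \<and>
        (\<lambda>j. \<integral>\<^sup>+s\<in>S. ennreal (Hdot_norm m (\<lambda>x. g s x - (\<Sum>i<n j. indicator (A j i) s * h j i x)))
               \<partial>lborel) \<longlonglongrightarrow> 0 \<and>
        (\<lambda>j. Hdot_norm m (\<lambda>x. (\<Sum>i<n j. measure lborel (A j i) * h j i x) - J x)) \<longlonglongrightarrow> 0)"


section \<open>Fourier multipliers\<close>

definition fourier :: "(real \<Rightarrow> real) \<Rightarrow> int \<Rightarrow> complex" where
  "fourier u k = 1 / (2 * pi) *
     (CLBINT x:{0..2*pi}. complex_of_real (u x) * exp (- (\<i> * of_int k * of_real x)))"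

definition is_multiplier :: "(int \<Rightarrow> complex) \<Rightarrow> (real \<Rightarrow> real) \<Rightarrow> (real \<Rightarrow> real) \<Rightarrow> bool" where
  "is_multiplier \<sigma> f g \<longleftrightarrow>
     f \<in> L2_circle \<and> g \<in> L2_circle \<and> (\<forall>k. fourier g k = \<sigma> k * fourier f k)"

text \<open>The value of \<open>multiplier \<sigma> f\<close> is determined almost everywhere if some \<open>L\<^sup>2\<close> function has
  Fourier coefficients \<open>\<sigma> k * fourier f k\<close>, and it is meaningless otherwise. The symbols of the
  Hilbert transform and of the heat semigroup are bounded, so these are defined on all of \<open>L\<^sup>2\<close>;
  the weak derivative \<open>wderiv\<close> is defined on the Sobolev space of order one.\<close>

definition multiplier :: "(int \<Rightarrow> complex) \<Rightarrow> (real \<Rightarrow> real) \<Rightarrow> real \<Rightarrow> real" where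
  "multiplier \<sigma> f = (SOME g. is_multiplier \<sigma> f g)"

definition hilbert :: "(real \<Rightarrow> real) \<Rightarrow> real \<Rightarrow> real" where
  "hilbert = multiplier (\<lambda>k. - \<i> * of_int (sgn k))"

definition wderiv :: "(real \<Rightarrow> real) \<Rightarrow> real \<Rightarrow> real" where
  "wderiv = multiplier (\<lambda>k. \<i> * of_int k)"

definition heat :: "real \<Rightarrow> real \<Rightarrow> (real \<Rightarrow> real) \<Rightarrow> real \<Rightarrow> real" where
  "heat \<nu> t = multiplier (\<lambda>k. of_real (exp (- \<nu> * (of_int k)\<^sup>2 * t)))"

text \<open>The mean-zero solution \<open>u\<close> of \<open>u\<^sub>x = hilbert \<omega>\<close>. The relation \<^const>\<open>is_multiplier\<close> is used instead
  of \<^const>\<open>wderiv\<close> so that \<open>u\<close> is required to have a weak derivative in \<open>L\<^sup>2\<close>.\<close>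

definition velocity :: "(real \<Rightarrow> real) \<Rightarrow> real \<Rightarrow> real" where
  "velocity \<omega> = (SOME u. u \<in> H_circle \<and> is_multiplier (\<lambda>k. \<i> * of_int k) u (hilbert \<omega>))"


section \<open>Noise\<close>

definition filtered_prob_space :: "'a measure \<Rightarrow> (real \<Rightarrow> 'a measure) \<Rightarrow> bool" where
  "filtered_prob_space M F \<longleftrightarrow>
     prob_space M \<and> (\<forall>t\<ge>0. subalgebra M (F t)) \<and>
     (\<forall>s t. 0 \<le> s \<longrightarrow> s \<le> t \<longrightarrow> sets (F s) \<subseteq> sets (F t))"

definition brownian_motion :: "'a measure \<Rightarrow> (real \<Rightarrow> 'a \<Rightarrow> real) \<Rightarrow> bool" where
  "brownian_motion M W \<longleftrightarrow>
     (\<forall>t\<ge>0. W t \<in> borel_measurable M) \<and>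
     (AE w in M. W 0 w = 0) \<and>
     (\<forall>s t. 0 \<le> s \<longrightarrow> s < t \<longrightarrow>
        distributed M lborel (\<lambda>w. W t w - W s w) (normal_density 0 (sqrt (t - s)))) \<and>
     (\<forall>\<tau> n. 0 \<le> \<tau> (0::nat) \<longrightarrow> mono \<tau> \<longrightarrow>
        prob_space.indep_vars M (\<lambda>_. borel) (\<lambda>i w. W (\<tau> (Suc i)) w - W (\<tau> i) w) {..<n}) \<and>
     (AE w in M. continuous_on {0..} (\<lambda>t. W t w))"

definition independent_brownian_motions ::
  "'a measure \<Rightarrow> (real \<Rightarrow> 'a measure) \<Rightarrow> (int \<Rightarrow> real \<Rightarrow> 'a \<Rightarrow> real) \<Rightarrow> bool" where
  "independent_brownian_motions M F \<beta> \<longleftrightarrow>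
     (\<forall>k\<in>Zstar. brownian_motion M (\<beta> k)) \<and>
     prob_space.indep_vars M (\<lambda>_. Pi\<^sub>M {0..} (\<lambda>_. borel)) (\<lambda>k w. \<lambda>t\<in>{0..}. \<beta> k t w) Zstar \<and>
     (\<forall>k\<in>Zstar. \<forall>t\<ge>0. \<beta> k t \<in> borel_measurable (F t)) \<and>
     (\<forall>k\<in>Zstar. \<forall>s t. 0 \<le> s \<longrightarrow> s \<le> t \<longrightarrow>
        prob_space.indep_set M (sets (F s))
          (sets (vimage_algebra (space M) (\<lambda>w. \<beta> k t w - \<beta> k s w) borel)))"

definition B_noise :: "(int \<Rightarrow> real) \<Rightarrow> nat \<Rightarrow> ennreal" where
  "B_noise b m = (\<Sum>\<^sub>\<infinity>k\<in>Zstar. ennreal (real_of_int \<bar>k\<bar> ^ (2 * m) * (b k)\<^sup>2))"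

text \<open>\<open>wiener_integral M W t f I\<close> says that \<open>I\<close> is (a version of) the stochastic integral
  \<open>\<integral>\<^sub>0\<^sup>t f(s) dW(s)\<close> of the deterministic integrand \<open>f\<close>: an \<open>L\<^sup>2(M)\<close>-limit of the integrals of step
  functions converging to \<open>f\<close> in \<open>L\<^sup>2(0,t)\<close>. By the Ito isometry the limit does not depend on the
  approximating sequence.\<close>

definition wiener_integral ::
  "'a measure \<Rightarrow> (real \<Rightarrow> 'a \<Rightarrow> real) \<Rightarrow> real \<Rightarrow> (real \<Rightarrow> real) \<Rightarrow> ('a \<Rightarrow> real) \<Rightarrow> bool" where
  "wiener_integral M W t f I \<longleftrightarrow>
     f \<in> borel_measurable borel \<and> I \<in> borel_measurable M \<and>
     (\<exists>(n :: nat \<Rightarrow> nat) (\<tau> :: nat \<Rightarrow> nat \<Rightarrow> real) (c :: nat \<Rightarrow> nat \<Rightarrow> real).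
        (\<forall>j. mono (\<tau> j) \<and> range (\<tau> j) \<subseteq> {0..t}) \<and>
        (\<lambda>j. \<integral>\<^sup>+s\<in>{0..t}.
               ennreal ((f s - (\<Sum>i<n j. c j i * indicator {\<tau> j i<..\<tau> j (Suc i)} s))\<^sup>2) \<partial>lborel)
          \<longlonglongrightarrow> 0 \<and>
        (\<lambda>j. \<integral>\<^sup>+w. ennreal ((I w - (\<Sum>i<n j. c j i * (W (\<tau> j (Suc i)) w - W (\<tau> j i) w)))\<^sup>2) \<partial>M)
          \<longlonglongrightarrow> 0)"

text \<open>\<open>Z\<close> is a version with continuous paths in \<open>Hdot m\<close> of the process
  \<open>t \<mapsto> \<integral>\<^sub>0\<^sup>t heat \<nu> (t - s) d\<xi>(s)\<close>, \<open>0 \<le> t \<le> T\<close>, where \<open>\<xi>(t,x) = \<Sum>\<^sub>k b k * \<beta> k t * ebasis k x\<close>.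
  Since \<open>heat \<nu> r (ebasis k) = exp (- \<nu> * k\<^sup>2 * r) * ebasis k\<close>, the integral is the sum in \<open>L\<^sup>2(M; Hdot m)\<close> of the
  series of the scalar integrals below.\<close>

definition stochastic_convolution ::
  "'a measure \<Rightarrow> (int \<Rightarrow> real \<Rightarrow> 'a \<Rightarrow> real) \<Rightarrow> (int \<Rightarrow> real) \<Rightarrow> real \<Rightarrow> nat \<Rightarrow> real \<Rightarrow>
     (real \<Rightarrow> 'a \<Rightarrow> real \<Rightarrow> real) \<Rightarrow> bool" where
  "stochastic_convolution M \<beta> b \<nu> m T Z \<longleftrightarrow>
     (\<forall>t\<in>{0..T}. Z t \<in> measurable M (Hdot_borel m)) \<and>
     (AE w in M. Hdot_continuous_on m {0..T} (\<lambda>t. Z t w)) \<and>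
     (\<forall>t\<in>{0..T}. \<exists>I :: int \<Rightarrow> 'a \<Rightarrow> real.
        (\<forall>k\<in>Zstar. wiener_integral M (\<beta> k) t (\<lambda>s. exp (- \<nu> * (of_int k)\<^sup>2 * (t - s))) (I k)) \<and>
        (\<lambda>N. \<integral>\<^sup>+w. ennreal
               ((Hdot_norm m (\<lambda>x. Z t w x - (\<Sum>k\<in>modes N. b k * I k w * ebasis k x)))\<^sup>2) \<partial>M)
          \<longlonglongrightarrow> 0)"


section \<open>Solutions\<close>

definition adapted ::
  "(real \<Rightarrow> 'a measure) \<Rightarrow> nat \<Rightarrow> (real \<Rightarrow> 'a \<Rightarrow> real \<Rightarrow> real) \<Rightarrow> bool" where
  "adapted F m \<omega> \<longleftrightarrow> (\<forall>t\<ge>0. \<omega> t \<in> measurable (F t) (Hdot_borel m))"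

definition indistinguishable ::
  "'a measure \<Rightarrow> (real \<Rightarrow> 'a \<Rightarrow> real \<Rightarrow> real) \<Rightarrow> (real \<Rightarrow> 'a \<Rightarrow> real \<Rightarrow> real) \<Rightarrow> bool" where
  "indistinguishable M \<omega> \<omega>' \<longleftrightarrow>
     (AE w in M. \<forall>t\<ge>0. AE x in lborel. \<omega> t w x = \<omega>' t w x)"

definition drift :: "real \<Rightarrow> (real \<Rightarrow> real) \<Rightarrow> real \<Rightarrow> real" where
  "drift a \<omega> = (let u = velocity \<omega> in
     (\<lambda>x. - a * wderiv (\<lambda>y. u y * \<omega> y) x + (1 + a) * (wderiv u x * \<omega> x)))"

text \<open>The time integral is taken over \<open>{0..<t}\<close> because at \<open>s = t\<close> the integrand is \<open>drift a (\<omega> t)\<close>,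
  which in general is not in \<open>Hdot m\<close>.\<close>

definition mild_solution_on ::
  "'a measure \<Rightarrow> (int \<Rightarrow> real \<Rightarrow> 'a \<Rightarrow> real) \<Rightarrow> (int \<Rightarrow> real) \<Rightarrow> real \<Rightarrow> real \<Rightarrow> nat \<Rightarrow>
     ('a \<Rightarrow> real \<Rightarrow> real) \<Rightarrow> real \<Rightarrow> (real \<Rightarrow> 'a \<Rightarrow> real \<Rightarrow> real) \<Rightarrow> bool" where
  "mild_solution_on M \<beta> b \<nu> a m \<omega>0 T \<omega> \<longleftrightarrow>
     (AE w in M. Hdot_continuous_on m {0..T} (\<lambda>t. \<omega> t w)) \<and>
     (\<exists>Z. stochastic_convolution M \<beta> b \<nu> m T Z \<and>
        (AE w in M. \<forall>t\<in>{0..T}. \<exists>J.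
           Hdot_has_integral m {0..<t} (\<lambda>s. heat \<nu> (t - s) (drift a (\<omega> s w))) J \<and>
           (AE x in lborel. \<omega> t w x = heat \<nu> t (\<omega>0 w) x + J x + Z t w x)))"

definition mild_solution ::
  "'a measure \<Rightarrow> (int \<Rightarrow> real \<Rightarrow> 'a \<Rightarrow> real) \<Rightarrow> (int \<Rightarrow> real) \<Rightarrow> real \<Rightarrow> real \<Rightarrow> nat \<Rightarrow>
     ('a \<Rightarrow> real \<Rightarrow> real) \<Rightarrow> (real \<Rightarrow> 'a \<Rightarrow> real \<Rightarrow> real) \<Rightarrow> bool" where
  "mild_solution M \<beta> b \<nu> a m \<omega>0 \<omega> \<longleftrightarrow> (\<forall>T>0. mild_solution_on M \<beta> b \<nu> a m \<omega>0 T \<omega>)"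

text \<open>\<open>proj N (velocity (proj N f))\<close> is the element \<open>v\<close> of \<open>trig_span N\<close> with \<open>v\<^sub>x = hilbert (proj N f)\<close>.
  All functions differentiated below are trigonometric polynomials, so \<^const>\<open>deriv\<close> is the
  classical derivative.\<close>

definition galerkin_nonlinearity :: "real \<Rightarrow> nat \<Rightarrow> (real \<Rightarrow> real) \<Rightarrow> real \<Rightarrow> real" where
  "galerkin_nonlinearity a N f = (let v = proj N (velocity (proj N f)); g = proj N f in
     proj N (\<lambda>x. deriv v x * g x - a * v x * deriv g x))"

text \<open>The noise in the projected equation is additive, so \<open>\<integral>\<^sub>0\<^sup>t P\<^sub>N d\<xi>\<close> is the projection of \<open>\<xi>(t)\<close>
  and no stochastic integral is needed in its integrated form.\<close>

definition galerkin_solution ::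
  "'a measure \<Rightarrow> (int \<Rightarrow> real \<Rightarrow> 'a \<Rightarrow> real) \<Rightarrow> (int \<Rightarrow> real) \<Rightarrow> real \<Rightarrow> real \<Rightarrow> nat \<Rightarrow>
     ('a \<Rightarrow> real \<Rightarrow> real) \<Rightarrow> nat \<Rightarrow> (real \<Rightarrow> 'a \<Rightarrow> real \<Rightarrow> real) \<Rightarrow> bool" where
  "galerkin_solution M \<beta> b \<nu> a m \<omega>0 N \<omega> \<longleftrightarrow>
     (AE w in M.
        Hdot_continuous_on m {0..} (\<lambda>t. \<omega> t w) \<and>
        (\<forall>t\<ge>0. \<omega> t w \<in> trig_span N \<and>
           (\<forall>x. \<omega> t w x =
              proj N (\<omega>0 w) x
              + (LBINT s:{0..t}.
                   \<nu> * deriv (deriv (\<omega> s w)) x + galerkin_nonlinearity a N (\<omega> s w) x)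
              + (\<Sum>k\<in>modes N. b k * \<beta> k t w * ebasis k x))))"

end

theory Submission
  imports Defs
begin

text \<open>
  In the weighted Fourier coefficients \<open>\<bar>k\<bar> ^ m * coef \<omega> k\<close> the mild equation becomes \<open>y = f + Duh (Q y y)\<close> on
  square summable sequences. Here \<open>Q\<close> is bounded and bilinear, because the derivative that the nonlinearity loses
  is regained by the Duhamel operator \<open>Duh\<close>, and \<open>f\<close> is the heat flow of the initial value plus the stochastic
  convolution \<open>z\<close>. With \<open>Q\<close> cut off outside a ball the equation has a Lipschitz nonlinearity: Picard iteration
  and Gronwall's inequality give existence, uniqueness and convergence of the Galerkin approximations.

  The cut-off is removed by an a priori bound that is uniform in the cut-off and in the Galerkin truncation. For
  \<open>a = -2\<close> the nonlinearity is orthogonal to \<open>\<omega>\<close> in \<open>L\<^sup>2\<close>, so the energy estimate for \<open>y - z\<close> bounds the solution in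
  \<open>L\<^sup>\<infinity>(0,T; L\<^sup>2)\<close> and in \<open>L\<^sup>2(0,T; H\<^sup>1)\<close>; as \<open>\<parallel>Q y y\<parallel>\<close> is at most a constant times the product of the \<open>H\<^sup>m\<close> norm and the \<open>H\<^sup>1\<close> norm,
  Gronwall's inequality then bounds the \<open>H\<^sup>m\<close> norm.

  Since \<open>m_star > m\<close>, the series \<open>\<Sum>k. \<bar>k\<bar> ^ m * \<bar>b k\<bar>\<close> converges. Chaining bounds the expected maximum of
  a Brownian path, hence almost surely the coordinates of \<open>z\<close> are dominated on \<open>[0,T]\<close> by a summable sequence.
  Everything after that is deterministic, path by path.
\<close>

section \<open>A sequence space\<close>

text \<open>The analysis takes place in a Banach space type \<open>hs\<close>, because
  \<open>Hdot m\<close> is a set of functions and not a type; integrals and measurability are then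
  standard, and results are carried back at the end. The energy identity is proved for Galerkin
  truncations only, where the energy is a finite sum that can be differentiated term by term; the
  full equation inherits the bound as a limit of truncations with the same cut-off. Subtracting
  \<open>z\<close> before the energy is computed makes it differentiable path by path and replaces
  Ito's formula. The price is a pairing of \<open>z\<close> with the nonlinearity: one derivative
  has to be put on \<open>z\<close>, and its coordinates enter through a sum of absolute values
  rather than of squares. This is what the stronger assumption on the noise pays for. The filtration
  is not assumed complete, so no object may be altered on a null set: solutions and stochastic
  integrals are limits of finite expressions in the path, defined for every sample, and have their
  properties on the samples called \<open>good\<close>.\<close>

lemma summable_sq_mult:
  fixes f g :: "'i \<Rightarrow> real"
  assumes "(\<lambda>k. (f k)\<^sup>2) summable_on A" "(\<lambda>k. (g k)\<^sup>2) summable_on A"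
  shows "(\<lambda>k. f k * g k) summable_on A" "(\<lambda>k. \<bar>f k * g k\<bar>) summable_on A"
proof -
  have "\<bar>f k * g k\<bar> \<le> (f k)\<^sup>2 + (g k)\<^sup>2" for k
  proof -
    have "2 * \<bar>f k * g k\<bar> \<le> (f k)\<^sup>2 + (g k)\<^sup>2"
      using sum_squares_bound[of "\<bar>f k\<bar>" "\<bar>g k\<bar>"] by (simp add: abs_mult)
    then show ?thesis using abs_ge_zero[of "f k * g k"] by linarith
  qed
  moreover have "(\<lambda>k. (f k)\<^sup>2 + (g k)\<^sup>2) summable_on A"
    using assms by (rule summable_on_add)
  ultimately show *: "(\<lambda>k. \<bar>f k * g k\<bar>) summable_on A"
    by (rule_tac summable_on_comparison_test) (assumption | rule abs_ge_zero)+
  then show "(\<lambda>k. f k * g k) summable_on A"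
    using summable_on_iff_abs_summable_on_real[of "\<lambda>k. f k * g k" A] by simp
qed

lemma summable_sq_add:
  fixes f g :: "'i \<Rightarrow> real"
  assumes "(\<lambda>k. (f k)\<^sup>2) summable_on A" "(\<lambda>k. (g k)\<^sup>2) summable_on A"
  shows "(\<lambda>k. (f k + g k)\<^sup>2) summable_on A"
proof -
  have "(\<lambda>k. (f k)\<^sup>2 + (g k)\<^sup>2 + 2 * (f k * g k)) summable_on A"
    by (intro summable_on_add summable_on_cmult_right summable_sq_mult assms)
  then show ?thesis
    by (simp add: power2_sum mult.assoc)
qed

lemma infsum_Cauchy_Schwarz:
  fixes f g :: "'i \<Rightarrow> real"
  assumes "(\<lambda>k. (f k)\<^sup>2) summable_on A" "(\<lambda>k. (g k)\<^sup>2) summable_on A"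
  shows "(\<Sum>\<^sub>\<infinity>k\<in>A. \<bar>f k * g k\<bar>) \<le> sqrt (\<Sum>\<^sub>\<infinity>k\<in>A. (f k)\<^sup>2) * sqrt (\<Sum>\<^sub>\<infinity>k\<in>A. (g k)\<^sup>2)"
proof (rule infsum_le_finite_sums)
  show "(\<lambda>k. \<bar>f k * g k\<bar>) summable_on A" using assms by (rule summable_sq_mult)
  fix F assume F: "finite F" "F \<subseteq> A"
  have "(\<Sum>k\<in>F. \<bar>f k * g k\<bar>) \<le> L2_set f F * L2_set g F"
    using L2_set_mult_ineq[of f g F] by (simp add: abs_mult)
  also have "\<dots> \<le> sqrt (\<Sum>\<^sub>\<infinity>k\<in>A. (f k)\<^sup>2) * sqrt (\<Sum>\<^sub>\<infinity>k\<in>A. (g k)\<^sup>2)"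
    unfolding L2_set_def using F assms
    by (intro mult_mono real_sqrt_le_mono finite_sum_le_infsum) (auto intro: sum_nonneg infsum_nonneg)
  finally show "(\<Sum>k\<in>F. \<bar>f k * g k\<bar>) \<le> sqrt (\<Sum>\<^sub>\<infinity>k\<in>A. (f k)\<^sup>2) * sqrt (\<Sum>\<^sub>\<infinity>k\<in>A. (g k)\<^sup>2)" .
qed

lemma summable_on_bdd:
  fixes f :: "'i \<Rightarrow> real"
  assumes "\<And>k. k \<in> A \<Longrightarrow> 0 \<le> f k" "\<And>F. finite F \<Longrightarrow> F \<subseteq> A \<Longrightarrow> sum f F \<le> C"
  shows "f summable_on A" "(\<Sum>\<^sub>\<infinity>k\<in>A. f k) \<le> C"
proof -
  show *: "f summable_on A"
    by (rule nonneg_bdd_above_summable_on) (use assms in \<open>auto intro!: bdd_aboveI2[where M=C]\<close>)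
  show "(\<Sum>\<^sub>\<infinity>k\<in>A. f k) \<le> C"
    by (rule infsum_le_finite_sums[OF *]) (use assms in auto)
qed

text \<open>The state space: the coordinate \<open>k\<close> stands for the weighted coefficient
  \<open>\<bar>k\<bar> ^ m * coef u k\<close>, and the coordinate \<open>0\<close> is only kept to index by all integers.\<close>

typedef hs = "{f :: int \<Rightarrow> real. f 0 = 0 \<and> (\<lambda>k. (f k)\<^sup>2) summable_on UNIV}"
  morphisms hnth Abs_hs
  by (rule exI[of _ "\<lambda>_. 0"]) auto

setup_lifting type_definition_hs

lemma hnth_0 [simp]: "hnth x 0 = 0" and summable_hnth: "(\<lambda>k. (hnth x k)\<^sup>2) summable_on UNIV"
  using hnth[of x] by auto

lemma hs_eqI: "(\<And>k. hnth x k = hnth y k) \<Longrightarrow> x = y"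
  by (metis ext hnth_inject)

instantiation hs :: real_vector
begin

lift_definition zero_hs :: hs is "\<lambda>_. 0" by auto
lift_definition plus_hs :: "hs \<Rightarrow> hs \<Rightarrow> hs" is "\<lambda>f g k. f k + g k" by (auto intro: summable_sq_add)
lift_definition uminus_hs :: "hs \<Rightarrow> hs" is "\<lambda>f k. - f k" by auto
lift_definition minus_hs :: "hs \<Rightarrow> hs \<Rightarrow> hs" is "\<lambda>f g k. f k - g k"
  using summable_sq_add[of _ UNIV "\<lambda>k. - g k" for g] by (auto)
lift_definition scaleR_hs :: "real \<Rightarrow> hs \<Rightarrow> hs" is "\<lambda>c f k. c * f k"
  by (auto simp: power_mult_distrib intro: summable_on_cmult_right)
instance
proof
  fix x y z :: hs and a b :: real
  show "x - y = x + - y" "x + y + z = x + (y + z)" "x + y = y + x" "0 + x = x" "- x + x = 0"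
    by (transfer; simp add: algebra_simps)+
  show "a *\<^sub>R (x + y) = a *\<^sub>R x + a *\<^sub>R y" "(a + b) *\<^sub>R x = a *\<^sub>R x + b *\<^sub>R x"
    "a *\<^sub>R b *\<^sub>R x = (a * b) *\<^sub>R x" "1 *\<^sub>R x = x"
    by (transfer; simp add: algebra_simps)+
qed

end

instantiation hs :: real_inner
begin

definition inner_hs :: "hs \<Rightarrow> hs \<Rightarrow> real" where "inner_hs x y = (\<Sum>\<^sub>\<infinity>k. hnth x k * hnth y k)"
definition norm_hs :: "hs \<Rightarrow> real" where "norm_hs x = sqrt (inner x x)"
definition dist_hs :: "hs \<Rightarrow> hs \<Rightarrow> real" where "dist_hs x y = norm (x - y)"
definition sgn_hs :: "hs \<Rightarrow> hs" where "sgn_hs x = x /\<^sub>R norm x"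
definition uniformity_hs :: "(hs \<times> hs) filter" where
  "uniformity_hs = (INF e\<in>{0 <..}. principal {(x, y). dist x y < e})"
definition open_hs :: "hs set \<Rightarrow> bool" where
  "open_hs S = (\<forall>x\<in>S. \<forall>\<^sub>F (x', y) in uniformity. x' = x \<longrightarrow> y \<in> S)"

instance
proof
  fix x y z :: hs and a b :: real
  show "dist x y = norm (x - y)" by (rule dist_hs_def)
  show "sgn x = x /\<^sub>R norm x" by (rule sgn_hs_def)
  show "uniformity = (INF e\<in>{0 <..}. principal {(x::hs, y). dist x y < e})" by (rule uniformity_hs_def)
  show "open U = (\<forall>x\<in>U. \<forall>\<^sub>F (x', y) in uniformity. x' = x \<longrightarrow> y \<in> U)" for U :: "hs set"
    by (rule open_hs_def)
  show "inner x y = inner y x" by (simp add: inner_hs_def mult.commute)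
  show "inner (x + y) z = inner x z + inner y z"
    by (simp add: inner_hs_def plus_hs.rep_eq distrib_right infsum_add summable_sq_mult summable_hnth)
  show "inner (a *\<^sub>R x) y = a * inner x y"
    by (simp add: inner_hs_def scaleR_hs.rep_eq mult.assoc infsum_cmult_right')
  show "0 \<le> inner x x" by (simp add: inner_hs_def infsum_nonneg)
  show "norm x = sqrt (inner x x)" by (rule norm_hs_def)
  have "x = 0" if "inner x x = 0"
  proof (rule hs_eqI)
    fix k
    have "hnth x k * hnth x k = 0"
      using that summable_hnth[of x] unfolding inner_hs_def
      by (intro nonneg_infsum_le_0D[of "\<lambda>k. hnth x k * hnth x k" UNIV]) (auto simp: power2_eq_square)
    then show "hnth x k = hnth 0 k" by (simp add: zero_hs.rep_eq)
  qed
  then show "inner x x = 0 \<longleftrightarrow> x = 0"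
    by (auto simp: inner_hs_def zero_hs.rep_eq)
qed

end

lemma hnth_simps [simp]:
  "hnth 0 k = 0" "hnth (x + y) k = hnth x k + hnth y k" "hnth (x - y) k = hnth x k - hnth y k"
  "hnth (- x) k = - hnth x k" "hnth (c *\<^sub>R x) k = c * hnth x k"
  by (transfer, simp)+

lemma hnth_sum [simp]: "hnth (\<Sum>i\<in>A. f i) k = (\<Sum>i\<in>A. hnth (f i) k)"
  by (induction A rule: infinite_finite_induct) auto

lemma norm_hs_sq: "(norm x)\<^sup>2 = (\<Sum>\<^sub>\<infinity>k. (hnth x k)\<^sup>2)"
  unfolding norm_hs_def by (simp add: inner_hs_def power2_eq_square infsum_nonneg)

lemma sum_hnth_le: "finite F \<Longrightarrow> (\<Sum>k\<in>F. (hnth x k)\<^sup>2) \<le> (norm x)\<^sup>2"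
  unfolding norm_hs_sq by (intro finite_sum_le_infsum summable_hnth) auto

lemma abs_hnth_le: "\<bar>hnth x k\<bar> \<le> norm x"
  using sum_hnth_le[of "{k}" x] abs_le_square_iff[of "hnth x k" "norm x"] by simp

lemma bounded_linear_hnth: "bounded_linear (\<lambda>x. hnth x k)"
  by (rule bounded_linear_intro[where K=1]) (auto simp: abs_hnth_le)

lemmas continuous_on_hnth [continuous_intros] = bounded_linear.continuous_on[OF bounded_linear_hnth]

lemma hnth_Abs:
  assumes "f 0 = 0" "\<And>F. finite F \<Longrightarrow> (\<Sum>k\<in>F. (f k)\<^sup>2) \<le> C"
  shows "hnth (Abs_hs f) = f"
  using assms summable_on_bdd(1)[of UNIV "\<lambda>k. (f k)\<^sup>2" C] by (intro Abs_hs_inverse) simp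

lemma norm_hs_le:
  assumes "\<And>F. finite F \<Longrightarrow> (\<Sum>k\<in>F. (hnth x k)\<^sup>2) \<le> C"
  shows "(norm x)\<^sup>2 \<le> C"
  unfolding norm_hs_sq by (rule summable_on_bdd) (use assms in auto)

text \<open>On each finite set of coordinates the Cauchy estimate passes to the coordinatewise
  limit. These uniform finite bounds give first that the limit is square summable and then
  convergence in norm.\<close>

instance hs :: banach
proof
  fix X :: "nat \<Rightarrow> hs" assume X: "Cauchy X"
  have "Cauchy (\<lambda>n. hnth (X n) k)" for k
    by (rule bounded_linear.Cauchy[OF bounded_linear_hnth X])
  then have "\<exists>l. (\<lambda>n. hnth (X n) k) \<longlonglongrightarrow> l" for k
    using Cauchy_convergent by (auto simp: convergent_def)
  then obtain l where l: "\<And>k. (\<lambda>n. hnth (X n) k) \<longlonglongrightarrow> l k" by metis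
  have l0: "l 0 = 0" using LIMSEQ_unique[OF l[of 0]] by simp
  have fatou: "(\<Sum>k\<in>F. (hnth (X n) k - l k)\<^sup>2) \<le> e\<^sup>2"
    if "finite F" "\<And>i j. i \<ge> M \<Longrightarrow> j \<ge> M \<Longrightarrow> norm (X i - X j) \<le> e" "n \<ge> M" for F n M e
  proof (rule LIMSEQ_le_const2)
    show "(\<lambda>j. \<Sum>k\<in>F. (hnth (X n) k - hnth (X j) k)\<^sup>2) \<longlonglongrightarrow> (\<Sum>k\<in>F. (hnth (X n) k - l k)\<^sup>2)"
      by (intro tendsto_intros l)
    show "\<exists>N. \<forall>j\<ge>N. (\<Sum>k\<in>F. (hnth (X n) k - hnth (X j) k)\<^sup>2) \<le> e\<^sup>2"
    proof (intro exI allI impI)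
      fix j assume "j \<ge> M"
      have "(\<Sum>k\<in>F. (hnth (X n - X j) k)\<^sup>2) \<le> (norm (X n - X j))\<^sup>2"
        by (rule sum_hnth_le[OF that(1)])
      also have "\<dots> \<le> e\<^sup>2" using that(2)[OF that(3) \<open>j \<ge> M\<close>] by (intro power_mono) auto
      finally show "(\<Sum>k\<in>F. (hnth (X n) k - hnth (X j) k)\<^sup>2) \<le> e\<^sup>2" by simp
    qed
  qed
  obtain M where M: "\<And>i j. i \<ge> M \<Longrightarrow> j \<ge> M \<Longrightarrow> norm (X i - X j) \<le> 1"
    using X unfolding Cauchy_iff by (meson less_imp_le zero_less_one)
  have "(\<lambda>k. (hnth (X M) k - l k)\<^sup>2) summable_on UNIV"
    by (rule summable_on_bdd[where C="1\<^sup>2"]) (rule zero_le_power2, rule fatou[OF _ M order_refl])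
  from summable_sq_add[OF this, of "\<lambda>k. - hnth (X M) k"]
  have "(\<lambda>k. (l k)\<^sup>2) summable_on UNIV" by (simp add: summable_hnth)
  then have L: "hnth (Abs_hs l) = l" using l0 by (intro Abs_hs_inverse) auto
  have "X \<longlonglongrightarrow> Abs_hs l"
  proof (rule LIMSEQ_I)
    fix e :: real assume "e > 0"
    then obtain M where M: "\<And>i j. i \<ge> M \<Longrightarrow> j \<ge> M \<Longrightarrow> norm (X i - X j) \<le> e/2"
      using X unfolding Cauchy_iff by (meson half_gt_zero less_imp_le)
    show "\<exists>no. \<forall>n\<ge>no. norm (X n - Abs_hs l) < e"
    proof (intro exI allI impI)
      fix n assume "n \<ge> M"
      have "(norm (X n - Abs_hs l))\<^sup>2 \<le> (e/2)\<^sup>2"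
        unfolding norm_hs_sq hnth_simps L by (rule summable_on_bdd(2), rule zero_le_power2, rule fatou[OF _ M \<open>n \<ge> M\<close>])
      then show "norm (X n - Abs_hs l) < e" using \<open>e > 0\<close>
power2_le_imp_le[of "norm (X n - Abs_hs l)" "e/2"] by simp
    qed
  qed
  then show "convergent X" by (auto simp: convergent_def)
qed

text \<open>Coordinate \<open>0\<close> vanishes throughout \<open>hs\<close>, so
  \<open>hbas 0\<close> is set to the zero vector; the other \<open>hbas k\<close> are the
  orthonormal coordinate vectors.\<close>

definition hbas :: "int \<Rightarrow> hs" where "hbas k = Abs_hs (\<lambda>j. if j = k \<and> k \<noteq> 0 then 1 else 0)"

lemma hnth_hbas [simp]: "hnth (hbas k) j = (if j = k \<and> k \<noteq> 0 then 1 else 0)"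
proof -
  have "hnth (Abs_hs (\<lambda>j. if j = k \<and> k \<noteq> 0 then 1 else 0)) = (\<lambda>j. if j = k \<and> k \<noteq> 0 then 1 else 0)"
  proof (rule hnth_Abs[where C=1])
    fix F :: "int set" assume "finite F"
    have "(\<Sum>j\<in>F. (if j = k \<and> k \<noteq> 0 then 1 else 0)\<^sup>2) \<le> (\<Sum>j\<in>F. if j = k then 1 else (0::real))"
      by (intro sum_mono) auto
    also have "\<dots> \<le> 1" using \<open>finite F\<close> by simp
    finally show "(\<Sum>j\<in>F. (if j = k \<and> k \<noteq> 0 then 1 else 0)\<^sup>2) \<le> (1::real)" .
  qed auto
  then show ?thesis by (simp add: hbas_def)
qed

lemma norm_hbas_le: "norm (hbas k) \<le> 1"
proof -
  have "(norm (hbas k))\<^sup>2 \<le> 1"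
  proof (rule norm_hs_le)
    fix F :: "int set" assume "finite F"
    have "(\<Sum>j\<in>F. (hnth (hbas k) j)\<^sup>2) \<le> (\<Sum>j\<in>F. if j = k then 1 else (0::real))"
      by (intro sum_mono) auto
    also have "\<dots> \<le> 1" using \<open>finite F\<close> by simp
    finally show "(\<Sum>j\<in>F. (hnth (hbas k) j)\<^sup>2) \<le> 1" .
  qed
  then show ?thesis using power2_le_imp_le[of "norm (hbas k)" 1] by simp
qed

lemma finite_modes [simp]: "finite (modes N)"
  by (rule finite_subset[of _ "{- int N..int N}"]) (auto simp: modes_def)

lemma zero_notin_modes [simp]: "0 \<notin> modes N" by (simp add: modes_def)

lemma modes_mono: "N \<le> N' \<Longrightarrow> modes N \<subseteq> modes N'" by (auto simp: modes_def)

lemma finite_subset_modes: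
  assumes "finite F" "0 \<notin> F" obtains N where "F \<subseteq> modes N"
proof -
  obtain K where K: "\<And>k. k \<in> F \<Longrightarrow> \<bar>k\<bar> \<le> K"
    using finite_imageI[OF assms(1), of abs] by (metis Max_ge image_eqI)
  have "F \<subseteq> modes (nat K)"
    using K assms(2) by (force simp: modes_def)
  then show ?thesis by (rule that)
qed

definition hproj :: "nat \<Rightarrow> hs \<Rightarrow> hs" where "hproj N x = (\<Sum>k\<in>modes N. hnth x k *\<^sub>R hbas k)"

lemma hnth_hproj [simp]: "hnth (hproj N x) k = (if k \<in> modes N then hnth x k else 0)"
proof -
  have "hnth (hproj N x) k = (\<Sum>j\<in>modes N. if j = k then hnth x k else 0)"
    unfolding hproj_def hnth_sum by (intro sum.cong) (auto simp: modes_def)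
  then show ?thesis by simp
qed

lemma norm_hproj_sq: "(norm (hproj N x))\<^sup>2 = (\<Sum>k\<in>modes N. (hnth x k)\<^sup>2)"
proof -
  have "(\<Sum>\<^sub>\<infinity>k. (hnth (hproj N x) k)\<^sup>2) = (\<Sum>\<^sub>\<infinity>k\<in>modes N. (hnth x k)\<^sup>2)"
    by (intro infsum_cong_neutral) auto
  then show ?thesis by (simp add: norm_hs_sq)
qed

lemma norm_hproj_le: "norm (hproj N x) \<le> norm x"
  using sum_hnth_le[of "modes N" x] by (rule_tac power2_le_imp_le) (simp_all add: norm_hproj_sq)

lemma bounded_linear_hproj: "bounded_linear (hproj N)"
  by (rule bounded_linear_intro[where K=1]) (auto simp: norm_hproj_le intro!: hs_eqI)

lemma norm_hs_coord_mono:
  assumes "\<And>k. \<bar>hnth x k\<bar> \<le> \<bar>hnth y k\<bar>" shows "norm x \<le> norm y"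
proof -
  have "(norm x)\<^sup>2 \<le> (norm y)\<^sup>2" unfolding norm_hs_sq
    by (intro infsum_mono summable_hnth) (use assms in \<open>simp add: abs_le_square_iff\<close>)
  then show ?thesis by (rule power2_le_imp_le) simp
qed

text \<open>Pythagoras: the remainder is orthogonal to the projection, and the projection captures
  all but \<open>e\<^sup>2/2\<close> of the squared norm once \<open>modes n\<close> contains a
  suitable finite set.\<close>

lemma hproj_tendsto: "(\<lambda>N. hproj N x) \<longlonglongrightarrow> x"
proof (rule LIMSEQ_I)
  fix e :: real assume e: "e > 0"
  obtain F where F: "finite F" "dist (\<Sum>k\<in>F. (hnth x k)\<^sup>2) (\<Sum>\<^sub>\<infinity>k. (hnth x k)\<^sup>2) \<le> e\<^sup>2/2"
    using infsum_finite_approximation[OF summable_hnth, of "e\<^sup>2/2" x] e by auto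
  obtain N0 where N0: "F - {0} \<subseteq> modes N0" using F finite_subset_modes[of "F - {0}"] by auto
  show "\<exists>no. \<forall>n\<ge>no. norm (hproj n x - x) < e"
  proof (intro exI allI impI)
    fix n assume "n \<ge> N0"
    then have sub: "F - {0} \<subseteq> modes n" using N0 modes_mono by blast
    \<comment> \<open>The supports are disjoint, so every term vanishes and the sum reduces to one
      over the empty set.\<close>
    have "inner (x - hproj n x) (hproj n x) = (\<Sum>\<^sub>\<infinity>k\<in>({}::int set). 0)"
      unfolding inner_hs_def by (intro infsum_cong_neutral) auto
    then have "(norm x)\<^sup>2 = (norm (hproj n x))\<^sup>2 + (norm (x - hproj n x))\<^sup>2"
      by (simp add: power2_norm_eq_inner algebra_simps inner_commute)
    moreover have "(norm (hproj n x))\<^sup>2 \<ge> (\<Sum>k\<in>F. (hnth x k)\<^sup>2)"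
    proof -
      have "(\<Sum>k\<in>F. (hnth x k)\<^sup>2) = (\<Sum>k\<in>F - {0}. (hnth x k)\<^sup>2)"
        by (intro sum.mono_neutral_right) (use F in auto)
      also have "\<dots> \<le> (\<Sum>k\<in>modes n. (hnth x k)\<^sup>2)" using sub by (intro sum_mono2) auto
      finally show ?thesis by (simp add: norm_hproj_sq)
    qed
    ultimately have "(norm (x - hproj n x))\<^sup>2 \<le> e\<^sup>2/2"
      using F(2) unfolding dist_real_def norm_hs_sq[symmetric] by linarith
    also have "\<dots> < e\<^sup>2" using e by simp
    finally show "norm (hproj n x - x) < e" using e power2_less_imp_less[of "norm (x - hproj n x)" e] by (simp add: norm_minus_commute)
  qed
qed

text \<open>Finite rational combinations of the \<open>hbas k\<close>. The resulting second
  countability is what Borel measurability of sums and the Bochner integral require of the target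
  space.\<close>

lemma countable_dense_hs:
  "\<exists>D :: hs set. countable D \<and> (\<forall>x. \<forall>e>0. \<exists>d\<in>D. dist x d < e)"
proof -
  define S where "S N = (\<lambda>c. \<Sum>k\<in>modes N. c k *\<^sub>R hbas k) ` (PiE (modes N) (\<lambda>_. \<rat>))" for N
  have "countable (\<Union>N. S N)"
    unfolding S_def by (intro countable_UN countable_image countable_PiE) (auto simp: countable_rat)
  moreover have "\<exists>d\<in>(\<Union>N. S N). dist x d < e" if e: "e > 0" for x e
  proof -
    obtain N where N: "norm (hproj N x - x) < e/2"
      using LIMSEQ_D[OF hproj_tendsto[of x], of "e/2"] e by auto
    \<comment> \<open>The error \<open>e / 2\<close> is shared among the modes; the added 1 covers
      \<open>modes 0\<close>, which is empty, and makes the total strictly smaller than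
      \<open>e / 2\<close>.\<close>
    define d where "d = e / (2 * (card (modes N) + 1))"
    have d: "d > 0" using e by (simp add: d_def)
    have "\<exists>q\<in>\<rat>. \<bar>q - hnth x k\<bar> < d" for k
      using Rats_dense_in_real[of "hnth x k - d" "hnth x k + d"] d by (auto simp: abs_less_iff) (smt (verit))
    then obtain q where q: "\<And>k. q k \<in> \<rat>" "\<And>k. \<bar>q k - hnth x k\<bar> < d" by metis
    let ?q = "restrict q (modes N)"
    have "norm ((\<Sum>k\<in>modes N. ?q k *\<^sub>R hbas k) - hproj N x) = norm (\<Sum>k\<in>modes N. (q k - hnth x k) *\<^sub>R hbas k)"
      by (simp add: hproj_def sum_subtractf scaleR_diff_left)
    also have "\<dots> \<le> (\<Sum>k\<in>modes N. d)"
    proof (rule sum_norm_le)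
      fix k
      have "norm (hbas k) \<le> 1" by (rule norm_hbas_le)
      then show "norm ((q k - hnth x k) *\<^sub>R hbas k) \<le> d"
        using q(2)[of k] mult_mono[of "\<bar>q k - hnth x k\<bar>" d "norm (hbas k)" 1] d by simp
    qed
    also have "\<dots> < e / 2"
    proof -
      have "real (card (modes N)) * d < (real (card (modes N)) + 1) * d" using d by simp
      also have "\<dots> = e / 2" by (simp add: d_def field_simps add_nonneg_eq_0_iff)
      finally show ?thesis by simp
    qed
    finally have "norm (x - (\<Sum>k\<in>modes N. ?q k *\<^sub>R hbas k)) < e"
      using N norm_triangle_ineq[of "x - hproj N x" "hproj N x - (\<Sum>k\<in>modes N. ?q k *\<^sub>R hbas k)"]
      by (simp add: norm_minus_commute)
    moreover have "(\<Sum>k\<in>modes N. ?q k *\<^sub>R hbas k) \<in> S N" unfolding S_def using q(1) by (intro imageI) auto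
    ultimately show ?thesis by (auto simp: dist_norm)
  qed
  ultimately show ?thesis by blast
qed

instance hs :: second_countable_topology
proof
  obtain D :: "hs set" where D: "countable D" "\<And>x e. e > 0 \<Longrightarrow> \<exists>d\<in>D. dist x d < e"
    using countable_dense_hs by blast
  define B where "B = (\<lambda>(d, n). ball d (1 / real (Suc n))) ` (D \<times> UNIV)"
  have "topological_basis B"
  proof (rule topological_basisI)
    show "open b" if "b \<in> B" for b using that by (auto simp: B_def)
    fix U :: "hs set" and x assume "open U" "x \<in> U"
    then obtain e where e: "e > 0" "ball x e \<subseteq> U" by (meson open_contains_ball)
    obtain n where n: "1 / real (Suc n) < e / 2" using nat_approx_posE e(1) half_gt_zero by metis
    obtain d where d: "d \<in> D" "dist x d < 1 / real (Suc n)" using D(2)[of "1 / real (Suc n)" x] by auto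
    have "ball d (1 / real (Suc n)) \<subseteq> U"
    proof
      fix y assume "y \<in> ball d (1 / real (Suc n))"
      then have "dist x y < e" using d(2) n dist_triangle[of x y d] by (auto simp: dist_commute)
      then show "y \<in> U" using e(2) by auto
    qed
    then show "\<exists>b\<in>B. x \<in> b \<and> b \<subseteq> U" unfolding B_def using d
      by (intro bexI[of _ "ball d (1 / real (Suc n))"]) (auto simp: dist_commute)
  qed
  moreover have "countable B" unfolding B_def using D(1) by auto
  ultimately show "\<exists>B :: hs set set. countable B \<and> open = generate_topology B"
    using topological_basis_imp_subbasis by blast
qed

lemma borel_measurable_hnth [measurable (raw)]:
  "f \<in> borel_measurable M \<Longrightarrow> (\<lambda>w. hnth (f w) k) \<in> borel_measurable M"
  by (rule measurable_compose[OF _ borel_measurable_continuous_onI[OF continuous_on_hnth[OF continuous_on_id]]])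

text \<open>Each \<open>hproj N (f w)\<close> is a finite combination of coordinates, and the
  projections converge pointwise to \<open>f w\<close>.\<close>

lemma borel_measurable_hs_iff:
  "f \<in> borel_measurable M \<longleftrightarrow> (\<forall>k. (\<lambda>w. hnth (f w) k) \<in> borel_measurable M)"
proof
  assume *: "\<forall>k. (\<lambda>w. hnth (f w) k) \<in> borel_measurable M"
  have "(\<lambda>w. hproj N (f w)) \<in> borel_measurable M" for N
    unfolding hproj_def using * by (intro borel_measurable_sum borel_measurable_scaleR) auto
  then show "f \<in> borel_measurable M"
    by (rule borel_measurable_LIMSEQ_metric) (rule hproj_tendsto)
qed auto

text \<open>Projections are contractions, so convergence at the finitely many centres of an
  \<open>e/3\<close>-net spreads to all of \<open>K\<close>. Applied to the image of a continuous
  path it gives uniformity in time.\<close>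

lemma hproj_uniform_compact:
  assumes "compact K" "e > 0"
  shows "\<exists>n0. \<forall>n\<ge>n0. \<forall>x\<in>K. norm (x - hproj n x) < e"
proof -
  obtain D where D: "finite D" "K \<subseteq> (\<Union>x\<in>D. ball x (e/3))"
    using assms compact_eq_totally_bounded[of K] by (auto dest!: spec[of _ "e/3"])
  have "\<forall>d\<in>D. \<exists>n0. \<forall>n\<ge>n0. norm (hproj n d - d) < e/3"
    using LIMSEQ_D[OF hproj_tendsto, of "e/3"] assms by simp
  then obtain n0 where n0: "\<And>d n. d \<in> D \<Longrightarrow> n \<ge> n0 d \<Longrightarrow> norm (hproj n d - d) < e/3" by metis
  define m where "m = Max (insert 0 (n0 ` D))"
  have m: "n0 d \<le> m" if "d \<in> D" for d using that D(1) by (auto simp: m_def)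
  show ?thesis
  proof (intro exI allI impI ballI)
    fix n x assume n: "n \<ge> m" and "x \<in> K"
    then obtain d where d: "d \<in> D" "dist d x < e/3" using D(2) by auto
    have "norm (hproj n (d - x)) < e/3"
      using norm_hproj_le[of n "d - x"] d(2) by (simp add: dist_norm)
    moreover have eq: "x - hproj n x = (x - d) - (hproj n d - d) + hproj n (d - x)"
      by (rule hs_eqI) simp
    moreover have "norm (hproj n d - d) < e/3" using n0[OF d(1)] m[OF d(1)] n by simp
    moreover have "norm (x - d) < e/3" using d(2) by (simp add: dist_norm norm_minus_commute)
    ultimately show "norm (x - hproj n x) < e"
      using norm_triangle_ineq[of "(x - d) - (hproj n d - d)" "hproj n (d - x)"]
        norm_triangle_ineq4[of "x - d" "hproj n d - d"] unfolding eq by linarith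
  qed
qed

section \<open>Integrals of continuous functions\<close>

text \<open>Left endpoints of \<open>Suc n\<close> equal intervals, so there is no division by zero.
  Only finitely many values of \<open>f\<close> enter, which later yields measurability in a
  parameter.\<close>

definition riemann_sum :: "nat \<Rightarrow> (real \<Rightarrow> real) \<Rightarrow> real \<Rightarrow> real" where
  "riemann_sum n f t = (\<Sum>i<Suc n. f (t * real i / real (Suc n)) * (t / real (Suc n)))"

lemma riemann_sum_error:
  fixes f :: "real \<Rightarrow> real"
  assumes t: "t \<ge> 0" and cont: "continuous_on {0..t} f" and e: "e \<ge> 0"
    and small: "\<And>x y. x \<in> {0..t} \<Longrightarrow> y \<in> {0..t} \<Longrightarrow> \<bar>x - y\<bar> \<le> t / real (Suc n) \<Longrightarrow> \<bar>f x - f y\<bar> \<le> e"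
  shows "\<bar>integral {0..t} f - riemann_sum n f t\<bar> \<le> e * t"
proof -
  define a where "a i = t * real i / real (Suc n)" for i
  have a_mono: "a i \<le> a (Suc i)" for i using t by (simp add: a_def divide_right_mono mult_left_mono)
  have a_step: "a (Suc i) - a i = t / real (Suc n)" for i
    by (simp add: a_def diff_divide_distrib[symmetric] algebra_simps)
  have a_le: "a i \<le> t" if "i \<le> Suc n" for i
    using that t mult_left_mono[of "real i" "real (Suc n)" t] by (simp add: a_def field_simps)
  have a_ge: "a i \<ge> 0" for i using t by (simp add: a_def)
  have "\<bar>integral {0..a j} f - (\<Sum>i<j. f (a i) * (t / real (Suc n)))\<bar> \<le> e * a j" if "j \<le> Suc n" for j
    using that
  proof (induction j)
    case 0
    then show ?case by (simp add: a_def)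
  next
    case (Suc j)
    have int: "f integrable_on {x..y}" if "0 \<le> x" "y \<le> t" for x y
      by (rule integrable_continuous_real, rule continuous_on_subset[OF cont]) (use that in auto)
    have "integral {0..a j} f + integral {a j..a (Suc j)} f = integral {0..a (Suc j)} f"
      by (rule Henstock_Kurzweil_Integration.integral_combine)
        (use a_mono a_ge a_le[OF Suc.prems] int in auto)
    moreover have "\<bar>integral {a j..a (Suc j)} f - f (a j) * (t / real (Suc n))\<bar> \<le> e * (a (Suc j) - a j)"
    proof -
      have ij: "f integrable_on {a j..a (Suc j)}" using int a_ge a_le[OF Suc.prems] by auto
      have "integral {a j..a (Suc j)} f - f (a j) * (t / real (Suc n))
          = integral {a j..a (Suc j)} (\<lambda>x. f x - f (a j))"
        using ij a_mono[of j] by (subst Henstock_Kurzweil_Integration.integral_diff)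
          (auto simp: a_step)
      moreover have "norm (integral {a j..a (Suc j)} (\<lambda>x. f x - f (a j))) \<le> e * (a (Suc j) - a j)"
      proof (rule integral_bound[OF a_mono])
        show "continuous_on {a j..a (Suc j)} (\<lambda>x. f x - f (a j))"
          by (intro continuous_intros continuous_on_subset[OF cont]) (use a_ge[of j] a_le[OF Suc.prems] in auto)
        fix x assume x: "x \<in> {a j..a (Suc j)}"
        show "norm (f x - f (a j)) \<le> e"
          using small[of x "a j"] x a_step[of j] a_ge[of j] a_le[OF Suc.prems] a_mono[of j] by auto
      qed
      ultimately show ?thesis by simp
    qed
    ultimately show ?case using Suc by (simp add: algebra_simps)
  qed
  from this[of "Suc n"] show ?thesis by (simp add: a_def riemann_sum_def)
qed

lemma riemann_sum_tendsto:
  assumes t: "t \<ge> 0" and cont: "continuous_on {0..t} f"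
  shows "(\<lambda>n. riemann_sum n f t) \<longlonglongrightarrow> integral {0..t} f"
proof (rule LIMSEQ_I)
  fix r :: real assume r: "r > 0"
  \<comment> \<open>\<open>t + 1\<close> in place of \<open>t\<close> keeps the quotient defined at
    \<open>t = 0\<close>.\<close>
  define e where "e = r / (2 * (t + 1))"
  have e: "e > 0" "e * t < r" using r t by (auto simp: e_def field_simps intro: add_nonneg_pos)
  have "uniformly_continuous_on {0..t} f"
    using cont compact_Icc by (rule compact_uniformly_continuous)
  then obtain d where d: "d > 0" "\<And>x y. x \<in> {0..t} \<Longrightarrow> y \<in> {0..t} \<Longrightarrow> dist x y < d \<Longrightarrow> dist (f x) (f y) < e"
    using e(1) unfolding uniformly_continuous_on_def by metis
  have "(\<lambda>n. t / real (Suc n)) \<longlonglongrightarrow> 0" by real_asymp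
  from order_tendstoD(2)[OF this d(1)] obtain n0 where n0: "\<And>n. n \<ge> n0 \<Longrightarrow> t / real (Suc n) < d"
    by (auto simp: eventually_sequentially)
  show "\<exists>no. \<forall>n\<ge>no. norm (riemann_sum n f t - integral {0..t} f) < r"
  proof (intro exI allI impI)
    fix n assume n: "n \<ge> n0"
    have "\<bar>integral {0..t} f - riemann_sum n f t\<bar> \<le> e * t"
    proof (rule riemann_sum_error[OF t cont])
      show "0 \<le> e" using e by simp
      fix x y assume "x \<in> {0..t}" "y \<in> {0..t}" "\<bar>x - y\<bar> \<le> t / real (Suc n)"
      then show "\<bar>f x - f y\<bar> \<le> e" using d(2)[of x y] n0[OF n] by (simp add: dist_real_def)
    qed
    then show "norm (riemann_sum n f t - integral {0..t} f) < r" using e(2) by simp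
  qed
qed

section \<open>Gronwall's inequality and the Cauchy-Schwarz inequality for integrals\<close>

lemma integral_has_deriv_interior:
  fixes g :: "real \<Rightarrow> real"
  assumes "continuous_on {0..T} g" "0 < t" "t < T"
  shows "((\<lambda>x. integral {0..x} g) has_real_derivative g t) (at t)"
  using integral_has_real_derivative[OF assms(1), of t] assms(2,3)
  by (simp add: at_within_Icc_at)

text \<open>The right-hand side \<open>U\<close> of the integral inequality, multiplied by
  \<open>exp (- W)\<close>, is nonincreasing: its derivative is
  \<open>w * (u - U) * exp (- W)\<close>. The weight may depend on time because it will be the
  squared H1 norm of a solution.\<close>

lemma gronwall:
  fixes u w :: "real \<Rightarrow> real"
  assumes u: "continuous_on {0..T} u" and w: "continuous_on {0..T} w"
    and w0: "\<And>t. t \<in> {0..T} \<Longrightarrow> 0 \<le> w t"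
    and le: "\<And>t. t \<in> {0..T} \<Longrightarrow> u t \<le> A + integral {0..t} (\<lambda>s. w s * u s)"
    and t: "t \<in> {0..T}"
  shows "u t \<le> A * exp (integral {0..t} w)"
proof -
  define U where "U t = A + integral {0..t} (\<lambda>s. w s * u s)" for t
  define W where "W t = integral {0..t} w" for t
  have wu: "continuous_on {0..T} (\<lambda>s. w s * u s)" by (intro continuous_intros u w)
  have cU: "continuous_on {0..t} U" and cW: "continuous_on {0..t} W"
    unfolding U_def W_def using t
    by (auto intro!: continuous_intros indefinite_integral_continuous_1 integrable_continuous_real
        continuous_on_subset[OF wu] continuous_on_subset[OF w])
  have "U t * exp (- W t) \<le> U 0 * exp (- W 0)"
  proof (rule DERIV_nonpos_imp_decreasing_open[where f="\<lambda>a. U a * exp (- W a)" and a=0 and b=t])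
    show "0 \<le> t" using t by simp
    show "continuous_on {0..t} (\<lambda>a. U a * exp (- W a))" by (intro continuous_intros cU cW)
    fix x assume x: "0 < x" "x < t"
    then have xT: "x < T" "x \<in> {0..T}" using t by auto
    have dU: "(U has_real_derivative w x * u x) (at x)"
      unfolding U_def using DERIV_add[OF DERIV_const integral_has_deriv_interior[OF wu x(1) xT(1)]] by simp
    have dW: "(W has_real_derivative w x) (at x)"
      unfolding W_def by (rule integral_has_deriv_interior[OF w x(1) xT(1)])
    have "((\<lambda>a. U a * exp (- W a)) has_real_derivative (w x * u x * exp (- W x) + U x * (exp (- W x) * (- w x)))) (at x)"
      by (auto intro!: derivative_eq_intros dU dW)
    moreover have "w x * u x * exp (- W x) + U x * (exp (- W x) * (- w x)) \<le> 0"
    proof -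
      have "w x * u x \<le> w x * U x" using le[OF xT(2)] w0[OF xT(2)] by (intro mult_left_mono) (auto simp: U_def)
      then have "(w x * u x - w x * U x) * exp (- W x) \<le> 0" by (intro mult_nonpos_nonneg) auto
      then show ?thesis by (simp add: algebra_simps)
    qed
    ultimately show "\<exists>y. ((\<lambda>a. U a * exp (- W a)) has_real_derivative y) (at x) \<and> y \<le> 0" by blast
  qed
  then have "U t \<le> A * exp (W t)" by (simp add: U_def W_def exp_minus field_simps)
  then show ?thesis using le[OF t] by (simp add: U_def W_def)
qed

text \<open>Follows from nonnegativity of the quadratic form \<open>quad\<close> in \<open>x\<close>
  and \<open>y\<close>.\<close>

lemma integral_Cauchy_Schwarz:
  fixes f g :: "real \<Rightarrow> real"
  assumes f: "continuous_on {a..b} f" and g: "continuous_on {a..b} g"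
  shows "(integral {a..b} (\<lambda>s. f s * g s))\<^sup>2 \<le> integral {a..b} (\<lambda>s. (f s)\<^sup>2) * integral {a..b} (\<lambda>s. (g s)\<^sup>2)"
proof -
  define F where "F = integral {a..b} (\<lambda>s. (f s)\<^sup>2)"
  define G where "G = integral {a..b} (\<lambda>s. (g s)\<^sup>2)"
  define P where "P = integral {a..b} (\<lambda>s. f s * g s)"
  have int: "(\<lambda>s. (f s)\<^sup>2) integrable_on {a..b}" "(\<lambda>s. (g s)\<^sup>2) integrable_on {a..b}"
    "(\<lambda>s. f s * g s) integrable_on {a..b}"
    by (intro integrable_continuous_real continuous_intros f g)+
  have quad: "0 \<le> x\<^sup>2 * F + 2 * x * y * P + y\<^sup>2 * G" for x y :: real
  proof -
    have "((\<lambda>s. x\<^sup>2 * (f s)\<^sup>2 + 2 * x * y * (f s * g s) + y\<^sup>2 * (g s)\<^sup>2) has_integral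
        x\<^sup>2 * F + 2 * x * y * P + y\<^sup>2 * G) {a..b}"
      unfolding F_def G_def P_def
      by (intro has_integral_add has_integral_mult_right integrable_integral int)
    moreover have "0 \<le> x\<^sup>2 * (f s)\<^sup>2 + 2 * x * y * (f s * g s) + y\<^sup>2 * (g s)\<^sup>2" for s
      using zero_le_power2[of "x * f s + y * g s"] by (simp add: power2_sum power_mult_distrib mult_ac)
    ultimately show ?thesis by (rule has_integral_nonneg)
  qed
  have F0: "F \<ge> 0" unfolding F_def by (rule integral_nonneg[OF int(1)]) simp
  have "P\<^sup>2 \<le> F * G"
  proof (cases "F = 0")
    case True
    have "P = 0"
    proof (rule ccontr)
      assume "P \<noteq> 0"
      \<comment> \<open>This \<open>x\<close> together with \<open>y = 1\<close> would give the
        quadratic form the value -1.\<close>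
      then have "2 * (- (G + 1) / (2 * P)) * 1 * P = - (G + 1)" by simp
      then show False using quad[of "- (G + 1) / (2 * P)" 1] True by simp
    qed
    then show ?thesis using True by simp
  next
    case False
    then have F: "F > 0" using F0 by simp
    \<comment> \<open>At \<open>x = - P\<close>, \<open>y = F\<close> the form factors as
      \<open>F * (F * G - P\<^sup>2)\<close>.\<close>
    from quad[of "- P" F] have "0 \<le> F * (F * G - P\<^sup>2)" by (simp add: power2_eq_square algebra_simps)
    then show ?thesis using F by (simp add: zero_le_mult_iff)
  qed
  then show ?thesis by (simp add: F_def G_def P_def)
qed

text \<open>The solution of \<open>q' = h - l * q\<close> with \<open>q 0 = 0\<close>;
  \<open>l\<close> will be the heat rate \<open>\<nu> * k\<^sup>2\<close> of a mode.\<close>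

definition duhamel :: "real \<Rightarrow> (real \<Rightarrow> real) \<Rightarrow> real \<Rightarrow> real" where
  "duhamel l h t = integral {0..t} (\<lambda>s. exp (- l * (t - s)) * h s)"

lemma duhamel_0 [simp]: "duhamel l h 0 = 0"
  by (simp add: duhamel_def)

text \<open>Taking \<open>exp (- l * t)\<close> out leaves an integrand independent of
  \<open>t\<close>, to which the fundamental theorem of calculus applies.\<close>

lemma duhamel_eq: "duhamel l h t = exp (- l * t) * integral {0..t} (\<lambda>s. exp (l * s) * h s)"
proof -
  have "exp (- l * (t - s)) * h s = exp (- l * t) * (exp (l * s) * h s)" for s
    unfolding mult.assoc[symmetric] exp_add[symmetric] by (simp add: algebra_simps)
  then show ?thesis unfolding duhamel_def by (simp only: Henstock_Kurzweil_Integration.integral_mult_right)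
qed

lemma duhamel_cong: "(\<And>s. s \<in> {0..t} \<Longrightarrow> h s = h' s) \<Longrightarrow> duhamel l h t = duhamel l h' t"
  unfolding duhamel_def by (rule Henstock_Kurzweil_Integration.integral_cong) simp

lemma duhamel_has_deriv:
  assumes "continuous_on {0..T} h" "t \<in> {0..T}"
  shows "(duhamel l h has_real_derivative h t - l * duhamel l h t) (at t within {0..T})"
proof -
  have "continuous_on {0..T} (\<lambda>s. exp (l * s) * h s)" by (intro continuous_intros assms)
  from integral_has_real_derivative[OF this assms(2)]
  have "((\<lambda>t. exp (- l * t) * integral {0..t} (\<lambda>s. exp (l * s) * h s)) has_real_derivative
     (exp (- l * t) * (exp (l * t) * h t) + (exp (- l * t) * (- l)) * integral {0..t} (\<lambda>s. exp (l * s) * h s)))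
     (at t within {0..T})"
    by (auto intro!: derivative_eq_intros)
  moreover have "exp (- l * t) * (exp (l * t) * h t) + (exp (- l * t) * (- l)) * integral {0..t} (\<lambda>s. exp (l * s) * h s)
      = h t - l * duhamel l h t"
    by (simp add: duhamel_eq exp_minus)
  ultimately show ?thesis
    unfolding duhamel_eq[abs_def] by (simp only:)
qed

lemma continuous_on_duhamel: "continuous_on {0..T} h \<Longrightarrow> continuous_on {0..T} (duhamel l h)"
  by (rule DERIV_continuous_on[OF duhamel_has_deriv])

lemma duhamel_diff:
  assumes "continuous_on {0..t} h" "continuous_on {0..t} h'"
  shows "duhamel l (\<lambda>s. h s - h' s) t = duhamel l h t - duhamel l h' t"
  unfolding duhamel_def
  by (subst Henstock_Kurzweil_Integration.integral_diff[symmetric])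
    (auto intro!: integrable_continuous_real continuous_intros assms simp: algebra_simps)

lemma duhamel_mult: "duhamel l (\<lambda>s. c * h s) t = c * duhamel l h t"
  unfolding duhamel_def by (simp add: mult.left_commute)

text \<open>The smoothing factor \<open>\<bar>k\<bar>\<close> costs only \<open>1 / (2 * \<nu>)\<close> in the square mean, which keeps the integral
  inequalities below free of singular kernels.\<close>

lemma duhamel_smoothing:
  fixes k :: int
  assumes nu: "\<nu> > 0" and t: "t \<ge> 0" and g: "continuous_on {0..t} g"
  shows "(\<bar>of_int k\<bar> * duhamel (\<nu> * (of_int k)\<^sup>2) g t)\<^sup>2 \<le> 1 / (2 * \<nu>) * integral {0..t} (\<lambda>s. (g s)\<^sup>2)"
proof -
  define l where "l = \<nu> * (of_int k)\<^sup>2"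
  have I0: "0 \<le> integral {0..t} (\<lambda>s. (g s)\<^sup>2)"
    by (rule integral_nonneg) (auto intro!: integrable_continuous_real continuous_intros g)
  show ?thesis
  proof (cases "k = 0")
    case True
    then show ?thesis using nu I0 by simp
  next
    case False
    have l: "l > 0" using False nu by (simp add: l_def)
    have "((\<lambda>s. exp (- 2 * l * (t - s))) has_integral
       (exp (- 2 * l * (t - t)) / (2 * l) - exp (- 2 * l * (t - 0)) / (2 * l))) {0..t}"
      by (rule fundamental_theorem_of_calculus[OF t])
        (use l in \<open>auto intro!: derivative_eq_intros simp flip: has_real_derivative_iff_has_vector_derivative\<close>)
    then have "integral {0..t} (\<lambda>s. exp (- 2 * l * (t - s))) = (1 - exp (- 2 * l * t)) / (2 * l)"
      by (simp add: integral_unique diff_divide_distrib)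
    also have "\<dots> \<le> 1 / (2 * l)" using l by (intro divide_right_mono) auto
    finally have E: "integral {0..t} (\<lambda>s. (exp (- l * (t - s)))\<^sup>2) \<le> 1 / (2 * l)"
      by (simp add: power2_eq_square flip: exp_add) (simp add: algebra_simps)
    have "(duhamel l g t)\<^sup>2 \<le> integral {0..t} (\<lambda>s. (exp (- l * (t - s)))\<^sup>2) * integral {0..t} (\<lambda>s. (g s)\<^sup>2)"
      unfolding duhamel_def by (intro integral_Cauchy_Schwarz continuous_intros g)
    also have "\<dots> \<le> 1 / (2 * l) * integral {0..t} (\<lambda>s. (g s)\<^sup>2)"
      using E I0 by (intro mult_right_mono)
    finally have "(of_int k)\<^sup>2 * (duhamel l g t)\<^sup>2 \<le> (of_int k)\<^sup>2 * (1 / (2 * l) * integral {0..t} (\<lambda>s. (g s)\<^sup>2))"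
      by (intro mult_left_mono) auto
    also have "\<dots> = 1 / (2 * \<nu>) * integral {0..t} (\<lambda>s. (g s)\<^sup>2)"
      using False nu by (simp add: l_def field_simps)
    finally show ?thesis by (simp add: l_def power_mult_distrib)
  qed
qed

text \<open>Variation of constants for a single mode. It connects the projected equation, which is
  stated in integrated form, with the mild formulation used everywhere else.\<close>

lemma integrated_iff_mild:
  fixes q h :: "real \<Rightarrow> real"
  assumes q: "continuous_on {0..T} q" and h: "continuous_on {0..T} h"
  shows "(\<forall>t\<in>{0..T}. q t = p + integral {0..t} (\<lambda>s. h s - l * q s)) \<longleftrightarrow>
    (\<forall>t\<in>{0..T}. q t = exp (- l * t) * p + duhamel l h t)" (is "?A \<longleftrightarrow> ?B")
proof
  assume A: ?A
  show ?B
  proof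
    fix t assume t: "t \<in> {0..T}"
    have hq: "continuous_on {0..T} (\<lambda>s. h s - l * q s)" by (intro continuous_intros q h)
    have d: "(q has_real_derivative h x - l * q x) (at x within {0..t})" if x: "x \<in> {0..t}" for x
    proof -
      have "((\<lambda>t. p + integral {0..t} (\<lambda>s. h s - l * q s)) has_real_derivative h x - l * q x) (at x within {0..T})"
        using DERIV_add[OF DERIV_const integral_has_real_derivative[OF hq, of x]] x t by simp
      then have "((\<lambda>t. p + integral {0..t} (\<lambda>s. h s - l * q s)) has_real_derivative h x - l * q x) (at x within {0..t})"
        by (rule DERIV_subset) (use t in auto)
      then show ?thesis
        by (rule has_field_derivative_transform_within[where d=1]) (use A x t in auto)
    qed
    \<comment> \<open>The integrating factor \<open>exp (l * s)\<close> turns the right side into an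
      exact derivative.\<close>
    have "((\<lambda>s. exp (l * s) * h s) has_integral (exp (l * t) * q t - exp (l * 0) * q 0)) {0..t}"
    proof (rule fundamental_theorem_of_calculus)
      fix x assume x: "x \<in> {0..t}"
      have "((\<lambda>s. exp (l * s) * q s) has_real_derivative (exp (l * x) * (h x - l * q x) + exp (l * x) * l * q x)) (at x within {0..t})"
        by (auto intro!: derivative_eq_intros d[OF x])
      then show "((\<lambda>s. exp (l * s) * q s) has_vector_derivative exp (l * x) * h x) (at x within {0..t})"
        by (simp add: algebra_simps flip: has_real_derivative_iff_has_vector_derivative)
    qed (use t in auto)
    moreover have "q 0 = p" using A t by auto
    ultimately have "integral {0..t} (\<lambda>s. exp (l * s) * h s) = exp (l * t) * q t - p"
      by (simp add: integral_unique)
    then have "duhamel l h t = exp (- l * t) * (exp (l * t) * q t - p)"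
      by (simp only: duhamel_eq)
    then show "q t = exp (- l * t) * p + duhamel l h t" by (simp add: exp_minus right_diff_distrib)
  qed
next
  assume B: ?B
  show ?A
  proof
    fix t assume t: "t \<in> {0..T}"
    have "((\<lambda>s. h s - l * q s) has_integral (q t - q 0)) {0..t}"
    proof (rule fundamental_theorem_of_calculus)
      fix x assume x: "x \<in> {0..t}"
      have "((\<lambda>t. exp (- l * t) * p + duhamel l h t) has_real_derivative
         (- l * (exp (- l * x) * p) + (h x - l * duhamel l h x))) (at x within {0..t})"
        by (rule DERIV_add, (auto intro!: derivative_eq_intros)[1], rule duhamel_has_deriv)
          (use x t in \<open>auto intro: continuous_on_subset[OF h]\<close>)
      moreover have "- l * (exp (- l * x) * p) + (h x - l * duhamel l h x) = h x - l * q x"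
        using B x t by (auto simp: algebra_simps)
      ultimately have "((\<lambda>t. exp (- l * t) * p + duhamel l h t) has_real_derivative h x - l * q x) (at x within {0..t})"
        by (simp only:)
      then show "(q has_vector_derivative h x - l * q x) (at x within {0..t})"
        unfolding has_real_derivative_iff_has_vector_derivative[symmetric]
        by (rule has_field_derivative_transform_within[where d=1]) (use B x t in auto)
    qed (use t in auto)
    moreover have "q 0 = p" using B t by auto
    ultimately show "q t = p + integral {0..t} (\<lambda>s. h s - l * q s)" by (simp add: integral_unique)
  qed
qed

section \<open>Mild equations with a Lipschitz nonlinearity\<close>

text \<open>The Duhamel operator and the Picard iteration are written as limits of finite sums over finitely many
  times. They are then measurable in a parameter without any regularity of the paths, which gives
  adapted solutions although the filtration is not assumed complete.\<close>

definition Duh_coord :: "real \<Rightarrow> (real \<Rightarrow> hs) \<Rightarrow> real \<Rightarrow> int \<Rightarrow> real" where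
  "Duh_coord \<nu> g t k = lim (\<lambda>n. \<bar>of_int k\<bar> * riemann_sum n (\<lambda>s. exp (- (\<nu> * (of_int k)\<^sup>2) * (t - s)) * hnth (g s) k) t)"

definition Duh :: "real \<Rightarrow> (real \<Rightarrow> hs) \<Rightarrow> real \<Rightarrow> hs" where
  "Duh \<nu> g t = lim (\<lambda>N. \<Sum>k\<in>modes N. Duh_coord \<nu> g t k *\<^sub>R hbas k)"

lemma Duh_coord_eq:
  assumes "t \<ge> 0" "continuous_on {0..t} g"
  shows "Duh_coord \<nu> g t k = \<bar>of_int k\<bar> * duhamel (\<nu> * (of_int k)\<^sup>2) (\<lambda>s. hnth (g s) k) t"
  unfolding Duh_coord_def duhamel_def
  by (rule limI, intro tendsto_mult tendsto_const riemann_sum_tendsto assms(1) continuous_intros assms(2))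

text \<open>The smoothing estimate is summed over finite sets of modes under the time integral,
  which bounds all finite sums of squared coordinates at once. Hence the coordinates define an
  element of \<open>hs\<close>, and its projections are the sums whose \<open>lim\<close> defines
  \<open>Duh\<close>.\<close>

lemma
  assumes nu: "\<nu> > 0" and t: "t \<ge> 0" and g: "continuous_on {0..t} g"
  shows hnth_Duh: "hnth (Duh \<nu> g t) k = \<bar>of_int k\<bar> * duhamel (\<nu> * (of_int k)\<^sup>2) (\<lambda>s. hnth (g s) k) t"
    and norm_Duh_sq_le: "(norm (Duh \<nu> g t))\<^sup>2 \<le> 1 / (2 * \<nu>) * integral {0..t} (\<lambda>s. (norm (g s))\<^sup>2)"
proof -
  define c where "c k = \<bar>of_int k\<bar> * duhamel (\<nu> * (of_int k)\<^sup>2) (\<lambda>s. hnth (g s) k) t" for k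
  define C where "C = 1 / (2 * \<nu>) * integral {0..t} (\<lambda>s. (norm (g s))\<^sup>2)"
  have bound: "(\<Sum>k\<in>F. (c k)\<^sup>2) \<le> C" if F: "finite F" for F
  proof -
    have "(\<Sum>k\<in>F. (c k)\<^sup>2) \<le> (\<Sum>k\<in>F. 1 / (2 * \<nu>) * integral {0..t} (\<lambda>s. (hnth (g s) k)\<^sup>2))"
      unfolding c_def by (intro sum_mono duhamel_smoothing nu t continuous_intros g)
    also have "\<dots> = 1 / (2 * \<nu>) * integral {0..t} (\<lambda>s. \<Sum>k\<in>F. (hnth (g s) k)\<^sup>2)"
      by (subst integral_sum)
        (auto intro!: integrable_continuous_real continuous_intros g F simp: sum_distrib_left)
    also have "\<dots> \<le> C"
      unfolding C_def using nu F
      by (intro mult_left_mono integral_le integrable_continuous_real continuous_intros g sum_hnth_le) auto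
    finally show ?thesis .
  qed
  have c0: "c 0 = 0" by (simp add: c_def)
  define x where "x = Abs_hs c"
  have x: "hnth x = c" unfolding x_def by (rule hnth_Abs[OF c0 bound])
  have "(\<lambda>N. hproj N x) = (\<lambda>N. \<Sum>k\<in>modes N. Duh_coord \<nu> g t k *\<^sub>R hbas k)"
    by (simp add: hproj_def x c_def Duh_coord_eq[OF t g])
  then have "Duh \<nu> g t = x"
    unfolding Duh_def using hproj_tendsto[of x] by (intro limI) simp
  then show "hnth (Duh \<nu> g t) k = \<bar>of_int k\<bar> * duhamel (\<nu> * (of_int k)\<^sup>2) (\<lambda>s. hnth (g s) k) t"
    "(norm (Duh \<nu> g t))\<^sup>2 \<le> 1 / (2 * \<nu>) * integral {0..t} (\<lambda>s. (norm (g s))\<^sup>2)"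
    using norm_hs_le[of x C] bound by (auto simp: x c_def C_def)
qed

text \<open>The Riemann sums sample the path only at times in \<open>[0,t]\<close>.\<close>

lemma Duh_cong:
  assumes "t \<ge> 0" "\<And>s. s \<in> {0..t} \<Longrightarrow> g s = h s"
  shows "Duh \<nu> g t = Duh \<nu> h t"
proof -
  have "t * real i / real (Suc n) \<in> {0..t}" if "i < Suc n" for i n
    using that assms(1) mult_left_mono[of "real i" "real (Suc n)" t] by (simp add: field_simps)
  then have "riemann_sum n (\<lambda>s. exp (- (\<nu> * (of_int k)\<^sup>2) * (t - s)) * hnth (g s) k) t =
    riemann_sum n (\<lambda>s. exp (- (\<nu> * (of_int k)\<^sup>2) * (t - s)) * hnth (h s) k) t" for n k
    unfolding riemann_sum_def by (intro sum.cong refl) (simp add: assms(2))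
  then show ?thesis by (simp add: Duh_def Duh_coord_def)
qed

lemma Duh_diff:
  assumes "\<nu> > 0" "t \<ge> 0" "continuous_on {0..t} g" "continuous_on {0..t} h"
  shows "Duh \<nu> (\<lambda>s. g s - h s) t = Duh \<nu> g t - Duh \<nu> h t"
  by (rule hs_eqI)
    (simp add: hnth_Duh assms continuous_on_diff duhamel_diff continuous_on_hnth right_diff_distrib)

lemma hproj_Duh:
  assumes "\<nu> > 0" "t \<ge> 0" "continuous_on {0..t} g"
  shows "Duh \<nu> (\<lambda>s. hproj N (g s)) t = hproj N (Duh \<nu> g t)"
proof (rule hs_eqI)
  fix k
  have "continuous_on {0..t} (\<lambda>s. hproj N (g s))"
    using assms(3) by (rule bounded_linear.continuous_on[OF bounded_linear_hproj])
  then show "hnth (Duh \<nu> (\<lambda>s. hproj N (g s)) t) k = hnth (hproj N (Duh \<nu> g t)) k"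
    using assms duhamel_mult[of "\<nu> * (of_int k)\<^sup>2" 0 _ t] by (simp add: hnth_Duh)
qed

lemma norm_Duh_le:
  assumes nu: "\<nu> > 0" and t: "t \<ge> 0" and g: "continuous_on {0..t} g" and e: "\<And>s. s \<in> {0..t} \<Longrightarrow> norm (g s) \<le> e"
  shows "(norm (Duh \<nu> g t))\<^sup>2 \<le> t / (2 * \<nu>) * e\<^sup>2"
proof -
  have "(norm (Duh \<nu> g t))\<^sup>2 \<le> 1 / (2 * \<nu>) * integral {0..t} (\<lambda>s. (norm (g s))\<^sup>2)"
    by (rule norm_Duh_sq_le[OF nu t g])
  also have "\<dots> \<le> 1 / (2 * \<nu>) * integral {0..t} (\<lambda>s. e\<^sup>2)"
    using nu e by (intro mult_left_mono integral_le integrable_continuous_real continuous_intros g power_mono) auto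
  finally show ?thesis using t by simp
qed

text \<open>Each coordinate is continuous, and the projections converge uniformly in time: the path
  \<open>g\<close> has compact image, so its tails are uniformly small, and
  \<open>norm_Duh_le\<close> passes this smallness on to \<open>Duh\<close>.\<close>

lemma continuous_on_Duh:
  assumes nu: "\<nu> > 0" and g: "continuous_on {0..T} g"
  shows "continuous_on {0..T} (Duh \<nu> g)"
proof (rule uniform_limit_theorem[where F=sequentially and f="\<lambda>N t. hproj N (Duh \<nu> g t)"])
  have gt: "continuous_on {0..t} g" if "t \<in> {0..T}" for t
    by (rule continuous_on_subset[OF g]) (use that in auto)
  have "continuous_on {0..T} (\<lambda>t. hnth (Duh \<nu> g t) k)" for k
  proof -
    have "continuous_on {0..T} (\<lambda>t. \<bar>of_int k\<bar> * duhamel (\<nu> * (of_int k)\<^sup>2) (\<lambda>s. hnth (g s) k) t)"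
      by (intro continuous_intros continuous_on_duhamel g)
    then show ?thesis by (rule continuous_on_eq) (use gt nu in \<open>simp add: hnth_Duh\<close>)
  qed
  then show "\<forall>\<^sub>F N in sequentially. continuous_on {0..T} (\<lambda>t. hproj N (Duh \<nu> g t))"
    unfolding hproj_def
    by (intro always_eventually allI continuous_on_sum continuous_on_scaleR continuous_on_const) auto
  show "uniform_limit {0..T} (\<lambda>N t. hproj N (Duh \<nu> g t)) (Duh \<nu> g) sequentially"
    unfolding uniform_limit_iff
  proof (intro allI impI)
    fix e :: real assume e: "e > 0"
    \<comment> \<open>\<open>q\<close> is positive for every real \<open>T\<close> and strictly
      exceeds the factor \<open>t / (2 * \<nu>)\<close> for all \<open>t\<close> in
      \<open>[0,T]\<close>.\<close>
    define q where "q = (\<bar>T\<bar> + 1) / (2 * \<nu>)"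
    define d where "d = e / sqrt q"
    have "q > 0" using nu by (simp add: q_def)
    then have d: "d > 0" "(\<bar>T\<bar> + 1) / (2 * \<nu>) * d\<^sup>2 = e\<^sup>2" using e
      by (auto simp: d_def power_divide simp flip: q_def)
    have "compact (g ` {0..T})" by (rule compact_continuous_image[OF g compact_Icc])
    then obtain n0 where n0: "\<And>n x. n \<ge> n0 \<Longrightarrow> x \<in> g ` {0..T} \<Longrightarrow> norm (x - hproj n x) < d"
      using hproj_uniform_compact[OF _ d(1)] by metis
    have "norm (hproj N (Duh \<nu> g t) - Duh \<nu> g t) < e" if N: "N \<ge> n0" and t: "t \<in> {0..T}" for N t
    proof -
      have ch: "continuous_on {0..t} (\<lambda>s. hproj N (g s))"
        by (intro bounded_linear.continuous_on[OF bounded_linear_hproj] gt t)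
      have t0: "t \<ge> 0" using t by simp
      have "(norm (Duh \<nu> g t - hproj N (Duh \<nu> g t)))\<^sup>2 = (norm (Duh \<nu> (\<lambda>s. g s - hproj N (g s)) t))\<^sup>2"
        by (simp add: Duh_diff[OF nu t0 gt[OF t] ch] hproj_Duh[OF nu t0 gt[OF t]])
      also have "\<dots> \<le> t / (2 * \<nu>) * d\<^sup>2"
        by (rule norm_Duh_le[OF nu t0])
          (use t N n0 in \<open>auto intro!: continuous_intros gt ch less_imp_le\<close>)
      also have "\<dots> < (\<bar>T\<bar> + 1) / (2 * \<nu>) * d\<^sup>2"
        using t nu d(1) by (intro mult_strict_right_mono divide_strict_right_mono) auto
      also have "\<dots> = e\<^sup>2" by (rule d(2))
      finally have "norm (Duh \<nu> g t - hproj N (Duh \<nu> g t)) < e" by (rule power2_less_imp_less) (use e in simp)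
      then show ?thesis by (simp add: norm_minus_commute)
    qed
    then show "\<forall>\<^sub>F n in sequentially. \<forall>x\<in>{0..T}. dist (hproj n (Duh \<nu> g x)) (Duh \<nu> g x) < e"
      unfolding eventually_sequentially dist_norm by blast
  qed
qed simp

definition mild_eq :: "real \<Rightarrow> (hs \<Rightarrow> hs) \<Rightarrow> (real \<Rightarrow> hs) \<Rightarrow> real \<Rightarrow> (real \<Rightarrow> hs) \<Rightarrow> bool" where
  "mild_eq \<nu> G f T y \<longleftrightarrow> continuous_on {0..T} y \<and> (\<forall>t\<in>{0..T}. y t = f t + Duh \<nu> (\<lambda>s. G (y s)) t)"

definition lipschitz :: "real \<Rightarrow> (hs \<Rightarrow> hs) \<Rightarrow> bool" where
  "lipschitz L G \<longleftrightarrow> (\<forall>x y. norm (G x - G y) \<le> L * norm (x - y))"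

lemma lipschitz_nonneg:
  assumes "lipschitz L G" shows "L \<ge> 0"
proof -
  have "0 \<le> L * norm (hbas 1 - 0)"
    using assms norm_ge_zero order_trans unfolding lipschitz_def by blast
  moreover have "norm (hbas 1 - 0) > 0"
    using abs_hnth_le[of "hbas 1" 1] by (simp del: zero_less_norm_iff)
  ultimately show ?thesis by (metis mult_less_0_iff not_le)
qed

lemma lipschitz_continuous: assumes "lipschitz L G" shows "continuous_on A G"
proof -
  have "L-lipschitz_on UNIV G" 
    using assms lipschitz_nonneg[OF assms] by (intro lipschitz_onI) (auto simp: lipschitz_def dist_norm)
  then show ?thesis using lipschitz_on_continuous_on continuous_on_subset by blast
qed

lemma continuous_on_lipschitz_compose:
  "lipschitz L G \<Longrightarrow> continuous_on A y \<Longrightarrow> continuous_on A (\<lambda>s. G (y s))"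
  by (rule continuous_on_compose2[of UNIV G, OF lipschitz_continuous]) auto

section \<open>Existence by Picard iteration\<close>

fun picard :: "real \<Rightarrow> (hs \<Rightarrow> hs) \<Rightarrow> (real \<Rightarrow> hs) \<Rightarrow> nat \<Rightarrow> real \<Rightarrow> hs" where
  "picard \<nu> G f 0 t = f t"
| "picard \<nu> G f (Suc n) t = f t + Duh \<nu> (\<lambda>s. G (picard \<nu> G f n s)) t"

definition mild_sol :: "real \<Rightarrow> (hs \<Rightarrow> hs) \<Rightarrow> (real \<Rightarrow> hs) \<Rightarrow> real \<Rightarrow> hs" where
  "mild_sol \<nu> G f t = lim (\<lambda>n. picard \<nu> G f n t)"

lemma continuous_on_picard:
  assumes "\<nu> > 0" "lipschitz L G" "continuous_on {0..T} f"
  shows "continuous_on {0..T} (picard \<nu> G f n)"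
proof (induction n)
  case 0
  then show ?case using assms(3) by (simp cong: continuous_on_cong)
next
  case (Suc n)
  have "continuous_on {0..T} (\<lambda>t. f t + Duh \<nu> (\<lambda>s. G (picard \<nu> G f n s)) t)"
    by (intro continuous_intros continuous_on_Duh assms continuous_on_lipschitz_compose[OF assms(2)] Suc)
  then show ?case by (simp cong: continuous_on_cong)
qed

lemma integral_exp_le:
  assumes "t \<ge> 0" "c > 0"
  shows "integral {0..t} (\<lambda>s. exp (c * s)) \<le> exp (c * t) / (c::real)"
proof -
  have "((\<lambda>s. exp (c * s)) has_integral (exp (c * t) / c - exp (c * 0) / c)) {0..t}"
    by (rule fundamental_theorem_of_calculus)
      (use assms in \<open>auto intro!: derivative_eq_intros simp flip: has_real_derivative_iff_has_vector_derivative\<close>)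
  then show ?thesis using assms by (simp add: integral_unique)
qed

lemma continuous_on_Icc_bdd:
  fixes u :: "real \<Rightarrow> real"
  assumes "continuous_on {a..b} u" shows "\<exists>M. \<forall>t\<in>{a..b}. u t \<le> M"
proof (cases "a \<le> b")
  case True
  then show ?thesis using continuous_attains_sup[OF compact_Icc _ assms] by auto
qed auto

text \<open>An exponentially weighted norm: with weight \<open>exp (c * t)\<close> an integration in
  time gains \<open>1 / c\<close>, so a large \<open>c\<close> makes every iteration a contraction
  on the whole of \<open>[0,T]\<close>, without splitting the interval.\<close>

lemma picard_step:
  assumes nu: "\<nu> > 0" and L: "lipschitz L G" and f: "continuous_on {0..T} f"
  shows "\<exists>M\<ge>0. \<exists>c>0. \<forall>n. \<forall>t\<in>{0..T}. (norm (picard \<nu> G f (Suc n) t - picard \<nu> G f n t))\<^sup>2 \<le> M * (1/4)^n * exp (c * t)"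
proof (cases "T \<ge> 0")
  case True
  \<comment> \<open>Chosen so that \<open>L\<^sup>2 / (2 * \<nu>)\<close> is at most
    \<open>c / 4\<close>; together with the gain \<open>1 / c\<close> from the exponential, squared
    distances shrink by \<open>1/4\<close>. The added 1 keeps \<open>c\<close> positive for
    \<open>L = 0\<close>.\<close>
  define c where "c = 4 * (L\<^sup>2 / (2 * \<nu>) + 1)"
  have c: "c > 0" using nu by (simp add: c_def add_nonneg_pos)
  note cont = continuous_on_picard[OF nu L f]
  have "continuous_on {0..T} (\<lambda>t. (norm (picard \<nu> G f (Suc 0) t - picard \<nu> G f 0 t))\<^sup>2)"
    by (rule continuous_on_power[OF continuous_on_norm[OF continuous_on_diff[OF cont[of "Suc 0"] cont[of 0]]]])
  then obtain M where M: "\<And>t. t \<in> {0..T} \<Longrightarrow> (norm (picard \<nu> G f (Suc 0) t - picard \<nu> G f 0 t))\<^sup>2 \<le> M"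
    using continuous_on_Icc_bdd by meson
  have M0: "M \<ge> 0" by (rule order_trans[OF zero_le_power2 M[of 0]]) (use True in simp)
  have "\<forall>t\<in>{0..T}. (norm (picard \<nu> G f (Suc n) t - picard \<nu> G f n t))\<^sup>2 \<le> M * (1/4)^n * exp (c * t)" for n
  proof (induction n)
    case 0
    show ?case
    proof
      fix t assume t: "t \<in> {0..T}"
      have "M * 1 \<le> M * exp (c * t)" using M0 c t by (intro mult_left_mono) auto
      then show "(norm (picard \<nu> G f (Suc 0) t - picard \<nu> G f 0 t))\<^sup>2 \<le> M * (1/4)^0 * exp (c * t)"
        using M[OF t] by simp
    qed
  next
    case (Suc n)
    show ?case
    proof
      fix t assume t: "t \<in> {0..T}"
      let ?p = "picard \<nu> G f"
      have ct: "continuous_on {0..t} (?p n)" for n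
        by (rule continuous_on_subset[OF cont]) (use t in auto)
      note cG = continuous_on_lipschitz_compose[OF L ct]
      have t0: "t \<ge> 0" using t by simp
      have "?p (Suc (Suc n)) t - ?p (Suc n) t = Duh \<nu> (\<lambda>s. G (?p (Suc n) s) - G (?p n s)) t"
        by (subst Duh_diff[OF nu t0 cG cG]) simp
      then have "(norm (?p (Suc (Suc n)) t - ?p (Suc n) t))\<^sup>2
        \<le> 1 / (2 * \<nu>) * integral {0..t} (\<lambda>s. (norm (G (?p (Suc n) s) - G (?p n s)))\<^sup>2)"
        using norm_Duh_sq_le[OF nu t0 continuous_on_diff[OF cG[of "Suc n"] cG[of n]]] by (simp del: picard.simps)
      also have "\<dots> \<le> 1 / (2 * \<nu>) * integral {0..t} (\<lambda>s. L\<^sup>2 * (M * (1/4)^n * exp (c * s)))"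
      proof (intro mult_left_mono integral_le integrable_continuous_real continuous_intros cG)
        fix s assume s: "s \<in> {0..t}"
        have "(norm (G (?p (Suc n) s) - G (?p n s)))\<^sup>2 \<le> (L * norm (?p (Suc n) s - ?p n s))\<^sup>2"
          using L by (intro power_mono) (auto simp: lipschitz_def)
        also have "\<dots> \<le> L\<^sup>2 * (M * (1/4)^n * exp (c * s))"
          using Suc s t by (auto simp: power_mult_distrib intro!: mult_left_mono)
        finally show "(norm (G (?p (Suc n) s) - G (?p n s)))\<^sup>2 \<le> L\<^sup>2 * (M * (1/4)^n * exp (c * s))" .
      qed (use nu in auto)
      also have "\<dots> = (L\<^sup>2 / (2 * \<nu>)) * M * (1/4)^n * integral {0..t} (\<lambda>s. exp (c * s))"
        by simp
      also have "\<dots> \<le> (c / 4) * M * (1/4)^n * (exp (c * t) / c)"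
        using M0 nu c integral_exp_le[OF t0 c]
        by (intro mult_mono) (auto simp: c_def intro!: integral_nonneg integrable_continuous_real continuous_intros mult_nonneg_nonneg)
      also have "\<dots> = M * (1/4)^(Suc n) * exp (c * t)" using c by simp
      finally show "(norm (?p (Suc (Suc n)) t - ?p (Suc n) t))\<^sup>2 \<le> M * (1/4)^(Suc n) * exp (c * t)" .
    qed
  qed
  then show ?thesis using M0 c by blast
qed (auto intro!: exI[of _ 0] exI[of _ 1])

text \<open>The square roots of the bounds in \<open>picard_step\<close> form a geometric series of
  ratio \<open>1/2\<close>, so the telescoping series converges uniformly. The equation survives the
  limit because \<open>norm_Duh_le\<close> makes \<open>Duh\<close> continuous under uniform
  convergence.\<close>

lemma mild_sol:
  assumes nu: "\<nu> > 0" and L: "lipschitz L G" and f: "continuous_on {0..T} f"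
  shows "mild_eq \<nu> G f T (mild_sol \<nu> G f)"
proof -
  let ?p = "picard \<nu> G f"
  obtain M c where M: "M \<ge> 0" "c > 0" and
    step: "\<And>n t. t \<in> {0..T} \<Longrightarrow> (norm (?p (Suc n) t - ?p n t))\<^sup>2 \<le> M * (1/4)^n * exp (c * t)"
    using picard_step[OF nu L f] by blast
  define A where "A = sqrt (M * exp (c * T))"
  have step': "norm (?p (Suc n) t - ?p n t) \<le> A * (1/2)^n" if t: "t \<in> {0..T}" for n t
  proof (rule power2_le_imp_le)
    have "(norm (?p (Suc n) t - ?p n t))\<^sup>2 \<le> M * (1/4)^n * exp (c * t)" by (rule step[OF t])
    also have "\<dots> \<le> M * (1/4)^n * exp (c * T)" using M t by (intro mult_left_mono) auto
    also have "\<dots> = (A * (1/2)^n)\<^sup>2"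
      using M by (simp add: A_def power_mult_distrib power_divide power2_eq_square flip: power_mult_distrib)
    finally show "(norm (?p (Suc n) t - ?p n t))\<^sup>2 \<le> (A * (1/2)^n)\<^sup>2" .
    show "0 \<le> A * (1/2)^n" using M by (simp add: A_def)
  qed
  have tele: "?p n t = f t + (\<Sum>i<n. ?p (Suc i) t - ?p i t)" for n t
    by (induction n) (auto simp: algebra_simps simp del: picard.simps(2))
  have "uniform_limit {0..T} (\<lambda>n t. \<Sum>i<n. ?p (Suc i) t - ?p i t) (\<lambda>t. suminf (\<lambda>i. ?p (Suc i) t - ?p i t)) sequentially"
    by (rule Weierstrass_m_test[where M="\<lambda>n. A * (1/2)^n"])
      (use step' in \<open>auto intro!: summable_mult summable_geometric simp del: picard.simps\<close>)
  then have ul': "uniform_limit {0..T} (\<lambda>n t. f t + (\<Sum>i<n. ?p (Suc i) t - ?p i t))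
      (\<lambda>t. f t + suminf (\<lambda>i. ?p (Suc i) t - ?p i t)) sequentially"
    by (intro uniform_limit_intros)
  define y where "y t = f t + suminf (\<lambda>i. ?p (Suc i) t - ?p i t)" for t
  have ul: "uniform_limit {0..T} ?p y sequentially"
    using ul' unfolding tele[symmetric] y_def by simp
  have lim: "(\<lambda>n. ?p n t) \<longlonglongrightarrow> y t" if "t \<in> {0..T}" for t
    by (rule tendsto_uniform_limitI[OF ul that])
  have ysol: "mild_sol \<nu> G f t = y t" if "t \<in> {0..T}" for t
    unfolding mild_sol_def by (rule limI[OF lim[OF that]])
  have cy: "continuous_on {0..T} y"
    by (rule uniform_limit_theorem[OF _ ul]) (simp_all add: continuous_on_picard[OF nu L f])
  have "y t = f t + Duh \<nu> (\<lambda>s. G (y s)) t" if t: "t \<in> {0..T}" for t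
  proof -
    have t0: "t \<ge> 0" using t by simp
    have sub: "{0..t} \<subseteq> {0..T}" using t by auto
    note cp = continuous_on_subset[OF continuous_on_picard[OF nu L f] sub]
    note cy' = continuous_on_subset[OF cy sub]
    have "(\<lambda>n. Duh \<nu> (\<lambda>s. G (?p n s)) t) \<longlonglongrightarrow> Duh \<nu> (\<lambda>s. G (y s)) t"
    proof (rule LIMSEQ_I)
      fix e :: real assume e: "e > 0"
      \<comment> \<open>The added ones keep the denominator positive when \<open>L\<close> or
        \<open>t\<close> is zero.\<close>
      define d where "d = e / ((L + 1) * sqrt ((t + 1) / (2 * \<nu>)))"
      have L0: "L \<ge> 0" by (rule lipschitz_nonneg[OF L])
      have d: "d > 0" using e L0 nu t0 by (simp add: d_def)
      have dd: "t / (2 * \<nu>) * (L * d)\<^sup>2 < e\<^sup>2"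
      proof -
        have "L * d < (L + 1) * d" using d by simp
        then have "(L * d)\<^sup>2 < ((L + 1) * d)\<^sup>2" using L0 d by (intro power_strict_mono) auto
        moreover have "t / (2 * \<nu>) < (t + 1) / (2 * \<nu>)" using nu by (intro divide_strict_right_mono) auto
        ultimately have "t / (2 * \<nu>) * (L * d)\<^sup>2 < (t + 1) / (2 * \<nu>) * ((L + 1) * d)\<^sup>2"
          using t0 nu by (intro mult_strict_mono') auto
        also have "(L + 1) * d = e / sqrt ((t + 1) / (2 * \<nu>))" using L0 by (simp add: d_def)
        also have "(t + 1) / (2 * \<nu>) * (e / sqrt ((t + 1) / (2 * \<nu>)))\<^sup>2 = e\<^sup>2"
          using t0 nu by (simp add: power_divide)
        finally show ?thesis .
      qed
      obtain n0 where n0: "\<And>n s. n \<ge> n0 \<Longrightarrow> s \<in> {0..T} \<Longrightarrow> norm (?p n s - y s) < d"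
        using ul d unfolding uniform_limit_iff eventually_sequentially dist_norm by meson
      show "\<exists>no. \<forall>n\<ge>no. norm (Duh \<nu> (\<lambda>s. G (?p n s)) t - Duh \<nu> (\<lambda>s. G (y s)) t) < e"
      proof (intro exI allI impI)
        fix n assume n: "n \<ge> n0"
        note c1 = continuous_on_lipschitz_compose[OF L cp] and c2 = continuous_on_lipschitz_compose[OF L cy']
        have "(norm (Duh \<nu> (\<lambda>s. G (?p n s) - G (y s)) t))\<^sup>2 \<le> t / (2 * \<nu>) * (L * d)\<^sup>2"
        proof (rule norm_Duh_le[OF nu t0 continuous_on_diff[OF c1 c2]])
          fix s assume "s \<in> {0..t}"
          then have "norm (?p n s - y s) \<le> d" using n0[OF n, of s] sub by force
          then show "norm (G (?p n s) - G (y s)) \<le> L * d"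
            using L mult_left_mono[OF _ L0] unfolding lipschitz_def by (meson order_trans)
        qed
        also have "\<dots> < e\<^sup>2" by (rule dd)
        finally show "norm (Duh \<nu> (\<lambda>s. G (?p n s)) t - Duh \<nu> (\<lambda>s. G (y s)) t) < e"
          unfolding Duh_diff[OF nu t0 c1 c2] using e by (intro power2_less_imp_less[of _ e]) auto
      qed
    qed
    then have "(\<lambda>n. ?p (Suc n) t) \<longlonglongrightarrow> f t + Duh \<nu> (\<lambda>s. G (y s)) t"
      by (auto intro!: tendsto_add)
    then show ?thesis using LIMSEQ_Suc[OF lim[OF t]] LIMSEQ_unique by blast
  qed
  then have "y t = f t + Duh \<nu> (\<lambda>s. G (mild_sol \<nu> G f s)) t" if t: "t \<in> {0..T}" for t
    using that Duh_cong[of t "\<lambda>s. G (y s)" "\<lambda>s. G (mild_sol \<nu> G f s)" \<nu>] ysol by auto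
  then show ?thesis
    unfolding mild_eq_def using continuous_on_eq[OF cy, of "mild_sol \<nu> G f"] ysol by auto
qed

text \<open>The two nonlinearities are compared along \<open>y\<close> alone, and the Lipschitz
  bound of \<open>G'\<close> absorbs the change from \<open>y\<close> to \<open>y'\<close>. With
  \<open>e = 0\<close> this gives uniqueness; with a projected nonlinearity as \<open>G'\<close>,
  \<open>e\<close> becomes a projection error on the compact image of a path.\<close>

lemma mild_eq_stability:
  assumes nu: "\<nu> > 0" and L: "lipschitz L G'" and G: "continuous_on UNIV G"
    and y: "mild_eq \<nu> G f T y" and y': "mild_eq \<nu> G' f' T y'"
    and e: "\<And>t. t \<in> {0..T} \<Longrightarrow> norm (f t - f' t) \<le> e"
      "\<And>t. t \<in> {0..T} \<Longrightarrow> norm (G (y t) - G' (y t)) \<le> e"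
    and t: "t \<in> {0..T}"
  shows "(norm (y t - y' t))\<^sup>2 \<le> (2 + 2 * T / \<nu>) * e\<^sup>2 * exp (2 * L\<^sup>2 / \<nu> * T)"
proof -
  have cy: "continuous_on {0..T} y" "continuous_on {0..T} y'" using y y' by (auto simp: mild_eq_def)
  have sq: "(norm (a + b))\<^sup>2 \<le> 2 * (norm a)\<^sup>2 + 2 * (norm b)\<^sup>2" for a b :: hs
  proof -
    have "(norm (a + b))\<^sup>2 \<le> (norm a + norm b)\<^sup>2" by (intro power_mono norm_triangle_ineq) auto
    also have "\<dots> \<le> 2 * (norm a)\<^sup>2 + 2 * (norm b)\<^sup>2"
      using sum_squares_bound[of "norm a" "norm b"] by (simp add: power2_sum)
    finally show ?thesis .
  qed
  have e0: "e \<ge> 0" using e(1)[OF t] norm_ge_zero order_trans by blast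
  have ineq: "(norm (y t - y' t))\<^sup>2 \<le> (2 + 2 * T / \<nu>) * e\<^sup>2 + integral {0..t} (\<lambda>s. 2 * L\<^sup>2 / \<nu> * (norm (y s - y' s))\<^sup>2)"
    if t: "t \<in> {0..T}" for t
  proof -
    have t0: "t \<ge> 0" and sub: "{0..t} \<subseteq> {0..T}" using t by auto
    note c = continuous_on_subset[OF cy(1) sub] continuous_on_subset[OF cy(2) sub]
    have c1: "continuous_on {0..t} (\<lambda>s. G (y s))" by (rule continuous_on_compose2[OF G c(1)]) auto
    note c2 = continuous_on_lipschitz_compose[OF L c(2)]
    have "y t - y' t = (f t - f' t) + Duh \<nu> (\<lambda>s. G (y s) - G' (y' s)) t"
      using y y' t by (simp add: mild_eq_def Duh_diff[OF nu t0 c1 c2])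
    then have "(norm (y t - y' t))\<^sup>2 \<le> 2 * (norm (f t - f' t))\<^sup>2 + 2 * (norm (Duh \<nu> (\<lambda>s. G (y s) - G' (y' s)) t))\<^sup>2"
      using sq by metis
    also have "\<dots> \<le> 2 * e\<^sup>2 + 2 * (1 / (2 * \<nu>) * integral {0..t} (\<lambda>s. 2 * e\<^sup>2 + 2 * (L\<^sup>2 * (norm (y s - y' s))\<^sup>2)))"
    proof (intro add_mono mult_left_mono power_mono e t)
      have "(norm (Duh \<nu> (\<lambda>s. G (y s) - G' (y' s)) t))\<^sup>2 \<le> 1 / (2 * \<nu>) * integral {0..t} (\<lambda>s. (norm (G (y s) - G' (y' s)))\<^sup>2)"
        by (rule norm_Duh_sq_le[OF nu t0 continuous_on_diff[OF c1 c2]])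
      also have "\<dots> \<le> 1 / (2 * \<nu>) * integral {0..t} (\<lambda>s. 2 * e\<^sup>2 + 2 * (L\<^sup>2 * (norm (y s - y' s))\<^sup>2))"
      proof (intro mult_left_mono integral_le integrable_continuous_real continuous_intros c1 c2 c)
        fix s assume s: "s \<in> {0..t}"
        have "(norm (G (y s) - G' (y' s)))\<^sup>2 \<le> 2 * (norm (G (y s) - G' (y s)))\<^sup>2 + 2 * (norm (G' (y s) - G' (y' s)))\<^sup>2"
          using sq[of "G (y s) - G' (y s)" "G' (y s) - G' (y' s)"] by simp
        also have "\<dots> \<le> 2 * e\<^sup>2 + 2 * (L * norm (y s - y' s))\<^sup>2"
          using L e(2)[of s] s sub by (intro add_mono mult_left_mono power_mono) (auto simp: lipschitz_def)
        finally show "(norm (G (y s) - G' (y' s)))\<^sup>2 \<le> 2 * e\<^sup>2 + 2 * (L\<^sup>2 * (norm (y s - y' s))\<^sup>2)"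
          by (simp add: power_mult_distrib)
      qed (use nu in auto)
      finally show "(norm (Duh \<nu> (\<lambda>s. G (y s) - G' (y' s)) t))\<^sup>2 \<le> 1 / (2 * \<nu>) * integral {0..t} (\<lambda>s. 2 * e\<^sup>2 + 2 * (L\<^sup>2 * (norm (y s - y' s))\<^sup>2))" .
    qed auto
    also have "integral {0..t} (\<lambda>s. 2 * e\<^sup>2 + 2 * (L\<^sup>2 * (norm (y s - y' s))\<^sup>2)) =
       2 * e\<^sup>2 * t + 2 * L\<^sup>2 * integral {0..t} (\<lambda>s. (norm (y s - y' s))\<^sup>2)"
      using t0 by (subst Henstock_Kurzweil_Integration.integral_add)
        (auto intro!: integrable_continuous_real continuous_intros c)
    also have "2 * e\<^sup>2 + 2 * (1 / (2 * \<nu>) * (2 * e\<^sup>2 * t + 2 * L\<^sup>2 * integral {0..t} (\<lambda>s. (norm (y s - y' s))\<^sup>2)))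
      = (2 + 2 * t / \<nu>) * e\<^sup>2 + 2 * L\<^sup>2 / \<nu> * integral {0..t} (\<lambda>s. (norm (y s - y' s))\<^sup>2)"
      using nu by (simp add: field_simps)
    also have "\<dots> \<le> (2 + 2 * T / \<nu>) * e\<^sup>2 + 2 * L\<^sup>2 / \<nu> * integral {0..t} (\<lambda>s. (norm (y s - y' s))\<^sup>2)"
      using t nu by (intro add_right_mono mult_right_mono add_left_mono divide_right_mono) auto
    finally show ?thesis by simp
  qed
  have "(norm (y t - y' t))\<^sup>2 \<le> (2 + 2 * T / \<nu>) * e\<^sup>2 * exp (integral {0..t} (\<lambda>s. 2 * L\<^sup>2 / \<nu>))"
    by (rule gronwall[OF _ _ _ ineq t]) (use nu in \<open>auto intro!: continuous_intros cy\<close>)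
  also have "\<dots> \<le> (2 + 2 * T / \<nu>) * e\<^sup>2 * exp (2 * L\<^sup>2 / \<nu> * T)"
    using t nu by (intro mult_left_mono) (auto simp: mult.commute intro!: mult_right_mono divide_right_mono)
  finally show ?thesis .
qed

lemma mild_eq_unique:
  assumes "\<nu> > 0" "lipschitz L G" "mild_eq \<nu> G f T y" "mild_eq \<nu> G f T y'" "t \<in> {0..T}"
  shows "y t = y' t"
  using mild_eq_stability[OF assms(1,2) lipschitz_continuous[OF assms(2)] assms(3,4), of 0 t] assms(5) by simp

lemma mild_eq_subset:
  assumes "mild_eq \<nu> G f T y" "T' \<le> T" shows "mild_eq \<nu> G f T' y"
  using assms by (auto simp: mild_eq_def intro: continuous_on_subset)

lemma mild_eq_cong:
  assumes "mild_eq \<nu> G f T y" "\<And>t. t \<in> {0..T} \<Longrightarrow> G (y t) = G' (y t)" "\<And>t. t \<in> {0..T} \<Longrightarrow> f t = f' t"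
  shows "mild_eq \<nu> G' f' T y"
  unfolding mild_eq_def
proof (intro conjI ballI)
  show "continuous_on {0..T} y" using assms(1) by (simp add: mild_eq_def)
  fix t assume t: "t \<in> {0..T}"
  have "Duh \<nu> (\<lambda>s. G (y s)) t = Duh \<nu> (\<lambda>s. G' (y s)) t"
    by (rule Duh_cong) (use t assms(2) in auto)
  then show "y t = f' t + Duh \<nu> (\<lambda>s. G' (y s)) t"
    using assms(1,3) t by (simp add: mild_eq_def)
qed

section \<open>Measurability of the solution in a parameter\<close>

lemma measurable_Duh:
  assumes "t \<ge> 0" "\<And>s. s \<in> {0..t} \<Longrightarrow> (\<lambda>w. g w s) \<in> borel_measurable M"
  shows "(\<lambda>w. Duh \<nu> (g w) t) \<in> borel_measurable M"
proof -
  have [measurable]: "(\<lambda>w. g w (t * real i / real (Suc n))) \<in> borel_measurable M" if "i \<in> {..<Suc n}" for i n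
    using that assms(1) mult_left_mono[of "real i" "real (Suc n)" t]
    by (intro assms(2)) (simp add: field_simps)
  show ?thesis
    unfolding Duh_def Duh_coord_def riemann_sum_def by measurable
qed

lemma measurable_mild_sol:
  assumes G: "G \<in> borel_measurable borel"
    and f: "\<And>s. s \<in> {0..t} \<Longrightarrow> (\<lambda>w. f w s) \<in> borel_measurable M" and t: "t \<ge> 0"
  shows "(\<lambda>w. mild_sol \<nu> G (f w) t) \<in> borel_measurable M"
proof -
  have "(\<lambda>w. picard \<nu> G (f w) n s) \<in> borel_measurable M" if "s \<in> {0..t}" for n s
    using that
  proof (induction n arbitrary: s)
    case (Suc n)
    have "(\<lambda>w. Duh \<nu> (\<lambda>s. G (picard \<nu> G (f w) n s)) s) \<in> borel_measurable M"
      by (rule measurable_Duh) (use Suc in \<open>auto intro!: measurable_compose[OF _ G]\<close>)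
    then show ?case using f[OF Suc.prems] by simp
  qed (use f in simp)
  then show ?thesis unfolding mild_sol_def using t by (intro borel_measurable_lim_metric) auto
qed

section \<open>The nonlinearity in Fourier coefficients\<close>

text \<open>\<open>cf x\<close> are the complex Fourier coefficients of \<open>\<Sum>k. x k * ebasis k\<close>, and \<open>rc\<close> inverts \<open>cf\<close>.\<close>

definition cf :: "(int \<Rightarrow> real) \<Rightarrow> int \<Rightarrow> complex" where
  "cf x k = (if k = 0 then 0 else Complex (x \<bar>k\<bar>) (- of_int (sgn k) * x (- \<bar>k\<bar>)) / (2 * sqrt pi))"

definition rc :: "(int \<Rightarrow> complex) \<Rightarrow> int \<Rightarrow> real" where
  "rc c k = (if k = 0 then 0 else 2 * sqrt pi * (if k > 0 then Re (c k) else - Im (c (- k))))"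

lemma cf_0 [simp]: "cf x 0 = 0" and rc_0 [simp]: "rc c 0 = 0"
  by (simp_all add: cf_def rc_def)

lemma rc_cf: "k \<noteq> 0 \<Longrightarrow> rc (cf x) k = x k"
  by (auto simp: rc_def cf_def)

lemma cf_uminus: "cf x (- k) = cnj (cf x k)"
  by (simp add: cf_def complex_eq_iff)

lemma cf_scale: "cf (\<lambda>k. r * x k) k = of_real r * cf x k"
  by (auto simp: cf_def complex_eq_iff field_simps)

lemma cf_cong: "x k = y k \<Longrightarrow> x (- k) = y (- k) \<Longrightarrow> cf x k = cf y k"
  by (cases "k > 0") (auto simp: cf_def)

lemma norm_cf_sq: "k \<noteq> 0 \<Longrightarrow> (norm (cf x k))\<^sup>2 = ((x k)\<^sup>2 + (x (- k))\<^sup>2) / (4 * pi)"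
  by (cases "k > 0") (auto simp: cf_def norm_divide norm_mult cmod_power2 power_divide power_mult_distrib)

lemma norm_cf_sq_le: "(norm (cf x k))\<^sup>2 \<le> (x k)\<^sup>2 + (x (- k))\<^sup>2"
proof (cases "k = 0")
  case False
  have "((x k)\<^sup>2 + (x (- k))\<^sup>2) / (4 * pi) \<le> ((x k)\<^sup>2 + (x (- k))\<^sup>2) / 1"
    using pi_gt3 by (intro divide_left_mono) auto
  then show ?thesis using False by (simp add: norm_cf_sq)
qed simp

lemma abs_rc_le: "\<bar>rc c k\<bar> \<le> 2 * sqrt pi * norm (c \<bar>k\<bar>)"
  using abs_Re_le_cmod[of "c k"] abs_Im_le_cmod[of "c (- k)"]
  by (auto simp: rc_def abs_mult)

text \<open>With \<open>a = -2\<close> the nonlinearity is \<open>2 * (u * \<omega>)\<^sub>x - u\<^sub>x * \<omega>\<close>, and \<open>u\<close> has the coefficients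
  \<open>- cf x j / \<bar>j\<bar>\<close>; the symbol below vanishes at \<open>j = 0\<close> because \<open>1 / 0 = 0\<close>.\<close>

definition csym :: "int \<Rightarrow> int \<Rightarrow> complex" where
  "csym k j = - (\<i> * of_int (2 * k - j) / of_int \<bar>j\<bar>)"

text \<open>For \<open>x = y\<close> this is the coefficient \<open>k\<close> of the nonlinearity.
  The arguments are kept apart because the Lipschitz bound will come from polarising the bilinear
  map.\<close>

definition conv :: "(int \<Rightarrow> real) \<Rightarrow> (int \<Rightarrow> real) \<Rightarrow> int \<Rightarrow> complex" where
  "conv x y k = (\<Sum>\<^sub>\<infinity>j. csym k j * (cf x j * cf y (k - j)))"

text \<open>All signs come from \<open>2 * k - j\<close>, which changes sign under each of the two
  substitutions. The second one is the source of the energy cancellation.\<close>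

lemma csym_uminus: "csym (- k) (- j) = cnj (csym k j)"
  and csym_reflect: "csym (j - k) j = - csym k j"
proof -
  define n where "n = 2 * k - j"
  have n: "2 * - k - - j = - n" "2 * (j - k) - j = - n" by (simp_all add: n_def)
  show "csym (- k) (- j) = cnj (csym k j)" "csym (j - k) j = - csym k j"
    unfolding csym_def n n_def[symmetric] by simp_all
qed

text \<open>Replacing \<open>j\<close> by \<open>-j\<close> and using conjugate symmetry of the
  symbol and of the coefficients. It expresses that the nonlinearity of real functions is
  real.\<close>

lemma conv_uminus: "conv x y (- k) = cnj (conv x y k)"
proof -
  have "conv x y (- k) = (\<Sum>\<^sub>\<infinity>j. csym (- k) (- j) * (cf x (- j) * cf y (- k - - j)))"
    unfolding conv_def by (rule infsum_reindex_bij_betw[symmetric]) (auto intro!: bij_betwI[of _ _ _ uminus])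
  also have "\<dots> = (\<Sum>\<^sub>\<infinity>j. cnj (csym k j * (cf x j * cf y (k - j))))"
  proof (rule infsum_cong)
    fix j
    have "cf y (- k - - j) = cnj (cf y (k - j))" using cf_uminus[of y "k - j"] by simp
    then show "csym (- k) (- j) * (cf x (- j) * cf y (- k - - j)) = cnj (csym k j * (cf x j * cf y (k - j)))"
      by (simp only: csym_uminus cf_uminus complex_cnj_mult)
  qed
  finally show ?thesis by (simp only: conv_def infsum_cnj)
qed

text \<open>For nonzero \<open>k\<close> and \<open>j\<close> both \<open>|k|\<close> and
  \<open>|j|\<close> are at most \<open>|k| * |j|\<close>. After division by \<open>|j|\<close> only
  the factor \<open>|k|\<close> remains, the single derivative lost by the nonlinearity.\<close>

lemma norm_csym_le:
  assumes "k \<noteq> 0" shows "norm (csym k j) \<le> 3 * \<bar>of_int k\<bar>"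
proof (cases "j = 0")
  case False
  have "norm (csym k j) = \<bar>of_int (2 * k - j)\<bar> / \<bar>of_int j\<bar>"
    by (simp add: csym_def norm_mult norm_divide del: of_int_diff of_int_mult flip: of_int_abs)
  also have "\<dots> \<le> (3 * \<bar>of_int k\<bar> * \<bar>of_int j\<bar>) / \<bar>of_int j\<bar>"
  proof (rule divide_right_mono)
    have "\<bar>2 * k - j\<bar> \<le> 2 * \<bar>k\<bar> + \<bar>j\<bar>" by simp
    also have "\<dots> \<le> 2 * (\<bar>k\<bar> * \<bar>j\<bar>) + \<bar>k\<bar> * \<bar>j\<bar>"
    proof -
      have "1 \<le> \<bar>j\<bar>" "1 \<le> \<bar>k\<bar>" using False assms by auto
      then have "\<bar>k\<bar> * 1 \<le> \<bar>k\<bar> * \<bar>j\<bar>" "1 * \<bar>j\<bar> \<le> \<bar>k\<bar> * \<bar>j\<bar>"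
        by (intro mult_left_mono mult_right_mono; simp)+
      then show ?thesis by (simp add: mult.commute)
    qed
    finally have "\<bar>2 * k - j\<bar> \<le> 3 * \<bar>k\<bar> * \<bar>j\<bar>" by (simp add: mult_ac)
    then have "real_of_int \<bar>2 * k - j\<bar> \<le> real_of_int (3 * \<bar>k\<bar> * \<bar>j\<bar>)" by (rule of_int_le_iff[THEN iffD2])
    then show "\<bar>real_of_int (2 * k - j)\<bar> \<le> 3 * \<bar>of_int k\<bar> * \<bar>of_int j\<bar>" by simp
  qed simp
  finally show ?thesis using False by simp
qed (simp add: csym_def)

section \<open>Convolution estimates\<close>

lemma
  fixes f :: "'i \<Rightarrow> 'j \<Rightarrow> real"
  assumes "\<And>i. i \<in> I \<Longrightarrow> f i summable_on A"
  shows summable_on_finite_sum: "(\<lambda>x. \<Sum>i\<in>I. f i x) summable_on A"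
    and infsum_finite_sum: "(\<Sum>\<^sub>\<infinity>x\<in>A. \<Sum>i\<in>I. f i x) = (\<Sum>i\<in>I. \<Sum>\<^sub>\<infinity>x\<in>A. f i x)"
proof -
  have "(\<lambda>x. \<Sum>i\<in>I. f i x) summable_on A \<and> (\<Sum>\<^sub>\<infinity>x\<in>A. \<Sum>i\<in>I. f i x) = (\<Sum>i\<in>I. \<Sum>\<^sub>\<infinity>x\<in>A. f i x)"
    using assms by (induction I rule: infinite_finite_induct) (auto simp: summable_on_add infsum_add)
  then show "(\<lambda>x. \<Sum>i\<in>I. f i x) summable_on A" "(\<Sum>\<^sub>\<infinity>x\<in>A. \<Sum>i\<in>I. f i x) = (\<Sum>i\<in>I. \<Sum>\<^sub>\<infinity>x\<in>A. f i x)"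
    by auto
qed

lemma summable_shift:
  fixes f :: "int \<Rightarrow> real"
  assumes "f summable_on UNIV"
  shows "(\<lambda>j. f (k - j)) summable_on UNIV" "(\<Sum>\<^sub>\<infinity>j. f (k - j)) = (\<Sum>\<^sub>\<infinity>j. f j)"
proof -
  have "bij_betw (\<lambda>j. k - j) UNIV UNIV" by (auto intro!: bij_betwI[of _ _ _ "\<lambda>j. k - j"])
  from summable_on_reindex_bij_betw[OF this, of f] infsum_reindex_bij_betw[OF this, of f]
  show "(\<lambda>j. f (k - j)) summable_on UNIV" "(\<Sum>\<^sub>\<infinity>j. f (k - j)) = (\<Sum>\<^sub>\<infinity>j. f j)" using assms by auto
qed

text \<open>Young's inequality: \<open>b\<close> is written as a product of two square roots,
  Cauchy-Schwarz leaves one of them with \<open>X\<close>, and summing over \<open>k\<close> first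
  produces the total mass of \<open>b\<close>. Finite sums over \<open>K\<close> are the form in
  which membership in \<open>hs\<close> is tested.\<close>

lemma Young_l2_l1:
  fixes X b :: "int \<Rightarrow> real"
  assumes X: "(\<lambda>j. (X j)\<^sup>2) summable_on UNIV" "\<And>j. X j \<ge> 0" and b: "b summable_on UNIV" "\<And>j. b j \<ge> 0"
  shows "(\<lambda>j. X j * b (k - j)) summable_on UNIV"
    and "finite K \<Longrightarrow> (\<Sum>k\<in>K. (\<Sum>\<^sub>\<infinity>j. X j * b (k - j))\<^sup>2) \<le> (\<Sum>\<^sub>\<infinity>j. b j)\<^sup>2 * (\<Sum>\<^sub>\<infinity>j. (X j)\<^sup>2)"
proof -
  define B where "B = (\<Sum>\<^sub>\<infinity>j. b j)"
  have B0: "B \<ge> 0" unfolding B_def by (rule infsum_nonneg) (rule b)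
  have bB: "sum b F \<le> B" if "finite F" for F
    unfolding B_def using that b by (intro finite_sum_le_infsum) auto
  have sX: "(\<lambda>j. (X j)\<^sup>2 * b (k - j)) summable_on UNIV" for k
    by (rule summable_on_comparison_test[OF summable_on_cmult_left[OF X(1), of B]])
      (use bB[of "{k - j}" for j] b(2) in \<open>auto intro!: mult_left_mono\<close>)
  have s: "(\<lambda>j. (X j * sqrt (b (k - j)))\<^sup>2) summable_on UNIV" "(\<lambda>j. (sqrt (b (k - j)))\<^sup>2) summable_on UNIV" for k
    using sX summable_shift(1)[OF b(1)] b(2) by (simp_all add: power_mult_distrib)
  have eq: "\<bar>X j * sqrt (b (k - j)) * sqrt (b (k - j))\<bar> = X j * b (k - j)" for j k
    using X(2) b(2) by (simp add: abs_mult mult.assoc)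
  show "(\<lambda>j. X j * b (k - j)) summable_on UNIV" for k
    using summable_sq_mult(2)[OF s(1)[of k] s(2)[of k]] by (simp only: eq)
  assume K: "finite K"
  have "(\<Sum>\<^sub>\<infinity>j. X j * b (k - j))\<^sup>2 \<le> (\<Sum>\<^sub>\<infinity>j. (X j)\<^sup>2 * b (k - j)) * B" for k
  proof -
    have "(\<Sum>\<^sub>\<infinity>j. X j * b (k - j)) \<le> sqrt (\<Sum>\<^sub>\<infinity>j. (X j)\<^sup>2 * b (k - j)) * sqrt B"
      using infsum_Cauchy_Schwarz[OF s(1)[of k] s(2)[of k]] summable_shift(2)[OF b(1), of k] b(2)
      by (simp only: eq power_mult_distrib real_sqrt_pow2 B_def)
    moreover have "0 \<le> (\<Sum>\<^sub>\<infinity>j. X j * b (k - j))" "0 \<le> (\<Sum>\<^sub>\<infinity>j. (X j)\<^sup>2 * b (k - j))"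
      using X b by (auto intro!: infsum_nonneg)
    ultimately show ?thesis
      using B0 power_mono[of "\<Sum>\<^sub>\<infinity>j. X j * b (k - j)" "sqrt (\<Sum>\<^sub>\<infinity>j. (X j)\<^sup>2 * b (k - j)) * sqrt B" 2]
      by (simp add: power_mult_distrib)
  qed
  then have "(\<Sum>k\<in>K. (\<Sum>\<^sub>\<infinity>j. X j * b (k - j))\<^sup>2) \<le> (\<Sum>k\<in>K. (\<Sum>\<^sub>\<infinity>j. (X j)\<^sup>2 * b (k - j)) * B)"
    by (rule sum_mono)
  also have "\<dots> = (\<Sum>\<^sub>\<infinity>j. (\<Sum>k\<in>K. (X j)\<^sup>2 * b (k - j))) * B"
    by (simp add: infsum_finite_sum[OF sX] sum_distrib_right)
  also have "\<dots> \<le> (\<Sum>\<^sub>\<infinity>j. (X j)\<^sup>2 * B) * B"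
  proof (intro mult_right_mono B0 infsum_mono)
    show "(\<lambda>j. \<Sum>k\<in>K. (X j)\<^sup>2 * b (k - j)) summable_on UNIV" by (rule summable_on_finite_sum[OF sX])
    show "(\<lambda>j. (X j)\<^sup>2 * B) summable_on UNIV" by (rule summable_on_cmult_left[OF X(1)])
    fix j
    have "(\<Sum>k\<in>K. b (k - j)) = sum b ((\<lambda>k. k - j) ` K)"
      by (subst sum.reindex) (auto simp: inj_on_def)
    then show "(\<Sum>k\<in>K. (X j)\<^sup>2 * b (k - j)) \<le> (X j)\<^sup>2 * B"
      using bB[of "(\<lambda>k. k - j) ` K"] K by (simp add: mult_left_mono flip: sum_distrib_left)
  qed
  also have "\<dots> = (\<Sum>\<^sub>\<infinity>j. b j)\<^sup>2 * (\<Sum>\<^sub>\<infinity>j. (X j)\<^sup>2)"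
    by (simp add: infsum_cmult_left' B_def power2_eq_square)
  finally show "(\<Sum>k\<in>K. (\<Sum>\<^sub>\<infinity>j. X j * b (k - j))\<^sup>2) \<le> (\<Sum>\<^sub>\<infinity>j. b j)\<^sup>2 * (\<Sum>\<^sub>\<infinity>j. (X j)\<^sup>2)" .
qed

text \<open>Passing from order \<open>s\<close> to order \<open>s - p\<close> of the Sobolev scale.\<close>

definition dn :: "nat \<Rightarrow> hs \<Rightarrow> hs" where "dn p y = Abs_hs (\<lambda>k. hnth y k / \<bar>of_int k\<bar> ^ p)"

lemma abs_int_power_ge1: "k \<noteq> 0 \<Longrightarrow> 1 \<le> \<bar>real_of_int k\<bar> ^ p"
  by (rule one_le_power) linarith

lemma hnth_dn [simp]: "hnth (dn p y) k = hnth y k / \<bar>of_int k\<bar> ^ p"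
proof -
  have "\<bar>hnth y k / \<bar>of_int k\<bar> ^ p\<bar> \<le> \<bar>hnth y k\<bar>" for k
    using abs_int_power_ge1[of k p] by (cases "k = 0") (auto simp: divide_le_eq mult_le_cancel_left1 abs_mult power_abs)
  then have "(\<Sum>k\<in>F. (hnth y k / \<bar>of_int k\<bar> ^ p)\<^sup>2) \<le> (norm y)\<^sup>2" if "finite F" for F
    using sum_hnth_le[OF that, of y] by (meson abs_le_square_iff order_trans sum_mono)
  then have "hnth (Abs_hs (\<lambda>k. hnth y k / \<bar>of_int k\<bar> ^ p)) = (\<lambda>k. hnth y k / \<bar>of_int k\<bar> ^ p)"
    by (intro hnth_Abs) auto
  then show ?thesis by (simp add: dn_def)
qed

lemma norm_dn_le: "norm (dn p y) \<le> norm y"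
proof (rule norm_hs_coord_mono)
  fix k show "\<bar>hnth (dn p y) k\<bar> \<le> \<bar>hnth y k\<bar>"
    using abs_int_power_ge1[of k p] by (cases "k = 0") (auto simp: divide_le_eq mult_le_cancel_left1 abs_mult power_abs)
qed

lemma bounded_linear_dn: "bounded_linear (dn p)"
  by (rule bounded_linear_intro[where K=1]) (auto intro!: hs_eqI simp: norm_dn_le add_divide_distrib)

text \<open>Each coordinate is counted once at \<open>j\<close> and once at \<open>-j\<close>, hence
  the factor 2.\<close>

lemma
  shows summable_cf_sq: "(\<lambda>j. (norm (cf (hnth x) j))\<^sup>2) summable_on UNIV"
    and infsum_cf_sq_le: "(\<Sum>\<^sub>\<infinity>j. (norm (cf (hnth x) j))\<^sup>2) \<le> 2 * (norm x)\<^sup>2"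
proof -
  have s: "(\<lambda>j. (hnth x (- j))\<^sup>2) summable_on UNIV" "(\<Sum>\<^sub>\<infinity>j. (hnth x (- j))\<^sup>2) = (norm x)\<^sup>2"
    using summable_shift[OF summable_hnth[of x], of 0] by (simp_all add: norm_hs_sq)
  have s2: "(\<lambda>j. (hnth x j)\<^sup>2 + (hnth x (- j))\<^sup>2) summable_on UNIV"
    by (intro summable_on_add s summable_hnth)
  show *: "(\<lambda>j. (norm (cf (hnth x) j))\<^sup>2) summable_on UNIV"
    by (rule summable_on_comparison_test[OF s2]) (auto simp: norm_cf_sq_le)
  have "(\<Sum>\<^sub>\<infinity>j. (norm (cf (hnth x) j))\<^sup>2) \<le> (\<Sum>\<^sub>\<infinity>j. (hnth x j)\<^sup>2 + (hnth x (- j))\<^sup>2)"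
    by (rule infsum_mono[OF * s2]) (rule norm_cf_sq_le)
  also have "\<dots> = 2 * (norm x)\<^sup>2" by (subst infsum_add) (auto simp: s summable_hnth norm_hs_sq)
  finally show "(\<Sum>\<^sub>\<infinity>j. (norm (cf (hnth x) j))\<^sup>2) \<le> 2 * (norm x)\<^sup>2" .
qed

lemma cf_dn: "cf (hnth (dn p x)) j = cf (hnth x) j / of_real (\<bar>of_int j\<bar> ^ p)"
  by (auto simp: cf_def complex_eq_iff)

lemma norm_cf_dn: "norm (cf (hnth (dn p x)) j) = norm (cf (hnth x) j) / \<bar>of_int j\<bar> ^ p"
  unfolding cf_dn norm_divide norm_of_real by (simp add: power_abs)

text \<open>The term at 0 vanishes because \<open>1 / 0 = 0\<close>; the two half-lines are copies
  of the series over the naturals.\<close>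

lemma summable_inverse_sq_int: "(\<lambda>k::int. (1 / \<bar>real_of_int k\<bar>)\<^sup>2) summable_on UNIV"
proof -
  have nat: "(\<lambda>n::nat. (1 / real n)\<^sup>2) summable_on UNIV"
    using inverse_power_summable[of 2, where ?'a = real]
    by (intro summable_nonneg_imp_summable_on) (auto simp: divide_inverse power_inverse)
  have 1: "(\<lambda>k::int. (1 / \<bar>real_of_int k\<bar>)\<^sup>2) summable_on range int"
    using nat by (subst summable_on_reindex) (auto simp: o_def)
  have 2: "(\<lambda>k::int. (1 / \<bar>real_of_int k\<bar>)\<^sup>2) summable_on range (\<lambda>n. - int n)"
    using nat by (subst summable_on_reindex) (auto simp: o_def inj_on_def)
  have "range int \<union> range (\<lambda>n. - int n) = UNIV"
    by (auto simp: image_iff) (metis int_cases2)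
  then show ?thesis using summable_on_union[OF 1 2] by simp
qed

definition inv_sq_sum :: real where "inv_sq_sum = (\<Sum>\<^sub>\<infinity>k::int. (1 / \<bar>real_of_int k\<bar>)\<^sup>2)"

lemma inv_sq_sum_nonneg: "inv_sq_sum \<ge> 0"
  unfolding inv_sq_sum_def by (rule infsum_nonneg) simp

text \<open>Cauchy-Schwarz against \<open>1 / |j|\<close>: one derivative in L2 gives an absolutely
  convergent Fourier series. If \<open>x\<close> holds weighted coefficients of order
  \<open>p\<close>, then \<open>dn p x\<close> holds the plain coefficients and the norm of
  \<open>dn (p - 1) x\<close> is the H1 norm.\<close>

lemma
  assumes "p \<ge> 1"
  shows summable_norm_cf: "(\<lambda>j. norm (cf (hnth (dn p x)) j)) summable_on UNIV"
    and infsum_norm_cf_le: "(\<Sum>\<^sub>\<infinity>j. norm (cf (hnth (dn p x)) j)) \<le> sqrt (2 * inv_sq_sum) * norm (dn (p - 1) x)"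
proof -
  have eq: "norm (cf (hnth (dn p x)) j) = \<bar>1 / \<bar>real_of_int j\<bar> * norm (cf (hnth (dn (p - 1) x)) j)\<bar>" for j
  proof -
    have "\<bar>real_of_int j\<bar> ^ p = \<bar>real_of_int j\<bar> * \<bar>real_of_int j\<bar> ^ (p - 1)"
      using assms by (cases p) auto
    then show ?thesis by (simp add: norm_cf_dn abs_mult)
  qed
  show "(\<lambda>j. norm (cf (hnth (dn p x)) j)) summable_on UNIV"
    unfolding eq by (intro summable_sq_mult(2) summable_inverse_sq_int summable_cf_sq)
  have "(\<Sum>\<^sub>\<infinity>j. norm (cf (hnth (dn p x)) j)) \<le> sqrt inv_sq_sum * sqrt (\<Sum>\<^sub>\<infinity>j. (norm (cf (hnth (dn (p - 1) x)) j))\<^sup>2)"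
    unfolding eq inv_sq_sum_def by (rule infsum_Cauchy_Schwarz[OF summable_inverse_sq_int summable_cf_sq])
  also have "\<dots> \<le> sqrt inv_sq_sum * sqrt (2 * (norm (dn (p - 1) x))\<^sup>2)"
    using infsum_cf_sq_le inv_sq_sum_nonneg by (intro mult_left_mono real_sqrt_le_mono) auto
  also have "\<dots> = sqrt (2 * inv_sq_sum) * norm (dn (p - 1) x)" by (simp add: real_sqrt_mult)
  finally show "(\<Sum>\<^sub>\<infinity>j. norm (cf (hnth (dn p x)) j)) \<le> sqrt (2 * inv_sq_sum) * norm (dn (p - 1) x)" .
qed

lemma summable_conv:
  assumes "k \<noteq> 0"
  shows "(\<lambda>j. norm (cf (hnth x) j) * norm (cf (hnth y) (k - j))) summable_on UNIV"
    and "(\<lambda>j. csym k j * (cf (hnth x) j * cf (hnth y) (k - j))) summable_on UNIV"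
    and "norm (conv (hnth x) (hnth y) k) \<le> 3 * \<bar>of_int k\<bar> * (\<Sum>\<^sub>\<infinity>j. norm (cf (hnth x) j) * norm (cf (hnth y) (k - j)))"
proof -
  have sy: "(\<lambda>j. (norm (cf (hnth y) (k - j)))\<^sup>2) summable_on UNIV"
    by (rule summable_shift(1)[OF summable_cf_sq])
  show 1: "(\<lambda>j. norm (cf (hnth x) j) * norm (cf (hnth y) (k - j))) summable_on UNIV"
    by (rule summable_sq_mult(1)[OF summable_cf_sq sy])
  then have 2: "(\<lambda>j. 3 * \<bar>of_int k\<bar> * (norm (cf (hnth x) j) * norm (cf (hnth y) (k - j)))) summable_on UNIV"
    by (rule summable_on_cmult_right)
  have le: "norm (csym k j * (cf (hnth x) j * cf (hnth y) (k - j))) \<le> 3 * \<bar>of_int k\<bar> * (norm (cf (hnth x) j) * norm (cf (hnth y) (k - j)))" for j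
    using norm_csym_le[OF assms, of j] by (simp add: norm_mult mult_right_mono)
  have 3: "(\<lambda>j. norm (csym k j * (cf (hnth x) j * cf (hnth y) (k - j)))) summable_on UNIV"
    by (rule summable_on_comparison_test[OF 2 le]) simp
  then show "(\<lambda>j. csym k j * (cf (hnth x) j * cf (hnth y) (k - j))) summable_on UNIV"
    by (rule abs_summable_summable)
  have "norm (conv (hnth x) (hnth y) k) \<le> (\<Sum>\<^sub>\<infinity>j. norm (csym k j * (cf (hnth x) j * cf (hnth y) (k - j))))"
    unfolding conv_def by (rule norm_infsum_bound[OF 3])
  also have "\<dots> \<le> (\<Sum>\<^sub>\<infinity>j. 3 * \<bar>of_int k\<bar> * (norm (cf (hnth x) j) * norm (cf (hnth y) (k - j))))"
    by (rule infsum_mono[OF 3 2 le])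
  finally show "norm (conv (hnth x) (hnth y) k) \<le> 3 * \<bar>of_int k\<bar> * (\<Sum>\<^sub>\<infinity>j. norm (cf (hnth x) j) * norm (cf (hnth y) (k - j)))"
    by (simp add: infsum_cmult_right')
qed

text \<open>The exponent is \<open>m - 1\<close> and not \<open>m\<close> because the nonlinearity
  loses one derivative; the missing factor \<open>|k|\<close> is built into
  \<open>Duh\<close>.\<close>

definition Qseq :: "nat \<Rightarrow> hs \<Rightarrow> hs \<Rightarrow> int \<Rightarrow> real" where
  "Qseq m x y k = \<bar>of_int k\<bar> ^ (m - 1) * rc (conv (hnth (dn m x)) (hnth (dn m y))) k"

definition Q :: "nat \<Rightarrow> hs \<Rightarrow> hs \<Rightarrow> hs" where "Q m x y = Abs_hs (Qseq m x y)"

text \<open>The larger of \<open>|j|\<close> and \<open>|k - j|\<close> is at least half of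
  \<open>|k|\<close>.\<close>

lemma power_abs_split: "\<bar>real_of_int k\<bar> ^ m \<le> 2 ^ m * (\<bar>real_of_int j\<bar> ^ m + \<bar>real_of_int (k - j)\<bar> ^ m)"
proof -
  have "\<bar>real_of_int k\<bar> \<le> 2 * max \<bar>real_of_int j\<bar> \<bar>real_of_int (k - j)\<bar>"
    using abs_triangle_ineq[of "real_of_int j" "real_of_int (k - j)"] by (simp add: max_def)
  then have "\<bar>real_of_int k\<bar> ^ m \<le> (2 * max \<bar>real_of_int j\<bar> \<bar>real_of_int (k - j)\<bar>) ^ m" by (intro power_mono) auto
  also have "\<dots> \<le> 2 ^ m * (\<bar>real_of_int j\<bar> ^ m + \<bar>real_of_int (k - j)\<bar> ^ m)"
    unfolding power_mult_distrib by (intro mult_left_mono) (auto simp: max_def)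
  finally show ?thesis .
qed

text \<open>\<open>|k| ^ (m - 1)\<close> and the factor \<open>|k|\<close> of the symbol combine to
  \<open>|k| ^ m\<close>, which is moved onto one of the two factors. In every term one factor
  \<open>A\<close> then carries the full weight and is square summable, while the other factor
  \<open>a\<close> is absolutely summable, as Young's inequality requires.\<close>

lemma Qseq_bound:
  assumes m: "m \<ge> 1"
  defines "A \<equiv> \<lambda>x j. norm (cf (hnth x) j)" and "a \<equiv> \<lambda>x j. norm (cf (hnth (dn m x)) j)"
  shows "\<bar>Qseq m x y k\<bar> \<le> 6 * sqrt pi * 2 ^ m * ((\<Sum>\<^sub>\<infinity>j. A x j * a y (\<bar>k\<bar> - j)) + (\<Sum>\<^sub>\<infinity>j. A y j * a x (\<bar>k\<bar> - j)))"
proof (cases "k = 0")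
  case True
  then show ?thesis
    by (auto simp: Qseq_def A_def a_def intro!: mult_nonneg_nonneg add_nonneg_nonneg infsum_nonneg)
next
  case False
  \<comment> \<open>\<open>rc\<close> reads its real coordinates off the complex coefficient at
    \<open>|k|\<close>.\<close>
  define l where "l = \<bar>k\<bar>"
  have l: "l \<noteq> 0" "\<bar>real_of_int l\<bar> = \<bar>real_of_int k\<bar>" using False by (auto simp: l_def)
  have sA: "(\<lambda>j. (A x j)\<^sup>2) summable_on UNIV" for x unfolding A_def by (rule summable_cf_sq)
  have sa: "a x summable_on UNIV" for x unfolding a_def by (rule summable_norm_cf[OF m])
  have nn: "A x j \<ge> 0" "a x j \<ge> 0" for x j by (auto simp: A_def a_def)
  note Y = Young_l2_l1(1)[OF sA nn(1) sa nn(2)]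
  have flip: "(\<lambda>j. a x j * A y (l - j)) summable_on UNIV"
     "(\<Sum>\<^sub>\<infinity>j. a x j * A y (l - j)) = (\<Sum>\<^sub>\<infinity>j. A y j * a x (l - j))"
    using summable_shift[OF Y[of y x l], of l] by (simp_all add: mult.commute)
  have pw: "\<bar>real_of_int j\<bar> ^ m * a x j = A x j" for j x
    by (cases "j = 0") (auto simp: A_def a_def norm_cf_dn)
  have S: "\<bar>of_int k\<bar> ^ m * (a x j * a y (l - j)) \<le> 2 ^ m * (A x j * a y (l - j) + a x j * A y (l - j))" for j
  proof -
    have "\<bar>of_int k\<bar> ^ m * (a x j * a y (l - j)) \<le> 2 ^ m * (\<bar>real_of_int j\<bar> ^ m + \<bar>real_of_int (l - j)\<bar> ^ m) * (a x j * a y (l - j))"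
      using power_abs_split[of l m j] l nn by (intro mult_right_mono) auto
    also have "\<dots> = 2 ^ m * (\<bar>real_of_int j\<bar> ^ m * a x j * a y (l - j) + a x j * (\<bar>real_of_int (l - j)\<bar> ^ m * a y (l - j)))"
      by (simp add: algebra_simps)
    finally show ?thesis by (simp only: pw)
  qed
  have sxy: "(\<lambda>j. a x j * a y (l - j)) summable_on UNIV"
    unfolding a_def by (rule summable_conv(1)[OF l(1)])
  have pm: "\<bar>real_of_int k\<bar> ^ m = \<bar>real_of_int k\<bar> ^ (m - 1) * \<bar>real_of_int k\<bar>"
    using m by (cases m) auto
  have "\<bar>Qseq m x y k\<bar> \<le> \<bar>of_int k\<bar> ^ (m - 1) * (2 * sqrt pi * norm (conv (hnth (dn m x)) (hnth (dn m y)) l))"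
    unfolding Qseq_def abs_mult l_def using abs_rc_le by (intro mult_mono) auto
  also have "\<dots> \<le> \<bar>of_int k\<bar> ^ (m - 1) * (2 * sqrt pi * (3 * \<bar>of_int l\<bar> * (\<Sum>\<^sub>\<infinity>j. a x j * a y (l - j))))"
    using summable_conv(3)[OF l(1), of "dn m x" "dn m y"] by (intro mult_left_mono) (auto simp: a_def)
  also have "\<dots> = 6 * sqrt pi * (\<bar>of_int k\<bar> ^ m * (\<Sum>\<^sub>\<infinity>j. a x j * a y (l - j)))"
    unfolding l pm by simp
  also have "\<dots> = 6 * sqrt pi * (\<Sum>\<^sub>\<infinity>j. \<bar>of_int k\<bar> ^ m * (a x j * a y (l - j)))"
    by (simp only: infsum_cmult_right')
  also have "\<dots> \<le> 6 * sqrt pi * (\<Sum>\<^sub>\<infinity>j. 2 ^ m * (A x j * a y (l - j) + a x j * A y (l - j)))"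
    by (intro mult_left_mono infsum_mono S summable_on_cmult_right summable_on_add sxy flip Y) auto
  also have "\<dots> = 6 * sqrt pi * 2 ^ m * ((\<Sum>\<^sub>\<infinity>j. A x j * a y (l - j)) + (\<Sum>\<^sub>\<infinity>j. A y j * a x (l - j)))"
    by (simp add: infsum_cmult_right' infsum_add[OF Y flip(1)] flip(2))
  finally show ?thesis by (simp add: l_def)
qed

text \<open>Young's inequality with the l1 norm bounded by the H1 norm through
  \<open>infsum_norm_cf_le\<close>; each product contains the top-order norm of one factor
  only.\<close>

lemma Qseq_sq_bound:
  assumes m: "m \<ge> 1"
  shows "\<exists>C\<ge>0. \<forall>x y F. finite F \<longrightarrow> (\<Sum>k\<in>F. (Qseq m x y k)\<^sup>2)
    \<le> (C * (norm x * norm (dn (m - 1) y) + norm (dn (m - 1) x) * norm y))\<^sup>2"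
proof -
  define A where "A = (\<lambda>x j. norm (cf (hnth x) j))"
  define a where "a = (\<lambda>x j. norm (cf (hnth (dn m x)) j))"
  have sA: "(\<lambda>j. (A x j)\<^sup>2) summable_on UNIV" for x unfolding A_def by (rule summable_cf_sq)
  have sa: "a x summable_on UNIV" for x unfolding a_def by (rule summable_norm_cf[OF m])
  have nn: "A x j \<ge> 0" "a x j \<ge> 0" for x j by (auto simp: A_def a_def)
  define P where "P x y k = (\<Sum>\<^sub>\<infinity>j. A x j * a y (k - j))" for x y k
  have P0: "P x y k \<ge> 0" for x y k unfolding P_def using nn by (intro infsum_nonneg) auto
  define c where "c = 6 * sqrt pi * 2 ^ m"
  define D where "D = sqrt (2 * inv_sq_sum)"
  have D0: "D \<ge> 0" using inv_sq_sum_nonneg by (simp add: D_def)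
  have P: "(\<Sum>k\<in>F. (P x y k)\<^sup>2) \<le> 2 * (D * norm (dn (m - 1) y) * norm x)\<^sup>2" if F: "finite F" for F x y
  proof -
    have "(\<Sum>k\<in>F. (P x y k)\<^sup>2) \<le> (\<Sum>\<^sub>\<infinity>j. a y j)\<^sup>2 * (\<Sum>\<^sub>\<infinity>j. (A x j)\<^sup>2)"
      unfolding P_def by (rule Young_l2_l1(2)[OF sA nn(1) sa nn(2) F])
    also have "\<dots> \<le> (D * norm (dn (m - 1) y))\<^sup>2 * (2 * (norm x)\<^sup>2)"
      using infsum_norm_cf_le[OF m, of y] infsum_cf_sq_le[of x]
      by (intro mult_mono power_mono infsum_nonneg) (auto simp: A_def a_def D_def infsum_nonneg)
    finally show ?thesis by (simp add: power_mult_distrib)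
  qed
  have sq: "(s + t)\<^sup>2 \<le> 2 * s\<^sup>2 + 2 * t\<^sup>2" for s t :: real
    using sum_squares_bound[of s t] by (simp add: power2_sum)
  have main: "(\<Sum>k\<in>F. (Qseq m x y k)\<^sup>2) \<le> (sqrt 8 * c * D * (norm x * norm (dn (m - 1) y) + norm (dn (m - 1) x) * norm y))\<^sup>2"
    if F: "finite F" for F x y
  proof -
    \<comment> \<open>The bound for coordinate \<open>k\<close> is evaluated at \<open>|k|\<close>,
      and \<open>R k + R (- k)\<close> covers both signs. Three doublings, from squaring a sum, from
      \<open>P\<close> and from the two signs, produce the 8.\<close>
    define R where "R k = 2 * (P x y k)\<^sup>2 + 2 * (P y x k)\<^sup>2" for k
    have c0: "c \<ge> 0" by (simp add: c_def)
    have R: "sum R F \<le> 4 * ((D * norm (dn (m - 1) y) * norm x)\<^sup>2 + (D * norm (dn (m - 1) x) * norm y)\<^sup>2)" if "finite F" for F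
      unfolding R_def sum.distrib sum_distrib_left[symmetric] using P[OF that, of x y] P[OF that, of y x] by simp
    have R0: "R k \<ge> 0" for k by (simp add: R_def)
    have "(Qseq m x y k)\<^sup>2 \<le> c\<^sup>2 * (R k + R (- k))" for k
    proof -
      have "\<bar>Qseq m x y k\<bar> \<le> c * (P x y \<bar>k\<bar> + P y x \<bar>k\<bar>)"
        unfolding c_def P_def A_def a_def by (rule Qseq_bound[OF m])
      then have "(Qseq m x y k)\<^sup>2 \<le> (c * (P x y \<bar>k\<bar> + P y x \<bar>k\<bar>))\<^sup>2"
        by (metis abs_ge_zero power2_abs power_mono)
      also have "\<dots> \<le> c\<^sup>2 * R \<bar>k\<bar>" unfolding power_mult_distrib R_def by (intro mult_left_mono sq) auto
      also have "\<dots> \<le> c\<^sup>2 * (R k + R (- k))"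
        using R0[of k] R0[of "- k"] by (intro mult_left_mono) (auto simp: abs_if)
      finally show ?thesis .
    qed
    then have "(\<Sum>k\<in>F. (Qseq m x y k)\<^sup>2) \<le> (\<Sum>k\<in>F. c\<^sup>2 * (R k + R (- k)))" by (rule sum_mono)
    also have "\<dots> = c\<^sup>2 * (sum R F + sum R (uminus ` F))"
      by (subst sum.reindex) (auto simp: inj_on_def sum.distrib simp flip: sum_distrib_left)
    also have "\<dots> \<le> c\<^sup>2 * (8 * ((D * norm (dn (m - 1) y) * norm x)\<^sup>2 + (D * norm (dn (m - 1) x) * norm y)\<^sup>2))"
      using R[OF F] R[of "uminus ` F"] F by (intro mult_left_mono) auto
    also have "\<dots> \<le> c\<^sup>2 * (8 * (D * norm (dn (m - 1) y) * norm x + D * norm (dn (m - 1) x) * norm y)\<^sup>2)"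
      using D0 by (intro mult_left_mono) (auto simp: power2_sum)
    also have "\<dots> = (sqrt 8 * c * D * (norm x * norm (dn (m - 1) y) + norm (dn (m - 1) x) * norm y))\<^sup>2"
    proof -
      have "D * norm (dn (m - 1) y) * norm x + D * norm (dn (m - 1) x) * norm y =
        D * (norm x * norm (dn (m - 1) y) + norm (dn (m - 1) x) * norm y)" by (simp add: algebra_simps)
      then show ?thesis by (simp only: power_mult_distrib) simp
    qed
    finally show ?thesis .
  qed
  show ?thesis
    by (rule exI[of _ "sqrt 8 * c * D"]) (use main D0 in \<open>auto simp: c_def\<close>)
qed

lemma hnth_Q: "m \<ge> 1 \<Longrightarrow> hnth (Q m x y) k = Qseq m x y k"
proof -
  assume "m \<ge> 1"
  then obtain C where "\<And>F. finite F \<Longrightarrow> (\<Sum>k\<in>F. (Qseq m x y k)\<^sup>2) \<le> C"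
    using Qseq_sq_bound by meson
  then show ?thesis unfolding Q_def by (subst hnth_Abs) (auto simp: Qseq_def)
qed

text \<open>The tame form of the product estimate. In the a priori bound it leaves the top-order
  norm to the first power, multiplied by the H1 norm, whose square is integrable in time; this is
  what lets Gronwall's inequality close.\<close>

lemma norm_Q_le:
  assumes "m \<ge> 1"
  shows "\<exists>C\<ge>0. \<forall>x y. norm (Q m x y) \<le> C * (norm x * norm (dn (m - 1) y) + norm (dn (m - 1) x) * norm y)"
proof -
  obtain C where C: "C \<ge> 0" "\<And>x y F. finite F \<Longrightarrow> (\<Sum>k\<in>F. (Qseq m x y k)\<^sup>2)
    \<le> (C * (norm x * norm (dn (m - 1) y) + norm (dn (m - 1) x) * norm y))\<^sup>2"
    using Qseq_sq_bound[OF assms] by auto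
  have "norm (Q m x y) \<le> C * (norm x * norm (dn (m - 1) y) + norm (dn (m - 1) x) * norm y)" for x y
    by (rule power2_le_imp_le[OF norm_hs_le]) (use C in \<open>auto simp: hnth_Q[OF assms]\<close>)
  then show ?thesis using C(1) by blast
qed

section \<open>Bilinearity\<close>

lemma conv_add_left: "k \<noteq> 0 \<Longrightarrow> conv (hnth (x + x')) (hnth y) k = conv (hnth x) (hnth y) k + conv (hnth x') (hnth y) k"
  and conv_add_right: "k \<noteq> 0 \<Longrightarrow> conv (hnth x) (hnth (y + y')) k = conv (hnth x) (hnth y) k + conv (hnth x) (hnth y') k"
  and conv_scale_left: "conv (hnth (r *\<^sub>R x)) (hnth y) k = of_real r * conv (hnth x) (hnth y) k"
  and conv_scale_right: "conv (hnth x) (hnth (r *\<^sub>R y)) k = of_real r * conv (hnth x) (hnth y) k"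
proof -
  have add: "cf (hnth (x + y)) j = cf (hnth x) j + cf (hnth y) j" for x y j
    by (auto simp: cf_def complex_eq_iff field_simps)
  have scale: "cf (hnth (r *\<^sub>R x)) j = of_real r * cf (hnth x) j" for r x j
    by (auto simp: cf_def complex_eq_iff field_simps)
  show "k \<noteq> 0 \<Longrightarrow> conv (hnth (x + x')) (hnth y) k = conv (hnth x) (hnth y) k + conv (hnth x') (hnth y) k"
    unfolding conv_def by (subst infsum_add[symmetric]) (auto intro: summable_conv(2) simp: add algebra_simps)
  show "k \<noteq> 0 \<Longrightarrow> conv (hnth x) (hnth (y + y')) k = conv (hnth x) (hnth y) k + conv (hnth x) (hnth y') k"
    unfolding conv_def by (subst infsum_add[symmetric]) (auto intro: summable_conv(2) simp: add algebra_simps)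
  show "conv (hnth (r *\<^sub>R x)) (hnth y) k = of_real r * conv (hnth x) (hnth y) k"
    unfolding conv_def by (subst infsum_cmult_right'[symmetric]) (simp add: scale mult_ac)
  show "conv (hnth x) (hnth (r *\<^sub>R y)) k = of_real r * conv (hnth x) (hnth y) k"
    unfolding conv_def by (subst infsum_cmult_right'[symmetric]) (simp add: scale mult_ac)
qed

lemma rc_conv_linear:
  "rc (conv (hnth (x + x')) (hnth y)) k = rc (conv (hnth x) (hnth y)) k + rc (conv (hnth x') (hnth y)) k"
  "rc (conv (hnth x) (hnth (y + y'))) k = rc (conv (hnth x) (hnth y)) k + rc (conv (hnth x) (hnth y')) k"
  "rc (conv (hnth (r *\<^sub>R x)) (hnth y)) k = r * rc (conv (hnth x) (hnth y)) k"
  "rc (conv (hnth x) (hnth (r *\<^sub>R y))) k = r * rc (conv (hnth x) (hnth y)) k"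
  by (auto simp: rc_def conv_add_left conv_add_right conv_scale_left conv_scale_right algebra_simps)

lemma bounded_bilinear_Q:
  assumes m: "m \<ge> 1" shows "bounded_bilinear (Q m)"
proof
  note lin = linear_add[OF bounded_linear.linear[OF bounded_linear_dn]]
    linear_scale[OF bounded_linear.linear[OF bounded_linear_dn]]
  have coord: "hnth (Q m x y) k = \<bar>of_int k\<bar> ^ (m - 1) * rc (conv (hnth (dn m x)) (hnth (dn m y))) k" for x y k
    by (simp only: hnth_Q[OF m] Qseq_def)
  show "Q m (x + x') y = Q m x y + Q m x' y" "Q m x (y + y') = Q m x y + Q m x y'"
    "Q m (r *\<^sub>R x) y = r *\<^sub>R Q m x y" "Q m x (r *\<^sub>R y) = r *\<^sub>R Q m x y" for x x' y y' r
    by (rule hs_eqI, simp only: coord lin rc_conv_linear hnth_simps distrib_left mult.left_commute)+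
  obtain C where C: "C \<ge> 0" "\<And>x y. norm (Q m x y) \<le> C * (norm x * norm (dn (m - 1) y) + norm (dn (m - 1) x) * norm y)"
    using norm_Q_le[OF m] by auto
  have "norm (Q m x y) \<le> norm x * norm y * (C * 2)" for x y
  proof -
    have "norm (Q m x y) \<le> C * (norm x * norm (dn (m - 1) y) + norm (dn (m - 1) x) * norm y)" by (rule C)
    also have "\<dots> \<le> C * (norm x * norm y + norm x * norm y)"
      using C(1) norm_dn_le by (intro mult_left_mono add_mono mult_right_mono) auto
    finally show ?thesis by (simp add: algebra_simps)
  qed
  then show "\<exists>K. \<forall>x y. norm (Q m x y) \<le> norm x * norm y * K" by blast
qed

text \<open>The product with the derivative of the noise only costs the \<open>L\<^sup>2\<close> norm of the solution squared.\<close>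

lemma rc_conv_crude: "\<bar>rc (conv (hnth x) (hnth x)) k\<bar> \<le> 12 * sqrt pi * \<bar>of_int k\<bar> * (norm x)\<^sup>2"
proof (cases "k = 0")
  case False
  define l where "l = \<bar>k\<bar>"
  have l: "l \<noteq> 0" "\<bar>real_of_int l\<bar> = \<bar>real_of_int k\<bar>" using False by (auto simp: l_def)
  let ?a = "\<lambda>j. norm (cf (hnth x) j)"
  have "(\<Sum>\<^sub>\<infinity>j. \<bar>?a j * ?a (l - j)\<bar>) \<le> sqrt (\<Sum>\<^sub>\<infinity>j. (?a j)\<^sup>2) * sqrt (\<Sum>\<^sub>\<infinity>j. (?a (l - j))\<^sup>2)"
    by (rule infsum_Cauchy_Schwarz) (rule summable_cf_sq, rule summable_shift(1)[OF summable_cf_sq])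
  also have "\<dots> = (\<Sum>\<^sub>\<infinity>j. (?a j)\<^sup>2)"
    by (subst summable_shift(2)[OF summable_cf_sq]) (simp add: infsum_nonneg flip: power2_eq_square)
  also have "\<dots> \<le> 2 * (norm x)\<^sup>2" by (rule infsum_cf_sq_le)
  finally have *: "(\<Sum>\<^sub>\<infinity>j. ?a j * ?a (l - j)) \<le> 2 * (norm x)\<^sup>2" by (simp add: abs_mult)
  have "\<bar>rc (conv (hnth x) (hnth x)) k\<bar> \<le> 2 * sqrt pi * norm (conv (hnth x) (hnth x) l)"
    unfolding l_def by (rule abs_rc_le)
  also have "\<dots> \<le> 2 * sqrt pi * (3 * \<bar>of_int l\<bar> * (2 * (norm x)\<^sup>2))"
    by (intro mult_left_mono order_trans[OF summable_conv(3)[OF l(1), of x x]] mult_left_mono[OF *]) auto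
  finally show ?thesis by (simp add: l)
qed simp

lemma sum_modes_split: "sum f (modes N) = (\<Sum>k\<in>{1..int N}. f k + f (- k))"
proof -
  have eq: "modes N = {1..int N} \<union> uminus ` {1..int N}"
    by (auto simp: modes_def image_iff)
  have "sum f (uminus ` {1..int N}) = (\<Sum>k\<in>{1..int N}. f (- k))"
    by (subst sum.reindex) (auto simp: inj_on_def)
  then show ?thesis unfolding eq by (subst sum.union_disjoint) (auto simp: sum.distrib)
qed

text \<open>Parseval's identity, obtained by pairing the modes \<open>k\<close> and
  \<open>-k\<close>: conjugate symmetry gives their complex contributions the same real
  part.\<close>

lemma sum_rc:
  assumes "\<And>k. c (- k) = cnj (c k)"
  shows "(\<Sum>k\<in>modes N. x k * rc c k) = 2 * pi * Re (\<Sum>k\<in>modes N. c k * cf x (- k))"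
proof -
  have "x k * rc c k + x (- k) * rc c (- k) = 2 * pi * Re (c k * cf x (- k) + c (- k) * cf x (- (- k)))"
    if "k \<in> {1..int N}" for k
  proof -
    have "Re (c (- k) * cf x (- (- k))) = Re (c k * cf x (- k))"
      using assms[of k] cf_uminus[of x k] by simp
    moreover define s where "s = sqrt pi"
    have s: "pi = s * s" "s > 0" by (simp_all add: s_def)
    have "x k * rc c k + x (- k) * rc c (- k) = 2 * s * (x k * Re (c k) - x (- k) * Im (c k))"
      using that by (simp add: rc_def s_def algebra_simps)
    moreover have "Re (c k * cf x (- k)) = (x k * Re (c k) - x (- k) * Im (c k)) / (2 * s)"
      using that s(2) by (simp add: cf_def field_simps flip: s_def)
    ultimately show ?thesis using s(2) by (simp add: s(1))
  qed
  then show ?thesis unfolding sum_modes_split Re_sum sum_distrib_left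
    by (intro sum.cong) (auto simp: assms)
qed

text \<open>This is the cancellation that is special to \<open>a = -2\<close>: for a fixed mode \<open>j\<close> of the velocity the reflection
  \<open>k \<mapsto> j - k\<close> changes the sign of every term.\<close>

lemma energy_cancellation:
  assumes x: "\<And>k. k \<notin> modes N \<Longrightarrow> x k = 0"
  shows "(\<Sum>k\<in>modes N. x k * rc (conv x x) k) = 0"
proof -
  have m: "- k \<in> modes N \<longleftrightarrow> k \<in> modes N" for k by (auto simp: modes_def)
  have c0: "cf x k = 0" if "k \<notin> modes N" for k
    using that x[of k] x[of "- k"] m by (cases "k > 0") (auto simp: cf_def complex_eq_iff)
  have conv: "conv x x k = (\<Sum>j\<in>modes N. csym k j * (cf x j * cf x (k - j)))" for k
  proof -
    have "conv x x k = (\<Sum>\<^sub>\<infinity>j\<in>modes N. csym k j * (cf x j * cf x (k - j)))"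
      unfolding conv_def by (rule infsum_cong_neutral) (auto simp: c0)
    then show ?thesis by simp
  qed
  have inner: "(\<Sum>k\<in>modes N. csym k j * cf x (k - j) * cf x (- k)) = 0" (is "?S = 0") for j
  proof -
    \<comment> \<open>\<open>modes N\<close> itself is not invariant under
      \<open>k \<mapsto> j - k\<close>; the index set left after discarding vanishing terms
      is.\<close>
    define A where "A = {k \<in> modes N. k - j \<in> modes N}"
    have A: "?S = (\<Sum>k\<in>A. csym k j * cf x (k - j) * cf x (- k))"
      unfolding A_def by (rule sum.mono_neutral_right) (auto simp: c0)
    have "(\<Sum>k\<in>A. csym k j * cf x (k - j) * cf x (- k)) = (\<Sum>k\<in>A. csym (j - k) j * cf x (j - k - j) * cf x (- (j - k)))"
    proof (rule sum.reindex_bij_witness[where i="\<lambda>k. j - k" and j="\<lambda>k. j - k"])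
      show "j - k \<in> A" if "k \<in> A" for k using that m[of "k - j"] m[of k] by (auto simp: A_def)
      then show "j - k \<in> A" if "k \<in> A" for k using that .
    qed auto
    also have "\<dots> = - (\<Sum>k\<in>A. csym k j * cf x (k - j) * cf x (- k))"
      unfolding sum_negf[symmetric] by (rule sum.cong) (auto simp: csym_reflect)
    finally show ?thesis unfolding A by (simp add: equation_minus_iff)
  qed
  have "(\<Sum>k\<in>modes N. conv x x k * cf x (- k)) = (\<Sum>k\<in>modes N. \<Sum>j\<in>modes N. cf x j * (csym k j * cf x (k - j) * cf x (- k)))"
    unfolding conv by (simp add: sum_distrib_right sum_distrib_left mult_ac)
  also have "\<dots> = (\<Sum>j\<in>modes N. cf x j * (\<Sum>k\<in>modes N. csym k j * cf x (k - j) * cf x (- k)))"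
    by (subst sum.swap) (simp add: sum_distrib_left)
  also have "\<dots> = 0" by (simp add: inner)
  finally show ?thesis by (subst sum_rc) (auto simp: conv_uminus)
qed

section \<open>Truncation and a priori bounds\<close>

text \<open>The radial retraction onto the ball of radius \<open>R\<close>. Being a scalar multiple
  of \<open>x\<close>, it turns \<open>Q m x x\<close> into a scalar multiple of itself, so the
  energy cancellation survives the cut-off.\<close>

definition cutoff :: "real \<Rightarrow> hs \<Rightarrow> hs" where "cutoff R x = (R / max R (norm x)) *\<^sub>R x"

lemma
  assumes R: "R > 0"
  shows norm_cutoff_le: "norm (cutoff R x) \<le> R"
    and cutoff_id: "norm x \<le> R \<Longrightarrow> cutoff R x = x"
    and cutoff_factor: "0 \<le> R / max R (norm x)" "R / max R (norm x) \<le> 1"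
    and cutoff_lipschitz: "norm (cutoff R x - cutoff R y) \<le> 2 * norm (x - y)"
proof -
  show f: "0 \<le> R / max R (norm x)" "R / max R (norm x) \<le> 1" for x :: hs using R by (auto simp: divide_le_eq)
  have "R * norm x \<le> R * max R (norm x)" using R by (intro mult_left_mono) auto
  then show "norm (cutoff R x) \<le> R" using R by (simp add: cutoff_def divide_le_eq)
  show "norm x \<le> R \<Longrightarrow> cutoff R x = x" using R by (simp add: cutoff_def max_def)
  define a where "a = max R (norm x)"
  define b where "b = max R (norm y)"
  have ab: "a > 0" "b > 0" "R \<le> a" "norm y \<le> b" "\<bar>a - b\<bar> \<le> norm (x - y)" 
    using R norm_triangle_ineq3[of x y] by (auto simp: a_def b_def)
  \<comment> \<open>The first part moves the vector with the factor fixed, the second changes the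
    factor; each contributes at most \<open>norm (x - y)\<close>, hence the constant 2.\<close>
  have "cutoff R x - cutoff R y = (R / a) *\<^sub>R (x - y) + (R / a - R / b) *\<^sub>R y"
    by (simp add: cutoff_def a_def b_def algebra_simps)
  then have "norm (cutoff R x - cutoff R y) \<le> norm ((R / a) *\<^sub>R (x - y)) + norm ((R / a - R / b) *\<^sub>R y)"
    by (simp only: norm_triangle_ineq)
  also have "norm ((R / a) *\<^sub>R (x - y)) \<le> 1 * norm (x - y)"
    unfolding norm_scaleR using ab R by (intro mult_right_mono) auto
  also have "norm ((R / a - R / b) *\<^sub>R y) = (R / a) * (norm y / b) * \<bar>a - b\<bar>"
  proof -
    have "R / a - R / b = (R / a) * (1 / b) * (b - a)" using ab by (simp add: field_simps)
    then show ?thesis using ab R by (simp add: abs_mult abs_minus_commute)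
  qed
  also have "(R / a) * (norm y / b) * \<bar>a - b\<bar> \<le> 1 * 1 * norm (x - y)"
    using ab R by (intro mult_mono) auto
  finally show "norm (cutoff R x - cutoff R y) \<le> 2 * norm (x - y)" by simp
qed

text \<open>One index for both equations: \<open>None\<close> stands for the full equation and
  \<open>Some N\<close> for the projected one, so that statements about both can be shared.\<close>

primrec tr :: "nat option \<Rightarrow> hs \<Rightarrow> hs" where
  "tr None x = x"
| "tr (Some N) x = hproj N x"

lemma norm_tr_le: "norm (tr n x) \<le> norm x" by (cases n) (auto simp: norm_hproj_le)

lemma bounded_linear_tr: "bounded_linear (tr n)"
proof (cases n)
  case None
  then have "tr n = (\<lambda>x. x)" by auto
  then show ?thesis by (simp add: bounded_linear_ident)
next
  case (Some N)
  then have "tr n = hproj N" by auto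
  then show ?thesis by (simp add: bounded_linear_hproj)
qed

definition tQ :: "nat \<Rightarrow> nat option \<Rightarrow> real \<Rightarrow> hs \<Rightarrow> hs" where
  "tQ m n R x = tr n (Q m (cutoff R x) (cutoff R x))"

text \<open>Polarisation of the bilinear map on a ball. One \<open>L\<close> serves all truncations
  because \<open>tr n\<close> is a contraction; the limit over the truncations relies on this
  uniformity.\<close>

lemma lipschitz_tQ:
  assumes m: "m \<ge> 1" and R: "R > 0" shows "\<exists>L. \<forall>n. lipschitz L (tQ m n R)"
proof -
  interpret Q: bounded_bilinear "Q m" by (rule bounded_bilinear_Q[OF m])
  obtain K where K: "K > 0" "\<And>x y. norm (Q m x y) \<le> norm x * norm y * K" using Q.pos_bounded by blast
  have "norm (tQ m n R x - tQ m n R y) \<le> (4 * R * K) * norm (x - y)" for n x y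
  proof -
    define p q where "p = cutoff R x" and "q = cutoff R y"
    have pq: "norm p \<le> R" "norm q \<le> R" "norm (p - q) \<le> 2 * norm (x - y)"
      by (simp_all add: p_def q_def norm_cutoff_le cutoff_lipschitz R)
    have "norm (tQ m n R x - tQ m n R y) = norm (tr n (Q m p p - Q m q q))"
      by (simp add: tQ_def p_def q_def linear_diff[OF bounded_linear.linear[OF bounded_linear_tr]])
    also have "\<dots> \<le> norm (Q m p p - Q m q q)" by (rule norm_tr_le)
    also have "Q m p p - Q m q q = Q m (p - q) p + Q m q (p - q)"
      by (simp add: Q.diff_left Q.diff_right)
    also have "norm \<dots> \<le> norm (p - q) * norm p * K + norm q * norm (p - q) * K"
      using norm_triangle_ineq K(2) add_mono order_trans by meson
    also have "\<dots> \<le> norm (p - q) * R * K + R * norm (p - q) * K"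
      using pq K(1) by (intro add_mono mult_right_mono mult_left_mono) auto
    also have "\<dots> = (2 * R * K) * norm (p - q)" by simp
    also have "\<dots> \<le> (2 * R * K) * (2 * norm (x - y))" using pq(3) K(1) R by (intro mult_left_mono) auto
    finally show ?thesis by simp
  qed
  then show ?thesis unfolding lipschitz_def by blast
qed

definition hheat :: "real \<Rightarrow> real \<Rightarrow> hs \<Rightarrow> hs" where
  "hheat \<nu> t x = Abs_hs (\<lambda>k. exp (- (\<nu> * (of_int k)\<^sup>2) * t) * hnth x k)"

lemma hnth_hheat:
  assumes "\<nu> > 0" "t \<ge> 0"
  shows "hnth (hheat \<nu> t x) k = exp (- (\<nu> * (of_int k)\<^sup>2) * t) * hnth x k"
proof -
  have "\<bar>exp (- (\<nu> * (of_int k)\<^sup>2) * t) * hnth x k\<bar> \<le> \<bar>hnth x k\<bar>" for k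
    using assms by (simp add: abs_mult mult_left_le_one_le)
  then have "(\<Sum>k\<in>F. (exp (- (\<nu> * (of_int k)\<^sup>2) * t) * hnth x k)\<^sup>2) \<le> (norm x)\<^sup>2" if "finite F" for F
    using sum_hnth_le[OF that, of x] by (meson abs_le_square_iff order_trans sum_mono)
  then show ?thesis unfolding hheat_def by (subst hnth_Abs) auto
qed

lemma norm_hheat_le:
  assumes "\<nu> > 0" "t \<ge> 0" shows "norm (hheat \<nu> t x) \<le> norm x"
  by (rule norm_hs_coord_mono) (use assms in \<open>simp add: hnth_hheat abs_mult mult_left_le_one_le\<close>)

lemma uniform_limit_hproj_continuous:
  assumes "\<And>k. continuous_on S (\<lambda>t. hnth (g t) k)"
    and "uniform_limit S (\<lambda>N t. hproj N (g t)) g sequentially"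
  shows "continuous_on S g"
  by (rule uniform_limit_theorem[OF _ assms(2)])
    (auto simp: hproj_def intro!: always_eventually continuous_on_sum continuous_on_scaleR continuous_on_const assms(1))

text \<open>The heat flow is a contraction and commutes with projections, so the tails of
  \<open>hheat \<nu> t x\<close> are bounded by those of \<open>x\<close> uniformly in
  \<open>t\<close>.\<close>

lemma continuous_on_hheat:
  assumes nu: "\<nu> > 0" and S: "S \<subseteq> {0..}" shows "continuous_on S (\<lambda>t. hheat \<nu> t x)"
proof (rule uniform_limit_hproj_continuous)
  fix k
  have "continuous_on S (\<lambda>t. exp (- (\<nu> * (of_int k)\<^sup>2) * t) * hnth x k)" by (intro continuous_intros)
  then show "continuous_on S (\<lambda>t. hnth (hheat \<nu> t x) k)"
    by (rule continuous_on_eq) (use S nu in \<open>auto simp: hnth_hheat\<close>)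
next
  show "uniform_limit S (\<lambda>N t. hproj N (hheat \<nu> t x)) (\<lambda>t. hheat \<nu> t x) sequentially"
    unfolding uniform_limit_iff
  proof (intro allI impI)
    fix e :: real assume "e > 0"
    from LIMSEQ_D[OF hproj_tendsto this] obtain n0 where n0: "\<And>n. n \<ge> n0 \<Longrightarrow> norm (hproj n x - x) < e" by blast
    have "norm (hproj n (hheat \<nu> t x) - hheat \<nu> t x) < e" if "n \<ge> n0" "t \<in> S" for n t
    proof -
      have "hproj n (hheat \<nu> t x) - hheat \<nu> t x = hheat \<nu> t (hproj n x - x)"
        by (rule hs_eqI) (use that S nu in \<open>auto simp: hnth_hheat\<close>)
      then show ?thesis using norm_hheat_le[OF nu, of t "hproj n x - x"] n0[OF that(1)] that(2) S by auto
    qed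
    then show "\<forall>\<^sub>F n in sequentially. \<forall>t\<in>S. dist (hproj n (hheat \<nu> t x)) (hheat \<nu> t x) < e"
      unfolding eventually_sequentially dist_norm by blast
  qed
qed

lemma norm_le_infsum_abs:
  assumes "\<And>k. \<bar>hnth x k\<bar> \<le> \<zeta> k" "\<zeta> summable_on UNIV"
  shows "(\<Sum>k\<in>F. (hnth x k)\<^sup>2) \<le> (\<Sum>\<^sub>\<infinity>k. \<zeta> k)\<^sup>2" "norm x \<le> (\<Sum>\<^sub>\<infinity>k. \<zeta> k)"
proof -
  have z0: "\<zeta> k \<ge> 0" for k using assms(1)[of k] abs_ge_zero order_trans by blast
  show *: "(\<Sum>k\<in>F. (hnth x k)\<^sup>2) \<le> (\<Sum>\<^sub>\<infinity>k. \<zeta> k)\<^sup>2" for F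
  proof (cases "finite F")
    case True
    have "L2_set (hnth x) F \<le> (\<Sum>k\<in>F. \<bar>hnth x k\<bar>)" by (rule L2_set_le_sum_abs)
    also have "\<dots> \<le> sum \<zeta> F" by (intro sum_mono assms)
    also have "\<dots> \<le> (\<Sum>\<^sub>\<infinity>k. \<zeta> k)" using True assms z0 by (intro finite_sum_le_infsum) auto
    finally have "(L2_set (hnth x) F)\<^sup>2 \<le> (\<Sum>\<^sub>\<infinity>k. \<zeta> k)\<^sup>2" by (intro power_mono) auto
    then show ?thesis by (simp add: L2_set_def sum_nonneg)
  qed simp
  show "norm x \<le> (\<Sum>\<^sub>\<infinity>k. \<zeta> k)"
    by (rule power2_le_imp_le[OF norm_hs_le[OF *]]) (simp add: z0 infsum_nonneg)
qed

text \<open>A single noise path \<open>z\<close> with initial value \<open>x0\<close>, both in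
  weighted coordinates. Domination by an absolutely summable \<open>\<zeta>\<close>, uniformly in
  time, is what the pairing of \<open>z\<close> with the nonlinearity in the energy balance
  requires.\<close>

locale forced =
  fixes \<nu> T :: real and m :: nat and x0 :: hs and z :: "real \<Rightarrow> hs" and \<zeta> :: "int \<Rightarrow> real"
  assumes nu: "\<nu> > 0" and m: "m \<ge> 1" and T: "T \<ge> 0"
    and zcont: "continuous_on {0..T} z"
    and zdom: "\<And>t k. t \<in> {0..T} \<Longrightarrow> \<bar>hnth (z t) k\<bar> \<le> \<zeta> k" and zsum: "\<zeta> summable_on UNIV"
begin

definition force :: "nat option \<Rightarrow> real \<Rightarrow> hs" where "force n t = tr n (hheat \<nu> t x0 + z t)"

definition Z :: real where "Z = (\<Sum>\<^sub>\<infinity>k. \<zeta> k)"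

lemma zeta_nonneg: "\<zeta> k \<ge> 0"
  using zdom[of 0 k] T by (meson abs_ge_zero atLeastAtMost_iff order_refl order_trans)

lemma Z_nonneg: "Z \<ge> 0" unfolding Z_def by (rule infsum_nonneg) (rule zeta_nonneg)

lemma norm_z_le: "t \<in> {0..T} \<Longrightarrow> norm (z t) \<le> Z" 
  unfolding Z_def by (rule norm_le_infsum_abs(2)[OF zdom zsum])

lemma continuous_on_force: "continuous_on {0..T} (force n)"
proof -
  have "continuous_on {0..T} (\<lambda>t. tr n (hheat \<nu> t x0 + z t))"
    by (intro bounded_linear.continuous_on[OF bounded_linear_tr] continuous_intros zcont continuous_on_hheat nu) auto
  then show ?thesis unfolding force_def[abs_def] .
qed

lemma norm_force_le: "t \<in> {0..T} \<Longrightarrow> norm (force n t) \<le> norm x0 + Z"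
  unfolding force_def
  using norm_tr_le[of n "hheat \<nu> t x0 + z t"] norm_triangle_ineq[of "hheat \<nu> t x0" "z t"]
    norm_hheat_le[OF nu, of t x0] norm_z_le[of t] by simp

lemma continuous_on_tQ:
  assumes "R > 0" "continuous_on S y" shows "continuous_on S (\<lambda>s. tQ m n R (y s))"
  using lipschitz_tQ[OF m assms(1)] continuous_on_lipschitz_compose assms(2) by blast

text \<open>Gronwall's bound for the squared L2 norm of \<open>y - z\<close>, independent of the
  truncation and of the cut-off radius. The 48 is four times the constant 12 of
  \<open>rc_conv_crude\<close>: one factor 2 comes from differentiating a square, the other from
  splitting the square of a sum.\<close>

definition K0 :: real where "K0 = ((norm x0)\<^sup>2 + 48 * sqrt pi * Z * Z\<^sup>2 * T) * exp (48 * sqrt pi * Z * T)"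
text \<open>Bounds the time integral of the squared H1 norm of \<open>y\<close>: the dissipation
  part of the energy inequality plus the share of \<open>z\<close>.\<close>

definition K2 :: real where "K2 = ((norm x0)\<^sup>2 + 24 * sqrt pi * Z * (2 * K0 + 2 * Z\<^sup>2) * T) / \<nu> + 2 * Z\<^sup>2 * T"

section \<open>Energy estimate for the Galerkin equations with cut-off\<close>

context
  fixes N :: nat and R :: real and y :: "real \<Rightarrow> hs"
  assumes R: "R > 0" and y: "mild_eq \<nu> (tQ m (Some N) R) (force (Some N)) T y"
begin

lemma ycont: "continuous_on {0..T} y" using y by (simp add: mild_eq_def)

definition B :: "real \<Rightarrow> int \<Rightarrow> real" where "B t k = rc (conv (hnth (dn m (y t))) (hnth (dn m (y t)))) k"
definition c :: "real \<Rightarrow> real" where "c t = R / max R (norm (y t))"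
text \<open>Coefficients of \<open>y - z\<close> without the Sobolev weight. The rough noise
  cancels, which makes them differentiable in time.\<close>

definition v :: "int \<Rightarrow> real \<Rightarrow> real" where "v k t = (hnth (y t) k - hnth (z t) k) / \<bar>of_int k\<bar> ^ m"

lemma tQ_coord: "k \<in> modes N \<Longrightarrow> hnth (tQ m (Some N) R (y t)) k = \<bar>of_int k\<bar> ^ (m - 1) * ((c t)\<^sup>2 * B t k)"
proof -
  assume k: "k \<in> modes N"
  interpret Q: bounded_bilinear "Q m" by (rule bounded_bilinear_Q[OF m])
  have "Q m (cutoff R (y t)) (cutoff R (y t)) = (c t)\<^sup>2 *\<^sub>R Q m (y t) (y t)"
    by (simp add: cutoff_def c_def Q.scaleR_left Q.scaleR_right power2_eq_square)
  then show ?thesis using k by (simp add: tQ_def hnth_Q[OF m] Qseq_def B_def)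
qed

lemma y_hproj: assumes "t \<in> {0..T}" shows "hproj N (y t) = y t"
proof -
  have t0: "t \<ge> 0" using assms by simp
  have ct: "continuous_on {0..t} (\<lambda>s. Q m (cutoff R (y s)) (cutoff R (y s)))"
    using continuous_on_subset[OF continuous_on_tQ[OF R ycont, of None], of "{0..t}"] assms by (simp add: tQ_def)
  have yt: "y t = force (Some N) t + Duh \<nu> (\<lambda>s. tQ m (Some N) R (y s)) t" using y assms by (simp add: mild_eq_def)
  also have "\<dots> = hproj N (hheat \<nu> t x0 + z t + Duh \<nu> (\<lambda>s. Q m (cutoff R (y s)) (cutoff R (y s))) t)"
    by (simp add: force_def tQ_def hproj_Duh[OF nu t0 ct] linear_add[OF bounded_linear.linear[OF bounded_linear_hproj]])
  finally obtain w where "y t = hproj N w" by blast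
  then show ?thesis by (auto intro: hs_eqI)
qed

lemma y_zero: "t \<in> {0..T} \<Longrightarrow> k \<notin> modes N \<Longrightarrow> hnth (y t) k = 0"
  using y_hproj[of t] hnth_hproj[of N "y t" k] by simp

lemma cB_cont:
  assumes "k \<in> modes N" shows "continuous_on {0..T} (\<lambda>t. (c t)\<^sup>2 * B t k)"
proof -
  have k: "k \<noteq> 0" using assms by auto
  have "continuous_on {0..T} (\<lambda>t. hnth (tQ m (Some N) R (y t)) k / \<bar>of_int k\<bar> ^ (m - 1))"
    using k by (intro continuous_intros continuous_on_tQ R ycont) auto
  then show ?thesis
    by (rule continuous_on_eq) (use assms k in \<open>simp add: tQ_coord\<close>)
qed

lemma v_eq:
  assumes k: "k \<in> modes N" and t: "t \<in> {0..T}"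
  shows "v k t = exp (- (\<nu> * (of_int k)\<^sup>2) * t) * (hnth x0 k / \<bar>of_int k\<bar> ^ m) + duhamel (\<nu> * (of_int k)\<^sup>2) (\<lambda>s. (c s)\<^sup>2 * B s k) t"
proof -
  have t0: "t \<ge> 0" and sub: "{0..t} \<subseteq> {0..T}" using t by auto
  have k0: "k \<noteq> 0" using k by auto
  have pm: "\<bar>real_of_int k\<bar> ^ m = \<bar>of_int k\<bar> * \<bar>of_int k\<bar> ^ (m - 1)" using m by (cases m) auto
  have "y t = force (Some N) t + Duh \<nu> (\<lambda>s. tQ m (Some N) R (y s)) t" using y t by (simp add: mild_eq_def)
  then have "hnth (y t) k = exp (- (\<nu> * (of_int k)\<^sup>2) * t) * hnth x0 k + hnth (z t) k
     + \<bar>of_int k\<bar> * duhamel (\<nu> * (of_int k)\<^sup>2) (\<lambda>s. \<bar>of_int k\<bar> ^ (m - 1) * ((c s)\<^sup>2 * B s k)) t"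
    using k hnth_Duh[OF nu t0 continuous_on_subset[OF continuous_on_tQ[OF R ycont] sub], of "Some N" k]
    by (simp add: force_def hnth_hheat[OF nu t0] tQ_coord)
  also have "\<bar>of_int k\<bar> * duhamel (\<nu> * (of_int k)\<^sup>2) (\<lambda>s. \<bar>of_int k\<bar> ^ (m - 1) * ((c s)\<^sup>2 * B s k)) t
     = \<bar>of_int k\<bar> ^ m * duhamel (\<nu> * (of_int k)\<^sup>2) (\<lambda>s. (c s)\<^sup>2 * B s k) t"
    by (simp add: duhamel_mult pm)
  finally show ?thesis using k0 by (simp add: v_def add_divide_distrib)
qed

lemma v_deriv:
  assumes k: "k \<in> modes N" and t: "t \<in> {0..T}"
  shows "(v k has_real_derivative ((c t)\<^sup>2 * B t k - \<nu> * (of_int k)\<^sup>2 * v k t)) (at t within {0..T})"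
proof -
  define p where "p = hnth x0 k / \<bar>of_int k\<bar> ^ m"
  let ?l = "\<nu> * (of_int k)\<^sup>2"
  let ?u = "\<lambda>t. exp (- ?l * t) * p + duhamel ?l (\<lambda>s. (c s)\<^sup>2 * B s k) t"
  have u: "v k s = ?u s" if "s \<in> {0..T}" for s unfolding p_def by (rule v_eq[OF k that])
  have "((\<lambda>t. exp (- ?l * t) * p) has_real_derivative (- ?l * (exp (- ?l * t) * p))) (at t within {0..T})"
    by (auto intro!: derivative_eq_intros)
  from DERIV_add[OF this duhamel_has_deriv[OF cB_cont[OF k] t]]
  have "(?u has_real_derivative (- ?l * (exp (- ?l * t) * p) + ((c t)\<^sup>2 * B t k - ?l * duhamel ?l (\<lambda>s. (c s)\<^sup>2 * B s k) t))) (at t within {0..T})" .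
  also have "- ?l * (exp (- ?l * t) * p) + ((c t)\<^sup>2 * B t k - ?l * duhamel ?l (\<lambda>s. (c s)\<^sup>2 * B s k) t) = (c t)\<^sup>2 * B t k - ?l * v k t"
    unfolding u[OF t] by (simp add: algebra_simps)
  finally show ?thesis
    by (rule has_field_derivative_transform_within[where d=1]) (use t u in auto)
qed

text \<open>\<open>E\<close> and \<open>D\<close> are the squared L2 and H1 norms of the projection
  of \<open>y - z\<close>. \<open>P\<close> is what remains of the nonlinear term, because it is
  tested with \<open>y - z\<close> while only the pairing with \<open>y\<close> cancels.\<close>

definition E :: "real \<Rightarrow> real" where "E t = (\<Sum>k\<in>modes N. (v k t)\<^sup>2)"
definition D :: "real \<Rightarrow> real" where "D t = (\<Sum>k\<in>modes N. (of_int k)\<^sup>2 * (v k t)\<^sup>2)"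
definition P :: "real \<Rightarrow> real" where "P t = 2 * (c t)\<^sup>2 * (\<Sum>k\<in>modes N. hnth (dn m (z t)) k * B t k)"

lemma v_cont: "k \<in> modes N \<Longrightarrow> continuous_on {0..T} (v k)"
  by (rule DERIV_continuous_on[OF v_deriv])

lemma E_cont: "continuous_on {0..T} E" and D_cont: "continuous_on {0..T} D"
  unfolding E_def[abs_def] D_def[abs_def] by (intro continuous_intros v_cont; assumption)+

lemma P_cont: "continuous_on {0..T} P"
proof -
  have "continuous_on {0..T} (\<lambda>t. 2 * (\<Sum>k\<in>modes N. hnth (dn m (z t)) k * ((c t)\<^sup>2 * B t k)))"
    by (intro continuous_intros bounded_linear.continuous_on[OF bounded_linear_dn] zcont cB_cont)
  then show ?thesis unfolding P_def[abs_def] by (simp add: sum_distrib_left mult_ac)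
qed

lemma E_deriv:
  assumes t: "t \<in> {0..T}"
  shows "(E has_real_derivative (- 2 * \<nu> * D t - P t)) (at t within {0..T})"
proof -
  let ?d = "\<Sum>k\<in>modes N. 2 * v k t * ((c t)\<^sup>2 * B t k - \<nu> * (of_int k)\<^sup>2 * v k t)"
  have E1: "(E has_real_derivative ?d) (at t within {0..T})"
    unfolding E_def[abs_def]
  proof (rule DERIV_sum)
    fix k assume k: "k \<in> modes N"
    show "((\<lambda>t. (v k t)\<^sup>2) has_real_derivative 2 * v k t * ((c t)\<^sup>2 * B t k - \<nu> * (of_int k)\<^sup>2 * v k t)) (at t within {0..T})"
      using DERIV_power[OF v_deriv[OF k t], of 2] by (simp add: mult_ac)
  qed
  \<comment> \<open>The cut-off contributes only the common factor \<open>(c t)\<^sup>2\<close>, so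
    the cancellation of the plain quadratic term can be used.\<close>
  have van: "(\<Sum>k\<in>modes N. hnth (dn m (y t)) k * B t k) = 0"
    unfolding B_def by (rule energy_cancellation) (use y_zero[OF t] in simp)
  have "?d = (\<Sum>k\<in>modes N. 2 * (c t)\<^sup>2 * (hnth (dn m (y t)) k * B t k) - 2 * (c t)\<^sup>2 * (hnth (dn m (z t)) k * B t k)
      - 2 * \<nu> * ((of_int k)\<^sup>2 * (v k t)\<^sup>2))"
    by (rule sum.cong) (auto simp: v_def diff_divide_distrib power2_eq_square algebra_simps)
  also have "\<dots> = 2 * (c t)\<^sup>2 * (\<Sum>k\<in>modes N. hnth (dn m (y t)) k * B t k) - P t - 2 * \<nu> * D t"
    by (simp only: sum_subtractf sum_distrib_left[symmetric] P_def D_def mult.assoc)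
  finally have "?d = - 2 * \<nu> * D t - P t" unfolding van by simp
  then show ?thesis using E1 by (simp only:)
qed

lemma dn_le: "(hnth (dn m (z t)) k)\<^sup>2 \<le> (hnth (z t) k)\<^sup>2" "(of_int k)\<^sup>2 * (hnth (dn m (z t)) k)\<^sup>2 \<le> (hnth (z t) k)\<^sup>2"
  "\<bar>of_int k\<bar> * \<bar>hnth (dn m (z t)) k\<bar> \<le> \<bar>hnth (z t) k\<bar>"
proof -
  show 3: "\<bar>of_int k\<bar> * \<bar>hnth (dn m (z t)) k\<bar> \<le> \<bar>hnth (z t) k\<bar>"
  proof (cases "k = 0")
    case False
    have pm: "\<bar>real_of_int k\<bar> ^ m = \<bar>of_int k\<bar> * \<bar>of_int k\<bar> ^ (m - 1)" using m by (cases m) auto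
    have "\<bar>of_int k\<bar> * \<bar>hnth (dn m (z t)) k\<bar> = \<bar>hnth (z t) k\<bar> / \<bar>of_int k\<bar> ^ (m - 1)"
      using False by (simp add: pm abs_mult power_abs)
    also have "\<dots> \<le> \<bar>hnth (z t) k\<bar> / 1"
      using False abs_int_power_ge1[OF False, of "m - 1"] by (intro divide_left_mono) auto
    finally show ?thesis by simp
  qed simp
  then show "(of_int k)\<^sup>2 * (hnth (dn m (z t)) k)\<^sup>2 \<le> (hnth (z t) k)\<^sup>2"
    using power_mono[OF 3, of 2] by (simp only: power_mult_distrib power2_abs) simp
  have "\<bar>hnth (dn m (z t)) k\<bar> \<le> \<bar>hnth (z t) k\<bar>"
    using abs_int_power_ge1[of k m] by (cases "k = 0") (auto simp: divide_le_eq mult_le_cancel_left1 abs_mult power_abs)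
  then show "(hnth (dn m (z t)) k)\<^sup>2 \<le> (hnth (z t) k)\<^sup>2" by (simp only: abs_le_square_iff)
qed

lemma z_sums:
  assumes t: "t \<in> {0..T}"
  shows "(\<Sum>k\<in>modes N. (hnth (dn m (z t)) k)\<^sup>2) \<le> Z\<^sup>2" 
    and "(\<Sum>k\<in>modes N. (of_int k)\<^sup>2 * (hnth (dn m (z t)) k)\<^sup>2) \<le> Z\<^sup>2"
    and "(\<Sum>k\<in>modes N. \<bar>of_int k\<bar> * \<bar>hnth (dn m (z t)) k\<bar>) \<le> Z"
proof -
  have "(\<Sum>k\<in>modes N. (hnth (z t) k)\<^sup>2) \<le> Z\<^sup>2"
    unfolding Z_def by (rule norm_le_infsum_abs(1)[OF zdom[OF t] zsum])
  note zz = this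
  show "(\<Sum>k\<in>modes N. (hnth (dn m (z t)) k)\<^sup>2) \<le> Z\<^sup>2"
    by (rule order_trans[OF sum_mono[OF dn_le(1)] zz])
  show "(\<Sum>k\<in>modes N. (of_int k)\<^sup>2 * (hnth (dn m (z t)) k)\<^sup>2) \<le> Z\<^sup>2"
    by (rule order_trans[OF sum_mono[OF dn_le(2)] zz])
  have "(\<Sum>k\<in>modes N. \<bar>of_int k\<bar> * \<bar>hnth (dn m (z t)) k\<bar>) \<le> (\<Sum>k\<in>modes N. \<zeta> k)"
    by (intro sum_mono order_trans[OF dn_le(3) zdom[OF t]])
  also have "\<dots> \<le> Z" unfolding Z_def by (intro finite_sum_le_infsum zsum) (auto simp: zeta_nonneg)
  finally show "(\<Sum>k\<in>modes N. \<bar>of_int k\<bar> * \<bar>hnth (dn m (z t)) k\<bar>) \<le> Z" .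
qed

lemma sq_sum: "(a + b)\<^sup>2 \<le> 2 * a\<^sup>2 + 2 * (b::real)\<^sup>2"
  using sum_squares_bound[of a b] by (simp add: power2_sum)

lemma norm_dn_y:
  assumes t: "t \<in> {0..T}"
  shows "(norm (dn m (y t)))\<^sup>2 \<le> 2 * E t + 2 * Z\<^sup>2"
    and "(norm (dn (m - 1) (y t)))\<^sup>2 \<le> 2 * D t + 2 * Z\<^sup>2"
proof -
  have pr: "(norm (dn p (y t)))\<^sup>2 = (\<Sum>k\<in>modes N. (hnth (dn p (y t)) k)\<^sup>2)" for p
  proof -
    have "hproj N (dn p (y t)) = dn p (y t)" by (rule hs_eqI) (use y_zero[OF t] in auto)
    then show ?thesis using norm_hproj_sq[of N "dn p (y t)"] by simp
  qed
  have s: "hnth (dn m (y t)) k = v k t + hnth (dn m (z t)) k" for k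
    by (simp add: v_def diff_divide_distrib)
  have "(\<Sum>k\<in>modes N. (hnth (dn m (y t)) k)\<^sup>2) \<le> (\<Sum>k\<in>modes N. 2 * (v k t)\<^sup>2 + 2 * (hnth (dn m (z t)) k)\<^sup>2)"
    unfolding s by (intro sum_mono sq_sum)
  also have "\<dots> \<le> 2 * E t + 2 * Z\<^sup>2" using z_sums(1)[OF t] by (simp add: sum.distrib E_def flip: sum_distrib_left)
  finally show "(norm (dn m (y t)))\<^sup>2 \<le> 2 * E t + 2 * Z\<^sup>2" unfolding pr .
  have s': "hnth (dn (m - 1) (y t)) k = \<bar>of_int k\<bar> * (v k t + hnth (dn m (z t)) k)" if "k \<in> modes N" for k
  proof -
    have "\<bar>real_of_int k\<bar> ^ m = \<bar>of_int k\<bar> * \<bar>of_int k\<bar> ^ (m - 1)" using m by (cases m) auto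
    moreover have "k \<noteq> 0" using that by auto
    ultimately show ?thesis unfolding s[symmetric] by simp
  qed
  have "(\<Sum>k\<in>modes N. (hnth (dn (m - 1) (y t)) k)\<^sup>2) \<le> (\<Sum>k\<in>modes N. (of_int k)\<^sup>2 * (2 * (v k t)\<^sup>2 + 2 * (hnth (dn m (z t)) k)\<^sup>2))"
    by (intro sum_mono) (simp only: s' power_mult_distrib power2_abs mult_left_mono[OF sq_sum] zero_le_power2)
  also have "\<dots> = 2 * D t + 2 * (\<Sum>k\<in>modes N. (of_int k)\<^sup>2 * (hnth (dn m (z t)) k)\<^sup>2)"
    unfolding D_def by (simp add: sum_distrib_left flip: sum.distrib) (simp add: algebra_simps)
  also have "\<dots> \<le> 2 * D t + 2 * Z\<^sup>2" using z_sums(2)[OF t] by simp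
  finally show "(norm (dn (m - 1) (y t)))\<^sup>2 \<le> 2 * D t + 2 * Z\<^sup>2" unfolding pr .
qed

lemma E_nonneg: "E t \<ge> 0" and D_nonneg: "D t \<ge> 0"
  unfolding E_def D_def by (intro sum_nonneg; simp)+

text \<open>The factor \<open>|k|\<close> in \<open>rc_conv_crude\<close> falls on \<open>z\<close>,
  where the weight of order \<open>m \<ge> 1\<close> and the summability of \<open>\<zeta>\<close>
  pay for it; what is left is the squared L2 norm of \<open>y\<close>, controlled by
  \<open>E\<close>.\<close>

lemma P_bound:
  assumes t: "t \<in> {0..T}" shows "\<bar>P t\<bar> \<le> 24 * sqrt pi * Z * (2 * E t + 2 * Z\<^sup>2)"
proof -
  have c1: "(c t)\<^sup>2 \<le> 1" using cutoff_factor[OF R, of "y t"] by (simp add: c_def power_le_one)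
  have "\<bar>\<Sum>k\<in>modes N. hnth (dn m (z t)) k * B t k\<bar> \<le> (\<Sum>k\<in>modes N. \<bar>hnth (dn m (z t)) k * B t k\<bar>)"
    by (rule sum_abs)
  also have "\<dots> \<le> (\<Sum>k\<in>modes N. 12 * sqrt pi * (norm (dn m (y t)))\<^sup>2 * (\<bar>of_int k\<bar> * \<bar>hnth (dn m (z t)) k\<bar>))"
  proof (rule sum_mono)
    fix k
    have "\<bar>hnth (dn m (z t)) k * B t k\<bar> \<le> \<bar>hnth (dn m (z t)) k\<bar> * (12 * sqrt pi * \<bar>of_int k\<bar> * (norm (dn m (y t)))\<^sup>2)"
      unfolding abs_mult B_def by (intro mult_left_mono rc_conv_crude) auto
    then show "\<bar>hnth (dn m (z t)) k * B t k\<bar> \<le> 12 * sqrt pi * (norm (dn m (y t)))\<^sup>2 * (\<bar>of_int k\<bar> * \<bar>hnth (dn m (z t)) k\<bar>)"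
      by (simp only: mult_ac)
  qed
  also have "\<dots> \<le> 12 * sqrt pi * (2 * E t + 2 * Z\<^sup>2) * Z"
    unfolding sum_distrib_left[symmetric]
    using norm_dn_y(1)[OF t] z_sums(3)[OF t] E_nonneg[of t] zero_le_power2[of "norm (dn m (y t))"]
    by (intro mult_mono mult_left_mono sum_nonneg) (auto simp del: zero_le_power2)
  finally have "\<bar>\<Sum>k\<in>modes N. hnth (dn m (z t)) k * B t k\<bar> \<le> 12 * sqrt pi * (2 * E t + 2 * Z\<^sup>2) * Z" .
  then have "2 * (c t)\<^sup>2 * \<bar>\<Sum>k\<in>modes N. hnth (dn m (z t)) k * B t k\<bar> \<le> 2 * 1 * (12 * sqrt pi * (2 * E t + 2 * Z\<^sup>2) * Z)"
    using c1 by (intro mult_mono) auto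
  then show ?thesis by (simp add: P_def abs_mult mult_ac)
qed

text \<open>Both terms are kept on the left: dropping the dissipation leads to
  \<open>E_bound\<close>, dropping \<open>E\<close> leads to
  \<open>h1_integral_bound\<close>.\<close>

lemma E_integral:
  assumes t: "t \<in> {0..T}"
  shows "E t + 2 * \<nu> * integral {0..t} D \<le> (norm x0)\<^sup>2 + integral {0..t} (\<lambda>s. 24 * sqrt pi * Z * (2 * E s + 2 * Z\<^sup>2))"
proof -
  have sub: "{0..t} \<subseteq> {0..T}" using t by auto
  note ct = continuous_on_subset[OF E_cont sub] continuous_on_subset[OF D_cont sub] continuous_on_subset[OF P_cont sub]
  have "((\<lambda>s. - 2 * \<nu> * D s - P s) has_integral (E t - E 0)) {0..t}"
  proof (rule fundamental_theorem_of_calculus)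
    fix s assume s: "s \<in> {0..t}"
    show "(E has_vector_derivative - 2 * \<nu> * D s - P s) (at s within {0..t})"
      unfolding has_real_derivative_iff_has_vector_derivative[symmetric]
      by (rule DERIV_subset[OF E_deriv sub]) (use s sub in auto)
  qed (use t in simp)
  then have "E t - E 0 = integral {0..t} (\<lambda>s. - 2 * \<nu> * D s - P s)" by (simp add: integral_unique)
  also have "\<dots> = - 2 * \<nu> * integral {0..t} D - integral {0..t} P"
    by (subst Henstock_Kurzweil_Integration.integral_diff)
      (auto intro!: integrable_continuous_real continuous_intros ct)
  finally have eq: "E t + 2 * \<nu> * integral {0..t} D = E 0 + - integral {0..t} P" by simp
  have "- integral {0..t} P = integral {0..t} (\<lambda>s. - P s)" by simp
  also have "\<dots> \<le> integral {0..t} (\<lambda>s. 24 * sqrt pi * Z * (2 * E s + 2 * Z\<^sup>2))"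
  proof (intro integral_le integrable_continuous_real continuous_intros ct)
    fix s assume "s \<in> {0..t}"
    then show "- P s \<le> 24 * sqrt pi * Z * (2 * E s + 2 * Z\<^sup>2)" using P_bound[of s] sub by force
  qed
  finally have 1: "- integral {0..t} P \<le> integral {0..t} (\<lambda>s. 24 * sqrt pi * Z * (2 * E s + 2 * Z\<^sup>2))" .
  \<comment> \<open>At time 0 \<open>v_eq\<close> gives the coefficients of \<open>x0\<close>,
    whatever the value of \<open>z 0\<close>.\<close>
  have "E 0 = (\<Sum>k\<in>modes N. (hnth (dn m x0) k)\<^sup>2)"
    unfolding E_def using T by (intro sum.cong) (simp_all add: v_eq)
  also have "\<dots> \<le> (norm (dn m x0))\<^sup>2" by (rule sum_hnth_le) simp
  also have "\<dots> \<le> (norm x0)\<^sup>2" by (intro power_mono norm_dn_le) simp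
  finally show ?thesis using eq 1 by simp
qed

lemma E_bound:
  assumes t: "t \<in> {0..T}" shows "E t \<le> K0"
proof -
  have "E s \<le> ((norm x0)\<^sup>2 + 48 * sqrt pi * Z * Z\<^sup>2 * T) + integral {0..s} (\<lambda>s. 48 * sqrt pi * Z * E s)"
    if s: "s \<in> {0..T}" for s
  proof -
    have sub: "{0..s} \<subseteq> {0..T}" using s by auto
    have "0 \<le> integral {0..s} D"
      by (intro integral_nonneg integrable_continuous_real continuous_on_subset[OF D_cont sub] D_nonneg)
    then have "E s \<le> (norm x0)\<^sup>2 + integral {0..s} (\<lambda>s. 24 * sqrt pi * Z * (2 * E s + 2 * Z\<^sup>2))"
      using E_integral[OF s] nu mult_nonneg_nonneg[of "2 * \<nu>" "integral {0..s} D"] by linarith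
    also have "(\<lambda>s. 24 * sqrt pi * Z * (2 * E s + 2 * Z\<^sup>2)) = (\<lambda>s. 48 * sqrt pi * Z * E s + 48 * sqrt pi * Z * Z\<^sup>2)"
      by (simp add: algebra_simps)
    also have "integral {0..s} \<dots> = integral {0..s} (\<lambda>s. 48 * sqrt pi * Z * E s) + 48 * sqrt pi * Z * Z\<^sup>2 * s"
      using s by (subst Henstock_Kurzweil_Integration.integral_add)
        (auto intro!: integrable_continuous_real continuous_intros continuous_on_subset[OF E_cont sub])
    also have "48 * sqrt pi * Z * Z\<^sup>2 * s \<le> 48 * sqrt pi * Z * Z\<^sup>2 * T"
      using s Z_nonneg by (intro mult_left_mono) auto
    finally show ?thesis by simp
  qed
  from gronwall[OF E_cont continuous_on_const _ this t]
  have "E t \<le> ((norm x0)\<^sup>2 + 48 * sqrt pi * Z * Z\<^sup>2 * T) * exp (integral {0..t} (\<lambda>s. 48 * sqrt pi * Z))"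
    using Z_nonneg by simp
  also have "\<dots> \<le> K0"
  proof -
    have "48 * sqrt pi * Z * t \<le> 48 * sqrt pi * Z * T" using t Z_nonneg by (intro mult_left_mono) auto
    moreover have "integral {0..t} (\<lambda>s. q) = q * t" for q :: real using t by simp
    ultimately have "integral {0..t} (\<lambda>s. 48 * sqrt pi * Z) \<le> 48 * sqrt pi * Z * T" by (simp only:)
    then show ?thesis unfolding K0_def using Z_nonneg T by (intro mult_left_mono) auto
  qed
  finally show ?thesis .
qed

lemma h1_integral_bound:
  assumes t: "t \<in> {0..T}"
  shows "integral {0..t} (\<lambda>s. (norm (dn (m - 1) (y s)))\<^sup>2) \<le> K2"
proof -
  have sub: "{0..t} \<subseteq> {0..T}" using t by auto
  note ct = continuous_on_subset[OF E_cont sub] continuous_on_subset[OF D_cont sub] continuous_on_subset[OF ycont sub]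
  have "2 * \<nu> * integral {0..t} D \<le> (norm x0)\<^sup>2 + integral {0..t} (\<lambda>s. 24 * sqrt pi * Z * (2 * E s + 2 * Z\<^sup>2))"
    using E_integral[OF t] E_nonneg[of t] by simp
  also have "integral {0..t} (\<lambda>s. 24 * sqrt pi * Z * (2 * E s + 2 * Z\<^sup>2)) \<le> integral {0..t} (\<lambda>s. 24 * sqrt pi * Z * (2 * K0 + 2 * Z\<^sup>2))"
    using E_bound sub Z_nonneg
    by (intro integral_le integrable_continuous_real continuous_intros ct mult_left_mono add_mono) auto
  also have "\<dots> \<le> 24 * sqrt pi * Z * (2 * K0 + 2 * Z\<^sup>2) * T"
  proof -
    have "0 \<le> 24 * sqrt pi * Z * (2 * K0 + 2 * Z\<^sup>2)" using Z_nonneg E_bound[OF t] E_nonneg[of t] by simp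
    then have "24 * sqrt pi * Z * (2 * K0 + 2 * Z\<^sup>2) * t \<le> 24 * sqrt pi * Z * (2 * K0 + 2 * Z\<^sup>2) * T"
      using t by (intro mult_left_mono) auto
    moreover have "integral {0..t} (\<lambda>s. q) = q * t" for q :: real using t by simp
    ultimately show ?thesis by (simp only:)
  qed
  finally have "integral {0..t} D \<le> ((norm x0)\<^sup>2 + 24 * sqrt pi * Z * (2 * K0 + 2 * Z\<^sup>2) * T) / (2 * \<nu>)"
    using nu by (simp add: field_simps)
  moreover have "integral {0..t} (\<lambda>s. (norm (dn (m - 1) (y s)))\<^sup>2) \<le> integral {0..t} (\<lambda>s. 2 * D s + 2 * Z\<^sup>2)"
    using norm_dn_y(2) sub
    by (intro integral_le integrable_continuous_real continuous_intros ct bounded_linear.continuous_on[OF bounded_linear_dn]) auto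
  moreover have "integral {0..t} (\<lambda>s. 2 * D s + 2 * Z\<^sup>2) = 2 * integral {0..t} D + 2 * Z\<^sup>2 * t"
    using t by (subst Henstock_Kurzweil_Integration.integral_add)
      (auto intro!: integrable_continuous_real continuous_intros ct)
  moreover have "2 * Z\<^sup>2 * t \<le> 2 * Z\<^sup>2 * T" using t by (intro mult_left_mono) auto
  moreover have "A / \<nu> = 2 * (A / (2 * \<nu>))" for A by simp
  note this[of "(norm x0)\<^sup>2 + 24 * sqrt pi * Z * (2 * K0 + 2 * Z\<^sup>2) * T"]
  \<comment> \<open>The linear arithmetic of the conclusion, with the long expressions replaced by
    variables.\<close>
  moreover have "a \<le> b \<Longrightarrow> I \<le> J \<Longrightarrow> J = 2 * a + p \<Longrightarrow> p \<le> d \<Longrightarrow> q = 2 * b \<Longrightarrow> I \<le> q + d" for a b I J p d q :: real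
    by linarith
  ultimately show ?thesis unfolding K2_def by blast
qed

text \<open>The tame estimate bounds \<open>tQ\<close> by the norm of \<open>y\<close> times its H1
  norm. The squared H1 norm thus becomes the weight in Gronwall's inequality, and \<open>K2\<close>
  bounds its integral.\<close>

lemma norm_y_bound:
  assumes C: "C \<ge> 0" "\<And>x y. norm (Q m x y) \<le> C * (norm x * norm (dn (m - 1) y) + norm (dn (m - 1) x) * norm y)"
    and t: "t \<in> {0..T}"
  shows "(norm (y t))\<^sup>2 \<le> 2 * (norm x0 + Z)\<^sup>2 * exp (4 * C\<^sup>2 / \<nu> * K2)"
proof -
  let ?h = "\<lambda>s. 4 * C\<^sup>2 / \<nu> * (norm (dn (m - 1) (y s)))\<^sup>2"
  have ch: "continuous_on {0..T} ?h"
    by (intro continuous_intros bounded_linear.continuous_on[OF bounded_linear_dn] ycont)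
  have ineq: "(norm (y t))\<^sup>2 \<le> 2 * (norm x0 + Z)\<^sup>2 + integral {0..t} (\<lambda>s. ?h s * (norm (y s))\<^sup>2)" if t: "t \<in> {0..T}" for t
  proof -
    have t0: "t \<ge> 0" and sub: "{0..t} \<subseteq> {0..T}" using t by auto
    note ct = continuous_on_subset[OF ycont sub] continuous_on_subset[OF continuous_on_tQ[OF R ycont] sub]
    have "y t = force (Some N) t + Duh \<nu> (\<lambda>s. tQ m (Some N) R (y s)) t" using y t by (simp add: mild_eq_def)
    then have "norm (y t) \<le> norm (force (Some N) t) + norm (Duh \<nu> (\<lambda>s. tQ m (Some N) R (y s)) t)"
      using norm_triangle_ineq by metis
    then have "(norm (y t))\<^sup>2 \<le> (norm (force (Some N) t) + norm (Duh \<nu> (\<lambda>s. tQ m (Some N) R (y s)) t))\<^sup>2"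
      by (rule power_mono) simp
    also have "\<dots> \<le> 2 * (norm (force (Some N) t))\<^sup>2 + 2 * (norm (Duh \<nu> (\<lambda>s. tQ m (Some N) R (y s)) t))\<^sup>2" by (rule sq_sum)
    also have "(norm (force (Some N) t))\<^sup>2 \<le> (norm x0 + Z)\<^sup>2" by (intro power_mono norm_force_le t) simp
    also have "(norm (Duh \<nu> (\<lambda>s. tQ m (Some N) R (y s)) t))\<^sup>2 \<le> 1 / (2 * \<nu>) * integral {0..t} (\<lambda>s. (norm (tQ m (Some N) R (y s)))\<^sup>2)"
      by (rule norm_Duh_sq_le[OF nu t0 ct(2)])
    also have "integral {0..t} (\<lambda>s. (norm (tQ m (Some N) R (y s)))\<^sup>2) \<le> integral {0..t} (\<lambda>s. (2 * C * norm (y s) * norm (dn (m - 1) (y s)))\<^sup>2)"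
    proof (intro integral_le integrable_continuous_real continuous_intros ct bounded_linear.continuous_on[OF bounded_linear_dn] power_mono)
      fix s
      define w where "w = cutoff R (y s)"
      \<comment> \<open>The cut-off multiplies by a factor in \<open>[0,1]\<close>, so it shrinks
        both norms.\<close>
      have w: "norm w \<le> norm (y s)" "norm (dn (m - 1) w) \<le> norm (dn (m - 1) (y s))"
      proof -
        define q where "q = R / max R (norm (y s))"
        have q: "0 \<le> q" "q \<le> 1" unfolding q_def by (rule cutoff_factor[OF R])+
        have "w = q *\<^sub>R y s" by (simp add: w_def cutoff_def q_def)
        then show "norm w \<le> norm (y s)" "norm (dn (m - 1) w) \<le> norm (dn (m - 1) (y s))"
          using q by (simp_all add: linear_scale[OF bounded_linear.linear[OF bounded_linear_dn]] mult_left_le_one_le)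
      qed
      have "norm (tQ m (Some N) R (y s)) \<le> norm (Q m w w)" unfolding tQ_def w_def by (rule norm_tr_le)
      also have "\<dots> \<le> C * (norm w * norm (dn (m - 1) w) + norm (dn (m - 1) w) * norm w)" by (rule C)
      also have "\<dots> \<le> C * (norm (y s) * norm (dn (m - 1) (y s)) + norm (dn (m - 1) (y s)) * norm (y s))"
        using w C(1) by (intro mult_left_mono add_mono mult_mono) auto
      finally show "norm (tQ m (Some N) R (y s)) \<le> 2 * C * norm (y s) * norm (dn (m - 1) (y s))" by (simp add: mult_ac)
    qed auto
    finally have "(norm (y t))\<^sup>2 \<le> 2 * (norm x0 + Z)\<^sup>2 + 2 * (1 / (2 * \<nu>) * integral {0..t} (\<lambda>s. (2 * C * norm (y s) * norm (dn (m - 1) (y s)))\<^sup>2))"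
      using nu by (simp add: divide_right_mono)
    also have "2 * (1 / (2 * \<nu>) * integral {0..t} (\<lambda>s. (2 * C * norm (y s) * norm (dn (m - 1) (y s)))\<^sup>2)) = integral {0..t} (\<lambda>s. ?h s * (norm (y s))\<^sup>2)"
    proof -
      have "integral {0..t} (\<lambda>s. ?h s * (norm (y s))\<^sup>2) = integral {0..t} (\<lambda>s. 1 / \<nu> * (2 * C * norm (y s) * norm (dn (m - 1) (y s)))\<^sup>2)"
        by (rule Henstock_Kurzweil_Integration.integral_cong) (simp add: power_mult_distrib)
      then show ?thesis by (simp only: Henstock_Kurzweil_Integration.integral_mult_right)
    qed
    finally show ?thesis .
  qed
  have "(norm (y t))\<^sup>2 \<le> 2 * (norm x0 + Z)\<^sup>2 * exp (integral {0..t} ?h)"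
    by (rule gronwall[OF _ ch _ ineq t]) (use nu in \<open>auto intro!: continuous_intros ycont\<close>)
  also have "integral {0..t} ?h \<le> 4 * C\<^sup>2 / \<nu> * K2"
    using h1_integral_bound[OF t] nu by (simp add: mult_left_mono divide_right_mono)
  finally show ?thesis by (simp add: mult_left_mono)
qed

end

text \<open>The bound is fixed before \<open>N\<close>, \<open>R\<close> and \<open>y\<close>; this
  uniformity is what later removes the cut-off and survives the limit in \<open>N\<close>.\<close>

lemma truncated_Galerkin_bound:
  "\<exists>K>0. \<forall>N R y. R > 0 \<longrightarrow> mild_eq \<nu> (tQ m (Some N) R) (force (Some N)) T y \<longrightarrow> (\<forall>t\<in>{0..T}. norm (y t) \<le> K)"
proof -
  obtain C where C: "C \<ge> 0" "\<And>x y. norm (Q m x y) \<le> C * (norm x * norm (dn (m - 1) y) + norm (dn (m - 1) x) * norm y)"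
    using norm_Q_le[OF m] by auto
  define K where "K = sqrt (2 * (norm x0 + Z)\<^sup>2 * exp (4 * C\<^sup>2 / \<nu> * K2)) + 1"
  have "norm (y t) \<le> K" if "R > 0" "mild_eq \<nu> (tQ m (Some N) R) (force (Some N)) T y" "t \<in> {0..T}" for N R y t
  proof -
    have "norm (y t) \<le> sqrt (2 * (norm x0 + Z)\<^sup>2 * exp (4 * C\<^sup>2 / \<nu> * K2))"
      by (rule real_le_rsqrt) (rule norm_y_bound[OF that(1,2) C that(3)])
    then show ?thesis by (simp add: K_def)
  qed
  moreover have "K > 0" unfolding K_def by (intro add_nonneg_pos) auto
  ultimately show ?thesis by blast
qed

section \<open>Convergence of the truncations and removal of the cut-off\<close>

lemma uniform_hproj:
  assumes "continuous_on {0..T} g" "e > 0"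
  shows "\<exists>N0. \<forall>N\<ge>N0. \<forall>t\<in>{0..T}. norm (g t - hproj N (g t)) < e"
  using hproj_uniform_compact[OF compact_continuous_image[OF assms(1) compact_Icc] assms(2)] by auto

text \<open>\<open>mild_eq_stability\<close> with the projected equation in the role of
  \<open>G'\<close>: both defects are projection errors along paths that do not depend on
  \<open>N\<close>, small uniformly in time by compactness.\<close>

lemma truncated_convergence:
  assumes R: "R > 0" and y: "mild_eq \<nu> (tQ m None R) (force None) T y"
    and yN: "\<And>N. N \<ge> M \<Longrightarrow> mild_eq \<nu> (tQ m (Some N) R) (force (Some N)) T (yN N)" and e: "e > 0"
  shows "\<exists>N0. \<forall>N\<ge>N0. \<forall>t\<in>{0..T}. norm (yN N t - y t) < e"
proof -
  obtain L where L: "\<And>n. lipschitz L (tQ m n R)" using lipschitz_tQ[OF m R] by blast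
  define q where "q = (2 + 2 * T / \<nu>) * exp (2 * L\<^sup>2 / \<nu> * T)"
  have q: "q > 0" unfolding q_def using T nu by (intro mult_pos_pos add_pos_nonneg) auto
  \<comment> \<open>The factor 2 gives \<open>q * d\<^sup>2 = e\<^sup>2 / 4\<close>, hence a strict
    inequality.\<close>
  define d where "d = e / (2 * sqrt q)"
  have d: "d > 0" "q * d\<^sup>2 < e\<^sup>2" using e q by (auto simp: d_def power_divide)
  have cy: "continuous_on {0..T} y" using y by (simp add: mild_eq_def)
  obtain N1 where N1: "\<And>N t. N \<ge> N1 \<Longrightarrow> t \<in> {0..T} \<Longrightarrow> norm (force None t - hproj N (force None t)) < d"
    using uniform_hproj[OF continuous_on_force d(1)] by blast
  obtain N2 where N2: "\<And>N t. N \<ge> N2 \<Longrightarrow> t \<in> {0..T} \<Longrightarrow> norm (tQ m None R (y t) - hproj N (tQ m None R (y t))) < d"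
    using uniform_hproj[OF continuous_on_tQ[OF R cy] d(1)] by blast
  have "norm (yN N t - y t) < e" if N: "N \<ge> max M (max N1 N2)" and t: "t \<in> {0..T}" for N t
  proof -
    have "(norm (y t - yN N t))\<^sup>2 \<le> (2 + 2 * T / \<nu>) * d\<^sup>2 * exp (2 * L\<^sup>2 / \<nu> * T)"
    proof (rule mild_eq_stability[OF nu L lipschitz_continuous[OF L] y yN _ _ t])
      show "M \<le> N" using N by simp
      fix s assume s: "s \<in> {0..T}"
      show "norm (force None s - force (Some N) s) \<le> d"
        using N1[of N s] N s by (simp add: force_def)
      show "norm (tQ m None R (y s) - tQ m (Some N) R (y s)) \<le> d"
        using N2[of N s] N s by (simp add: tQ_def)
    qed
    also have "\<dots> = q * d\<^sup>2" by (simp add: q_def)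
    also have "\<dots> < e\<^sup>2" by (rule d(2))
    finally have "norm (y t - yN N t) < e" by (rule power2_less_imp_less) (use e in simp)
    then show ?thesis by (simp add: norm_minus_commute)
  qed
  then show ?thesis by blast
qed

lemma truncated_solution:
  assumes R: "R > 0" shows "mild_eq \<nu> (tQ m n R) (force n) T (mild_sol \<nu> (tQ m n R) (force n))"
  using mild_sol[OF nu _ continuous_on_force] lipschitz_tQ[OF m R] by blast

text \<open>The energy argument works on finite sums of modes. The equation without projection
  inherits the bound because its Galerkin approximations with the same cut-off converge to its
  solution.\<close>

lemma truncated_bound:
  "\<exists>K>0. \<forall>n R y. R > 0 \<longrightarrow> mild_eq \<nu> (tQ m n R) (force n) T y \<longrightarrow> (\<forall>t\<in>{0..T}. norm (y t) \<le> K)"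
proof -
  obtain K where K: "K > 0"
    "\<And>N R y t. R > 0 \<Longrightarrow> mild_eq \<nu> (tQ m (Some N) R) (force (Some N)) T y \<Longrightarrow> t \<in> {0..T} \<Longrightarrow> norm (y t) \<le> K"
    using truncated_Galerkin_bound by blast
  have "norm (y t) \<le> K" if R: "R > 0" and y: "mild_eq \<nu> (tQ m n R) (force n) T y" and t: "t \<in> {0..T}" for n R y t
  proof (cases n)
    case None
    show ?thesis
    proof (rule field_le_epsilon)
      fix e :: real assume e: "e > 0"
      let ?yN = "\<lambda>N. mild_sol \<nu> (tQ m (Some N) R) (force (Some N))"
      obtain N where N: "norm (?yN N t - y t) < e"
        using truncated_convergence[OF R y[unfolded None] truncated_solution[OF R] e] t by blast
      have "norm (?yN N t) \<le> K" by (rule K(2)[OF R truncated_solution[OF R] t])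
      then show "norm (y t) \<le> K + e"
        using N norm_triangle_ineq4[of "?yN N t" "?yN N t - y t"] by simp
    qed
  qed (use K(2)[OF R _ t] y in auto)
  then show ?thesis using K(1) by blast
qed

abbreviation full :: "nat option \<Rightarrow> hs \<Rightarrow> hs" where "full n \<equiv> (\<lambda>x. tr n (Q m x x))"

lemma full_eq_truncated:
  assumes y: "continuous_on {0..T} y" and R: "R > 0" "\<And>t. t \<in> {0..T} \<Longrightarrow> norm (y t) \<le> R"
  shows "mild_eq \<nu> (full n) (force n) T y \<longleftrightarrow> mild_eq \<nu> (tQ m n R) (force n) T y"
proof -
  have "full n (y t) = tQ m n R (y t)" if "t \<in> {0..T}" for t
    by (simp add: tQ_def cutoff_id[OF R(1) R(2)[OF that]])
  then show ?thesis using mild_eq_cong[of \<nu> "full n" "force n" T y "tQ m n R" "force n"]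
      mild_eq_cong[of \<nu> "tQ m n R" "force n" T y "full n" "force n"] by auto
qed

text \<open>The a priori bound \<open>K\<close> does not depend on the radius. A solution with
  cut-off therefore stays where the cut-off is the identity. Conversely, a solution without cut-off
  is bounded on \<open>[0,T]\<close>, so it solves the equation with some larger radius and then
  obeys the bound \<open>K\<close> as well.\<close>

lemma full_is_truncated:
  "\<exists>K>0. \<forall>R\<ge>K. \<forall>n y. mild_eq \<nu> (full n) (force n) T y \<longleftrightarrow> mild_eq \<nu> (tQ m n R) (force n) T y"
proof -
  obtain K where K: "K > 0"
    "\<And>n R y t. R > 0 \<Longrightarrow> mild_eq \<nu> (tQ m n R) (force n) T y \<Longrightarrow> t \<in> {0..T} \<Longrightarrow> norm (y t) \<le> K"
    using truncated_bound by blast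
  have "mild_eq \<nu> (full n) (force n) T y \<longleftrightarrow> mild_eq \<nu> (tQ m n R) (force n) T y" if R: "R \<ge> K" for R n y
  proof
    assume y: "mild_eq \<nu> (tQ m n R) (force n) T y"
    have "continuous_on {0..T} y" using y by (simp add: mild_eq_def)
    moreover have "norm (y t) \<le> R" if "t \<in> {0..T}" for t using K(2)[OF _ y that] K(1) R by simp
    ultimately show "mild_eq \<nu> (full n) (force n) T y" using full_eq_truncated[of y R n] y K(1) R by simp
  next
    assume y: "mild_eq \<nu> (full n) (force n) T y"
    have cy: "continuous_on {0..T} y" using y by (simp add: mild_eq_def)
    obtain R0 where R0: "\<forall>t\<in>{0..T}. norm (y t) \<le> R0"
      using continuous_on_Icc_bdd[OF continuous_on_norm[OF cy]] by blast
    define R1 where "R1 = max R0 K"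
    have R1: "R1 > 0" "\<And>t. t \<in> {0..T} \<Longrightarrow> norm (y t) \<le> R1"
      using R0 K(1) by (auto simp: R1_def intro: max.coboundedI1)
    have "mild_eq \<nu> (tQ m n R1) (force n) T y" using full_eq_truncated[OF cy R1] y by simp
    then have "norm (y t) \<le> R" if "t \<in> {0..T}" for t using K(2)[OF R1(1) _ that] R by force
    then show "mild_eq \<nu> (tQ m n R) (force n) T y" using full_eq_truncated[OF cy, of R n] y K(1) R by simp
  qed
  then show ?thesis using K(1) by blast
qed

lemma full_unique:
  assumes "mild_eq \<nu> (full n) (force n) T y" "mild_eq \<nu> (full n) (force n) T y'" "t \<in> {0..T}"
  shows "y t = y' t"
proof -
  obtain K where K: "K > 0" "\<And>n y. mild_eq \<nu> (full n) (force n) T y \<longleftrightarrow> mild_eq \<nu> (tQ m n K) (force n) T y"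
    using full_is_truncated by blast
  obtain L where "lipschitz L (tQ m n K)" using lipschitz_tQ[OF m K(1)] by blast
  from mild_eq_unique[OF nu this] show ?thesis using K(2) assms by blast
qed

lemma full_convergence:
  assumes "mild_eq \<nu> (full None) (force None) T y"
    and "\<And>N. N \<ge> M \<Longrightarrow> mild_eq \<nu> (full (Some N)) (force (Some N)) T (yN N)" and "e > 0"
  shows "\<exists>N0. \<forall>N\<ge>N0. \<forall>t\<in>{0..T}. norm (yN N t - y t) < e"
proof -
  obtain K where K: "K > 0" "\<And>n y. mild_eq \<nu> (full n) (force n) T y \<longleftrightarrow> mild_eq \<nu> (tQ m n K) (force n) T y"
    using full_is_truncated by blast
  show ?thesis by (rule truncated_convergence[OF K(1) _ _ assms(3)]) (use assms K(2) in blast)+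
qed

text \<open>For every \<open>t\<close> the sequence in \<open>R\<close> is eventually constant. The
  radius at which this happens depends on the path, so a limit over all integer radii is taken: it
  is a formula in the path and stays measurable in the sample.\<close>

lemma full_solution:
  "mild_eq \<nu> (full n) (force n) T (\<lambda>t. lim (\<lambda>R. mild_sol \<nu> (tQ m n (real (Suc R))) (force n) t))"
proof -
  obtain K where K: "K > 0" "\<And>R n y. R \<ge> K \<Longrightarrow> mild_eq \<nu> (full n) (force n) T y \<longleftrightarrow> mild_eq \<nu> (tQ m n R) (force n) T y"
    using full_is_truncated by blast
  let ?y = "mild_sol \<nu> (tQ m n K) (force n)"
  have y: "mild_eq \<nu> (full n) (force n) T ?y" using K(2)[OF order_refl] truncated_solution[OF K(1)] by blast
  obtain R0 :: nat where R0: "K \<le> real R0" using real_arch_simple by blast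
  have lim: "lim (\<lambda>R. mild_sol \<nu> (tQ m n (real (Suc R))) (force n) t) = ?y t" if t: "t \<in> {0..T}" for t
  proof (rule limI, rule tendsto_eventually)
    have "mild_sol \<nu> (tQ m n (real (Suc R))) (force n) t = ?y t" if R: "R \<ge> R0" for R
    proof (rule full_unique[OF _ y t])
      show "mild_eq \<nu> (full n) (force n) T (mild_sol \<nu> (tQ m n (real (Suc R))) (force n))"
        using K(2)[of "real (Suc R)"] truncated_solution[of "real (Suc R)" n] R R0 by simp
    qed
    then show "\<forall>\<^sub>F R in sequentially. mild_sol \<nu> (tQ m n (real (Suc R))) (force n) t = ?y t"
      unfolding eventually_sequentially by blast
  qed
  show ?thesis unfolding mild_eq_def
  proof (intro conjI ballI)
    show "continuous_on {0..T} (\<lambda>t. lim (\<lambda>R. mild_sol \<nu> (tQ m n (real (Suc R))) (force n) t))"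
      by (rule continuous_on_eq[of _ ?y]) (use y lim in \<open>auto simp: mild_eq_def\<close>)
    fix t assume t: "t \<in> {0..T}"
    have "Duh \<nu> (\<lambda>s. full n (lim (\<lambda>R. mild_sol \<nu> (tQ m n (real (Suc R))) (force n) s))) t = Duh \<nu> (\<lambda>s. full n (?y s)) t"
      by (rule Duh_cong) (use t lim in auto)
    then show "lim (\<lambda>R. mild_sol \<nu> (tQ m n (real (Suc R))) (force n) t) = force n t +
         Duh \<nu> (\<lambda>s. full n (lim (\<lambda>R. mild_sol \<nu> (tQ m n (real (Suc R))) (force n) s))) t"
      using y t lim[OF t] by (simp add: mild_eq_def)
  qed
qed

end

section \<open>Fourier series on the circle\<close>

text \<open>One period as a finite measure space of its own, in which bounded measurable functions
  are integrable.\<close>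

definition CM :: "real measure" where "CM = restrict_space lborel {0..2*pi}"

lemma space_CM [simp]: "space CM = {0..2*pi}"
  by (simp add: CM_def space_restrict_space)

lemma integral_CM:
  fixes f :: "real \<Rightarrow> 'a::{banach, second_countable_topology}"
  shows "set_lebesgue_integral lborel {0..2*pi} f = integral\<^sup>L CM f"
  unfolding CM_def set_lebesgue_integral_def by (subst integral_restrict_space) simp_all

lemma integrable_CM:
  fixes f :: "real \<Rightarrow> 'a::{banach, second_countable_topology}"
  shows "set_integrable lborel {0..2*pi} f \<longleftrightarrow> integrable CM f"
  unfolding CM_def set_integrable_def by (subst integrable_restrict_space) simp_all

lemma measurable_CM [measurable (raw)]: "f \<in> borel_measurable borel \<Longrightarrow> f \<in> borel_measurable CM"
  unfolding CM_def by (rule measurable_restrict_space1) simp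

interpretation CM: finite_measure CM
  by standard (simp add: CM_def emeasure_restrict_space)

lemma measure_CM: "measure CM (space CM) = 2 * pi"
  unfolding space_CM unfolding CM_def by (subst measure_restrict_space) auto

lemma AE_CM_iff: "(AE x in CM. P x) \<longleftrightarrow> (AE x in lborel. x \<in> {0..2*pi} \<longrightarrow> P x)"
  unfolding CM_def by (rule AE_restrict_space_iff) simp

lemma
  fixes f :: "real \<Rightarrow> 'a::euclidean_space"
  assumes "continuous_on {0..2*pi} f"
  shows integrable_CM_continuous: "integrable CM f"
    and integral_CM_continuous: "integral\<^sup>L CM f = integral {0..2*pi} f"
proof -
  have s: "set_integrable lborel {0..2*pi} f" using assms by (rule borel_integrable_atLeastAtMost')
  then show "integrable CM f" by (simp add: integrable_CM)
  show "integral\<^sup>L CM f = integral {0..2*pi} f"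
    using set_borel_integral_eq_integral(2)[OF s] by (simp add: integral_CM)
qed

lemma integral_cis: "(\<integral>x. cis (of_int k * x) \<partial>CM) = (if k = 0 then 2 * pi else 0)"
proof (cases "k = 0")
  case True
  then show ?thesis by (simp add: measure_CM[simplified] scaleR_conv_of_real)
next
  case False
  have "((\<lambda>x. cis (of_int k * x)) has_integral (cis (of_int k * (2 * pi)) / (\<i> * of_int k) - cis (of_int k * 0) / (\<i> * of_int k))) {0..2*pi}"
  proof (rule fundamental_theorem_of_calculus)
    fix x :: real
    have "((\<lambda>z. exp (\<i> * of_int k * z) / (\<i> * of_int k)) has_field_derivative exp (\<i> * of_int k * complex_of_real x)) (at (complex_of_real x))"
      using False by (auto intro!: derivative_eq_intros)
    from has_vector_derivative_real_field[OF this, of "{0..2*pi}"]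
    show "((\<lambda>x. cis (of_int k * x) / (\<i> * of_int k)) has_vector_derivative cis (of_int k * x)) (at x within {0..2*pi})"
      by (simp add: cis_conv_exp mult_ac)
  qed simp
  moreover have "cis (of_int k * (2 * pi)) = 1"
    by (metis cis_multiple_2pi Ints_of_int mult.commute)
  ultimately have "integral {0..2*pi} (\<lambda>x. cis (of_int k * x)) = 0" by (simp add: integral_unique)
  then show ?thesis using False by (subst integral_CM_continuous) (auto intro!: continuous_intros)
qed

lemma integral_cos: "(\<integral>x. cos (of_int k * x) \<partial>CM) = (if k = 0 then 2 * pi else 0)"
  and integral_sin: "(\<integral>x. sin (of_int k * x) \<partial>CM) = 0"
proof -
  have i: "integrable CM (\<lambda>x. cis (of_int k * x))" by (intro integrable_CM_continuous continuous_intros)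
  show "(\<integral>x. cos (of_int k * x) \<partial>CM) = (if k = 0 then 2 * pi else 0)"
    using integral_bounded_linear[OF bounded_linear_Re i] by (simp add: integral_cis split: if_splits)
  show "(\<integral>x. sin (of_int k * x) \<partial>CM) = 0"
    using integral_bounded_linear[OF bounded_linear_Im i] by (simp add: integral_cis split: if_splits)
qed

section \<open>The trigonometric basis\<close>

lemma ebasis_measurable [measurable]: "ebasis k \<in> borel_measurable borel"
  unfolding ebasis_def[abs_def] by measurable

lemma ebasis_continuous [continuous_intros]: "continuous_on S (ebasis k)"
  unfolding ebasis_def[abs_def] by (cases "k > 0") (auto intro!: continuous_intros)

lemma periodic_int:
  assumes "\<And>x. f (x + 2 * pi) = f x" shows "f (x + 2 * pi * of_int n) = f x"
proof -
  have nat: "f (x + 2 * pi * real n) = f x" for n x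
  proof (induction n)
    case (Suc n)
    have "f (x + 2 * pi * real (Suc n)) = f ((x + 2 * pi * real n) + 2 * pi)" by (simp add: algebra_simps)
    then show ?case using assms Suc by metis
  qed simp
  show ?thesis
  proof (cases "n \<ge> 0")
    case True
    then show ?thesis using nat[of x "nat n"] by simp
  next
    case False
    then show ?thesis using nat[of "x + 2 * pi * of_int n" "nat (- n)"] by (simp add: algebra_simps)
  qed
qed

lemma cis_periodic: "cis (of_int k * (x + 2 * pi)) = cis (of_int k * x)"
proof -
  have "cis (2 * pi * of_int k) = 1" by (rule cis_multiple_2pi) simp
  then show ?thesis by (simp add: distrib_left mult_ac flip: cis_mult)
qed

lemma ebasis_periodic: "ebasis k (x + 2 * pi) = ebasis k x"
proof -
  have "cos (of_int k * (x + 2 * pi)) = cos (of_int k * x)" "sin (of_int (- k) * (x + 2 * pi)) = sin (of_int (- k) * x)"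
    using cis_periodic[of k x] cis_periodic[of "- k" x] by (metis cis.sel(1), metis cis.sel(2))
  then show ?thesis by (simp add: ebasis_def)
qed

lemma abs_ebasis_le: "\<bar>ebasis k x\<bar> \<le> 1"
proof -
  have "1 \<le> sqrt pi" using pi_ge_two by simp
  then show ?thesis by (auto simp: ebasis_def divide_le_eq intro: order_trans[OF abs_cos_le_one] order_trans[OF abs_sin_le_one])
qed

lemma ebasis_orthonormal:
  assumes "k \<noteq> 0" "l \<noteq> 0"
  shows "(\<integral>x. ebasis k x * ebasis l x \<partial>CM) = (if k = l then 1 else 0)"
proof -
  note c = integrable_CM_continuous[OF continuous_on_cos[OF continuous_on_mult_left[OF continuous_on_id]]]
    integrable_CM_continuous[OF continuous_on_sin[OF continuous_on_mult_left[OF continuous_on_id]]]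
  have cc: "(\<integral>x. cos (of_int p * x) * cos (of_int q * x) \<partial>CM) = ((if p - q = 0 then 2 * pi else 0) + (if p + q = 0 then 2 * pi else 0)) / 2"
    and ss: "(\<integral>x. sin (of_int p * x) * sin (of_int q * x) \<partial>CM) = ((if p - q = 0 then 2 * pi else 0) - (if p + q = 0 then 2 * pi else 0)) / 2"
    and sc: "(\<integral>x. sin (of_int p * x) * cos (of_int q * x) \<partial>CM) = 0" for p q :: int
  proof -
    have "(\<lambda>x::real. cos (of_int p * x) * cos (of_int q * x)) = (\<lambda>x. (cos (of_int (p - q) * x) + cos (of_int (p + q) * x)) / 2)"
      "(\<lambda>x::real. sin (of_int p * x) * sin (of_int q * x)) = (\<lambda>x. (cos (of_int (p - q) * x) - cos (of_int (p + q) * x)) / 2)"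
      "(\<lambda>x::real. sin (of_int p * x) * cos (of_int q * x)) = (\<lambda>x. (sin (of_int (p + q) * x) + sin (of_int (p - q) * x)) / 2)"
      by (auto simp: fun_eq_iff cos_add cos_diff sin_add sin_diff algebra_simps)
    then show "(\<integral>x. cos (of_int p * x) * cos (of_int q * x) \<partial>CM) = ((if p - q = 0 then 2 * pi else 0) + (if p + q = 0 then 2 * pi else 0)) / 2"
      "(\<integral>x. sin (of_int p * x) * sin (of_int q * x) \<partial>CM) = ((if p - q = 0 then 2 * pi else 0) - (if p + q = 0 then 2 * pi else 0)) / 2"
      "(\<integral>x. sin (of_int p * x) * cos (of_int q * x) \<partial>CM) = 0"
      by (simp_all only: integral_divide_zero Bochner_Integration.integral_add[OF c(1) c(1)]
          Bochner_Integration.integral_diff[OF c(1) c(1)] Bochner_Integration.integral_add[OF c(2) c(2)]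
          integral_cos integral_sin) simp_all
  qed
  have cs: "(\<integral>x. cos (of_int k * x) * sin (of_int (- l) * x) \<partial>CM) = 0"
    using sc[of "- l" k] by (simp only: mult.commute)
  have C: "(\<integral>x. cos (of_int k * x) * cos (of_int l * x) \<partial>CM) = (if k = l then pi else 0)" if "k > 0" "l > 0"
    unfolding cc using that by simp
  have S: "(\<integral>x. sin (of_int (- k) * x) * sin (of_int (- l) * x) \<partial>CM) = (if k = l then pi else 0)" if "k < 0" "l < 0"
    unfolding ss using that by simp
  have E: "(\<integral>x. ebasis k x * ebasis l x \<partial>CM) = (\<integral>x. (if k > 0 then cos (of_int k * x) else sin (- of_int k * x)) *
      (if l > 0 then cos (of_int l * x) else sin (- of_int l * x)) \<partial>CM) / pi"
    by (simp add: ebasis_def flip: integral_divide_zero)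
  consider "k > 0" "l > 0" | "k > 0" "\<not> l > 0" | "\<not> k > 0" "l > 0" | "\<not> k > 0" "\<not> l > 0" by blast
  then show ?thesis
  proof cases
    case 1
    then show ?thesis unfolding E using C by (simp only: if_True) simp
  next
    case 2
    then show ?thesis unfolding E using cs by (simp only: if_True if_False) auto
  next
    case 3
    then show ?thesis unfolding E using sc[of "- k" l] by (simp only: if_True if_False) auto
  next
    case 4
    then show ?thesis unfolding E using S assms by (simp only: if_False) auto
  qed
qed

section \<open>Square integrable periodic functions and their coefficients\<close>

lemma L2_circleD:
  assumes "f \<in> L2_circle"
  shows "f \<in> borel_measurable borel" "f (x + 2 * pi) = f x" "integrable CM (\<lambda>x. (f x)\<^sup>2)"
  using assms by (auto simp: L2_circle_def integrable_CM)

lemma L2_circleI: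
  "f \<in> borel_measurable borel \<Longrightarrow> (\<And>x. f (x + 2 * pi) = f x) \<Longrightarrow> integrable CM (\<lambda>x. (f x)\<^sup>2) \<Longrightarrow> f \<in> L2_circle"
  by (auto simp: L2_circle_def integrable_CM)

lemma abs_mult_le_sq: "\<bar>a * b\<bar> \<le> a\<^sup>2 + (b::real)\<^sup>2"
proof -
  have "2 * \<bar>a * b\<bar> \<le> a\<^sup>2 + b\<^sup>2"
    using sum_squares_bound[of "\<bar>a\<bar>" "\<bar>b\<bar>"] by (simp add: abs_mult)
  then show ?thesis using abs_ge_zero[of "a * b"] by linarith
qed

lemma L2_mult_integrable:
  assumes f: "f \<in> L2_circle" and g: "g \<in> L2_circle" shows "integrable CM (\<lambda>x. f x * g x)"
proof (rule Bochner_Integration.integrable_bound)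
  show "integrable CM (\<lambda>x. (f x)\<^sup>2 + (g x)\<^sup>2)" using L2_circleD(3) f g by auto
  show "(\<lambda>x. f x * g x) \<in> borel_measurable CM"
    by (intro measurable_CM borel_measurable_times L2_circleD(1) f g)
  show "AE x in CM. norm (f x * g x) \<le> norm ((f x)\<^sup>2 + (g x)\<^sup>2)"
    using abs_mult_le_sq by (intro AE_I2) (simp add: abs_of_nonneg)
qed

lemma L2_continuous:
  assumes "continuous_on UNIV f" "\<And>x. f (x + 2 * pi) = f x" shows "f \<in> L2_circle"
proof (rule L2_circleI)
  show "f \<in> borel_measurable borel" using assms(1) by (rule borel_measurable_continuous_onI)
  show "f (x + 2 * pi) = f x" for x by (rule assms(2))
  show "integrable CM (\<lambda>x. (f x)\<^sup>2)"
    by (intro integrable_CM_continuous continuous_intros continuous_on_subset[OF assms(1)]) auto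
qed

lemma L2_ebasis: "ebasis k \<in> L2_circle"
  by (intro L2_continuous continuous_intros ebasis_periodic)

lemma L2_add: "f \<in> L2_circle \<Longrightarrow> g \<in> L2_circle \<Longrightarrow> (\<lambda>x. f x + g x) \<in> L2_circle"
proof (rule L2_circleI)
  assume f: "f \<in> L2_circle" and g: "g \<in> L2_circle"
  show "(\<lambda>x. f x + g x) \<in> borel_measurable borel" using L2_circleD(1) f g by auto
  show "f (x + 2 * pi) + g (x + 2 * pi) = f x + g x" for x using L2_circleD(2) f g by metis
  have "integrable CM (\<lambda>x. (f x)\<^sup>2 + 2 * (f x * g x) + (g x)\<^sup>2)"
    using L2_circleD(3) L2_mult_integrable f g by auto
  then show "integrable CM (\<lambda>x. (f x + g x)\<^sup>2)" by (simp add: power2_sum algebra_simps)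
qed

lemma L2_scale: "f \<in> L2_circle \<Longrightarrow> (\<lambda>x. c * f x) \<in> L2_circle"
  by (rule L2_circleI) (auto simp: L2_circleD power_mult_distrib intro!: borel_measurable_times)

lemma L2_diff: "f \<in> L2_circle \<Longrightarrow> g \<in> L2_circle \<Longrightarrow> (\<lambda>x. f x - g x) \<in> L2_circle"
  using L2_add[of f "\<lambda>x. - 1 * g x"] L2_scale[of g "- 1"] by simp

lemma L2_0: "(\<lambda>x. 0) \<in> L2_circle" by (intro L2_continuous) auto

lemma L2_sum: "(\<And>i. i \<in> A \<Longrightarrow> f i \<in> L2_circle) \<Longrightarrow> (\<lambda>x. \<Sum>i\<in>A. f i x) \<in> L2_circle"
  by (induction A rule: infinite_finite_induct) (auto intro: L2_add L2_0)

lemma L2_integrable: "f \<in> L2_circle \<Longrightarrow> integrable CM f"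
  using L2_mult_integrable[of f "\<lambda>_. 1"] L2_continuous[of "\<lambda>_. 1"] by simp

lemma L2_mult_bounded:
  assumes f: "f \<in> borel_measurable borel" "\<And>x. f (x + 2 * pi) = f x" "AE x in CM. \<bar>f x\<bar> \<le> C" and g: "g \<in> L2_circle"
  shows "(\<lambda>x. f x * g x) \<in> L2_circle"
proof (rule L2_circleI)
  show m: "(\<lambda>x. f x * g x) \<in> borel_measurable borel" using f(1) L2_circleD(1)[OF g] by simp
  show "f (x + 2 * pi) * g (x + 2 * pi) = f x * g x" for x using f(2) L2_circleD(2)[OF g] by simp
  show "integrable CM (\<lambda>x. (f x * g x)\<^sup>2)"
  proof (rule Bochner_Integration.integrable_bound[of _ "\<lambda>x. C\<^sup>2 * (g x)\<^sup>2"])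
    show "integrable CM (\<lambda>x. C\<^sup>2 * (g x)\<^sup>2)" using L2_circleD(3)[OF g] by simp
    show "(\<lambda>x. (f x * g x)\<^sup>2) \<in> borel_measurable CM" using m by (intro measurable_CM) simp
    show "AE x in CM. norm ((f x * g x)\<^sup>2) \<le> norm (C\<^sup>2 * (g x)\<^sup>2)"
      using f(3)
    proof eventually_elim
      case (elim x)
      then have "(f x)\<^sup>2 \<le> C\<^sup>2" by (metis abs_ge_zero power2_abs power_mono)
      then show ?case by (simp add: power_mult_distrib mult_right_mono)
    qed
  qed
qed

lemma coef_eq: "coef u k = (\<integral>x. u x * ebasis k x \<partial>CM)"
  by (simp add: coef_def inner_H_def integral_CM)

lemma coef_add: "f \<in> L2_circle \<Longrightarrow> g \<in> L2_circle \<Longrightarrow> coef (\<lambda>x. f x + g x) k = coef f k + coef g k"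
  and coef_diff: "f \<in> L2_circle \<Longrightarrow> g \<in> L2_circle \<Longrightarrow> coef (\<lambda>x. f x - g x) k = coef f k - coef g k"
  and coef_scale: "coef (\<lambda>x. c * f x) k = c * coef f k"
  by (simp_all add: coef_eq distrib_right left_diff_distrib L2_mult_integrable L2_ebasis mult.assoc)

lemma coef_sum: "(\<And>i. i \<in> A \<Longrightarrow> f i \<in> L2_circle) \<Longrightarrow> coef (\<lambda>x. \<Sum>i\<in>A. f i x) k = (\<Sum>i\<in>A. coef (f i) k)"
proof (induction A rule: infinite_finite_induct)
  case (insert i A)
  then have "coef (\<lambda>x. f i x + (\<Sum>i\<in>A. f i x)) k = coef (f i) k + coef (\<lambda>x. \<Sum>i\<in>A. f i x) k"
    by (intro coef_add L2_sum) auto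
  then show ?case using insert by simp
qed (auto simp: coef_eq)

lemma coef_cong_AE:
  assumes "AE x in lborel. f x = g x" "f \<in> borel_measurable borel" "g \<in> borel_measurable borel"
  shows "coef f k = coef g k"
  unfolding coef_eq
  by (rule integral_cong_AE) (use assms in \<open>auto simp: AE_CM_iff intro!: measurable_CM elim: eventually_mono\<close>)

lemma coef_ebasis: "k \<noteq> 0 \<Longrightarrow> l \<noteq> 0 \<Longrightarrow> coef (ebasis l) k = (if k = l then 1 else 0)"
  by (simp add: coef_eq ebasis_orthonormal)

lemma fourier_eq: "fourier u k = 1 / (2 * pi) * (\<integral>x. u x * cis (- (of_int k * x)) \<partial>CM)"
  unfolding fourier_def integral_CM by (simp add: cis_conv_exp mult.assoc)

lemma fourier_0: "fourier u 0 = (\<integral>x. u x \<partial>CM) / (2 * pi)"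
  by (simp add: fourier_eq)

text \<open>The basis carries the factor \<open>1 / sqrt pi\<close> and the complex coefficients
  carry \<open>1 / (2 * pi)\<close>; this explains the \<open>2 * sqrt pi\<close> in
  \<open>cf\<close>.\<close>

lemma fourier_cf:
  assumes f: "f \<in> L2_circle" and k: "k \<noteq> 0" shows "fourier f k = cf (coef f) k"
proof -
  have fb: "f \<in> borel_measurable borel" by (rule L2_circleD(1)[OF f])
  have int: "integrable CM (\<lambda>x. f x * cos (of_int k * x))" "integrable CM (\<lambda>x. f x * sin (of_int k * x))" for k
    by (rule Bochner_Integration.integrable_bound[OF L2_integrable[OF f]],
        use fb in \<open>auto intro!: measurable_CM AE_I2 simp: abs_mult mult_left_le\<close>)+
  let ?C = "\<integral>x. f x * cos (of_int k * x) \<partial>CM" and ?S = "\<integral>x. f x * sin (of_int k * x) \<partial>CM"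
  have "(\<lambda>x. f x * cis (- (of_int k * x))) = (\<lambda>x. complex_of_real (f x * cos (of_int k * x)) - \<i> * complex_of_real (f x * sin (of_int k * x)))"
    by (auto simp: complex_eq_iff)
  then have "(\<integral>x. f x * cis (- (of_int k * x)) \<partial>CM) = complex_of_real ?C - \<i> * complex_of_real ?S"
    using int[of k] by (simp add: Bochner_Integration.integral_diff del: of_real_mult)
  then have F: "fourier f k = (complex_of_real ?C - \<i> * complex_of_real ?S) / (2 * pi)"
    by (simp add: fourier_eq)
  define s where "s = sqrt pi"
  have s: "pi = s * s" "s > 0" by (simp_all add: s_def)
  have neg: "(\<integral>x. f x * cos (- (of_int k * x)) \<partial>CM) = ?C" "(\<integral>x. f x * sin (- (of_int k * x)) \<partial>CM) = - ?S" by simp_all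
  have c: "coef f \<bar>k\<bar> = ?C / s"
    using k neg(1) by (cases "k > 0") (simp_all add: coef_eq ebasis_def integral_divide_zero s_def)
  have d: "of_int (sgn k) * coef f (- \<bar>k\<bar>) = ?S / s"
    using k neg(2) by (cases "k > 0") (simp_all add: coef_eq ebasis_def integral_divide_zero s_def)
  have "cf (coef f) k = Complex (?C / s) (- (?S / s)) / (2 * s)"
    using k c d by (simp add: cf_def s_def)
  also have "\<dots> = fourier f k"
    unfolding F s(1) using s(2) by (auto simp: complex_eq_iff)
  finally show ?thesis by simp
qed

lemma coef_fourier: "f \<in> L2_circle \<Longrightarrow> k \<noteq> 0 \<Longrightarrow> coef f k = rc (fourier f) k"
proof -
  assume f: "f \<in> L2_circle" and k: "k \<noteq> 0"
  have "rc (fourier f) k = rc (cf (coef f)) k" unfolding rc_def using fourier_cf[OF f] k by auto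
  then show ?thesis using rc_cf[OF k] by simp
qed

lemma H_circleI: "f \<in> L2_circle \<Longrightarrow> fourier f 0 = 0 \<Longrightarrow> f \<in> H_circle"
  by (simp add: H_circle_def fourier_0 integral_CM)

lemma H_circleD: "f \<in> H_circle \<Longrightarrow> f \<in> L2_circle" "f \<in> H_circle \<Longrightarrow> fourier f 0 = 0"
  by (simp_all add: H_circle_def fourier_0 integral_CM)

lemma fourier_cf_H: "f \<in> H_circle \<Longrightarrow> fourier f k = cf (coef f) k"
  using fourier_cf[of f k] H_circleD[of f] by (cases "k = 0") auto

lemma fourier_uminus: "f \<in> L2_circle \<Longrightarrow> fourier f (- k) = cnj (fourier f k)"
proof (cases "k = 0")
  case True
  then show ?thesis by (simp add: fourier_0 complex_cnj_divide)
qed (simp add: fourier_cf cf_uminus)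

lemma fourier_add: "f \<in> L2_circle \<Longrightarrow> g \<in> L2_circle \<Longrightarrow> fourier (\<lambda>x. f x + g x) k = fourier f k + fourier g k"
  and fourier_scale: "fourier (\<lambda>x. c * f x) k = c * fourier f k"
proof -
  have int: "integrable CM (\<lambda>x. f x * cis (- (of_int k * x)))" if "f \<in> L2_circle" for f
  proof (rule Bochner_Integration.integrable_bound[OF L2_integrable[OF that]])
    have "continuous_on UNIV (\<lambda>x. cis (- (real_of_int k * x)))" by (intro continuous_intros)
    then have "(\<lambda>x. cis (- (real_of_int k * x))) \<in> borel_measurable borel" by (rule borel_measurable_continuous_onI)
    then show "(\<lambda>x. f x * cis (- (of_int k * x))) \<in> borel_measurable CM"
      using L2_circleD(1)[OF that] by (intro measurable_CM) simp
  qed (simp add: norm_mult)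
  show "f \<in> L2_circle \<Longrightarrow> g \<in> L2_circle \<Longrightarrow> fourier (\<lambda>x. f x + g x) k = fourier f k + fourier g k"
    by (simp add: fourier_eq distrib_right distrib_left int)
  show "fourier (\<lambda>x. c * f x) k = c * fourier f k"
    by (simp add: fourier_eq mult.assoc)
qed

subsection \<open>Uniqueness\<close>

text \<open>Finite sums of exponentials. Polynomials restricted to the circle, as Stone-Weierstrass
  supplies them, belong to this set.\<close>

inductive_set trig_polys :: "(real \<Rightarrow> complex) set" where
  mono: "(\<lambda>x. c * cis (of_int k * x)) \<in> trig_polys"
| add: "f \<in> trig_polys \<Longrightarrow> g \<in> trig_polys \<Longrightarrow> (\<lambda>x. f x + g x) \<in> trig_polys"

lemma trig_polys_mult: "f \<in> trig_polys \<Longrightarrow> g \<in> trig_polys \<Longrightarrow> (\<lambda>x. f x * g x) \<in> trig_polys"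
proof (induction f rule: trig_polys.induct)
  case (mono c k)
  then show ?case
  proof (induction g rule: trig_polys.induct)
    case (mono d l)
    have "(\<lambda>x. (c * d) * cis (of_int (k + l) * x)) \<in> trig_polys" by (rule trig_polys.mono)
    also have "(\<lambda>x. (c * d) * cis (of_int (k + l) * x)) = (\<lambda>x. c * cis (of_int k * x) * (d * cis (of_int l * x)))"
    proof
      fix x
      have "c * cis (of_int k * x) * (d * cis (of_int l * x)) = c * d * (cis (of_int k * x) * cis (of_int l * x))"
        by (simp only: mult_ac)
      then show "(c * d) * cis (of_int (k + l) * x) = c * cis (of_int k * x) * (d * cis (of_int l * x))"
        by (simp add: cis_mult distrib_right)
    qed
    finally show ?case .
  qed (auto simp: distrib_left intro: trig_polys.add)
qed (auto simp: distrib_right intro: trig_polys.add)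

lemma real_polynomial_trig:
  "real_polynomial_function q \<Longrightarrow> (\<lambda>x. complex_of_real (q (cis x))) \<in> trig_polys"
proof (induction q rule: real_polynomial_function.induct)
  case (linear q)
  interpret q: bounded_linear q by fact
  \<comment> \<open>Euler's formulas, applied to
    \<open>cos x * q 1 + sin x * q \<i>\<close>.\<close>
  define A where "A = (complex_of_real (q 1) - \<i> * q \<i>) / 2"
  define B where "B = (complex_of_real (q 1) + \<i> * q \<i>) / 2"
  have "complex_of_real (q (cis x)) = A * cis (of_int 1 * x) + B * cis (of_int (- 1) * x)" for x
  proof -
    have "cis x = cos x *\<^sub>R 1 + sin x *\<^sub>R \<i>" by (simp add: complex_eq_iff)
    then have "q (cis x) = cos x * q 1 + sin x * q \<i>" by (simp only: q.add q.scaleR real_scaleR_def)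
    then show ?thesis by (simp add: A_def B_def complex_eq_iff field_simps)
  qed
  then show ?case using trig_polys.add[OF trig_polys.mono[of A 1] trig_polys.mono[of B "- 1"]] by simp
next
  case (const c)
  then show ?case using trig_polys.mono[of "complex_of_real c" 0] by simp
qed (auto intro: trig_polys.add trig_polys_mult)

text \<open>\<open>cis\<close> maps the compact interval onto the circle and sends closed sets to
  closed sets, so continuity can be tested on preimages of closed sets. The two endpoints, which
  \<open>cis\<close> identifies, have equal values by \<open>per\<close>.\<close>

lemma continuous_on_circle_lift:
  fixes g :: "real \<Rightarrow> real"
  assumes g: "continuous_on {0..2*pi} g" and per: "g 0 = g (2 * pi)"
  shows "\<exists>G. continuous_on (sphere (0::complex) 1) G \<and> (\<forall>x\<in>{0..2*pi}. G (cis x) = g x)"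
proof -
  define G where "G z = g (SOME x. x \<in> {0..2*pi} \<and> cis x = z)" for z
  have G: "G (cis x) = g x" if x: "x \<in> {0..2*pi}" for x
  proof -
    define y where "y = (SOME y. y \<in> {0..2*pi} \<and> cis y = cis x)"
    have y: "y \<in> {0..2*pi}" "cis y = cis x"
      using someI[of "\<lambda>y. y \<in> {0..2*pi} \<and> cis y = cis x" x] x unfolding y_def by auto
    obtain n :: int where n: "y = x + 2 * pi * n"
      using y(2) sin_cos_eq_iff[of y x] by (auto simp: complex_eq_iff)
    \<comment> \<open>Two preimages of one point differ by a multiple of \<open>2 * pi\<close> of
      size at most \<open>2 * pi\<close>, so they agree or are the two endpoints.\<close>
    have "\<bar>2 * pi * n\<bar> \<le> 2 * pi" using x y(1) n by auto
    then have "\<bar>real_of_int n\<bar> \<le> 1" by (simp add: abs_mult)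
    then have "n = 0 \<or> n = 1 \<or> n = -1" by linarith
    then have "y = x \<or> (y = 2 * pi \<and> x = 0) \<or> (y = 0 \<and> x = 2 * pi)" using n x y(1) by auto
    then have "g y = g x" using per by auto
    then show ?thesis by (simp add: G_def y_def)
  qed
  have circ: "cis ` {0..2*pi} = sphere 0 1"
  proof
    show "sphere 0 1 \<subseteq> cis ` {0..2*pi}"
    proof
      fix z :: complex assume "z \<in> sphere 0 1"
      then have "norm z = 1" by simp
      then obtain t where "0 \<le> t" "t < 2 * pi" "z = Complex (cos t) (sin t)"
        using complex_unimodular_polar by metis
      then show "z \<in> cis ` {0..2*pi}" by (intro image_eqI[of _ _ t]) (auto simp: complex_eq_iff)
    qed
  qed auto
  have "continuous_on (sphere 0 1) G"
    unfolding continuous_on_closed_vimage[OF closed_sphere]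
  proof (intro allI impI)
    fix B :: "real set" assume B: "closed B"
    have "G -` B \<inter> sphere 0 1 = cis ` (g -` B \<inter> {0..2*pi})"
      unfolding circ[symmetric] using G by auto
    moreover have "closed (g -` B \<inter> {0..2*pi})"
      using g B by (simp add: continuous_on_closed_vimage)
    then have "compact (g -` B \<inter> {0..2*pi})" by (metis compact_Icc compact_Int_closed inf_commute inf.right_idem)
    then have "closed (cis ` (g -` B \<inter> {0..2*pi}))"
      by (intro compact_imp_closed compact_continuous_image continuous_intros)
    ultimately show "closed (G -` B \<inter> sphere 0 1)" by simp
  qed
  then show ?thesis using G by blast
qed

text \<open>Stone-Weierstrass on the circle approximates \<open>g\<close> uniformly by trigonometric
  polynomials, to which \<open>f\<close> is orthogonal; the error is at most \<open>e\<close> times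
  the L1 norm of \<open>f\<close>.\<close>

lemma orthogonal_continuous:
  fixes f g :: "real \<Rightarrow> real"
  assumes f: "integrable CM f" and z: "\<And>k. fourier f k = 0"
    and g: "continuous_on {0..2*pi} g" "g 0 = g (2 * pi)"
  shows "(\<integral>x. f x * g x \<partial>CM) = 0"
proof -
  have meas: "p \<in> borel_measurable CM" if "p \<in> trig_polys" for p
  proof -
    have "continuous_on UNIV p" using that by induction (auto intro!: continuous_intros)
    then show ?thesis by (intro measurable_CM borel_measurable_continuous_onI)
  qed
  have zp: "integrable CM (\<lambda>x. complex_of_real (f x) * p x) \<and> (\<integral>x. complex_of_real (f x) * p x \<partial>CM) = 0" if "p \<in> trig_polys" for p
    using that
  proof (induction p rule: trig_polys.induct)
    case (mono c k)
    have "integrable CM (\<lambda>x. complex_of_real (f x) * (c * cis (of_int k * x)))"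
    proof (rule Bochner_Integration.integrable_bound[of _ "\<lambda>x. norm c * f x"])
      show "(\<lambda>x. complex_of_real (f x) * (c * cis (of_int k * x))) \<in> borel_measurable CM"
        using f by (intro borel_measurable_times[OF _ meas[OF trig_polys.mono]]) auto
    qed (use f in \<open>auto simp: norm_mult mult.commute\<close>)
    moreover have "(\<integral>x. f x * (c * cis (of_int k * x)) \<partial>CM) = c * (\<integral>x. f x * cis (- (of_int (- k) * x)) \<partial>CM)"
      by (simp add: mult.left_commute)
    moreover have "(\<integral>x. f x * cis (- (of_int (- k) * x)) \<partial>CM) = 0" using z[of "- k"] by (simp add: fourier_eq)
    ultimately show ?case by simp
  qed (auto simp: distrib_left)
  obtain G where G: "continuous_on (sphere (0::complex) 1) G" "\<And>x. x \<in> {0..2*pi} \<Longrightarrow> G (cis x) = g x"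
    using continuous_on_circle_lift[OF g] by blast
  have gm: "g \<in> borel_measurable CM"
    using integrable_CM_continuous[OF g(1)] by simp
  have le: "\<bar>\<integral>x. f x * g x \<partial>CM\<bar> \<le> e * (\<integral>x. \<bar>f x\<bar> \<partial>CM)" if e: "e > 0" for e
  proof -
    obtain q where q: "real_polynomial_function q" "\<And>z. z \<in> sphere 0 1 \<Longrightarrow> \<bar>G z - q z\<bar> < e"
      using Stone_Weierstrass_real_polynomial_function[OF compact_sphere G(1) e] by blast
    have b: "\<bar>g x - q (cis x)\<bar> \<le> e" if "x \<in> {0..2*pi}" for x using q(2)[of "cis x"] G(2)[OF that] by simp
    have tp: "(\<lambda>x. complex_of_real (q (cis x))) \<in> trig_polys" by (rule real_polynomial_trig[OF q(1)])
    have i: "integrable CM (\<lambda>x. complex_of_real (f x * q (cis x)))" "(\<integral>x. complex_of_real (f x * q (cis x)) \<partial>CM) = 0"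
      using zp[OF tp] by simp_all
    have iq: "integrable CM (\<lambda>x. f x * q (cis x))" "(\<integral>x. f x * q (cis x) \<partial>CM) = 0"
      using integral_bounded_linear[OF bounded_linear_Re i(1)] integrable_bounded_linear[OF bounded_linear_Re i(1)] i(2) by simp_all
    have id: "integrable CM (\<lambda>x. f x * (g x - q (cis x)))"
    proof (rule Bochner_Integration.integrable_bound[of _ "\<lambda>x. e * f x"])
      have "(\<lambda>x. Re (complex_of_real (q (cis x)))) \<in> borel_measurable CM" using meas[OF tp] by measurable
      then have "(\<lambda>x. q (cis x)) \<in> borel_measurable CM" by simp
      then show "(\<lambda>x. f x * (g x - q (cis x))) \<in> borel_measurable CM" using f gm by auto
      show "AE x in CM. norm (f x * (g x - q (cis x))) \<le> norm (e * f x)"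
      proof (rule AE_I2)
        fix x assume "x \<in> space CM"
        then have "\<bar>f x\<bar> * \<bar>g x - q (cis x)\<bar> \<le> \<bar>f x\<bar> * e" by (intro mult_left_mono b) auto
        then show "norm (f x * (g x - q (cis x))) \<le> norm (e * f x)" using e by (simp add: abs_mult mult.commute)
      qed
    qed (use f in auto)
    have "(\<integral>x. f x * g x \<partial>CM) = (\<integral>x. f x * (g x - q (cis x)) + f x * q (cis x) \<partial>CM)"
      by (simp add: algebra_simps)
    also have "\<dots> = (\<integral>x. f x * (g x - q (cis x)) \<partial>CM)" using id iq by simp
    finally have "\<bar>\<integral>x. f x * g x \<partial>CM\<bar> \<le> (\<integral>x. \<bar>f x * (g x - q (cis x))\<bar> \<partial>CM)" by simp
    also have "\<dots> \<le> (\<integral>x. e * \<bar>f x\<bar> \<partial>CM)"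
    proof (rule integral_mono)
      fix x assume "x \<in> space CM"
      then have "\<bar>f x\<bar> * \<bar>g x - q (cis x)\<bar> \<le> \<bar>f x\<bar> * e" by (intro mult_left_mono b) auto
      then show "\<bar>f x * (g x - q (cis x))\<bar> \<le> e * \<bar>f x\<bar>" by (simp add: abs_mult mult.commute)
    qed (use id f in auto)
    finally show ?thesis by simp
  qed
  have "\<bar>\<integral>x. f x * g x \<partial>CM\<bar> \<le> 0"
  proof (rule field_le_epsilon)
    fix e :: real assume e: "e > 0"
    define I where "I = (\<integral>x. \<bar>f x\<bar> \<partial>CM)"
    have I: "I \<ge> 0" by (simp add: I_def)
    have "e / (I + 1) > 0" using e I by simp
    from le[OF this] have "\<bar>\<integral>x. f x * g x \<partial>CM\<bar> \<le> e / (I + 1) * I" unfolding I_def[symmetric] .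
    also have "\<dots> \<le> e / (I + 1) * (I + 1)" using e I by (intro mult_left_mono) auto
    finally show "\<bar>\<integral>x. f x * g x \<partial>CM\<bar> \<le> 0 + e" using I by simp
  qed
  then show ?thesis by simp
qed

text \<open>The trapezoids \<open>g n\<close> converge pointwise to the indicator, with
  \<open>f\<close> itself providing the dominating function. They vanish at both ends of the period,
  which makes them admissible in \<open>orthogonal_continuous\<close>.\<close>

lemma interval_integral_zero:
  fixes f :: "real \<Rightarrow> real"
  assumes f: "integrable CM f" and z: "\<And>k. fourier f k = 0" and a: "0 \<le> a"
  shows "(\<integral>x. f x * indicator {a<..<2*pi} x \<partial>CM) = 0"
proof -
  define g where "g n x = max 0 (min 1 (real n * min (x - a) (2 * pi - x)))" for n x
  have "(\<lambda>n. \<integral>x. f x * g n x \<partial>CM) \<longlonglongrightarrow> (\<integral>x. f x * indicator {a<..<2*pi} x \<partial>CM)"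
  proof (rule integral_dominated_convergence[where w="\<lambda>x. \<bar>f x\<bar>"])
    have "continuous_on UNIV (g n)" for n unfolding g_def by (intro continuous_intros)
    then have "g n \<in> borel_measurable CM" for n by (intro measurable_CM borel_measurable_continuous_onI)
    then show "(\<lambda>x. f x * g n x) \<in> borel_measurable CM" for n using f by auto
    show "(\<lambda>x. f x * indicator {a<..<2*pi} x) \<in> borel_measurable CM"
      by (rule borel_measurable_times[OF borel_measurable_integrable[OF f] measurable_CM[OF borel_measurable_indicator]]) simp
    show "integrable CM (\<lambda>x. \<bar>f x\<bar>)" using f by simp
    show "AE x in CM. norm (f x * g n x) \<le> \<bar>f x\<bar>" for n
      by (intro AE_I2) (auto simp: g_def abs_mult mult_left_le)
    show "AE x in CM. (\<lambda>n. f x * g n x) \<longlonglongrightarrow> f x * indicator {a<..<2*pi} x"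
    proof (intro AE_I2 tendsto_mult tendsto_const)
      fix x
      show "(\<lambda>n. g n x) \<longlonglongrightarrow> indicator {a<..<2*pi} x"
      proof (cases "x \<in> {a<..<2*pi}")
        case True
        define d where "d = min (x - a) (2 * pi - x)"
        have d: "d > 0" using True by (auto simp: d_def)
        obtain n0 :: nat where n0: "1 / d \<le> real n0" using real_arch_simple by blast
        have "g n x = 1" if "n \<ge> n0" for n
        proof -
          have "1 / d \<le> real n" using n0 that by (meson of_nat_mono order_trans)
          then have "1 \<le> real n * d" using d by (simp add: divide_le_eq)
          then show ?thesis by (simp add: g_def flip: d_def)
        qed
        then have "(\<lambda>n. g n x) \<longlonglongrightarrow> 1"
          by (intro tendsto_eventually) (auto simp: eventually_sequentially)
        then show ?thesis using True by simp
      next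
        case False
        then have "min (x - a) (2 * pi - x) \<le> 0" by auto
        then have "real n * min (x - a) (2 * pi - x) \<le> 0" for n by (intro mult_nonneg_nonpos) auto
        then have "g n x = 0" for n unfolding g_def by (meson max_absorb1 min.coboundedI2)
        then show ?thesis using False by simp
      qed
    qed
  qed
  moreover have "(\<integral>x. f x * g n x \<partial>CM) = 0" for n
  proof (rule orthogonal_continuous[OF f z])
    show "continuous_on {0..2*pi} (g n)" unfolding g_def by (intro continuous_intros)
    have "min (0 - a) (2 * pi - 0) \<le> 0" "min (2 * pi - a) (2 * pi - 2 * pi) \<le> 0" using a by auto
    then have "real n * min (0 - a) (2 * pi - 0) \<le> 0" "real n * min (2 * pi - a) (2 * pi - 2 * pi) \<le> 0"
      by (intro mult_nonneg_nonpos; simp)+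
    then have "g n 0 = 0" "g n (2 * pi) = 0"
      unfolding g_def by (meson max_absorb1 min.coboundedI2)+
    then show "g n 0 = g n (2 * pi)" by simp
  qed
  ultimately have "(\<lambda>n. 0) \<longlonglongrightarrow> (\<integral>x. f x * indicator {a<..<2*pi} x \<partial>CM)" by simp
  then show ?thesis by (simp only: LIMSEQ_const_iff)
qed

text \<open>By \<open>interval_integral_zero\<close> the positive and negative parts of
  \<open>f\<close> have equal finite mass on every half-line. Half-lines generate the Borel sets and
  are stable under intersection, so the two densities define the same measure and agree almost
  everywhere.\<close>

lemma fourier_zero_imp_AE:
  assumes fb: "f \<in> borel_measurable borel" and f: "integrable CM f" and z: "\<And>k. fourier f k = 0"
  shows "AE x in CM. f x = 0"
proof -
  define I where "I = {0<..<2*pi}"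
  define p where "p x = ennreal (f x) * indicator I x" for x
  define q where "q x = ennreal (- f x) * indicator I x" for x
  have [measurable]: "f \<in> borel_measurable borel" "I \<in> sets borel" using fb by (auto simp: I_def)
  have pq [measurable]: "p \<in> borel_measurable borel" "q \<in> borel_measurable borel"
    unfolding p_def q_def by measurable
  have em: "emeasure (density lborel p) {a<..} = emeasure (density lborel q) {a<..}"
     "emeasure (density lborel p) {a<..} \<noteq> \<infinity>" for a
  proof -
    define b where "b = max a 0"
    define h where "h x = f x * indicator {b<..<2*pi} x" for x
    have hm [measurable]: "h \<in> borel_measurable borel" unfolding h_def by measurable
    have hi: "integrable CM h"
      by (rule Bochner_Integration.integrable_bound[OF f]) (auto intro!: measurable_CM AE_I2 simp: h_def abs_mult mult_left_le split: split_indicator)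
    have h0: "(\<integral>x. h x \<partial>CM) = 0" unfolding h_def by (rule interval_integral_zero[OF f z]) (simp add: b_def)
    have 1: "emeasure (density lborel p) {a<..} = (\<integral>\<^sup>+x. ennreal (h x) \<partial>CM)"
      unfolding CM_def by (subst emeasure_density, simp, simp, subst nn_integral_restrict_space)
        (auto intro!: nn_integral_cong simp: p_def h_def I_def b_def split: split_indicator)
    have 2: "emeasure (density lborel q) {a<..} = (\<integral>\<^sup>+x. ennreal (- h x) \<partial>CM)"
      unfolding CM_def by (subst emeasure_density, simp, simp, subst nn_integral_restrict_space)
        (auto intro!: nn_integral_cong simp: q_def h_def I_def b_def split: split_indicator)
    have fin: "(\<integral>\<^sup>+x. ennreal (h x) \<partial>CM) \<noteq> \<infinity>" "(\<integral>\<^sup>+x. ennreal (- h x) \<partial>CM) \<noteq> \<infinity>"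
      using hi by (auto simp: real_integrable_def)
    have "enn2real (\<integral>\<^sup>+x. ennreal (h x) \<partial>CM) = enn2real (\<integral>\<^sup>+x. ennreal (- h x) \<partial>CM)"
      using h0 real_lebesgue_integral_def[OF hi] by simp
    then have "(\<integral>\<^sup>+x. ennreal (h x) \<partial>CM) = (\<integral>\<^sup>+x. ennreal (- h x) \<partial>CM)"
      using fin by (metis ennreal_enn2real infinity_ennreal_def less_top)
    then show "emeasure (density lborel p) {a<..} = emeasure (density lborel q) {a<..}"
     "emeasure (density lborel p) {a<..} \<noteq> \<infinity>" using 1 2 fin by simp_all
  qed
  have bg: "sets borel = sigma_sets UNIV (range (\<lambda>a::real. {a<..}))"
  proof -
    have "borel = sigma UNIV (range (\<lambda>a::real. {a<..}))"
      using borel_eq_greaterThan[where 'a=real] by (simp add: eucl_less_def greaterThan_def)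
    then show ?thesis by (metis sets_measure_of top_greatest Pow_UNIV)
  qed
  have "density lborel p = density lborel q"
  proof (rule measure_eqI_generator_eq[where E="range (\<lambda>a::real. {a<..})" and \<Omega>=UNIV and A="\<lambda>i. {- real i<..}"])
    show "Int_stable (range (\<lambda>a::real. {a<..}))"
    proof -
      have "{a<..} \<inter> {b<..} = {max a b<..}" for a b :: real by auto
      then show ?thesis by (auto simp: Int_stable_def)
    qed
    show "(\<Union>i. {- real i<..}) = UNIV"
      by (auto simp: set_eq_iff) (metis minus_less_iff reals_Archimedean2)
  qed (use em bg in auto)
  then have "AE x in lborel. p x = q x"
    using sigma_finite_measure.density_unique_iff[OF lborel.sigma_finite_measure_axioms, of p q] pq by simp
  moreover have "AE x in lborel. x \<noteq> 0 \<and> x \<noteq> 2 * pi"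
    using AE_lborel_singleton[of 0] AE_lborel_singleton[of "2*pi"] by eventually_elim auto
  ultimately have "AE x in lborel. x \<in> {0..2*pi} \<longrightarrow> f x = 0"
  proof eventually_elim
    case (elim x)
    show ?case
    proof
      assume "x \<in> {0..2*pi}"
      then have "x \<in> I" using elim(2) by (auto simp: I_def)
      then have "ennreal (f x) = ennreal (- f x)" using elim(1) by (simp add: p_def q_def)
      then show "f x = 0" by (cases "f x \<ge> 0") (auto simp: ennreal_neg ennreal_eq_0_iff dest: sym)
    qed
  qed
  then show ?thesis by (simp add: AE_CM_iff)
qed

text \<open>The line is covered by countably many translates of one period, and Lebesgue measure is
  translation invariant.\<close>

lemma AE_periodic:
  assumes [measurable]: "Measurable.pred borel P" and per: "\<And>x. P (x + 2 * pi) \<longleftrightarrow> P x" and ae: "AE x in CM. P x"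
  shows "AE x in lborel. P x"
proof -
  have "AE x in lborel. x + 2 * pi * of_int n \<in> {0..2*pi} \<longrightarrow> P (x + 2 * pi * of_int n)" for n :: int
  proof -
    have "AE x in distr lborel borel ((+) (2 * pi * of_int n)). x \<in> {0..2*pi} \<longrightarrow> P x"
      unfolding lborel_distr_plus using ae by (simp add: AE_CM_iff)
    then have "AE x in lborel. 2 * pi * of_int n + x \<in> {0..2*pi} \<longrightarrow> P (2 * pi * of_int n + x)"
      by (subst (asm) AE_distr_iff) (simp_all add: pred_def)
    then show ?thesis by (simp add: add.commute)
  qed
  then have "AE x in lborel. \<forall>n::int. x + 2 * pi * of_int n \<in> {0..2*pi} \<longrightarrow> P (x + 2 * pi * of_int n)"
    by (simp only: AE_all_countable) blast
  then show ?thesis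
  proof eventually_elim
    case (elim x)
    define n where "n = - \<lfloor>x / (2 * pi)\<rfloor>"
    have pi2: "0 < 2 * pi" by simp
    have "real_of_int \<lfloor>x / (2 * pi)\<rfloor> \<le> x / (2 * pi)" "x / (2 * pi) \<le> real_of_int \<lfloor>x / (2 * pi)\<rfloor> + 1" by linarith+
    then have "real_of_int \<lfloor>x / (2 * pi)\<rfloor> * (2 * pi) \<le> x" "x \<le> (real_of_int \<lfloor>x / (2 * pi)\<rfloor> + 1) * (2 * pi)"
      by (simp_all only: pos_le_divide_eq[OF pi2] pos_divide_le_eq[OF pi2])
    then have "x + 2 * pi * of_int n \<in> {0..2*pi}" by (simp add: n_def algebra_simps)
    then show ?case using elim periodic_int[of P x n] per by auto
  qed
qed

lemma fourier_unique:
  assumes f: "f \<in> L2_circle" and g: "g \<in> L2_circle" and eq: "\<And>k. fourier f k = fourier g k"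
  shows "AE x in lborel. f x = g x"
proof -
  have d: "(\<lambda>x. f x - g x) \<in> L2_circle" by (rule L2_diff[OF f g])
  have "fourier (\<lambda>x. f x - g x) k = 0" for k
    using fourier_add[OF f L2_scale[OF g, of "- 1"], of k] fourier_scale[of "- 1" g k] eq by simp
  from fourier_zero_imp_AE[OF L2_circleD(1)[OF d] L2_integrable[OF d] this]
  have "AE x in CM. f x = g x" by simp
  moreover have "Measurable.pred borel (\<lambda>x. f x = g x)"
    using L2_circleD(1)[OF f] L2_circleD(1)[OF g] by measurable
  ultimately show ?thesis by (intro AE_periodic) (simp_all add: L2_circleD(2)[OF f] L2_circleD(2)[OF g])
qed

lemma coef_unique:
  assumes f: "f \<in> H_circle" and g: "g \<in> H_circle" and eq: "\<And>k. k \<noteq> 0 \<Longrightarrow> coef f k = coef g k"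
  shows "AE x in lborel. f x = g x"
proof (rule fourier_unique)
  show "fourier f k = fourier g k" for k
    using eq by (cases "k = 0") (auto simp: fourier_cf_H f g intro!: cf_cong)
qed (use f g H_circleD in auto)

subsection \<open>Fourier series with given coefficients\<close>

definition tser :: "(int \<Rightarrow> complex) \<Rightarrow> real \<Rightarrow> complex" where
  "tser c x = (\<Sum>\<^sub>\<infinity>j. c j * cis (of_int j * x))"

lemma
  assumes c: "(\<lambda>j. norm (c j)) summable_on UNIV"
  shows tser_uniform: "uniform_limit UNIV (\<lambda>F x. \<Sum>j\<in>F. c j * cis (of_int j * x)) (tser c) (finite_subsets_at_top UNIV)"
    and tser_continuous: "continuous_on UNIV (tser c)"
    and norm_tser_le: "norm (tser c x) \<le> (\<Sum>\<^sub>\<infinity>j. norm (c j))"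
proof -
  show u: "uniform_limit UNIV (\<lambda>F x. \<Sum>j\<in>F. c j * cis (of_int j * x)) (tser c) (finite_subsets_at_top UNIV)"
    unfolding tser_def[abs_def] by (rule Weierstrass_m_test_general[OF _ c]) (simp add: norm_mult)
  show "continuous_on UNIV (tser c)"
    by (rule uniform_limit_theorem[OF _ u]) (auto intro!: always_eventually continuous_intros)
  show "norm (tser c x) \<le> (\<Sum>\<^sub>\<infinity>j. norm (c j))"
    unfolding tser_def using norm_infsum_bound[of "\<lambda>j. c j * cis (of_int j * x)" UNIV] c by (simp add: norm_mult)
qed

lemma tser_periodic: "tser c (x + 2 * pi) = tser c x"
  by (simp add: tser_def cis_periodic)

text \<open>Uniform convergence of the partial sums allows integration term by term against any
  integrable \<open>h\<close>.\<close>

lemma tser_integral: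
  assumes c: "(\<lambda>j. norm (c j)) summable_on UNIV" and h: "integrable CM h"
  shows "integrable CM (\<lambda>x. tser c x * h x)"
    and "((\<lambda>j. c j * (\<integral>x. cis (of_int j * x) * h x \<partial>CM)) has_sum (\<integral>x. tser c x * h x \<partial>CM)) UNIV"
proof -
  have bm: "g \<in> borel_measurable CM" if "continuous_on UNIV g" for g :: "real \<Rightarrow> complex"
    by (intro measurable_CM borel_measurable_continuous_onI that)
  have hm: "h \<in> borel_measurable CM" using h by simp
  have bound: "integrable CM (\<lambda>x. g x * h x)" if g: "continuous_on UNIV g" "\<And>x. norm (g x) \<le> C" for g C
  proof (rule Bochner_Integration.integrable_bound[of _ "\<lambda>x. C * norm (h x)"])
    show "integrable CM (\<lambda>x. C * norm (h x))" using h by simp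
    show "(\<lambda>x. g x * h x) \<in> borel_measurable CM" by (intro borel_measurable_times bm g hm)
    have "C \<ge> 0" using g(2) norm_ge_zero order_trans by blast
    then show "AE x in CM. norm (g x * h x) \<le> norm (C * norm (h x))"
      using g(2) by (intro AE_I2) (simp add: norm_mult mult_right_mono)
  qed
  show i1: "integrable CM (\<lambda>x. tser c x * h x)"
    by (rule bound[OF tser_continuous[OF c] norm_tser_le[OF c]])
  have ij: "integrable CM (\<lambda>x. cis (of_int j * x) * h x)" for j
    by (rule bound[of _ 1]) (auto intro!: continuous_intros)
  define I where "I = (\<integral>x. norm (h x) \<partial>CM)"
  have I: "I \<ge> 0" by (simp add: I_def)
  show "((\<lambda>j. c j * (\<integral>x. cis (of_int j * x) * h x \<partial>CM)) has_sum (\<integral>x. tser c x * h x \<partial>CM)) UNIV"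
    unfolding has_sum_def
  proof (rule tendstoI)
    fix e :: real assume e: "e > 0"
    define d where "d = e / (I + 1)"
    have d: "d > 0" "d * I < e" using e I by (auto simp: d_def field_simps)
    have "\<forall>\<^sub>F F in finite_subsets_at_top UNIV. \<forall>x\<in>UNIV. dist (\<Sum>j\<in>F. c j * cis (of_int j * x)) (tser c x) < d"
      using tser_uniform[OF c] d(1) by (simp add: uniform_limit_iff)
    then show "\<forall>\<^sub>F F in finite_subsets_at_top UNIV. dist (\<Sum>j\<in>F. c j * (\<integral>x. cis (of_int j * x) * h x \<partial>CM)) (\<integral>x. tser c x * h x \<partial>CM) < e"
    proof eventually_elim
      case (elim F)
      have s: "(\<Sum>j\<in>F. c j * (\<integral>x. cis (of_int j * x) * h x \<partial>CM)) = (\<integral>x. (\<Sum>j\<in>F. c j * (cis (of_int j * x) * h x)) \<partial>CM)"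
        using ij by (subst Bochner_Integration.integral_sum) auto
      have iS: "integrable CM (\<lambda>x. \<Sum>j\<in>F. c j * (cis (of_int j * x) * h x))" using ij by auto
      have "(\<Sum>j\<in>F. c j * (\<integral>x. cis (of_int j * x) * h x \<partial>CM)) - (\<integral>x. tser c x * h x \<partial>CM)
         = (\<integral>x. ((\<Sum>j\<in>F. c j * cis (of_int j * x)) - tser c x) * h x \<partial>CM)"
        unfolding s Bochner_Integration.integral_diff[OF iS i1, symmetric]
        by (simp add: left_diff_distrib sum_distrib_right mult.assoc)
      also have "norm \<dots> \<le> (\<integral>x. norm (((\<Sum>j\<in>F. c j * cis (of_int j * x)) - tser c x) * h x) \<partial>CM)"
        by (rule integral_norm_bound)
      also have "\<dots> \<le> (\<integral>x. d * norm (h x) \<partial>CM)"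
      proof (rule integral_mono)
        have "integrable CM (\<lambda>x. ((\<Sum>j\<in>F. c j * cis (of_int j * x)) - tser c x) * h x)"
          using Bochner_Integration.integrable_diff[OF iS i1] by (simp add: left_diff_distrib sum_distrib_right mult.assoc)
        then show "integrable CM (\<lambda>x. norm (((\<Sum>j\<in>F. c j * cis (of_int j * x)) - tser c x) * h x))" by simp
        show "norm (((\<Sum>j\<in>F. c j * cis (of_int j * x)) - tser c x) * h x) \<le> d * norm (h x)" for x
          using elim by (simp add: norm_mult dist_norm mult_right_mono less_imp_le)
      qed (use h in simp)
      also have "\<dots> = d * I" by (simp add: I_def)
      finally show ?case using d(2) by (simp add: dist_norm)
    qed
  qed
qed

lemma cis_mult_int: "cis (of_int j * x) * cis (- (of_int k * x)) = cis (of_int (j - k) * x)"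
  by (simp add: cis_mult left_diff_distrib)

lemma tser_real:
  assumes "\<And>k. c (- k) = cnj (c k)" shows "tser c x = of_real (Re (tser c x))"
proof -
  have "cnj (tser c x) = (\<Sum>\<^sub>\<infinity>j. cnj (c j * cis (of_int j * x)))"
    by (simp only: tser_def infsum_cnj)
  also have "\<dots> = (\<Sum>\<^sub>\<infinity>j. c (- j) * cis (of_int (- j) * x))"
    by (simp add: assms cis_cnj)
  also have "\<dots> = tser c x"
    unfolding tser_def by (rule infsum_reindex_bij_betw) (auto intro!: bij_betwI[of _ _ _ uminus])
  finally show ?thesis by (metis Reals_cnj_iff of_real_Re)
qed

lemma
  assumes c: "(\<lambda>j. norm (c j)) summable_on UNIV" "\<And>k. c (- k) = cnj (c k)"
  shows L2_Re_tser: "(\<lambda>x. Re (tser c x)) \<in> L2_circle"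
    and fourier_Re_tser: "fourier (\<lambda>x. Re (tser c x)) k = c k"
proof -
  show "(\<lambda>x. Re (tser c x)) \<in> L2_circle"
    by (intro L2_continuous continuous_intros tser_continuous c(1)) (simp add: tser_periodic)
  let ?h = "\<lambda>x. cis (- (of_int k * x))"
  have "integrable CM ?h" by (intro integrable_CM_continuous continuous_intros)
  from tser_integral(2)[OF c(1) this]
  have "(\<integral>x. tser c x * ?h x \<partial>CM) = (\<Sum>\<^sub>\<infinity>j. c j * (if j - k = 0 then 2 * pi else 0))"
    by (simp only: cis_mult_int integral_cis infsumI)
  also have "\<dots> = (\<Sum>\<^sub>\<infinity>j\<in>{k}. c k * (2 * pi))"
    by (rule infsum_cong_neutral) auto
  finally have "(\<integral>x. of_real (Re (tser c x)) * ?h x \<partial>CM) = c k * (2 * pi)"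
    by (simp add: tser_real[of c, symmetric] c(2))
  then show "fourier (\<lambda>x. Re (tser c x)) k = c k" by (simp add: fourier_eq)
qed

lemma L2_tser_AE:
  assumes f: "f \<in> L2_circle" and c: "(\<lambda>j. norm (fourier f j)) summable_on UNIV"
  shows "AE x in lborel. f x = Re (tser (fourier f) x)"
  by (rule fourier_unique[OF f L2_Re_tser[OF c]]) (simp_all add: fourier_uminus f fourier_Re_tser c)

text \<open>A factor with absolutely convergent Fourier series is bounded almost everywhere, so the
  product stays in L2; integrating that series term by term against the other factor gives the
  convolution. The form \<open>has_sum\<close> allows two such series to be added.\<close>

lemma
  assumes f: "f \<in> L2_circle" and c: "(\<lambda>j. norm (fourier f j)) summable_on UNIV" and g: "g \<in> L2_circle"
  shows L2_product: "(\<lambda>x. f x * g x) \<in> L2_circle"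
    and fourier_product: "((\<lambda>j. fourier f j * fourier g (k - j)) has_sum fourier (\<lambda>x. f x * g x) k) UNIV"
proof -
  have ae: "AE x in lborel. f x = Re (tser (fourier f) x)" by (rule L2_tser_AE[OF f c])
  show L2: "(\<lambda>x. f x * g x) \<in> L2_circle"
  proof (rule L2_mult_bounded[OF L2_circleD(1,2)[OF f] _ g])
    show "AE x in CM. \<bar>f x\<bar> \<le> (\<Sum>\<^sub>\<infinity>j. norm (fourier f j))"
      unfolding AE_CM_iff using ae
      by eventually_elim (use order_trans[OF abs_Re_le_cmod norm_tser_le[OF c]] in simp)
  qed
  let ?h = "\<lambda>x. g x * cis (- (of_int k * x))"
  have cm: "(\<lambda>x. cis (- (of_int k * x))) \<in> borel_measurable borel"
    by (intro borel_measurable_continuous_onI continuous_intros)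
  have h: "integrable CM ?h"
    by (rule Bochner_Integration.integrable_bound[OF L2_integrable[OF g]])
      (use L2_circleD(1)[OF g] cm in \<open>auto intro!: measurable_CM simp: norm_mult\<close>)
  have "(\<integral>x. complex_of_real (f x * g x) * cis (- (of_int k * x)) \<partial>CM) = (\<integral>x. tser (fourier f) x * ?h x \<partial>CM)"
  proof (rule integral_cong_AE)
    show "(\<lambda>x. complex_of_real (f x * g x) * cis (- (of_int k * x))) \<in> borel_measurable CM"
      using L2_circleD(1)[OF L2] cm by (intro measurable_CM) (simp del: of_real_mult)
    show "(\<lambda>x. tser (fourier f) x * ?h x) \<in> borel_measurable CM"
      using tser_integral(1)[OF c h] by simp
    show "AE x in CM. complex_of_real (f x * g x) * cis (- (of_int k * x)) = tser (fourier f) x * ?h x"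
      unfolding AE_CM_iff using ae
    proof eventually_elim
      case (elim x)
      have "tser (fourier f) x = complex_of_real (f x)"
        using tser_real[of "fourier f" x] elim by (simp add: fourier_uminus f)
      then show ?case by (simp add: mult.assoc)
    qed
  qed
  then have eq: "fourier (\<lambda>x. f x * g x) k = 1 / (2 * pi) * (\<integral>x. tser (fourier f) x * ?h x \<partial>CM)"
    by (simp add: fourier_eq)
  have summand: "1 / (2 * pi) * (fourier f j * (\<integral>x. cis (of_int j * x) * ?h x \<partial>CM)) = fourier f j * fourier g (k - j)" for j
  proof -
    have "cis (of_int j * x) * ?h x = g x * cis (- (of_int (k - j) * x))" for x
    proof -
      have "cis (of_int j * x) * ?h x = g x * (cis (of_int j * x) * cis (- (of_int k * x)))"
        by (simp only: mult.left_commute)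
      also have "\<dots> = g x * cis (of_int (j - k) * x)" by (simp only: cis_mult_int)
      also have "of_int (j - k) * x = - (of_int (k - j) * x)" by (simp add: algebra_simps)
      finally show ?thesis .
    qed
    then have "(\<integral>x. cis (of_int j * x) * ?h x \<partial>CM) = (\<integral>x. g x * cis (- (of_int (k - j) * x)) \<partial>CM)" by (simp only:)
    then show ?thesis by (simp add: fourier_eq)
  qed
  show "((\<lambda>j. fourier f j * fourier g (k - j)) has_sum fourier (\<lambda>x. f x * g x) k) UNIV"
    using has_sum_cmult_right[OF tser_integral(2)[OF c h], of "1 / (2 * pi)"] unfolding eq[symmetric] summand .
qed

section \<open>Trigonometric polynomials and the Riesz-Fischer theorem\<close>

lemma coef_0 [simp]: "coef f 0 = 0"
  by (simp add: coef_eq ebasis_def)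

lemma integral_sq_trig_poly:
  assumes "finite A" "0 \<notin> A"
  shows "(\<integral>x. (\<Sum>k\<in>A. c k * ebasis k x)\<^sup>2 \<partial>CM) = (\<Sum>k\<in>A. (c k)\<^sup>2)"
proof -
  have i: "integrable CM (\<lambda>x. ebasis k x * ebasis l x)" for k l by (intro L2_mult_integrable L2_ebasis)
  have "(\<lambda>x. (\<Sum>k\<in>A. c k * ebasis k x)\<^sup>2) = (\<lambda>x. \<Sum>k\<in>A. \<Sum>l\<in>A. c k * c l * (ebasis k x * ebasis l x))"
    by (simp add: power2_eq_square sum_product mult_ac)
  then have "(\<integral>x. (\<Sum>k\<in>A. c k * ebasis k x)\<^sup>2 \<partial>CM) = (\<Sum>k\<in>A. \<Sum>l\<in>A. c k * c l * (\<integral>x. ebasis k x * ebasis l x \<partial>CM))"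
    using i by simp
  also have "\<dots> = (\<Sum>k\<in>A. \<Sum>l\<in>A. if l = k then (c k)\<^sup>2 else 0)"
    using assms by (intro sum.cong refl) (subst ebasis_orthonormal, auto simp: power2_eq_square)
  finally show ?thesis using assms by simp
qed

lemma coef_trig_poly:
  assumes "finite A" "0 \<notin> A"
  shows "coef (\<lambda>x. \<Sum>k\<in>A. c k * ebasis k x) l = (if l \<in> A then c l else 0)"
proof (cases "l = 0")
  case False
  have "coef (\<lambda>x. \<Sum>k\<in>A. c k * ebasis k x) l = (\<Sum>k\<in>A. c k * coef (ebasis k) l)"
    by (subst coef_sum) (auto intro: L2_scale L2_ebasis simp: coef_scale)
  also have "\<dots> = (\<Sum>k\<in>A. if k = l then c l else 0)"
  proof (rule sum.cong[OF refl])
    fix k assume "k \<in> A"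
    then have "k \<noteq> 0" using assms by metis
    then show "c k * coef (ebasis k) l = (if k = l then c l else 0)" using False by (simp add: coef_ebasis)
  qed
  finally show ?thesis using assms by simp
qed (use assms in auto)

lemma L2_trig_poly: "(\<lambda>x. \<Sum>k\<in>A. c k * ebasis k x) \<in> L2_circle"
  by (intro L2_sum L2_scale L2_ebasis)

lemma integral_ebasis: "(\<integral>x. ebasis k x \<partial>CM) = 0"
  using integral_cos[of k] integral_sin[of "- k"] by (cases "k > 0") (simp_all add: ebasis_def integral_divide_zero)

lemma H_trig_poly: "(\<lambda>x. \<Sum>k\<in>A. c k * ebasis k x) \<in> H_circle"
proof -
  have "(\<integral>x. (\<Sum>k\<in>A. c k * ebasis k x) \<partial>CM) = 0"
    by (simp add: Bochner_Integration.integral_sum integral_ebasis L2_integrable L2_ebasis)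
  then show ?thesis by (intro H_circleI L2_trig_poly) (simp add: fourier_0)
qed

text \<open>\<open>|g|\<close> is at most \<open>e\<close> where it does not exceed
  \<open>e\<close>, and at most \<open>g\<^sup>2 / e\<close> elsewhere.\<close>

lemma abs_integral_le_sq:
  assumes g: "integrable CM (\<lambda>x. (g x)\<^sup>2)" "g \<in> borel_measurable CM" and e: "e > 0"
    and "(\<integral>x. (g x)\<^sup>2 \<partial>CM) \<le> e\<^sup>2"
  shows "integrable CM (\<lambda>x. \<bar>g x\<bar>)" "(\<integral>x. \<bar>g x\<bar> \<partial>CM) \<le> (2 * pi + 1) * e"
proof -
  have le: "\<bar>g x\<bar> \<le> e + (g x)\<^sup>2 / e" for x
  proof (cases "\<bar>g x\<bar> \<le> e")
    case False
    then have "\<bar>g x\<bar> * e \<le> \<bar>g x\<bar> * \<bar>g x\<bar>" by (intro mult_left_mono) auto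
    then have "\<bar>g x\<bar> \<le> (g x)\<^sup>2 / e" using e by (simp add: field_simps power2_eq_square)
    then show ?thesis using e by simp
  qed (use e in \<open>simp add: add_increasing2\<close>)
  have i: "integrable CM (\<lambda>x. e + (g x)\<^sup>2 / e)" using g by simp
  show "integrable CM (\<lambda>x. \<bar>g x\<bar>)"
    by (rule Bochner_Integration.integrable_bound[OF i]) (use g le e in \<open>auto simp: abs_of_nonneg\<close>)
  then have "(\<integral>x. \<bar>g x\<bar> \<partial>CM) \<le> (\<integral>x. e + (g x)\<^sup>2 / e \<partial>CM)" by (rule integral_mono[OF _ i le])
  also have "\<dots> = 2 * pi * e + (\<integral>x. (g x)\<^sup>2 \<partial>CM) / e"
    using g by (simp add: measure_CM[simplified])
  also have "\<dots> \<le> 2 * pi * e + e\<^sup>2 / e" using assms(4) e by (intro add_left_mono divide_right_mono) auto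
  also have "\<dots> = (2 * pi + 1) * e" using e by (simp add: power2_eq_square algebra_simps)
  finally show "(\<integral>x. \<bar>g x\<bar> \<partial>CM) \<le> (2 * pi + 1) * e" .
qed

text \<open>The partial sums are Cauchy in L2, hence in L1, so a subsequence converges almost
  everywhere, and Fatou's lemma identifies its limit as the limit in L2.\<close>

lemma Riesz_Fischer: "\<exists>f\<in>H_circle. \<forall>k. coef f k = hnth y k"
proof -
  define s where "s N x = (\<Sum>k\<in>modes N. hnth y k * ebasis k x)" for N x
  have sL: "s N \<in> L2_circle" for N unfolding s_def by (rule L2_trig_poly)
  have sdiff: "(\<integral>x. (s i x - s j x)\<^sup>2 \<partial>CM) = (norm (hproj i y - hproj j y))\<^sup>2" for i j
  proof -
    have ext: "s n x = (\<Sum>k\<in>modes (max i j). hnth (hproj n y) k * ebasis k x)" if "n \<in> {i, j}" for n x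
      unfolding s_def
      by (rule sum.mono_neutral_cong_left) (use that modes_mono[of n "max i j"] in auto)
    have "s i x - s j x = (\<Sum>k\<in>modes (max i j). hnth (hproj i y - hproj j y) k * ebasis k x)" for x
      using ext[of i x] ext[of j x] by (simp add: left_diff_distrib sum_subtractf)
    then have "(\<integral>x. (s i x - s j x)\<^sup>2 \<partial>CM) = (\<Sum>k\<in>modes (max i j). (hnth (hproj i y - hproj j y) k)\<^sup>2)"
      by (simp only: integral_sq_trig_poly[OF finite_modes zero_notin_modes])
    also have "\<dots> = (norm (hproj (max i j) (hproj i y - hproj j y)))\<^sup>2" by (simp add: norm_hproj_sq)
    also have "hproj (max i j) (hproj i y - hproj j y) = hproj i y - hproj j y"
      by (rule hs_eqI) (use modes_mono[of i "max i j"] modes_mono[of j "max i j"] in auto)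
    finally show ?thesis .
  qed
  have d2: "integrable CM (\<lambda>x. (s i x - s j x)\<^sup>2)" for i j by (rule L2_circleD(3)[OF L2_diff[OF sL sL]])
  have dm: "(\<lambda>x. s i x - s j x) \<in> borel_measurable CM" for i j
    by (rule measurable_CM[OF L2_circleD(1)[OF L2_diff[OF sL sL]]])
  have cauchy: "\<exists>N. \<forall>i\<ge>N. \<forall>j\<ge>N. (\<integral>x. (s i x - s j x)\<^sup>2 \<partial>CM) \<le> e\<^sup>2" if e: "e > 0" for e
  proof -
    have "Cauchy (\<lambda>n. hproj n y)" using hproj_tendsto LIMSEQ_imp_Cauchy by blast
    then obtain N where "\<And>i j. i \<ge> N \<Longrightarrow> j \<ge> N \<Longrightarrow> norm (hproj i y - hproj j y) < e"
      using e unfolding Cauchy_iff by blast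
    then show ?thesis unfolding sdiff using e by (intro exI[of _ N]) (auto intro!: power_mono less_imp_le)
  qed
  obtain r where r: "strict_mono r" "AE x in CM. Cauchy (\<lambda>i. s (r i) x)"
  proof (rule cauchy_L1_AE_cauchy_subseq[of CM s])
    show "integrable CM (s n)" for n by (rule L2_integrable[OF sL])
    fix e :: real assume e: "e > 0"
    define d where "d = e / (2 * (2 * pi + 1))"
    have d: "d > 0" "(2 * pi + 1) * d < e" using e pi_gt_zero by (auto simp: d_def field_simps add_pos_pos)
    obtain N where N: "\<And>i j. i \<ge> N \<Longrightarrow> j \<ge> N \<Longrightarrow> (\<integral>x. (s i x - s j x)\<^sup>2 \<partial>CM) \<le> d\<^sup>2" using cauchy[OF d(1)] by blast
    show "\<exists>N. \<forall>i\<ge>N. \<forall>j\<ge>N. (\<integral>x. norm (s i x - s j x) \<partial>CM) < e"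
    proof (intro exI allI impI)
      fix i j assume "i \<ge> N" "j \<ge> N"
      from abs_integral_le_sq(2)[OF d2 dm d(1) N[OF this]] d(2)
      show "(\<integral>x. norm (s i x - s j x) \<partial>CM) < e" by simp
    qed
  qed
  \<comment> \<open>\<open>lim\<close> has a value at every point, so \<open>f\<close> is Borel and
    exactly periodic without modification on a null set.\<close>
  define f where "f x = lim (\<lambda>i. s (r i) x)" for x
  have fm: "f \<in> borel_measurable borel"
    unfolding f_def by (intro borel_measurable_lim_metric L2_circleD(1)[OF sL])
  have fp: "f (x + 2 * pi) = f x" for x unfolding f_def using L2_circleD(2)[OF sL] by simp
  have lim: "AE x in CM. (\<lambda>i. s (r i) x) \<longlonglongrightarrow> f x"
    using r(2) by eventually_elim (simp add: f_def Cauchy_convergent_iff convergent_LIMSEQ_iff)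
  have approx: "integrable CM (\<lambda>x. (f x - s n x)\<^sup>2) \<and> (\<integral>x. (f x - s n x)\<^sup>2 \<partial>CM) \<le> e\<^sup>2"
    if e: "e > 0" "\<forall>i\<ge>N. \<forall>j\<ge>N. (\<integral>x. (s i x - s j x)\<^sup>2 \<partial>CM) \<le> e\<^sup>2" and n: "n \<ge> N" for e N n
  proof -
    have m: "(\<lambda>x. (f x - s n x)\<^sup>2) \<in> borel_measurable CM"
      using fm L2_circleD(1)[OF sL[of n]] by (intro measurable_CM) simp
    have "(\<integral>\<^sup>+x. ennreal ((f x - s n x)\<^sup>2) \<partial>CM) = (\<integral>\<^sup>+x. liminf (\<lambda>i. ennreal ((s (r i) x - s n x)\<^sup>2)) \<partial>CM)"
    proof (rule nn_integral_cong_AE)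
      show "AE x in CM. ennreal ((f x - s n x)\<^sup>2) = liminf (\<lambda>i. ennreal ((s (r i) x - s n x)\<^sup>2))"
        using lim
      proof eventually_elim
        case (elim x)
        then have "(\<lambda>i. ennreal ((s (r i) x - s n x)\<^sup>2)) \<longlonglongrightarrow> ennreal ((f x - s n x)\<^sup>2)"
          by (intro tendsto_intros)
        then show ?case by (intro lim_imp_Liminf[symmetric]) auto
      qed
    qed
    also have "\<dots> \<le> liminf (\<lambda>i. \<integral>\<^sup>+x. ennreal ((s (r i) x - s n x)\<^sup>2) \<partial>CM)"
      using dm by (intro nn_integral_liminf) auto
    also have "\<dots> \<le> ennreal (e\<^sup>2)"
    proof (rule Liminf_le)
      show "\<forall>\<^sub>F i in sequentially. (\<integral>\<^sup>+x. ennreal ((s (r i) x - s n x)\<^sup>2) \<partial>CM) \<le> ennreal (e\<^sup>2)"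
        unfolding eventually_sequentially
      proof (intro exI allI impI)
        fix i assume "i \<ge> N"
        then have "r i \<ge> N" using seq_suble[OF r(1), of i] by simp
        then show "(\<integral>\<^sup>+x. ennreal ((s (r i) x - s n x)\<^sup>2) \<partial>CM) \<le> ennreal (e\<^sup>2)"
          using e(2) n by (subst nn_integral_eq_integral[OF d2]) (auto intro!: ennreal_leI)
      qed
    qed simp
    finally have le: "(\<integral>\<^sup>+x. ennreal ((f x - s n x)\<^sup>2) \<partial>CM) \<le> ennreal (e\<^sup>2)" .
    have i: "integrable CM (\<lambda>x. (f x - s n x)\<^sup>2)"
      by (rule integrableI_nonneg[OF m]) (use le in \<open>auto simp: le_less_trans\<close>)
    then show ?thesis using le nn_integral_eq_integral[OF i] by simp
  qed
  obtain N1 where N1: "\<forall>i\<ge>N1. \<forall>j\<ge>N1. (\<integral>x. (s i x - s j x)\<^sup>2 \<partial>CM) \<le> 1\<^sup>2" using cauchy[of 1] by auto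
  have "(\<lambda>x. f x - s N1 x) \<in> L2_circle"
    using approx[OF _ N1 order_refl] fm fp L2_circleD(1,2)[OF sL[of N1]] by (intro L2_circleI) auto
  from L2_add[OF this sL[of N1]] have fL: "f \<in> L2_circle" by simp
  \<comment> \<open>Pairings with bounded test functions pass to the limit. This is used for every
    \<open>ebasis k\<close>, and for the constant 1 to obtain mean zero.\<close>
  have test: "(\<integral>x. f x * \<phi> x \<partial>CM) = l"
    if ph: "\<phi> \<in> L2_circle" "\<And>x. \<bar>\<phi> x\<bar> \<le> 1" and l: "\<And>n. n \<ge> M \<Longrightarrow> (\<integral>x. s n x * \<phi> x \<partial>CM) = l" for \<phi> l M
  proof -
    have "\<bar>(\<integral>x. f x * \<phi> x \<partial>CM) - l\<bar> \<le> 0 + e" if e: "e > 0" for e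
    proof -
      define q where "q = 2 * pi + 1"
      define d where "d = e / q"
      have "q > 0" using pi_gt_zero unfolding q_def by linarith
      then have d: "d > 0" "(2 * pi + 1) * d = e" using e by (auto simp: d_def simp flip: q_def)
      obtain N where N: "\<forall>i\<ge>N. \<forall>j\<ge>N. (\<integral>x. (s i x - s j x)\<^sup>2 \<partial>CM) \<le> d\<^sup>2" using cauchy[OF d(1)] by blast
      define n where "n = max N M"
      have fs: "(\<lambda>x. f x - s n x) \<in> L2_circle" by (rule L2_diff[OF fL sL])
      have "(\<integral>x. f x * \<phi> x \<partial>CM) - l = (\<integral>x. f x * \<phi> x \<partial>CM) - (\<integral>x. s n x * \<phi> x \<partial>CM)"
        using l[of n] by (simp add: n_def)
      also have "\<dots> = (\<integral>x. (f x - s n x) * \<phi> x \<partial>CM)"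
        by (simp add: left_diff_distrib L2_mult_integrable fL sL ph)
      finally have "\<bar>(\<integral>x. f x * \<phi> x \<partial>CM) - l\<bar> \<le> (\<integral>x. \<bar>(f x - s n x) * \<phi> x\<bar> \<partial>CM)" by simp
      also have "\<dots> \<le> (\<integral>x. \<bar>f x - s n x\<bar> \<partial>CM)"
      proof (rule integral_mono)
        show "integrable CM (\<lambda>x. \<bar>(f x - s n x) * \<phi> x\<bar>)"
          by (rule integrable_abs[OF L2_mult_integrable[OF fs ph(1)]])
        show "\<bar>(f x - s n x) * \<phi> x\<bar> \<le> \<bar>f x - s n x\<bar>" for x
          using ph(2)[of x] by (simp add: abs_mult mult_left_le)
      qed (use L2_integrable[OF fs] in simp)
      also have "\<dots> \<le> (2 * pi + 1) * d"
        using approx[OF d(1) N, of n] measurable_CM[OF L2_circleD(1)[OF fs]]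
        by (intro abs_integral_le_sq(2)) (auto simp: n_def d(1))
      finally show ?thesis using d(2) by simp
    qed
    then have "\<bar>(\<integral>x. f x * \<phi> x \<partial>CM) - l\<bar> \<le> 0" by (rule field_le_epsilon)
    then show ?thesis by simp
  qed
  have "coef f k = hnth y k" for k
  proof (cases "k = 0")
    case False
    have "(\<integral>x. s n x * ebasis k x \<partial>CM) = hnth y k" if "n \<ge> nat \<bar>k\<bar>" for n
      using coef_trig_poly[OF finite_modes zero_notin_modes, of "hnth y" n k] that False
      by (simp add: coef_eq s_def[abs_def] modes_def)
    then show ?thesis unfolding coef_eq by (rule test[OF L2_ebasis abs_ebasis_le])
  qed simp
  moreover have "(\<integral>x. f x * 1 \<partial>CM) = 0"
  proof (rule test[where M=0])
    show "(\<integral>x. s n x * 1 \<partial>CM) = 0" for n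
      using H_circleD(2)[OF H_trig_poly[where A="modes n" and c="hnth y"]] by (simp add: fourier_0 s_def[abs_def])
  qed (auto intro: L2_continuous)
  then have "f \<in> H_circle" by (intro H_circleI fL) (simp add: fourier_0)
  ultimately show ?thesis by blast
qed

lemma cf_rc:
  assumes "\<And>k. d (- k) = cnj (d k)" "d 0 = 0" shows "cf (rc d) k = d k"
  using assms(1)[of k] assms(2) by (cases "k > 0"; cases "k = 0") (auto simp: cf_def rc_def complex_eq_iff)

lemma Riesz_Fischer_complex:
  assumes d: "\<And>k. d (- k) = cnj (d k)" "d 0 = 0" and s: "(\<lambda>k. (norm (d k))\<^sup>2) summable_on UNIV"
  shows "\<exists>f\<in>H_circle. \<forall>k. fourier f k = d k"
proof -
  have "\<bar>rc d k\<bar> \<le> 2 * sqrt pi * norm (d k)" for k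
    using abs_rc_le[of d k] d(1)[of k] by (cases "k \<ge> 0") simp_all
  then have "(rc d k)\<^sup>2 \<le> (2 * sqrt pi)\<^sup>2 * (norm (d k))\<^sup>2" for k
    by (metis abs_ge_zero power2_abs power_mono power_mult_distrib)
  then have "(\<lambda>k. (rc d k)\<^sup>2) summable_on UNIV"
    by (intro summable_on_comparison_test[OF summable_on_cmult_right[OF s, of "(2 * sqrt pi)\<^sup>2"]]) auto
  then have "hnth (Abs_hs (rc d)) = rc d" by (intro Abs_hs_inverse) simp
  then obtain f where f: "f \<in> H_circle" "\<And>k. coef f k = rc d k" using Riesz_Fischer by metis
  then have "fourier f k = d k" for k
    using cf_rc[OF d, of k] cf_cong[of "coef f" k "rc d"] by (simp add: fourier_cf_H)
  then show ?thesis using f(1) by blast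
qed

section \<open>The Sobolev spaces as sequence spaces\<close>

text \<open>On \<open>Hdot m\<close> this preserves norms and identifies exactly the functions that
  agree almost everywhere; outside \<open>Hdot m\<close> its value is meaningless.\<close>

definition emb :: "nat \<Rightarrow> (real \<Rightarrow> real) \<Rightarrow> hs" where "emb m f = Abs_hs (\<lambda>k. \<bar>of_int k\<bar> ^ m * coef f k)"

lemma summable_Zstar_iff:
  "(\<lambda>k. \<bar>real_of_int k\<bar> ^ (2 * m) * (coef u k)\<^sup>2) summable_on Zstar \<longleftrightarrow> (\<lambda>k. (\<bar>of_int k\<bar> ^ m * coef u k)\<^sup>2) summable_on UNIV"
  "(\<Sum>\<^sub>\<infinity>k\<in>Zstar. \<bar>real_of_int k\<bar> ^ (2 * m) * (coef u k)\<^sup>2) = (\<Sum>\<^sub>\<infinity>k. (\<bar>of_int k\<bar> ^ m * coef u k)\<^sup>2)"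
proof -
  have eq: "\<bar>real_of_int k\<bar> ^ (2 * m) * (coef u k)\<^sup>2 = (\<bar>of_int k\<bar> ^ m * coef u k)\<^sup>2" for k
    by (simp add: power_mult_distrib mult.commute flip: power_mult)
  show "(\<lambda>k. \<bar>real_of_int k\<bar> ^ (2 * m) * (coef u k)\<^sup>2) summable_on Zstar \<longleftrightarrow> (\<lambda>k. (\<bar>of_int k\<bar> ^ m * coef u k)\<^sup>2) summable_on UNIV"
    unfolding eq by (rule summable_on_cong_neutral) (auto simp: Zstar_def)
  show "(\<Sum>\<^sub>\<infinity>k\<in>Zstar. \<bar>real_of_int k\<bar> ^ (2 * m) * (coef u k)\<^sup>2) = (\<Sum>\<^sub>\<infinity>k. (\<bar>of_int k\<bar> ^ m * coef u k)\<^sup>2)"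
    unfolding eq by (rule infsum_cong_neutral) (auto simp: Zstar_def)
qed

lemma HdotD: "f \<in> Hdot m \<Longrightarrow> f \<in> H_circle" "f \<in> Hdot m \<Longrightarrow> f \<in> L2_circle"
  by (auto simp: Hdot_def H_circle_def)

lemma hnth_emb: "f \<in> Hdot m \<Longrightarrow> hnth (emb m f) k = \<bar>of_int k\<bar> ^ m * coef f k"
  unfolding emb_def by (subst Abs_hs_inverse) (auto simp: Hdot_def summable_Zstar_iff)

lemma Hdot_normE: "f \<in> Hdot m \<Longrightarrow> Hdot_norm m f = norm (emb m f)"
  by (simp add: Hdot_norm_def summable_Zstar_iff hnth_emb[symmetric] norm_hs_sq[symmetric])

lemma HdotI:
  assumes "f \<in> H_circle" "\<And>k. \<bar>of_int k\<bar> ^ m * coef f k = hnth y k"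
  shows "f \<in> Hdot m" "emb m f = y"
proof -
  show f: "f \<in> Hdot m" unfolding Hdot_def using assms by (simp add: summable_Zstar_iff summable_hnth)
  show "emb m f = y" by (rule hs_eqI) (simp add: hnth_emb[OF f] assms)
qed

lemma coef_emb: "f \<in> Hdot m \<Longrightarrow> coef f k = hnth (dn m (emb m f)) k"
  by (cases "k = 0") (simp_all add: hnth_emb)

lemma coef_emb_fun: "f \<in> Hdot m \<Longrightarrow> coef f = hnth (dn m (emb m f))"
  by (rule ext) (rule coef_emb)

lemma H_add: "f \<in> H_circle \<Longrightarrow> g \<in> H_circle \<Longrightarrow> (\<lambda>x. f x + g x) \<in> H_circle"
  by (intro H_circleI L2_add) (auto simp: H_circleD fourier_add)

lemma H_scale: "f \<in> H_circle \<Longrightarrow> (\<lambda>x. c * f x) \<in> H_circle"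
  by (intro H_circleI L2_scale) (auto simp: H_circleD fourier_scale)

lemma
  assumes f: "f \<in> Hdot m" and g: "g \<in> Hdot m"
  shows Hdot_add: "(\<lambda>x. f x + g x) \<in> Hdot m" and emb_add: "emb m (\<lambda>x. f x + g x) = emb m f + emb m g"
proof -
  have "(\<lambda>x. f x + g x) \<in> H_circle" by (intro H_add HdotD(1)[OF f] HdotD(1)[OF g])
  moreover have "\<bar>of_int k\<bar> ^ m * coef (\<lambda>x. f x + g x) k = hnth (emb m f + emb m g) k" for k
    by (simp add: hnth_emb f g coef_add HdotD(2)[OF f] HdotD(2)[OF g] distrib_left)
  ultimately show "(\<lambda>x. f x + g x) \<in> Hdot m" "emb m (\<lambda>x. f x + g x) = emb m f + emb m g" by (rule HdotI)+
qed

lemma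
  assumes f: "f \<in> Hdot m"
  shows Hdot_scale: "(\<lambda>x. c * f x) \<in> Hdot m" and emb_scale: "emb m (\<lambda>x. c * f x) = c *\<^sub>R emb m f"
proof -
  have "(\<lambda>x. c * f x) \<in> H_circle" by (intro H_scale HdotD(1)[OF f])
  moreover have "\<bar>of_int k\<bar> ^ m * coef (\<lambda>x. c * f x) k = hnth (c *\<^sub>R emb m f) k" for k
    by (simp add: hnth_emb f coef_scale)
  ultimately show "(\<lambda>x. c * f x) \<in> Hdot m" "emb m (\<lambda>x. c * f x) = c *\<^sub>R emb m f" by (rule HdotI)+
qed

lemma
  assumes f: "f \<in> Hdot m" and g: "g \<in> Hdot m"
  shows Hdot_diff: "(\<lambda>x. f x - g x) \<in> Hdot m" and emb_diff: "emb m (\<lambda>x. f x - g x) = emb m f - emb m g"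
  using Hdot_add[OF f Hdot_scale[OF g, of "- 1"]] emb_add[OF f Hdot_scale[OF g, of "- 1"]] emb_scale[OF g, of "- 1"] by auto

lemma Hdot_norm_diff: "f \<in> Hdot m \<Longrightarrow> g \<in> Hdot m \<Longrightarrow> Hdot_norm m (\<lambda>x. f x - g x) = norm (emb m f - emb m g)"
  by (simp add: Hdot_normE Hdot_diff emb_diff)

lemma H_0: "(\<lambda>x. 0) \<in> H_circle" using H_trig_poly[where A="{}"] by simp

lemma Hdot_0: "(\<lambda>x. 0) \<in> Hdot m" and emb_0: "emb m (\<lambda>x. 0) = 0"
proof -
  have "\<bar>of_int k\<bar> ^ m * coef (\<lambda>x. 0) k = hnth 0 k" for k by (simp add: coef_eq)
  from HdotI[OF H_0 this] show "(\<lambda>x. 0) \<in> Hdot m" "emb m (\<lambda>x. 0) = 0" .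
qed

lemma Hdot_emb_sum:
  assumes "\<And>i. i \<in> A \<Longrightarrow> h i \<in> Hdot m"
  shows "(\<lambda>x. \<Sum>i\<in>A. c i * h i x) \<in> Hdot m \<and> emb m (\<lambda>x. \<Sum>i\<in>A. c i * h i x) = (\<Sum>i\<in>A. c i *\<^sub>R emb m (h i))"
  using assms
proof (induction A rule: infinite_finite_induct)
  case (insert i A)
  then have i: "h i \<in> Hdot m" and A: "(\<lambda>x. \<Sum>i\<in>A. c i * h i x) \<in> Hdot m" 
    "emb m (\<lambda>x. \<Sum>i\<in>A. c i * h i x) = (\<Sum>i\<in>A. c i *\<^sub>R emb m (h i))" by auto
  show ?case using Hdot_add[OF Hdot_scale[OF i] A(1)] emb_add[OF Hdot_scale[OF i] A(1)] emb_scale[OF i] A(2) insert(1,2) by simp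
qed (auto simp: Hdot_0 emb_0)

lemma Hdot_cong_AE: "emb m f = emb m g \<Longrightarrow> f \<in> Hdot m \<Longrightarrow> g \<in> Hdot m \<Longrightarrow> AE x in lborel. f x = g x"
  by (rule coef_unique) (auto simp: HdotD coef_emb)

text \<open>An explicit right inverse of \<open>emb\<close>: for \<open>m \<ge> 1\<close> the series
  converges absolutely, which gives one representative of each sequence without a choice.\<close>

definition synth :: "nat \<Rightarrow> hs \<Rightarrow> real \<Rightarrow> real" where
  "synth m y x = Re (tser (cf (hnth (dn m y))) x)"

lemma
  assumes m: "m \<ge> 1"
  shows synth_Hdot: "synth m y \<in> Hdot m" and emb_synth: "emb m (synth m y) = y"
proof -
  have s: "(\<lambda>j. norm (cf (hnth (dn m y)) j)) summable_on UNIV" by (rule summable_norm_cf[OF m])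
  have L: "synth m y \<in> L2_circle" and F: "\<And>k. fourier (synth m y) k = cf (hnth (dn m y)) k"
    unfolding synth_def[abs_def] by (intro L2_Re_tser fourier_Re_tser s cf_uminus)+
  have "synth m y \<in> H_circle" by (rule H_circleI[OF L]) (simp add: F)
  moreover have "\<bar>of_int k\<bar> ^ m * coef (synth m y) k = hnth y k" for k
  proof (cases "k = 0")
    case False
    have "coef (synth m y) k = rc (cf (hnth (dn m y))) k"
      unfolding coef_fourier[OF L False] by (simp add: rc_def F)
    then show ?thesis using False by (simp add: rc_cf)
  qed simp
  ultimately show "synth m y \<in> Hdot m" "emb m (synth m y) = y" by (rule HdotI)+
qed

lemma sets_Hdot_borel:
  "space (Hdot_borel m) = Hdot m"
  "sets (Hdot_borel m) = sigma_sets (Hdot m) {U. U \<subseteq> Hdot m \<and> (\<forall>u\<in>U. \<exists>r>0. \<forall>v\<in>Hdot m. Hdot_norm m (\<lambda>x. v x - u x) < r \<longrightarrow> v \<in> U)}"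
  unfolding Hdot_borel_def by (auto intro!: space_measure_of sets_measure_of)

text \<open>A set that is open for the norm of \<open>Hdot m\<close> contains with a function every
  other one with the same image under \<open>emb\<close>, as their distance is 0. Together with the
  right inverse \<open>synth\<close> this makes open sets on both sides correspond.\<close>

lemma measurable_Hdot_borel_iff:
  assumes m: "m \<ge> 1"
  shows "f \<in> measurable N (Hdot_borel m) \<longleftrightarrow> (\<forall>w\<in>space N. f w \<in> Hdot m) \<and> (\<lambda>w. emb m (f w)) \<in> borel_measurable N"
proof (rule iffI)
  assume f: "f \<in> measurable N (Hdot_borel m)"
  have 1: "\<forall>w\<in>space N. f w \<in> Hdot m" using measurable_space[OF f] by (simp add: sets_Hdot_borel)
  have "emb m \<in> borel_measurable (Hdot_borel m)"
  proof (rule borel_measurableI)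
    fix V :: "hs set" assume V: "open V"
    have "emb m -` V \<inter> Hdot m \<in> {U. U \<subseteq> Hdot m \<and> (\<forall>u\<in>U. \<exists>r>0. \<forall>v\<in>Hdot m. Hdot_norm m (\<lambda>x. v x - u x) < r \<longrightarrow> v \<in> U)}"
    proof (intro CollectI conjI ballI)
      fix u assume u: "u \<in> emb m -` V \<inter> Hdot m"
      then obtain r where r: "r > 0" "\<And>y. dist y (emb m u) < r \<Longrightarrow> y \<in> V" using V unfolding open_dist by blast
      show "\<exists>r>0. \<forall>v\<in>Hdot m. Hdot_norm m (\<lambda>x. v x - u x) < r \<longrightarrow> v \<in> emb m -` V \<inter> Hdot m"
        using r u by (intro exI[of _ r]) (auto simp: Hdot_norm_diff dist_norm)
    qed auto
    then show "emb m -` V \<inter> space (Hdot_borel m) \<in> sets (Hdot_borel m)"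
      unfolding sets_Hdot_borel by (rule sigma_sets.Basic)
  qed
  from 1 measurable_compose[OF f this]
  show "(\<forall>w\<in>space N. f w \<in> Hdot m) \<and> (\<lambda>w. emb m (f w)) \<in> borel_measurable N" by blast
next
  assume f: "(\<forall>w\<in>space N. f w \<in> Hdot m) \<and> (\<lambda>w. emb m (f w)) \<in> borel_measurable N"
  show "f \<in> measurable N (Hdot_borel m)"
    unfolding Hdot_borel_def
  proof (rule measurable_measure_of)
    show "f \<in> space N \<rightarrow> Hdot m" using f by auto
    fix U assume U: "U \<in> {U. U \<subseteq> Hdot m \<and> (\<forall>u\<in>U. \<exists>r>0. \<forall>v\<in>Hdot m. Hdot_norm m (\<lambda>x. v x - u x) < r \<longrightarrow> v \<in> U)}"
    have op: "open (emb m ` U)"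
      unfolding open_dist
    proof
      fix y assume "y \<in> emb m ` U"
      then obtain u where u: "u \<in> U" "y = emb m u" by auto
      obtain r where r: "r > 0" "\<And>v. v \<in> Hdot m \<Longrightarrow> Hdot_norm m (\<lambda>x. v x - u x) < r \<Longrightarrow> v \<in> U" using U u(1) by blast
      have uH: "u \<in> Hdot m" using U u(1) by auto
      have "y' \<in> emb m ` U" if "dist y' y < r" for y'
      proof -
        have "synth m y' \<in> U" using that u(2) by (intro r(2) synth_Hdot m) (simp add: Hdot_norm_diff synth_Hdot[OF m] emb_synth[OF m] uH dist_norm)
        then show ?thesis using emb_synth[OF m, of y'] by (metis imageI)
      qed
      then show "\<exists>e>0. \<forall>y'. dist y' y < e \<longrightarrow> y' \<in> emb m ` U" using r(1) by blast
    qed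
    have "f w \<in> U" if w: "w \<in> space N" "emb m (f w) \<in> emb m ` U" for w
    proof -
      obtain u where u: "u \<in> U" "emb m (f w) = emb m u" using w(2) by auto
      obtain r where r: "r > 0" "\<And>v. v \<in> Hdot m \<Longrightarrow> Hdot_norm m (\<lambda>x. v x - u x) < r \<Longrightarrow> v \<in> U" using U u(1) by blast
      have "u \<in> Hdot m" "f w \<in> Hdot m" using U u(1) f w by auto
      then show ?thesis using r(1) u(2) by (intro r(2)) (simp_all add: Hdot_norm_diff)
    qed
    then have "f -` U \<inter> space N = (\<lambda>w. emb m (f w)) -` (emb m ` U) \<inter> space N" by auto
    then show "f -` U \<inter> space N \<in> sets N" using measurable_sets[of "\<lambda>w. emb m (f w)" N borel "emb m ` U"] f op by auto
  qed auto
qed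

lemma Hdot_continuous_iff:
  "Hdot_continuous_on m S f \<longleftrightarrow> (\<forall>t\<in>S. f t \<in> Hdot m) \<and> continuous_on S (\<lambda>t. emb m (f t))"
proof -
  have "((\<lambda>s. Hdot_norm m (\<lambda>x. f s x - f t x)) \<longlongrightarrow> 0) (at t within S) \<longleftrightarrow> ((\<lambda>s. emb m (f s)) \<longlongrightarrow> emb m (f t)) (at t within S)"
    if "\<forall>t\<in>S. f t \<in> Hdot m" "t \<in> S" for t
  proof -
    have "\<forall>\<^sub>F s in at t within S. Hdot_norm m (\<lambda>x. f s x - f t x) = dist (emb m (f s)) (emb m (f t))"
      unfolding eventually_at_filter using that by (intro always_eventually) (simp add: Hdot_norm_diff dist_norm)
    then show ?thesis unfolding tendsto_dist_iff[of "\<lambda>s. emb m (f s)"] by (rule tendsto_cong)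
  qed
  then show ?thesis unfolding Hdot_continuous_on_def continuous_on_def by blast
qed

section \<open>Multipliers and the drift\<close>

text \<open>Riesz-Fischer supplies a function with the required coefficients, so the choice in
  \<open>multiplier\<close> is made from a nonempty set; conjugate symmetry of the symbol keeps that
  function real.\<close>

lemma
  assumes f: "f \<in> L2_circle" and \<sigma>: "\<And>k. \<sigma> (- k) = cnj (\<sigma> k)" "\<sigma> 0 * fourier f 0 = 0"
    and s: "(\<lambda>k. (norm (\<sigma> k * fourier f k))\<^sup>2) summable_on UNIV"
  shows multiplier_H: "multiplier \<sigma> f \<in> H_circle" and fourier_multiplier: "fourier (multiplier \<sigma> f) k = \<sigma> k * fourier f k"
proof -
  obtain g where "g \<in> H_circle" "\<And>k. fourier g k = \<sigma> k * fourier f k"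
    using Riesz_Fischer_complex[of "\<lambda>k. \<sigma> k * fourier f k"] \<sigma> s by (auto simp: fourier_uminus f)
  then have "is_multiplier \<sigma> f g" using f by (auto simp: is_multiplier_def H_circleD)
  then have *: "is_multiplier \<sigma> f (multiplier \<sigma> f)" unfolding multiplier_def by (rule someI[of "is_multiplier \<sigma> f" g])
  then show F: "fourier (multiplier \<sigma> f) k = \<sigma> k * fourier f k" for k by (simp add: is_multiplier_def)
  show "multiplier \<sigma> f \<in> H_circle" using * \<sigma>(2) by (intro H_circleI) (auto simp: is_multiplier_def F)
qed

lemma summable_fourier_sq: "f \<in> Hdot m \<Longrightarrow> (\<lambda>k. (norm (fourier f k))\<^sup>2) summable_on UNIV"
  using summable_cf_sq[of "dn m (emb m f)"] by (simp add: fourier_cf_H HdotD coef_emb_fun[symmetric])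

lemma
  assumes w: "\<omega> \<in> Hdot m" 
  shows hilbert_H: "hilbert \<omega> \<in> H_circle"
    and fourier_hilbert: "fourier (hilbert \<omega>) k = - \<i> * of_int (sgn k) * fourier \<omega> k"
    and velocity_H: "velocity \<omega> \<in> H_circle"
    and fourier_velocity: "fourier (velocity \<omega>) k = - fourier \<omega> k / of_int \<bar>k\<bar>"
proof -
  note wL = HdotD(2)[OF w] and s = summable_fourier_sq[OF w]
  have 1: "(\<lambda>k. (norm (- \<i> * of_int (sgn k) * fourier \<omega> k))\<^sup>2) summable_on UNIV"
    by (rule summable_on_comparison_test[OF s]) (auto simp: norm_mult sgn_if)
  show hH: "hilbert \<omega> \<in> H_circle"
    unfolding hilbert_def by (rule multiplier_H[OF wL _ _ 1]) (auto simp: sgn_minus)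
  show Fh: "fourier (hilbert \<omega>) k = - \<i> * of_int (sgn k) * fourier \<omega> k" for k
    unfolding hilbert_def by (rule fourier_multiplier[OF wL _ _ 1]) (auto simp: sgn_minus)
  have 2: "(\<lambda>k. (norm (- fourier \<omega> k / of_int \<bar>k\<bar>))\<^sup>2) summable_on UNIV"
  proof (rule summable_on_comparison_test[OF s])
    fix k :: int
    have "norm (fourier \<omega> k) / \<bar>of_int k\<bar> \<le> norm (fourier \<omega> k)"
      by (cases "k = 0") (auto simp: divide_le_eq mult_le_cancel_left1)
    then show "(norm (- fourier \<omega> k / of_int \<bar>k\<bar>))\<^sup>2 \<le> (norm (fourier \<omega> k))\<^sup>2"
      by (intro power_mono) (auto simp: norm_divide)
  qed simp
  obtain u where u: "u \<in> H_circle" "\<And>k. fourier u k = - fourier \<omega> k / of_int \<bar>k\<bar>"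
    using Riesz_Fischer_complex[OF _ _ 2] by (auto simp: fourier_uminus wL)
  have "u \<in> H_circle \<and> is_multiplier (\<lambda>k. \<i> * of_int k) u (hilbert \<omega>)"
    using u hH by (auto simp: is_multiplier_def H_circleD Fh field_simps sgn_if)
  then have v: "velocity \<omega> \<in> H_circle \<and> is_multiplier (\<lambda>k. \<i> * of_int k) (velocity \<omega>) (hilbert \<omega>)"
    unfolding velocity_def by (rule someI[of "\<lambda>u. u \<in> H_circle \<and> is_multiplier (\<lambda>k. \<i> * of_int k) u (hilbert \<omega>)" u])
  then show vH: "velocity \<omega> \<in> H_circle" by blast
  show "fourier (velocity \<omega>) k = - fourier \<omega> k / of_int \<bar>k\<bar>"
  proof (cases "k = 0")
    case False
    have "\<i> * (of_int k * fourier (velocity \<omega>) k) = \<i> * (- of_int (sgn k) * fourier \<omega> k)"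
      using v Fh[of k] by (simp add: is_multiplier_def mult.assoc)
    then have "of_int k * fourier (velocity \<omega>) k = - of_int (sgn k) * fourier \<omega> k"
      by (simp only: mult_left_cancel[OF complex_i_not_zero])
    then show ?thesis using False by (simp add: field_simps sgn_if split: if_splits)
  qed (use H_circleD[OF vH] in auto)
qed

text \<open>Away from \<open>k = 0\<close> this unfolds the definition of \<open>Q\<close>. At
  \<open>k = 0\<close> replacing \<open>j\<close> by \<open>-j\<close> exchanges the two factors and
  reverses the sign of the symbol, so the nonlinearity has mean zero.\<close>

lemma conv_eq_cf_Q:
  assumes m: "m \<ge> 1"
  shows "conv (hnth (dn m y)) (hnth (dn m y)) k = cf (hnth (dn (m - 1) (Q m y y))) k"
proof (cases "k = 0")
  case True
  let ?x = "cf (hnth (dn m y))"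
  have "conv (hnth (dn m y)) (hnth (dn m y)) 0 = (\<Sum>\<^sub>\<infinity>j. csym 0 (- j) * (?x (- j) * ?x (0 - - j)))"
    unfolding conv_def by (rule infsum_reindex_bij_betw[symmetric]) (auto intro!: bij_betwI[of _ _ _ uminus])
  also have "\<dots> = (\<Sum>\<^sub>\<infinity>j. - (csym 0 j * (?x j * ?x (0 - j))))"
    by (intro infsum_cong) (simp add: csym_def)
  also have "\<dots> = - conv (hnth (dn m y)) (hnth (dn m y)) 0" by (simp add: infsum_uminus conv_def)
  finally show ?thesis using True by (simp add: equation_minus_iff)
next
  case False
  define d where "d = (\<lambda>k. if k = 0 then 0 else conv (hnth (dn m y)) (hnth (dn m y)) k)"
  have "rc d k = hnth (dn (m - 1) (Q m y y)) k" for k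
  proof (cases "k = 0")
    case False
    then have "rc d k = rc (conv (hnth (dn m y)) (hnth (dn m y))) k" by (simp add: rc_def d_def)
    then show ?thesis using False by (simp add: hnth_Q[OF m] Qseq_def)
  qed simp
  then have "rc d = hnth (dn (m - 1) (Q m y y))" by blast
  moreover have "cf (rc d) k = d k" by (rule cf_rc) (auto simp: d_def conv_uminus)
  ultimately show ?thesis using False by (simp add: d_def)
qed

text \<open>For \<open>m \<ge> 1\<close> the Fourier series of \<open>u\<close> and of its
  derivative converge absolutely, so both products lie in L2 and their coefficients are
  convolutions. The two convolutions add up to the one with symbol \<open>csym\<close>.\<close>

lemma
  assumes m: "m \<ge> 1" and w: "\<omega> \<in> Hdot m"
  shows drift_H: "drift (-2) \<omega> \<in> H_circle"
    and coef_drift: "coef (drift (-2) \<omega>) k = hnth (dn (m - 1) (Q m (emb m \<omega>) (emb m \<omega>))) k"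
proof -
  define x where "x = fourier \<omega>"
  define u where "u = velocity \<omega>"
  note wL = HdotD(2)[OF w]
  have xe: "x = cf (hnth (dn m (emb m \<omega>)))"
    unfolding x_def by (rule ext) (simp add: fourier_cf_H HdotD(1)[OF w] coef_emb_fun[OF w, symmetric])
  have sx: "(\<lambda>j. norm (x j)) summable_on UNIV" unfolding xe by (rule summable_norm_cf[OF m])
  have x0: "x 0 = 0" by (simp add: xe)
  have uL: "u \<in> L2_circle" using velocity_H[OF w] by (simp add: u_def H_circleD)
  have Fu: "fourier u k = - x k / of_int \<bar>k\<bar>" for k by (simp add: u_def x_def fourier_velocity[OF w])
  have le_u: "norm (fourier u k) \<le> norm (x k)" for k
    by (cases "k = 0") (auto simp: Fu norm_divide divide_le_eq mult_le_cancel_left1)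
  have su: "(\<lambda>j. norm (fourier u j)) summable_on UNIV"
    by (rule summable_on_comparison_test[OF sx le_u]) simp
  define p where "p = (\<lambda>y. u y * \<omega> y)"
  have pL: "p \<in> L2_circle" unfolding p_def by (rule L2_product[OF uL su wL])
  have Fp: "((\<lambda>j. fourier u j * x (k - j)) has_sum fourier p k) UNIV" for k
    unfolding p_def x_def by (rule fourier_product[OF uL su wL])
  \<comment> \<open>The product has a weak derivative in L2, as the meaning of
    \<open>wderiv p\<close> demands: the factor \<open>|k|\<close> is at most
    \<open>|j| + |k - j|\<close>, and each part is of the form treated by Young's
    inequality.\<close>
  have sp: "(\<lambda>k. (norm (\<i> * of_int k * fourier p k))\<^sup>2) summable_on UNIV"
  proof -
    define X where "X j = norm (cf (hnth (dn (m - 1) (emb m \<omega>))) j)" for j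
    define a where "a j = norm (x j)" for j
    have X: "(\<lambda>j. (X j)\<^sup>2) summable_on UNIV" "\<And>j. X j \<ge> 0" unfolding X_def by (simp_all add: summable_cf_sq)
    have a: "a summable_on UNIV" "\<And>j. a j \<ge> 0" unfolding a_def using sx by simp_all
    have aX: "\<bar>of_int j\<bar> * a j = X j" for j
    proof -
      have "\<bar>real_of_int j\<bar> ^ m = \<bar>real_of_int j\<bar> * \<bar>real_of_int j\<bar> ^ (m - 1)" using m by (cases m) auto
      then show ?thesis unfolding a_def X_def xe norm_cf_dn by (cases "j = 0") auto
    qed
    have aleX: "a j \<le> X j" for j
      unfolding aX[symmetric] by (cases "j = 0") (auto simp: a_def x0 mult_le_cancel_right1)
    note Y = Young_l2_l1[OF X a]
    have Y': "(\<lambda>j. a j * X (k - j)) summable_on UNIV" "(\<Sum>\<^sub>\<infinity>j. a j * X (k - j)) = (\<Sum>\<^sub>\<infinity>j. X j * a (k - j))" for k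
      using summable_shift[OF Y(1), of k k] by (simp_all add: mult.commute)
    have bound: "norm (\<i> * of_int k * fourier p k) \<le> 2 * (\<Sum>\<^sub>\<infinity>j. X j * a (k - j))" for k
    proof -
      let ?g = "\<lambda>j. of_int k * (fourier u j * x (k - j))"
      have g: "(?g has_sum (of_int k * fourier p k)) UNIV" by (rule has_sum_cmult_right[OF Fp])
      have le: "norm (?g j) \<le> X j * a (k - j) + a j * X (k - j)" for j
      proof -
        have "norm (?g j) = \<bar>of_int k\<bar> * (norm (fourier u j) * a (k - j))" by (simp add: norm_mult a_def)
        also have "\<dots> \<le> (\<bar>of_int j\<bar> + \<bar>of_int (k - j)\<bar>) * (norm (fourier u j) * a (k - j))"
          using a(2) abs_triangle_ineq[of "real_of_int j" "real_of_int (k - j)"] by (intro mult_right_mono) auto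
        also have "\<dots> = (\<bar>of_int j\<bar> * norm (fourier u j)) * a (k - j) + norm (fourier u j) * (\<bar>of_int (k - j)\<bar> * a (k - j))"
          by (simp add: algebra_simps)
        also have "\<dots> \<le> X j * a (k - j) + a j * X (k - j)"
        proof (rule add_mono)
          have "\<bar>of_int j\<bar> * norm (fourier u j) \<le> \<bar>of_int j\<bar> * a j" unfolding a_def by (intro mult_left_mono le_u) simp
          then show "\<bar>of_int j\<bar> * norm (fourier u j) * a (k - j) \<le> X j * a (k - j)"
            unfolding aX by (intro mult_right_mono a(2))
          have "norm (fourier u j) \<le> a j" by (simp add: a_def le_u)
          then show "norm (fourier u j) * (\<bar>of_int (k - j)\<bar> * a (k - j)) \<le> a j * X (k - j)"
            unfolding aX by (intro mult_right_mono X(2))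
        qed
        finally show ?thesis .
      qed
      have s: "(\<lambda>j. X j * a (k - j) + a j * X (k - j)) summable_on UNIV" by (intro summable_on_add Y Y')
      have ns: "(\<lambda>j. norm (?g j)) summable_on UNIV" by (rule summable_on_comparison_test[OF s le]) simp
      have "norm (of_int k * fourier p k) \<le> (\<Sum>\<^sub>\<infinity>j. norm (?g j))"
        using norm_infsum_bound[OF ns] infsumI[OF g] by simp
      also have "\<dots> \<le> (\<Sum>\<^sub>\<infinity>j. X j * a (k - j) + a j * X (k - j))" by (rule infsum_mono[OF ns s le])
      also have "\<dots> = 2 * (\<Sum>\<^sub>\<infinity>j. X j * a (k - j))" by (simp add: infsum_add Y(1) Y')
      finally show ?thesis by (simp add: norm_mult)
    qed
    have "(\<lambda>k. (\<Sum>\<^sub>\<infinity>j. X j * a (k - j))\<^sup>2) summable_on UNIV"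
      by (rule summable_on_bdd(1)[where C="(\<Sum>\<^sub>\<infinity>j. a j)\<^sup>2 * (\<Sum>\<^sub>\<infinity>j. (X j)\<^sup>2)"]) (auto intro: Y(2))
    from summable_on_cmult_right[OF this, of 4] show ?thesis
    proof (rule summable_on_comparison_test)
      fix k
      have "(norm (\<i> * of_int k * fourier p k))\<^sup>2 \<le> (2 * (\<Sum>\<^sub>\<infinity>j. X j * a (k - j)))\<^sup>2"
        by (intro power_mono bound) simp
      then show "(norm (\<i> * of_int k * fourier p k))\<^sup>2 \<le> 4 * (\<Sum>\<^sub>\<infinity>j. X j * a (k - j))\<^sup>2"
        by (simp add: power_mult_distrib)
    qed simp
  qed
  have dp: "wderiv p \<in> H_circle" "\<And>k. fourier (wderiv p) k = \<i> * of_int k * fourier p k"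
    unfolding wderiv_def by (intro multiplier_H fourier_multiplier pL sp; simp)+
  have Fiu: "\<i> * of_int k * fourier u k = - \<i> * of_int (sgn k) * x k" for k
    by (cases "k = 0") (auto simp: Fu x0 sgn_if field_simps)
  have siu: "(\<lambda>k. (norm (\<i> * of_int k * fourier u k))\<^sup>2) summable_on UNIV"
    unfolding Fiu by (rule summable_on_comparison_test[OF summable_fourier_sq[OF w]]) (auto simp: x_def norm_mult sgn_if)
  have du: "wderiv u \<in> H_circle" "\<And>k. fourier (wderiv u) k = - \<i> * of_int (sgn k) * x k"
    unfolding Fiu[symmetric] wderiv_def by (intro multiplier_H fourier_multiplier uL siu; simp)+
  have sdu: "(\<lambda>j. norm (fourier (wderiv u) j)) summable_on UNIV"
    by (rule summable_on_comparison_test[OF sx]) (auto simp: du norm_mult sgn_if)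
  define q where "q = (\<lambda>y. wderiv u y * \<omega> y)"
  have qL: "q \<in> L2_circle" unfolding q_def by (rule L2_product[OF H_circleD(1)[OF du(1)] sdu wL])
  have Fq: "((\<lambda>j. - \<i> * of_int (sgn j) * x j * x (k - j)) has_sum fourier q k) UNIV" for k
    using fourier_product[OF H_circleD(1)[OF du(1)] sdu wL, of k] by (simp add: q_def x_def[symmetric] du(2))
  have dr: "drift (-2) \<omega> = (\<lambda>y. 2 * wderiv p y + (-1) * q y)"
    by (simp add: drift_def Let_def u_def[symmetric] p_def q_def fun_eq_iff)
  have dL: "drift (-2) \<omega> \<in> L2_circle" unfolding dr by (intro L2_add L2_scale H_circleD(1) dp qL)
  have Fd: "fourier (drift (-2) \<omega>) k = conv (hnth (dn m (emb m \<omega>))) (hnth (dn m (emb m \<omega>))) k" for k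
  proof -
    have "fourier (drift (-2) \<omega>) k = 2 * (\<i> * of_int k * fourier p k) + (-1) * fourier q k"
    proof -
      have "fourier (\<lambda>y. 2 * wderiv p y + (-1) * q y) k = fourier (\<lambda>y. 2 * wderiv p y) k + fourier (\<lambda>y. (-1) * q y) k"
        by (rule fourier_add) (rule L2_scale, (rule H_circleD(1)[OF dp(1)] qL))+
      then show ?thesis unfolding dr fourier_scale dp(2) by simp
    qed
    moreover have "((\<lambda>j. 2 * (\<i> * of_int k * (fourier u j * x (k - j))) + (-1) * (- \<i> * of_int (sgn j) * x j * x (k - j)))
        has_sum (2 * (\<i> * of_int k * fourier p k) + (-1) * fourier q k)) UNIV"
      by (intro has_sum_add has_sum_cmult_right Fp Fq)
    moreover have "2 * (\<i> * of_int k * (fourier u j * x (k - j))) + (-1) * (- \<i> * of_int (sgn j) * x j * x (k - j)) = csym k j * (x j * x (k - j))" for j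
      by (cases "j = 0") (auto simp: Fu csym_def x0 sgn_if field_simps)
    ultimately show ?thesis by (simp add: infsumI conv_def xe)
  qed
  show dH: "drift (-2) \<omega> \<in> H_circle" by (rule H_circleI[OF dL]) (simp add: Fd conv_eq_cf_Q[OF m])
  show "coef (drift (-2) \<omega>) k = hnth (dn (m - 1) (Q m (emb m \<omega>) (emb m \<omega>))) k"
  proof (cases "k = 0")
    case False
    have "coef (drift (-2) \<omega>) k = rc (cf (hnth (dn (m - 1) (Q m (emb m \<omega>) (emb m \<omega>))))) k"
      unfolding coef_fourier[OF dL False] by (simp add: rc_def Fd conv_eq_cf_Q[OF m])
    then show ?thesis using rc_cf[OF False] by simp
  qed simp
qed

lemma
  assumes nu: "\<nu> > 0" and t: "t \<ge> 0" and g: "g \<in> H_circle" and y: "\<And>k. coef g k = hnth y k"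
  shows heat_H: "heat \<nu> t g \<in> H_circle"
    and coef_heat: "coef (heat \<nu> t g) k = exp (- (\<nu> * (of_int k)\<^sup>2) * t) * coef g k"
proof -
  have gL: "g \<in> L2_circle" by (rule H_circleD(1)[OF g])
  have "coef g = hnth y" using y by blast
  then have s0: "(\<lambda>k. (norm (fourier g k))\<^sup>2) summable_on UNIV"
    using summable_cf_sq[of y] by (simp add: fourier_cf_H[OF g])
  have e1: "exp (- \<nu> * (of_int k)\<^sup>2 * t) \<le> 1" for k :: int using nu t by simp
  have s: "(\<lambda>k. (norm (complex_of_real (exp (- \<nu> * (of_int k)\<^sup>2 * t)) * fourier g k))\<^sup>2) summable_on UNIV"
  proof (rule summable_on_comparison_test[OF s0])
    fix k :: int
    show "(norm (complex_of_real (exp (- \<nu> * (of_int k)\<^sup>2 * t)) * fourier g k))\<^sup>2 \<le> (norm (fourier g k))\<^sup>2"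
      using e1[of k] by (intro power_mono) (auto simp: norm_mult mult_left_le_one_le)
  qed simp
  have c: "complex_of_real (exp (- \<nu> * (real_of_int (- k))\<^sup>2 * t)) = cnj (complex_of_real (exp (- \<nu> * (real_of_int k)\<^sup>2 * t)))" for k by simp
  have z: "complex_of_real (exp (- \<nu> * (real_of_int 0)\<^sup>2 * t)) * fourier g 0 = 0" using H_circleD(2)[OF g] by simp
  show hH: "heat \<nu> t g \<in> H_circle" unfolding heat_def by (rule multiplier_H[OF gL c z s])
  have F: "fourier (heat \<nu> t g) k = complex_of_real (exp (- \<nu> * (of_int k)\<^sup>2 * t)) * fourier g k" for k
    unfolding heat_def by (rule fourier_multiplier[OF gL c z s])
  show "coef (heat \<nu> t g) k = exp (- (\<nu> * (of_int k)\<^sup>2) * t) * coef g k"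
  proof (cases "k = 0")
    case False
    then show ?thesis unfolding coef_fourier[OF H_circleD(1)[OF hH] False] coef_fourier[OF gL False]
      by (auto simp: rc_def F)
  qed simp
qed

lemma
  assumes nu: "\<nu> > 0" and t: "t \<ge> 0" and f: "f \<in> Hdot m"
  shows heat_Hdot: "heat \<nu> t f \<in> Hdot m" and emb_heat: "emb m (heat \<nu> t f) = hheat \<nu> t (emb m f)"
proof -
  note h = heat_H[OF nu t HdotD(1)[OF f] coef_emb[OF f]] coef_heat[OF nu t HdotD(1)[OF f] coef_emb[OF f]]
  have "\<bar>of_int k\<bar> ^ m * coef (heat \<nu> t f) k = hnth (hheat \<nu> t (emb m f)) k" for k
    by (simp add: h(2) hnth_hheat nu t hnth_emb f)
  from HdotI[OF h(1) this] show "heat \<nu> t f \<in> Hdot m" "emb m (heat \<nu> t f) = hheat \<nu> t (emb m f)" .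
qed

text \<open>The heat semigroup from order \<open>m - 1\<close> to order \<open>m\<close>, read in
  weighted coordinates; the factor \<open>|k|\<close> is the derivative gained.\<close>

definition smooth :: "real \<Rightarrow> real \<Rightarrow> hs \<Rightarrow> hs" where
  "smooth \<nu> t y = Abs_hs (\<lambda>k. \<bar>of_int k\<bar> * exp (- (\<nu> * (of_int k)\<^sup>2) * t) * hnth y k)"

lemma
  assumes nu: "\<nu> > 0" and t: "t > 0"
  shows hnth_smooth: "hnth (smooth \<nu> t y) k = \<bar>of_int k\<bar> * exp (- (\<nu> * (of_int k)\<^sup>2) * t) * hnth y k"
    and norm_smooth_le: "norm (smooth \<nu> t y) \<le> 1 / sqrt (\<nu> * t) * norm y"
proof -
  have b: "\<bar>of_int k\<bar> * exp (- (\<nu> * (of_int k)\<^sup>2) * t) \<le> 1 / sqrt (\<nu> * t)" for k :: int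
  proof -
    define s where "s = sqrt (\<nu> * t) * \<bar>of_int k\<bar>"
    have s0: "s \<ge> 0" and sq: "s\<^sup>2 = \<nu> * (of_int k)\<^sup>2 * t" using nu t by (simp_all add: s_def power_mult_distrib)
    \<comment> \<open>Leads to \<open>s * exp (- s\<^sup>2) \<le> 1\<close> in the parabolic
      variable \<open>s\<close>.\<close>
    have "2 * s \<le> 1 + s\<^sup>2" using sum_squares_bound[of 1 s] by simp
    also have "1 + s\<^sup>2 \<le> exp (s\<^sup>2)" by (rule exp_ge_add_one_self)
    finally have "s \<le> exp (s\<^sup>2)" using s0 by simp
    then have "s * exp (- (s\<^sup>2)) \<le> 1" by (simp add: exp_minus field_simps)
    then have "sqrt (\<nu> * t) * (\<bar>of_int k\<bar> * exp (- (\<nu> * (of_int k)\<^sup>2) * t)) \<le> 1"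
      unfolding sq by (simp add: s_def mult.assoc)
    then show ?thesis using nu t by (simp add: field_simps)
  qed
  have b2: "\<bar>\<bar>of_int k\<bar> * exp (- (\<nu> * (of_int k)\<^sup>2) * t) * hnth y k\<bar> \<le> \<bar>1 / sqrt (\<nu> * t) * hnth y k\<bar>" for k :: int
    using mult_right_mono[OF b[of k], of "\<bar>hnth y k\<bar>"] nu t by (simp add: abs_mult)
  have "(\<Sum>k\<in>F. (\<bar>of_int k\<bar> * exp (- (\<nu> * (of_int k)\<^sup>2) * t) * hnth y k)\<^sup>2) \<le> (norm ((1 / sqrt (\<nu> * t)) *\<^sub>R y))\<^sup>2" if "finite F" for F
  proof -
    have "(\<Sum>k\<in>F. (\<bar>of_int k\<bar> * exp (- (\<nu> * (of_int k)\<^sup>2) * t) * hnth y k)\<^sup>2) \<le> (\<Sum>k\<in>F. (hnth ((1 / sqrt (\<nu> * t)) *\<^sub>R y) k)\<^sup>2)"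
      using b2 by (intro sum_mono) (simp only: hnth_simps abs_le_square_iff)
    also have "\<dots> \<le> (norm ((1 / sqrt (\<nu> * t)) *\<^sub>R y))\<^sup>2" by (rule sum_hnth_le[OF that])
    finally show ?thesis .
  qed
  then have h: "hnth (smooth \<nu> t y) = (\<lambda>k. \<bar>of_int k\<bar> * exp (- (\<nu> * (of_int k)\<^sup>2) * t) * hnth y k)"
    unfolding smooth_def by (intro hnth_Abs) auto
  then show "hnth (smooth \<nu> t y) k = \<bar>of_int k\<bar> * exp (- (\<nu> * (of_int k)\<^sup>2) * t) * hnth y k" by simp
  have "norm (smooth \<nu> t y) \<le> norm ((1 / sqrt (\<nu> * t)) *\<^sub>R y)"
    by (rule norm_hs_coord_mono) (use b2 in \<open>simp only: h hnth_simps\<close>)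
  then show "norm (smooth \<nu> t y) \<le> 1 / sqrt (\<nu> * t) * norm y" using nu t by simp
qed

lemma
  assumes m: "m \<ge> 1" and nu: "\<nu> > 0" and t: "t > 0" and w: "\<omega> \<in> Hdot m"
  shows heat_drift_Hdot: "heat \<nu> t (drift (-2) \<omega>) \<in> Hdot m"
    and emb_heat_drift: "emb m (heat \<nu> t (drift (-2) \<omega>)) = smooth \<nu> t (Q m (emb m \<omega>) (emb m \<omega>))"
proof -
  note h = heat_H[OF nu less_imp_le[OF t] drift_H[OF m w] coef_drift[OF m w]]
    coef_heat[OF nu less_imp_le[OF t] drift_H[OF m w] coef_drift[OF m w]]
  have "\<bar>of_int k\<bar> ^ m * coef (heat \<nu> t (drift (-2) \<omega>)) k = hnth (smooth \<nu> t (Q m (emb m \<omega>) (emb m \<omega>))) k" for k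
  proof (cases "k = 0")
    case False
    have "\<bar>real_of_int k\<bar> ^ m = \<bar>real_of_int k\<bar> * \<bar>real_of_int k\<bar> ^ (m - 1)" using m by (cases m) auto
    then show ?thesis using False by (simp add: h(2) hnth_smooth[OF nu t] coef_drift[OF m w])
  qed simp
  from HdotI[OF h(1) this] show "heat \<nu> t (drift (-2) \<omega>) \<in> Hdot m"
    "emb m (heat \<nu> t (drift (-2) \<omega>)) = smooth \<nu> t (Q m (emb m \<omega>) (emb m \<omega>))" .
qed

section \<open>Bochner integrals\<close>

text \<open>Coordinate functionals are bounded by the norm, so they commute with the limit of simple
  functions. Hence the coordinates determine the integral, whatever approximating sequence was
  chosen.\<close>

lemma Hdot_has_integral_coef:
  assumes J: "Hdot_has_integral m S g J" and S: "S \<in> sets lborel"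
    and int: "set_integrable lborel S (\<lambda>s. hnth (emb m (g s)) k)"
  shows "hnth (emb m J) k = (LBINT s:S. hnth (emb m (g s)) k)"
proof -
  obtain n :: "nat \<Rightarrow> nat" and A :: "nat \<Rightarrow> nat \<Rightarrow> real set" and h where
    *: "\<forall>j. \<forall>i<n j. A j i \<in> sets lborel \<and> A j i \<subseteq> S \<and> emeasure lborel (A j i) < \<infinity> \<and> h j i \<in> Hdot m"
    and l1: "(\<lambda>j. \<integral>\<^sup>+s\<in>S. ennreal (Hdot_norm m (\<lambda>x. g s x - (\<Sum>i<n j. indicator (A j i) s * h j i x))) \<partial>lborel) \<longlonglongrightarrow> 0"
    and l2: "(\<lambda>j. Hdot_norm m (\<lambda>x. (\<Sum>i<n j. measure lborel (A j i) * h j i x) - J x)) \<longlonglongrightarrow> 0"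
    using J unfolding Hdot_has_integral_def by - (elim conjE exE; rule that; assumption)
  let ?D = "\<lambda>j s. Hdot_norm m (\<lambda>x. g s x - (\<Sum>i<n j. indicator (A j i) s * h j i x))"
  let ?L = "\<lambda>j. \<integral>\<^sup>+s\<in>S. ennreal (?D j s) \<partial>lborel"
  have A: "\<And>j i. i < n j \<Longrightarrow> A j i \<in> sets lborel" "\<And>j i. i < n j \<Longrightarrow> A j i \<subseteq> S"
      "\<And>j i. i < n j \<Longrightarrow> emeasure lborel (A j i) < \<infinity>" "\<And>j i. i < n j \<Longrightarrow> h j i \<in> Hdot m"
    using * by blast+
  have gm: "g \<in> measurable (restrict_space lborel S) (Hdot_borel m)" and JH: "J \<in> Hdot m"
    using J unfolding Hdot_has_integral_def by auto
  have gH: "g s \<in> Hdot m" if "s \<in> S" for s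
    using measurable_space[OF gm, of s] that S by (simp add: space_restrict_space sets_Hdot_borel)
  define p where "p j s = (\<Sum>i<n j. indicator (A j i) s * hnth (emb m (h j i)) k)" for j s
  define M where "M j = (\<Sum>i<n j. measure lborel (A j i) * hnth (emb m (h j i)) k)" for j
  have c1: "\<bar>hnth (emb m (g s)) k - p j s\<bar> \<le> ?D j s" if "s \<in> S" for j s
  proof -
    have h: "(\<lambda>x. \<Sum>i<n j. indicator (A j i) s * h j i x) \<in> Hdot m"
      "emb m (\<lambda>x. \<Sum>i<n j. indicator (A j i) s * h j i x) = (\<Sum>i<n j. indicator (A j i) s *\<^sub>R emb m (h j i))"
      using Hdot_emb_sum[of "{..<n j}" "h j" m "\<lambda>i. indicator (A j i) s"] A(4) by auto
    have e: "p j s = hnth (emb m (\<lambda>x. \<Sum>i<n j. indicator (A j i) s * h j i x)) k"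
      by (simp only: p_def h(2) hnth_sum hnth_simps)
    show ?thesis unfolding Hdot_norm_diff[OF gH[OF that] h(1)] e hnth_simps(3)[symmetric] by (rule abs_hnth_le)
  qed
  have c2: "\<bar>M j - hnth (emb m J) k\<bar> \<le> Hdot_norm m (\<lambda>x. (\<Sum>i<n j. measure lborel (A j i) * h j i x) - J x)" for j
  proof -
    have h: "(\<lambda>x. \<Sum>i<n j. measure lborel (A j i) * h j i x) \<in> Hdot m"
      "emb m (\<lambda>x. \<Sum>i<n j. measure lborel (A j i) * h j i x) = (\<Sum>i<n j. measure lborel (A j i) *\<^sub>R emb m (h j i))"
      using Hdot_emb_sum[of "{..<n j}" "h j" m "\<lambda>i. measure lborel (A j i)"] A(4) by auto
    have "M j = hnth (emb m (\<lambda>x. \<Sum>i<n j. measure lborel (A j i) * h j i x)) k" by (simp add: M_def h(2))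
    then show ?thesis
      using abs_hnth_le[of "emb m (\<lambda>x. \<Sum>i<n j. measure lborel (A j i) * h j i x) - emb m J" k]
      by (simp add: Hdot_norm_diff[OF h(1) JH])
  qed
  have "M \<longlonglongrightarrow> hnth (emb m J) k"
    by (rule Lim_null_comparison[THEN LIM_zero_cancel, OF _ l2]) (use c2 in auto)
  moreover have "M \<longlonglongrightarrow> (LBINT s:S. hnth (emb m (g s)) k)"
  proof -
    have pI: "integrable lborel (p j)" "(\<integral>s. p j s \<partial>lborel) = M j" for j
    proof -
      have i: "integrable lborel (\<lambda>s. indicator (A j i) s * hnth (emb m (h j i)) k)" if "i < n j" for i
        using A(1,3)[OF that] by (intro integrable_mult_left) (auto intro!: integrable_real_indicator)
      then show "integrable lborel (p j)" unfolding p_def[abs_def] by (intro Bochner_Integration.integrable_sum) auto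
      have "(\<integral>s. p j s \<partial>lborel) = (\<Sum>i<n j. \<integral>s. indicator (A j i) s * hnth (emb m (h j i)) k \<partial>lborel)"
        unfolding p_def using i by (subst Bochner_Integration.integral_sum) auto
      also have "\<dots> = M j" unfolding M_def using A(1) by (intro sum.cong) auto
      finally show "(\<integral>s. p j s \<partial>lborel) = M j" .
    qed
    have pS: "indicator S s *\<^sub>R p j s = p j s" for j s
    proof (cases "s \<in> S")
      case False
      then have "p j s = 0" unfolding p_def using A(2) by (intro sum.neutral) (auto simp: indicator_def)
      then show ?thesis by simp
    qed simp
    let ?G = "\<lambda>s. indicator S s *\<^sub>R hnth (emb m (g s)) k"
    have Gi: "integrable lborel ?G" using int by (simp add: set_integrable_def)
    have "norm (M j - (\<integral>s. ?G s \<partial>lborel)) \<le> enn2real (?L j)"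
      if fin: "?L j < \<infinity>" for j
    proof -
      have "norm (M j - (\<integral>s. ?G s \<partial>lborel)) = norm (\<integral>s. ?G s - p j s \<partial>lborel)"
        using pI[of j] Gi by (simp add: abs_minus_commute)
      also have "\<dots> \<le> (\<integral>s. norm (?G s - p j s) \<partial>lborel)" by (rule integral_norm_bound)
      also have "\<dots> = enn2real (\<integral>\<^sup>+s. ennreal (norm (?G s - p j s)) \<partial>lborel)"
        using pI(1)[of j] Gi by (intro integral_eq_nn_integral) auto
      also have "\<dots> \<le> enn2real (?L j)"
      proof (rule enn2real_mono[OF nn_integral_mono])
        fix s
        show "ennreal (norm (?G s - p j s)) \<le> ennreal (?D j s) * indicator S s"
          using c1[of s j] pS[of s j] by (cases "s \<in> S") (auto intro!: ennreal_leI)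
      qed (use fin in simp)
      finally show ?thesis .
    qed
    then have ev: "\<forall>\<^sub>F j in sequentially. norm (M j - (\<integral>s. ?G s \<partial>lborel)) \<le> enn2real (?L j)"
      using order_tendstoD(2)[OF l1, of 1] by (auto elim!: eventually_mono simp: less_trans[OF _ ennreal_one_less_top])
    have "(\<lambda>j. enn2real (?L j)) \<longlonglongrightarrow> 0"
    proof -
      have "?L \<longlonglongrightarrow> ennreal 0"
        using l1 by simp
      from tendsto_enn2real[OF this order_refl] show ?thesis .
    qed
    from Lim_null_comparison[OF ev this] show ?thesis
      unfolding set_lebesgue_integral_def by (rule LIM_zero_cancel)
  qed
  ultimately show ?thesis by (rule LIMSEQ_unique)
qed

text \<open>The Bochner integral in \<open>hs\<close> is carried back to functions: its simple
  functions take finitely many values, and each value is represented by its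
  \<open>synth\<close>.\<close>

lemma Hdot_has_integralI:
  assumes m: "m \<ge> 1" and S: "S \<in> sets lborel" and gH: "\<And>s. s \<in> S \<Longrightarrow> g s \<in> Hdot m"
    and int: "set_integrable lborel S (\<lambda>s. emb m (g s))"
    and J: "J \<in> Hdot m" "emb m J = (LBINT s:S. emb m (g s))"
  shows "Hdot_has_integral m S g J"
proof -
  define R where "R = restrict_space lborel S"
  have sp: "space R = S" unfolding R_def using S by (simp add: space_restrict_space)
  have SS: "S \<inter> space lborel \<in> sets lborel" using S by simp
  have sets_R: "A \<in> sets R \<longleftrightarrow> A \<subseteq> S \<and> A \<in> sets lborel" for A
    unfolding R_def by (rule sets_restrict_space_iff[OF SS])
  have em: "emeasure R A = emeasure lborel A" if "A \<in> sets R" for A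
    using that unfolding R_def by (intro emeasure_restrict_space SS) (auto simp: sets_R[unfolded R_def])
  have iR: "integrable R (\<lambda>s. emb m (g s))"
    using int unfolding R_def set_integrable_def by (subst integrable_restrict_space[OF SS])
  have JR: "emb m J = (\<integral>s. emb m (g s) \<partial>R)"
    unfolding J(2) R_def set_lebesgue_integral_def by (subst integral_restrict_space[OF SS]) simp
  have "has_bochner_integral R (\<lambda>s. emb m (g s)) (emb m J)"
    unfolding JR by (rule has_bochner_integral_integrable[OF iR])
  then obtain sf where sf: "\<And>i. Bochner_Integration.simple_bochner_integrable R (sf i)"
    "(\<lambda>i. \<integral>\<^sup>+s. norm (emb m (g s) - sf i s) \<partial>R) \<longlonglongrightarrow> 0" "(\<lambda>i. Bochner_Integration.simple_bochner_integral R (sf i)) \<longlonglongrightarrow> emb m J"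
    by (cases rule: has_bochner_integral.cases) auto
  have fin: "finite (sf j ` space R)" for j
    using sf(1)[of j] by (auto simp: simple_bochner_integrable.simps simple_function_def)
  \<comment> \<open>Only the nonzero values are enumerated, because the level set of 0 may have
    infinite measure.\<close>
  have "\<exists>n v. bij_betw v {..<n::nat} (sf j ` space R - {0})" for j
    using ex_bij_betw_nat_finite[of "sf j ` space R - {0}"] fin[of j] by (auto simp: atLeast0LessThan)
  then obtain n v where v: "\<And>j. bij_betw (v j) {..<n j :: nat} (sf j ` space R - {0})" by metis
  define A where "A j i = {s \<in> space R. sf j s = v j i}" for j i
  define h where "h j i = synth m (v j i)" for j i
  have v0: "v j i \<noteq> 0" if "i < n j" for j i using bij_betwE[OF v[of j]] that by auto
  have AR: "A j i \<in> sets R" for j i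
  proof -
    have "simple_function R (sf j)" using sf(1)[of j] by (simp add: simple_bochner_integrable.simps)
    then have "sf j -` {v j i} \<inter> space R \<in> sets R" by (rule simple_functionD(2))
    moreover have "sf j -` {v j i} \<inter> space R = A j i" by (auto simp: A_def)
    ultimately show ?thesis by simp
  qed
  have Afin: "emeasure lborel (A j i) < \<infinity>" if "i < n j" for j i
  proof -
    have sfm: "simple_function R (sf j)" and f: "emeasure R {y \<in> space R. sf j y \<noteq> 0} \<noteq> \<infinity>"
      using sf(1)[of j] by (auto simp: simple_bochner_integrable.simps)
    have "emeasure R (A j i) \<le> emeasure R {y \<in> space R. sf j y \<noteq> 0}"
    proof (rule emeasure_mono)
      show "A j i \<subseteq> {y \<in> space R. sf j y \<noteq> 0}" using v0[OF that] by (auto simp: A_def)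
      have "{y \<in> space R. sf j y \<noteq> 0} = space R - (sf j -` {0} \<inter> space R)" by auto
      then show "{y \<in> space R. sf j y \<noteq> 0} \<in> sets R" using simple_functionD(2)[OF sfm, of "{0}"] by auto
    qed
    then show ?thesis using f em[OF AR] by (simp add: less_top top.not_eq_extremum le_less_trans)
  qed
  have sum_ind: "(\<Sum>i<n j. indicator (A j i) s *\<^sub>R v j i) = sf j s" if "s \<in> S" for j s
  proof -
    have sp': "s \<in> space R" using that sp by simp
    have "(\<Sum>i<n j. indicator (A j i) s *\<^sub>R v j i) = (\<Sum>i<n j. if v j i = sf j s then sf j s else 0)"
      using sp' by (intro sum.cong) (auto simp: A_def indicator_def)
    also have "\<dots> = (\<Sum>w\<in>sf j ` space R - {0}. if w = sf j s then sf j s else 0)"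
      by (rule sum.reindex_bij_betw[OF v])
    also have "\<dots> = sf j s" using fin[of j] sp' by (cases "sf j s = 0") (auto simp: sum.delta)
    finally show ?thesis .
  qed
  have sum_meas: "(\<Sum>i<n j. measure lborel (A j i) *\<^sub>R v j i) = Bochner_Integration.simple_bochner_integral R (sf j)" for j
  proof -
    have "Bochner_Integration.simple_bochner_integral R (sf j) = (\<Sum>w\<in>sf j ` space R. measure R {s \<in> space R. sf j s = w} *\<^sub>R w)"
      by (simp add: simple_bochner_integral_def)
    also have "\<dots> = (\<Sum>w\<in>sf j ` space R - {0}. measure R {s \<in> space R. sf j s = w} *\<^sub>R w)"
      using fin[of j] by (intro sum.mono_neutral_right) auto
    also have "\<dots> = (\<Sum>i<n j. measure R {s \<in> space R. sf j s = v j i} *\<^sub>R v j i)"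
      by (rule sum.reindex_bij_betw[OF v, symmetric])
    also have "\<dots> = (\<Sum>i<n j. measure lborel (A j i) *\<^sub>R v j i)"
      using em[OF AR] by (intro sum.cong) (simp_all add: measure_def flip: A_def)
    finally show ?thesis by simp
  qed
  have hH: "h j i \<in> Hdot m" "emb m (h j i) = v j i" for j i by (simp_all add: h_def synth_Hdot[OF m] emb_synth[OF m])
  show ?thesis
    unfolding Hdot_has_integral_def
  proof (intro conjI exI allI impI)
    show "g \<in> measurable (restrict_space lborel S) (Hdot_borel m)"
      using iR gH sp by (simp add: measurable_Hdot_borel_iff[OF m] flip: R_def)
    show "J \<in> Hdot m" by (rule J)
    show "A j i \<in> sets lborel" "A j i \<subseteq> S" for j i using AR by (simp_all add: sets_R)
    show "emeasure lborel (A j i) < \<infinity>" if "i < n j" for j i by (rule Afin[OF that])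
    show "h j i \<in> Hdot m" for j i by (rule hH)
    have eq1: "Hdot_norm m (\<lambda>x. g s x - (\<Sum>i<n j. indicator (A j i) s * h j i x)) = norm (emb m (g s) - sf j s)" if "s \<in> S" for s j
      using Hdot_emb_sum[of "{..<n j}" "h j" m "\<lambda>i. indicator (A j i) s"] hH gH[OF that] sum_ind[OF that]
      by (simp add: Hdot_norm_diff)
    have "(\<integral>\<^sup>+s\<in>S. ennreal (Hdot_norm m (\<lambda>x. g s x - (\<Sum>i<n j. indicator (A j i) s * h j i x))) \<partial>lborel) = (\<integral>\<^sup>+s. norm (emb m (g s) - sf j s) \<partial>R)" for j
      unfolding R_def nn_integral_restrict_space[OF SS]
    proof (rule nn_integral_cong)
      fix s
      show "ennreal (Hdot_norm m (\<lambda>x. g s x - (\<Sum>i<n j. indicator (A j i) s * h j i x))) * indicator S s =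
        ennreal (norm (emb m (g s) - sf j s)) * indicator S s"
      proof (cases "s \<in> S")
        case True
        then show ?thesis by (simp only: eq1[OF True])
      qed simp
    qed
    then show "(\<lambda>j. \<integral>\<^sup>+s\<in>S. ennreal (Hdot_norm m (\<lambda>x. g s x - (\<Sum>i<n j. indicator (A j i) s * h j i x))) \<partial>lborel) \<longlonglongrightarrow> 0"
      using sf(2) by simp
    have "Hdot_norm m (\<lambda>x. (\<Sum>i<n j. measure lborel (A j i) * h j i x) - J x) = norm (Bochner_Integration.simple_bochner_integral R (sf j) - emb m J)" for j
      using Hdot_emb_sum[of "{..<n j}" "h j" m "\<lambda>i. measure lborel (A j i)"] hH J(1) sum_meas[of j]
      by (simp add: Hdot_norm_diff)
    then show "(\<lambda>j. Hdot_norm m (\<lambda>x. (\<Sum>i<n j. measure lborel (A j i) * h j i x) - J x)) \<longlonglongrightarrow> 0"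
      using tendsto_norm_zero[OF LIM_zero[OF sf(3)]] by simp
  qed
qed

lemma set_integrable_inverse_sqrt:
  assumes t: "t > 0" shows "set_integrable lborel {0..<t} (\<lambda>s. 1 / sqrt (t - s))"
proof -
  have "((\<lambda>s. 1 / sqrt (t - s)) has_integral ((- 2 * sqrt (t - t)) - (- 2 * sqrt (t - 0)))) {0..t}"
  proof (rule fundamental_theorem_of_calculus_interior)
    show "continuous_on {0..t} (\<lambda>s. - 2 * sqrt (t - s))" by (intro continuous_intros)
    fix s assume "s \<in> {0<..<t}"
    then show "((\<lambda>s. - 2 * sqrt (t - s)) has_vector_derivative 1 / sqrt (t - s)) (at s)"
      unfolding has_real_derivative_iff_has_vector_derivative[symmetric]
      by (auto intro!: derivative_eq_intros simp: divide_simps)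
  qed (use t in simp)
  then have i: "(\<lambda>s. 1 / sqrt (t - s)) integrable_on {0..t}" by blast
  then have "(\<lambda>s. 1 / sqrt (t - s)) absolutely_integrable_on {0..t}"
    by (rule nonnegative_absolutely_integrable_1) auto
  then have "set_integrable lebesgue {0..t} (\<lambda>s. 1 / sqrt (t - s))" .
  then have "set_integrable lborel {0..t} (\<lambda>s. 1 / sqrt (t - s))"
    unfolding set_integrable_def by (subst (asm) integrable_completion) measurable
  then show ?thesis by (rule set_integrable_subset) auto
qed

text \<open>\<open>norm_smooth_le\<close> bounds the integrand by a multiple of
  \<open>1 / sqrt (t - s)\<close>, an integrable singularity. There is no smoothing at
  \<open>s = t\<close>, hence the half-open interval.\<close>

lemma set_integrable_smooth:
  fixes q :: "real \<Rightarrow> hs"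
  assumes nu: "\<nu> > 0" and t: "t \<ge> 0" and q: "continuous_on {0..t} q"
  shows "set_integrable lborel {0..<t} (\<lambda>s. smooth \<nu> (t - s) (q s))"
    and "set_integrable lborel {0..<t} (\<lambda>s. hnth (smooth \<nu> (t - s) (q s)) k)"
    and "(LBINT s:{0..<t}. hnth (smooth \<nu> (t - s) (q s)) k) = hnth (Duh \<nu> q t) k"
    and "(LBINT s:{0..<t}. smooth \<nu> (t - s) (q s)) = Duh \<nu> q t"
proof -
  have meas: "(\<lambda>s. indicator {0..<t} s *\<^sub>R smooth \<nu> (t - s) (q s)) \<in> borel_measurable lborel"
  proof (subst borel_measurable_hs_iff, intro allI)
    fix k
    have "continuous_on {0..<t} (\<lambda>s. \<bar>of_int k\<bar> * exp (- (\<nu> * (of_int k)\<^sup>2) * (t - s)) * hnth (q s) k)"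
      by (intro continuous_intros continuous_on_subset[OF q]) auto
    then have "(\<lambda>s. indicator {0..<t} s *\<^sub>R (\<bar>of_int k\<bar> * exp (- (\<nu> * (of_int k)\<^sup>2) * (t - s)) * hnth (q s) k)) \<in> borel_measurable borel"
      by (intro borel_measurable_continuous_on_indicator) auto
    also have "(\<lambda>s. indicator {0..<t} s *\<^sub>R (\<bar>of_int k\<bar> * exp (- (\<nu> * (of_int k)\<^sup>2) * (t - s)) * hnth (q s) k))
      = (\<lambda>s. hnth (indicator {0..<t} s *\<^sub>R smooth \<nu> (t - s) (q s)) k)"
      using nu by (auto simp: fun_eq_iff hnth_smooth split: split_indicator)
    finally show "(\<lambda>s. hnth (indicator {0..<t} s *\<^sub>R smooth \<nu> (t - s) (q s)) k) \<in> borel_measurable lborel" by simp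
  qed
  obtain C where C: "\<And>s. s \<in> {0..t} \<Longrightarrow> norm (q s) \<le> C"
    using continuous_on_Icc_bdd[OF continuous_on_norm[OF q]] by blast
  show 1: "set_integrable lborel {0..<t} (\<lambda>s. smooth \<nu> (t - s) (q s))"
  proof (cases "t > 0")
    case True
    have C0: "C \<ge> 0" using order_trans[OF norm_ge_zero C[of 0]] True by simp
    have "set_integrable lborel {0..<t} (\<lambda>s. (C / sqrt \<nu>) * (1 / sqrt (t - s)))"
      by (intro set_integrable_mult_right set_integrable_inverse_sqrt True)
    then have "integrable lborel (\<lambda>s. indicator {0..<t} s *\<^sub>R ((C / sqrt \<nu>) * (1 / sqrt (t - s))))"
      by (simp add: set_integrable_def)
    then show ?thesis
      unfolding set_integrable_def
    proof (rule Bochner_Integration.integrable_bound[OF _ meas], intro AE_I2)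
      fix s
      show "norm (indicator {0..<t} s *\<^sub>R smooth \<nu> (t - s) (q s)) \<le> norm (indicator {0..<t} s *\<^sub>R ((C / sqrt \<nu>) * (1 / sqrt (t - s))))"
      proof (cases "s \<in> {0..<t}")
        case True
        have "norm (smooth \<nu> (t - s) (q s)) \<le> 1 / sqrt (\<nu> * (t - s)) * norm (q s)"
          using True by (intro norm_smooth_le nu) auto
        also have "\<dots> \<le> 1 / sqrt (\<nu> * (t - s)) * C"
          using True nu by (intro mult_left_mono C) auto
        finally show ?thesis using True nu C0 by (simp add: real_sqrt_mult mult_ac)
      qed simp
    qed
  qed (use t in \<open>auto simp: set_integrable_def\<close>)
  show 2: "set_integrable lborel {0..<t} (\<lambda>s. hnth (smooth \<nu> (t - s) (q s)) k)" for k
    using integrable_bounded_linear[OF bounded_linear_hnth 1[unfolded set_integrable_def], of k]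
    by (simp add: set_integrable_def)
  show 3: "(LBINT s:{0..<t}. hnth (smooth \<nu> (t - s) (q s)) k) = hnth (Duh \<nu> q t) k" for k
  proof -
    let ?f = "\<lambda>s. \<bar>of_int k\<bar> * (exp (- (\<nu> * (of_int k)\<^sup>2) * (t - s)) * hnth (q s) k)"
    have cf: "continuous_on {0..t} ?f" by (intro continuous_intros q)
    have "(LBINT s:{0..<t}. hnth (smooth \<nu> (t - s) (q s)) k) = (LBINT s:{0..<t}. ?f s)"
      by (rule set_lebesgue_integral_cong) (auto simp: hnth_smooth nu mult.assoc)
    also have "\<dots> = (LBINT s:{0..t}. ?f s)"
      by (rule set_integral_discrete_difference[where X="{t}"]) auto
    also have "\<dots> = integral {0..t} ?f"
      by (rule set_borel_integral_eq_integral(2)[OF borel_integrable_atLeastAtMost'[OF cf]])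
    also have "\<dots> = hnth (Duh \<nu> q t) k" by (simp add: hnth_Duh[OF nu t q] duhamel_def)
    finally show ?thesis .
  qed
  show "(LBINT s:{0..<t}. smooth \<nu> (t - s) (q s)) = Duh \<nu> q t"
  proof (rule hs_eqI)
    fix k
    have "hnth (LBINT s:{0..<t}. smooth \<nu> (t - s) (q s)) k = (LBINT s:{0..<t}. hnth (smooth \<nu> (t - s) (q s)) k)"
      using integral_bounded_linear[OF bounded_linear_hnth 1[unfolded set_integrable_def], of k]
      by (simp add: set_lebesgue_integral_def)
    then show "hnth (LBINT s:{0..<t}. smooth \<nu> (t - s) (q s)) k = hnth (Duh \<nu> q t) k" by (simp only: 3)
  qed
qed

text \<open>Turns the time integral in the definition of a mild solution into the operator
  \<open>Duh\<close>. One direction rests on uniqueness through coordinates, the other on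
  \<open>Hdot_has_integralI\<close>.\<close>

lemma Hdot_has_integral_drift_iff:
  assumes m: "m \<ge> 1" and nu: "\<nu> > 0" and t: "t \<ge> 0"
    and w: "\<And>s. s \<in> {0..t} \<Longrightarrow> \<omega> s \<in> Hdot m" and c: "continuous_on {0..t} (\<lambda>s. emb m (\<omega> s))"
  shows "Hdot_has_integral m {0..<t} (\<lambda>s. heat \<nu> (t - s) (drift (-2) (\<omega> s))) J \<longleftrightarrow>
    J \<in> Hdot m \<and> emb m J = Duh \<nu> (\<lambda>s. Q m (emb m (\<omega> s)) (emb m (\<omega> s))) t"
proof -
  define q where "q s = Q m (emb m (\<omega> s)) (emb m (\<omega> s))" for s
  define g where "g s = heat \<nu> (t - s) (drift (-2) (\<omega> s))" for s
  have q: "continuous_on {0..t} q"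
    unfolding q_def[abs_def] by (intro bounded_bilinear.continuous_on[OF bounded_bilinear_Q[OF m]] c)
  have g: "g s \<in> Hdot m" "emb m (g s) = smooth \<nu> (t - s) (q s)" if "s \<in> {0..<t}" for s
    using that unfolding g_def q_def by (intro heat_drift_Hdot emb_heat_drift m nu w; simp)+
  note si = set_integrable_smooth[OF nu t q]
  have cong: "set_integrable lborel {0..<t} (\<lambda>s. emb m (g s)) \<longleftrightarrow> set_integrable lborel {0..<t} (\<lambda>s. smooth \<nu> (t - s) (q s))"
    "set_integrable lborel {0..<t} (\<lambda>s. hnth (emb m (g s)) k) \<longleftrightarrow> set_integrable lborel {0..<t} (\<lambda>s. hnth (smooth \<nu> (t - s) (q s)) k)"
    "(LBINT s:{0..<t}. emb m (g s)) = (LBINT s:{0..<t}. smooth \<nu> (t - s) (q s))"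
    "(LBINT s:{0..<t}. hnth (emb m (g s)) k) = (LBINT s:{0..<t}. hnth (smooth \<nu> (t - s) (q s)) k)" for k
    unfolding set_integrable_def set_lebesgue_integral_def using g(2)
    by (auto intro!: Bochner_Integration.integrable_cong Bochner_Integration.integral_cong split: split_indicator)
  have "Hdot_has_integral m {0..<t} g J \<longleftrightarrow> J \<in> Hdot m \<and> emb m J = Duh \<nu> q t"
  proof
    assume J: "Hdot_has_integral m {0..<t} g J"
    have "emb m J = Duh \<nu> q t"
    proof (rule hs_eqI)
      fix k show "hnth (emb m J) k = hnth (Duh \<nu> q t) k"
      proof (cases "k = 0")
        case False
        have "hnth (emb m J) k = (LBINT s:{0..<t}. hnth (emb m (g s)) k)"
          by (rule Hdot_has_integral_coef[OF J]) (simp_all only: cong si(2), simp)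
        then show ?thesis by (simp only: cong si(3))
      qed simp
    qed
    then show "J \<in> Hdot m \<and> emb m J = Duh \<nu> q t" using J by (simp add: Hdot_has_integral_def)
  next
    assume J: "J \<in> Hdot m \<and> emb m J = Duh \<nu> q t"
    show "Hdot_has_integral m {0..<t} g J"
      by (rule Hdot_has_integralI[OF m]) (use J g in \<open>auto simp: cong si(1) si(4)\<close>)
  qed
  then show ?thesis unfolding g_def[abs_def] q_def[abs_def] .
qed

section \<open>Wiener integrals of deterministic functions\<close>

lemma
  fixes p q :: real
  shows emeasure_Ioc: "emeasure lborel {p<..q} = ennreal (q - p)"
    and measure_Ioc: "measure lborel {p<..q} = max 0 (q - p)"
proof -
  show e: "emeasure lborel {p<..q} = ennreal (q - p)" by (cases "p \<le> q") (auto simp: ennreal_neg)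
  show "measure lborel {p<..q} = max 0 (q - p)" unfolding measure_def e by (simp add: max_def ennreal_neg)
qed

locale bm = prob_space M for M :: "'a measure" +
  fixes W :: "real \<Rightarrow> 'a \<Rightarrow> real"
  assumes W: "brownian_motion M W"
begin

lemma W_measurable [measurable]: "t \<ge> 0 \<Longrightarrow> W t \<in> borel_measurable M"
  using W by (simp add: brownian_motion_def)

lemma W_0: "AE w in M. W 0 w = 0" and W_cont: "AE w in M. continuous_on {0..} (\<lambda>t. W t w)"
  using W by (simp_all add: brownian_motion_def)

text \<open>Second moments give the isometry, fourth moments drive the chaining estimate.\<close>

lemma
  assumes st: "0 \<le> s" "s \<le> t"
  shows increment_sq_integrable: "integrable M (\<lambda>w. (W t w - W s w)\<^sup>2)"
    and increment_sq: "(\<integral>w. (W t w - W s w)\<^sup>2 \<partial>M) = t - s"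
    and increment_4_integrable: "integrable M (\<lambda>w. (W t w - W s w)^4)"
    and increment_4: "(\<integral>w. (W t w - W s w)^4 \<partial>M) = 3 * (t - s)\<^sup>2"
proof -
  have "integrable M (\<lambda>w. (W t w - W s w)\<^sup>2) \<and> (\<integral>w. (W t w - W s w)\<^sup>2 \<partial>M) = t - s \<and>
    integrable M (\<lambda>w. (W t w - W s w)^4) \<and> (\<integral>w. (W t w - W s w)^4 \<partial>M) = 3 * (t - s)\<^sup>2"
  proof (cases "s = t")
    \<comment> \<open>The normal density is given for \<open>s < t\<close>; for \<open>s = t\<close>
      the increment is zero.\<close>
    case False
    then have lt: "s < t" using st by simp
    define \<sigma> where "\<sigma> = sqrt (t - s)"
    have \<sigma>: "\<sigma> > 0" "\<sigma>\<^sup>2 = t - s" using lt by (simp_all add: \<sigma>_def)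
    have d: "distributed M lborel (\<lambda>w. W t w - W s w) (normal_density 0 \<sigma>)"
      using W lt st(1) by (simp add: brownian_motion_def \<sigma>_def)
    have mom: "has_bochner_integral lborel (\<lambda>x. normal_density 0 \<sigma> x * x ^ (2 * k)) (fact (2 * k) / ((2 / \<sigma>\<^sup>2)^k * fact k))" for k
      using normal_moment_even[OF \<sigma>(1), of 0 k] by simp
    have i: "integrable M (\<lambda>w. (W t w - W s w)^(2 * k))" for k
      using distributed_integrable[OF d, of "\<lambda>x. x ^ (2 * k)"] mom[of k] by (simp add: has_bochner_integral_iff)
    have e: "(\<integral>w. (W t w - W s w)^(2 * k) \<partial>M) = fact (2 * k) / ((2 / \<sigma>\<^sup>2)^k * fact k)" for k
      using distributed_integral[OF d, of "\<lambda>x. x ^ (2 * k)"] mom[of k] by (simp add: has_bochner_integral_iff)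
    have e1: "fact (2 * 1) / ((2 / \<sigma>\<^sup>2)^1 * fact 1) = \<sigma>\<^sup>2" by simp
    have e2: "fact (2 * 2) / ((2 / \<sigma>\<^sup>2)^2 * fact 2) = 3 * (\<sigma>\<^sup>2)\<^sup>2"
      using \<sigma>(1) by (simp add: fact_numeral power_divide field_simps)
    show ?thesis
      using i[of 1] e[of 1, unfolded e1] i[of 2] e[of 2, unfolded e2] \<sigma>(2) by simp
  qed simp
  then show "integrable M (\<lambda>w. (W t w - W s w)\<^sup>2)" "(\<integral>w. (W t w - W s w)\<^sup>2 \<partial>M) = t - s"
    "integrable M (\<lambda>w. (W t w - W s w)^4)" "(\<integral>w. (W t w - W s w)^4 \<partial>M) = 3 * (t - s)\<^sup>2" by auto
qed

lemma
  assumes t: "t \<ge> 0"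
  shows W_sq_integrable: "integrable M (\<lambda>w. (W t w)\<^sup>2)" and W_sq: "(\<integral>w. (W t w)\<^sup>2 \<partial>M) = t"
proof -
  have ae: "AE w in M. (W t w - W 0 w)\<^sup>2 = (W t w)\<^sup>2" using W_0 by eventually_elim simp
  show "integrable M (\<lambda>w. (W t w)\<^sup>2)"
    by (rule integrable_cong_AE_imp[OF increment_sq_integrable[of 0 t] _ ae]) (use t in \<open>auto\<close>)
  have "(\<integral>w. (W t w - W 0 w)\<^sup>2 \<partial>M) = (\<integral>w. (W t w)\<^sup>2 \<partial>M)"
    by (rule integral_cong_AE[OF _ _ ae]) (use t in auto)
  then show "(\<integral>w. (W t w)\<^sup>2 \<partial>M) = t" using increment_sq[of 0 t] t by simp
qed

text \<open>Polarisation: twice the product is the sum of the two squares minus the squared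
  increment, so second moments yield the covariance.\<close>

lemma
  assumes s: "s \<ge> 0" and t: "t \<ge> 0"
  shows W_product_integrable: "integrable M (\<lambda>w. W s w * W t w)" and W_product: "(\<integral>w. W s w * W t w \<partial>M) = min s t"
proof -
  have *: "integrable M (\<lambda>w. W s w * W t w) \<and> (\<integral>w. W s w * W t w \<partial>M) = s" if "0 \<le> s" "s \<le> t" for s t
  proof -
    have t: "t \<ge> 0" using that by simp
    have eq: "(\<lambda>w. W s w * W t w) = (\<lambda>w. ((W s w)\<^sup>2 + (W t w)\<^sup>2 - (W t w - W s w)\<^sup>2) / 2)"
      by (auto simp: fun_eq_iff power2_eq_square field_simps)
    show ?thesis
      unfolding eq using W_sq_integrable[OF that(1)] W_sq_integrable[OF t] increment_sq_integrable[OF that]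
        W_sq[OF that(1)] W_sq[OF t] increment_sq[OF that] by simp
  qed
  show "integrable M (\<lambda>w. W s w * W t w)" "(\<integral>w. W s w * W t w \<partial>M) = min s t"
    using *[of s t] *[of t s] s t by (cases "s \<le> t"; simp add: mult.commute min_def)+
qed

text \<open>The covariance of increments is the length of the overlap, so the Ito isometry holds for arbitrary
  finite families of intervals; two step functions on different grids need no common refinement.\<close>

lemma
  assumes I: "finite I" and ab: "\<And>i. i \<in> I \<Longrightarrow> 0 \<le> a i \<and> a i \<le> b i"
  shows isometry_integrable: "integrable M (\<lambda>w. (\<Sum>i\<in>I. c i * (W (b i) w - W (a i) w))\<^sup>2)"
    and isometry: "(\<integral>w. (\<Sum>i\<in>I. c i * (W (b i) w - W (a i) w))\<^sup>2 \<partial>M) = (\<integral>s. (\<Sum>i\<in>I. c i * indicator {a i<..b i} s)\<^sup>2 \<partial>lborel)"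
proof -
  have pi: "integrable M (\<lambda>w. W (p i) w * W (q j) w)" if "i \<in> I" "j \<in> I" "p \<in> {a, b}" "q \<in> {a, b}" for i j p q
    using W_product_integrable[of "p i" "q j"] ab[OF that(1)] ab[OF that(2)] that(3,4) by auto
  define \<kappa> where "\<kappa> i j = min (b i) (b j) - min (b i) (a j) - min (a i) (b j) + min (a i) (a j)" for i j
  have inc: "integrable M (\<lambda>w. (W (b i) w - W (a i) w) * (W (b j) w - W (a j) w)) \<and>
    (\<integral>w. (W (b i) w - W (a i) w) * (W (b j) w - W (a j) w) \<partial>M) = \<kappa> i j" if ij: "i \<in> I" "j \<in> I" for i j
  proof -
    have eq: "(\<lambda>w. (W (b i) w - W (a i) w) * (W (b j) w - W (a j) w)) =
      (\<lambda>w. W (b i) w * W (b j) w - W (b i) w * W (a j) w - W (a i) w * W (b j) w + W (a i) w * W (a j) w)"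
      by (simp add: algebra_simps)
    have i4: "integrable M (\<lambda>w. W (b i) w * W (b j) w)" "integrable M (\<lambda>w. W (b i) w * W (a j) w)"
      "integrable M (\<lambda>w. W (a i) w * W (b j) w)" "integrable M (\<lambda>w. W (a i) w * W (a j) w)"
      using pi[OF ij] by auto
    have "0 \<le> a i" "0 \<le> b i" "0 \<le> a j" "0 \<le> b j" using ab[OF ij(1)] ab[OF ij(2)] by auto
    then show ?thesis unfolding eq using i4 by (simp add: W_product \<kappa>_def)
  qed
  have expand: "(\<Sum>i\<in>I. c i * x i)\<^sup>2 = (\<Sum>i\<in>I. \<Sum>j\<in>I. c i * c j * (x i * x j))" for x :: "'b \<Rightarrow> real"
    by (simp add: power2_eq_square sum_product mult_ac)
  show "integrable M (\<lambda>w. (\<Sum>i\<in>I. c i * (W (b i) w - W (a i) w))\<^sup>2)"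
    unfolding expand using inc by (intro Bochner_Integration.integrable_sum integrable_mult_right) blast
  have "(\<integral>w. (\<Sum>i\<in>I. c i * (W (b i) w - W (a i) w))\<^sup>2 \<partial>M) = (\<Sum>i\<in>I. \<Sum>j\<in>I. c i * c j * \<kappa> i j)"
  proof -
    have "(\<integral>w. (\<Sum>i\<in>I. c i * (W (b i) w - W (a i) w))\<^sup>2 \<partial>M)
      = (\<Sum>i\<in>I. \<integral>w. (\<Sum>j\<in>I. c i * c j * ((W (b i) w - W (a i) w) * (W (b j) w - W (a j) w))) \<partial>M)"
      unfolding expand
      by (rule Bochner_Integration.integral_sum) (intro Bochner_Integration.integrable_sum integrable_mult_right inc[THEN conjunct1])
    also have "\<dots> = (\<Sum>i\<in>I. \<Sum>j\<in>I. \<integral>w. c i * c j * ((W (b i) w - W (a i) w) * (W (b j) w - W (a j) w)) \<partial>M)"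
      by (intro sum.cong refl Bochner_Integration.integral_sum integrable_mult_right inc[THEN conjunct1])
    also have "\<dots> = (\<Sum>i\<in>I. \<Sum>j\<in>I. c i * c j * \<kappa> i j)"
      by (intro sum.cong refl) (simp add: inc)
    finally show ?thesis .
  qed
  moreover have ind: "has_bochner_integral lborel (\<lambda>s. indicator {a i<..b i} s * indicator {a j<..b j} s) (\<kappa> i j)" if ij: "i \<in> I" "j \<in> I" for i j
  proof -
    have eq: "(\<lambda>s. indicator {a i<..b i} s * indicator {a j<..b j} s) = (\<lambda>s. indicator {max (a i) (a j)<..min (b i) (b j)} s :: real)"
      by (auto simp: fun_eq_iff split: split_indicator)
    have "has_bochner_integral lborel (indicator {max (a i) (a j)<..min (b i) (b j)}) (measure lborel {max (a i) (a j)<..min (b i) (b j)})"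
      by (rule has_bochner_integral_real_indicator) (auto simp: emeasure_Ioc)
    moreover have "measure lborel {max (a i) (a j)<..min (b i) (b j)} = \<kappa> i j"
      using ab[OF ij(1)] ab[OF ij(2)] unfolding measure_Ioc by (auto simp: \<kappa>_def min_def max_def)
    ultimately show ?thesis unfolding eq by simp
  qed
  then have "has_bochner_integral lborel (\<lambda>s. \<Sum>i\<in>I. \<Sum>j\<in>I. c i * c j * (indicator {a i<..b i} s * indicator {a j<..b j} s)) (\<Sum>i\<in>I. \<Sum>j\<in>I. c i * c j * \<kappa> i j)"
    by (intro has_bochner_integral_sum has_bochner_integral_mult_right) auto
  then have "(\<integral>s. (\<Sum>i\<in>I. c i * indicator {a i<..b i} s)\<^sup>2 \<partial>lborel) = (\<Sum>i\<in>I. \<Sum>j\<in>I. c i * c j * \<kappa> i j)"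
    unfolding expand by (rule has_bochner_integral_integral_eq)
  ultimately show "(\<integral>w. (\<Sum>i\<in>I. c i * (W (b i) w - W (a i) w))\<^sup>2 \<partial>M) = (\<integral>s. (\<Sum>i\<in>I. c i * indicator {a i<..b i} s)\<^sup>2 \<partial>lborel)" by simp
qed

definition step :: "nat \<Rightarrow> (nat \<Rightarrow> real) \<Rightarrow> (nat \<Rightarrow> real) \<Rightarrow> real \<Rightarrow> real" where
  "step n \<tau> c s = (\<Sum>i<n. c i * indicator {\<tau> i<..\<tau> (Suc i)} s)"

definition stepint :: "nat \<Rightarrow> (nat \<Rightarrow> real) \<Rightarrow> (nat \<Rightarrow> real) \<Rightarrow> 'a \<Rightarrow> real" where
  "stepint n \<tau> c w = (\<Sum>i<n. c i * (W (\<tau> (Suc i)) w - W (\<tau> i) w))"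

lemma step_measurable [measurable]: "step n \<tau> c \<in> borel_measurable borel"
  unfolding step_def[abs_def] by measurable

lemma range_nth: "range \<tau> \<subseteq> {0..t} \<Longrightarrow> 0 \<le> \<tau> i \<and> \<tau> i \<le> (t::real)"
  by (meson atLeastAtMost_iff rangeI subsetD)

lemma stepint_measurable: "range \<tau> \<subseteq> {0..t} \<Longrightarrow> stepint n \<tau> c \<in> borel_measurable M"
  unfolding stepint_def[abs_def]
  by (intro borel_measurable_sum borel_measurable_times borel_measurable_diff W_measurable) (auto simp: range_nth)

lemma step_outside: "range \<tau> \<subseteq> {0..t} \<Longrightarrow> s \<notin> {0..t} \<Longrightarrow> step n \<tau> c s = 0"
  unfolding step_def
proof (intro sum.neutral ballI)
  fix i assume "range \<tau> \<subseteq> {0..t}" "s \<notin> {0..t}"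
  then show "c i * indicator {\<tau> i<..\<tau> (Suc i)} s = 0"
    using range_nth[of \<tau> t i] range_nth[of \<tau> t "Suc i"] by (auto split: split_indicator)
qed

lemma isometry_step_diff:
  assumes tau: "mono \<tau>" "range \<tau> \<subseteq> {0..t}" "mono \<tau>'" "range \<tau>' \<subseteq> {0..t}"
  shows "(\<integral>\<^sup>+w. ennreal ((stepint n \<tau> c w - stepint n' \<tau>' c' w)\<^sup>2) \<partial>M) = (\<integral>\<^sup>+s\<in>{0..t}. ennreal ((step n \<tau> c s - step n' \<tau>' c' s)\<^sup>2) \<partial>lborel)"
proof -
  \<comment> \<open>Both grids are placed side by side as one family of intervals, the second with
    negated coefficients.\<close>
  define I where "I = ({..<n} <+> {..<n'})"
  define a where "a = case_sum \<tau> \<tau>'"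
  define b where "b = case_sum (\<lambda>i. \<tau> (Suc i)) (\<lambda>i. \<tau>' (Suc i))"
  define d where "d = case_sum c (\<lambda>i. - c' i)"
  have I: "finite I" by (simp add: I_def)
  have ab: "0 \<le> a i \<and> a i \<le> b i" if "i \<in> I" for i
    using range_nth[OF tau(2)] range_nth[OF tau(4)] monoD[OF tau(1)] monoD[OF tau(3)]
    by (cases i) (auto simp: a_def b_def)
  have sp: "(\<Sum>i\<in>I. f i) = (\<Sum>i<n. f (Inl i)) + (\<Sum>i<n'. f (Inr i))" for f :: "nat + nat \<Rightarrow> real"
    unfolding I_def by (simp add: sum.Plus o_def)
  have e1: "stepint n \<tau> c w - stepint n' \<tau>' c' w = (\<Sum>i\<in>I. d i * (W (b i) w - W (a i) w))" for w
    by (simp add: sp stepint_def a_def b_def d_def sum_negf)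
  have e2: "step n \<tau> c s - step n' \<tau>' c' s = (\<Sum>i\<in>I. d i * indicator {a i<..b i} s)" for s
    by (simp add: sp step_def a_def b_def d_def sum_negf)
  have "(\<integral>\<^sup>+s\<in>{0..t}. ennreal ((step n \<tau> c s - step n' \<tau>' c' s)\<^sup>2) \<partial>lborel) = (\<integral>\<^sup>+s. ennreal ((step n \<tau> c s - step n' \<tau>' c' s)\<^sup>2) \<partial>lborel)"
    by (rule nn_integral_cong) (use step_outside tau in \<open>auto split: split_indicator\<close>)
  also have "\<dots> = ennreal (\<integral>s. (step n \<tau> c s - step n' \<tau>' c' s)\<^sup>2 \<partial>lborel)"
  proof (rule nn_integral_eq_integral)
    have iu: "integrable lborel (\<lambda>s. indicator {a i<..b i} s * indicator {a j<..b j} s :: real)" for i j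
    proof -
      have eq: "(\<lambda>s. indicator {a i<..b i} s * indicator {a j<..b j} s) = (\<lambda>s. indicator {max (a i) (a j)<..min (b i) (b j)} s :: real)"
        by (auto simp: fun_eq_iff split: split_indicator)
      show ?thesis unfolding eq by (rule integrable_real_indicator) (auto simp: emeasure_Ioc)
    qed
    show "integrable lborel (\<lambda>s. (step n \<tau> c s - step n' \<tau>' c' s)\<^sup>2)"
      unfolding e2 power2_eq_square sum_product
    proof (intro Bochner_Integration.integrable_sum)
      fix i j
      have eq: "(\<lambda>s. d i * indicator {a i<..b i} s * (d j * indicator {a j<..b j} s)) =
        (\<lambda>s. (d i * d j) * (indicator {a i<..b i} s * indicator {a j<..b j} s))" by (simp only: mult_ac)
      show "integrable lborel (\<lambda>s. d i * indicator {a i<..b i} s * (d j * indicator {a j<..b j} s))"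
        unfolding eq by (rule integrable_mult_right[OF iu])
    qed
  qed simp
  also have "\<dots> = ennreal (\<integral>w. (stepint n \<tau> c w - stepint n' \<tau>' c' w)\<^sup>2 \<partial>M)"
    unfolding e1 e2 by (subst isometry[where a=a and b=b, OF I ab]) auto
  also have "\<dots> = (\<integral>\<^sup>+w. ennreal ((stepint n \<tau> c w - stepint n' \<tau>' c' w)\<^sup>2) \<partial>M)"
    by (rule nn_integral_eq_integral[symmetric]) (unfold e1, rule isometry_integrable[where a=a and b=b, OF I ab], auto)
  finally show ?thesis by simp
qed

end

lemma ennreal_sq_add_le: "ennreal ((x + y)\<^sup>2) \<le> 2 * ennreal (x\<^sup>2) + 2 * ennreal (y\<^sup>2)"
proof -
  have "(x + y)\<^sup>2 \<le> 2 * x\<^sup>2 + 2 * y\<^sup>2" using sum_squares_bound[of x y] by (simp add: power2_sum)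
  then have "ennreal ((x + y)\<^sup>2) \<le> ennreal (2 * x\<^sup>2 + 2 * y\<^sup>2)" by (rule ennreal_leI)
  also have "\<dots> = 2 * ennreal (x\<^sup>2) + 2 * ennreal (y\<^sup>2)"
    by (simp add: ennreal_plus ennreal_mult)
  finally show ?thesis .
qed

lemma nn_integral_sq_add_le:
  assumes "f \<in> borel_measurable M" "g \<in> borel_measurable M"
  shows "(\<integral>\<^sup>+w. ennreal ((f w + g w)\<^sup>2) \<partial>M) \<le> 2 * (\<integral>\<^sup>+w. ennreal ((f w)\<^sup>2) \<partial>M) + 2 * (\<integral>\<^sup>+w. ennreal ((g w)\<^sup>2) \<partial>M)"
proof -
  have "(\<integral>\<^sup>+w. ennreal ((f w + g w)\<^sup>2) \<partial>M) \<le> (\<integral>\<^sup>+w. 2 * ennreal ((f w)\<^sup>2) + 2 * ennreal ((g w)\<^sup>2) \<partial>M)"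
    by (intro nn_integral_mono ennreal_sq_add_le)
  also have "\<dots> = 2 * (\<integral>\<^sup>+w. ennreal ((f w)\<^sup>2) \<partial>M) + 2 * (\<integral>\<^sup>+w. ennreal ((g w)\<^sup>2) \<partial>M)"
    using assms by (simp add: nn_integral_add nn_integral_cmult)
  finally show ?thesis .
qed

lemma nn_integral_sq_set_add_le:
  assumes "f \<in> borel_measurable borel" "g \<in> borel_measurable borel"
  shows "(\<integral>\<^sup>+s\<in>{0..t::real}. ennreal ((f s + g s)\<^sup>2) \<partial>lborel) \<le> 2 * (\<integral>\<^sup>+s\<in>{0..t}. ennreal ((f s)\<^sup>2) \<partial>lborel) + 2 * (\<integral>\<^sup>+s\<in>{0..t}. ennreal ((g s)\<^sup>2) \<partial>lborel)"
proof -
  have "(\<integral>\<^sup>+s\<in>{0..t}. ennreal ((f s + g s)\<^sup>2) \<partial>lborel) \<le> (\<integral>\<^sup>+s. 2 * (ennreal ((f s)\<^sup>2) * indicator {0..t} s) + 2 * (ennreal ((g s)\<^sup>2) * indicator {0..t} s) \<partial>lborel)"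
    by (intro nn_integral_mono) (use ennreal_sq_add_le in \<open>auto split: split_indicator\<close>)
  also have "\<dots> = 2 * (\<integral>\<^sup>+s\<in>{0..t}. ennreal ((f s)\<^sup>2) \<partial>lborel) + 2 * (\<integral>\<^sup>+s\<in>{0..t}. ennreal ((g s)\<^sup>2) \<partial>lborel)"
    using assms by (simp add: nn_integral_add nn_integral_cmult)
  finally show ?thesis .
qed

context bm
begin

lemma wiener_integralD:
  assumes "wiener_integral M W t f I"
  obtains n \<tau> c where "\<And>j. mono (\<tau> j)" "\<And>j. range (\<tau> j) \<subseteq> {0..t}"
    "(\<lambda>j. \<integral>\<^sup>+s\<in>{0..t}. ennreal ((f s - step (n j) (\<tau> j) (c j) s)\<^sup>2) \<partial>lborel) \<longlonglongrightarrow> 0"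
    "(\<lambda>j. \<integral>\<^sup>+w. ennreal ((I w - stepint (n j) (\<tau> j) (c j) w)\<^sup>2) \<partial>M) \<longlonglongrightarrow> 0"
    "f \<in> borel_measurable borel" "I \<in> borel_measurable M"
proof -
  obtain n :: "nat \<Rightarrow> nat" and \<tau> c :: "nat \<Rightarrow> nat \<Rightarrow> real" where
    *: "\<forall>j. mono (\<tau> j) \<and> range (\<tau> j) \<subseteq> {0..t}"
    "(\<lambda>j. \<integral>\<^sup>+s\<in>{0..t}. ennreal ((f s - (\<Sum>i<n j. c j i * indicator {\<tau> j i<..\<tau> j (Suc i)} s))\<^sup>2) \<partial>lborel) \<longlonglongrightarrow> 0"
    "(\<lambda>j. \<integral>\<^sup>+w. ennreal ((I w - (\<Sum>i<n j. c j i * (W (\<tau> j (Suc i)) w - W (\<tau> j i) w)))\<^sup>2) \<partial>M) \<longlonglongrightarrow> 0"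
    using assms unfolding wiener_integral_def by - (elim conjE exE; rule that; assumption)
  show thesis
  proof (rule that[of \<tau> n c])
    show "mono (\<tau> j)" "range (\<tau> j) \<subseteq> {0..t}" for j using *(1) by auto
  qed (use * assms in \<open>simp_all only: step_def stepint_def wiener_integral_def\<close>)
qed

text \<open>Four successive uses of
  \<open>(x + y)\<^sup>2 \<le> 2 * x\<^sup>2 + 2 * y\<^sup>2\<close> around the two approximating
  sequences produce the constant 16. It is not sharp, but suffices for uniqueness and for second
  moment bounds.\<close>

lemma wiener_integral_diff_le:
  assumes I: "wiener_integral M W t f I" and I': "wiener_integral M W t f' I'"
  shows "(\<integral>\<^sup>+w. ennreal ((I w - I' w)\<^sup>2) \<partial>M) \<le> 16 * (\<integral>\<^sup>+s\<in>{0..t}. ennreal ((f s - f' s)\<^sup>2) \<partial>lborel)" (is "?I \<le> 16 * ?F")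
proof -
  obtain n \<tau> c where 1: "\<And>j. mono (\<tau> j)" "\<And>j. range (\<tau> j) \<subseteq> {0..t}"
    "(\<lambda>j. \<integral>\<^sup>+s\<in>{0..t}. ennreal ((f s - step (n j) (\<tau> j) (c j) s)\<^sup>2) \<partial>lborel) \<longlonglongrightarrow> 0" (is "?a \<longlonglongrightarrow> 0")
    "(\<lambda>j. \<integral>\<^sup>+w. ennreal ((I w - stepint (n j) (\<tau> j) (c j) w)\<^sup>2) \<partial>M) \<longlonglongrightarrow> 0" (is "?b \<longlonglongrightarrow> 0")
    "f \<in> borel_measurable borel" "I \<in> borel_measurable M"
    by (rule wiener_integralD[OF I]) blast
  obtain n' \<tau>' c' where 2: "\<And>j. mono (\<tau>' j)" "\<And>j. range (\<tau>' j) \<subseteq> {0..t}"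
    "(\<lambda>j. \<integral>\<^sup>+s\<in>{0..t}. ennreal ((f' s - step (n' j) (\<tau>' j) (c' j) s)\<^sup>2) \<partial>lborel) \<longlonglongrightarrow> 0" (is "?a' \<longlonglongrightarrow> 0")
    "(\<lambda>j. \<integral>\<^sup>+w. ennreal ((I' w - stepint (n' j) (\<tau>' j) (c' j) w)\<^sup>2) \<partial>M) \<longlonglongrightarrow> 0" (is "?b' \<longlonglongrightarrow> 0")
    "f' \<in> borel_measurable borel" "I' \<in> borel_measurable M"
    by (rule wiener_integralD[OF I']) blast
  let ?S = "\<lambda>j. stepint (n j) (\<tau> j) (c j)" and ?S' = "\<lambda>j. stepint (n' j) (\<tau>' j) (c' j)"
  let ?s = "\<lambda>j. step (n j) (\<tau> j) (c j)" and ?s' = "\<lambda>j. step (n' j) (\<tau>' j) (c' j)"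
  note m = stepint_measurable[OF 1(2)] stepint_measurable[OF 2(2)]
  have le: "?I \<le> 2 * ?b j + 4 * ?b' j + 8 * ?a j + 16 * ?a' j + 16 * ?F" for j
  proof -
    have "?I = (\<integral>\<^sup>+w. ennreal (((I w - ?S j w) + (?S j w - I' w))\<^sup>2) \<partial>M)" by simp
    also have "\<dots> \<le> 2 * ?b j + 2 * (\<integral>\<^sup>+w. ennreal ((?S j w - I' w)\<^sup>2) \<partial>M)"
      by (rule nn_integral_sq_add_le) (use m 1 2 in measurable)
    also have "(\<integral>\<^sup>+w. ennreal ((?S j w - I' w)\<^sup>2) \<partial>M) = (\<integral>\<^sup>+w. ennreal (((I' w - ?S' j w) + (?S' j w - ?S j w))\<^sup>2) \<partial>M)"
      by (simp add: power2_commute)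
    also have "\<dots> \<le> 2 * ?b' j + 2 * (\<integral>\<^sup>+w. ennreal ((?S' j w - ?S j w)\<^sup>2) \<partial>M)"
      by (rule nn_integral_sq_add_le) (use m 1 2 in measurable)
    also have "(\<integral>\<^sup>+w. ennreal ((?S' j w - ?S j w)\<^sup>2) \<partial>M) = (\<integral>\<^sup>+s\<in>{0..t}. ennreal ((?s' j s - ?s j s)\<^sup>2) \<partial>lborel)"
      by (rule isometry_step_diff[OF 2(1,2) 1(1,2)])
    also have "\<dots> = (\<integral>\<^sup>+s\<in>{0..t}. ennreal (((f s - ?s j s) + (?s' j s - f s))\<^sup>2) \<partial>lborel)" by simp
    also have "\<dots> \<le> 2 * ?a j + 2 * (\<integral>\<^sup>+s\<in>{0..t}. ennreal ((?s' j s - f s)\<^sup>2) \<partial>lborel)"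
      by (rule nn_integral_sq_set_add_le) (use 1(5) in measurable)
    also have "(\<integral>\<^sup>+s\<in>{0..t}. ennreal ((?s' j s - f s)\<^sup>2) \<partial>lborel) = (\<integral>\<^sup>+s\<in>{0..t}. ennreal (((f' s - ?s' j s) + (f s - f' s))\<^sup>2) \<partial>lborel)"
      by (simp add: power2_commute)
    also have "\<dots> \<le> 2 * ?a' j + 2 * ?F"
      by (rule nn_integral_sq_set_add_le) (use 1(5) 2(5) in measurable)
    finally show ?thesis by (simp add: distrib_left mult.assoc[symmetric] add.assoc add_left_mono mult_left_mono)
  qed
  have "(\<lambda>j. 2 * ?b j + 4 * ?b' j + 8 * ?a j + 16 * ?a' j + 16 * ?F) \<longlonglongrightarrow> 2 * 0 + 4 * 0 + 8 * 0 + 16 * 0 + 16 * ?F"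
    by (intro tendsto_add ennreal_tendsto_cmult 1 2 tendsto_const) auto
  from LIMSEQ_le_const[OF this] le show ?thesis by simp
qed

lemma wiener_integral_unique:
  assumes I: "wiener_integral M W t f I" and I': "wiener_integral M W t f I'"
  shows "AE w in M. I w = I' w"
proof -
  have "(\<integral>\<^sup>+w. ennreal ((I w - I' w)\<^sup>2) \<partial>M) = 0" using wiener_integral_diff_le[OF I I'] by simp
  moreover have "I \<in> borel_measurable M" "I' \<in> borel_measurable M" using I I' by (simp_all add: wiener_integral_def)
  ultimately have "AE w in M. ennreal ((I w - I' w)\<^sup>2) = 0" by (subst (asm) nn_integral_0_iff_AE) auto
  then show ?thesis by eventually_elim (simp add: ennreal_eq_0_iff)
qed

text \<open>Comparison with the integral of the zero integrand.\<close>

lemma wiener_integral_L2: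
  assumes t: "t \<ge> 0" and I: "wiener_integral M W t f I"
  shows "(\<integral>\<^sup>+w. ennreal ((I w)\<^sup>2) \<partial>M) \<le> 16 * (\<integral>\<^sup>+s\<in>{0..t}. ennreal ((f s)\<^sup>2) \<partial>lborel)"
proof -
  have "wiener_integral M W t (\<lambda>s. 0) (\<lambda>w. 0)"
    unfolding wiener_integral_def
    by (intro conjI exI[of _ "\<lambda>j. 0"] exI[of _ "\<lambda>j i. t"]) (use t in \<open>auto simp: mono_def\<close>)
  from wiener_integral_diff_le[OF I this] show ?thesis by simp
qed

end

subsection \<open>Exponential integrands\<close>

text \<open>The left-endpoint sum for the Wiener integral of \<open>exp (- l * (t - s))\<close>. It
  involves finitely many times in \<open>[0,t]\<close>, so its pathwise limit \<open>wint\<close>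
  will be adapted.\<close>

definition wsum :: "real \<Rightarrow> real \<Rightarrow> nat \<Rightarrow> (real \<Rightarrow> real) \<Rightarrow> real" where
  "wsum l t n X = (\<Sum>i<Suc n. exp (- l * (t - t * real i / real (Suc n))) * (X (t * real (Suc i) / real (Suc n)) - X (t * real i / real (Suc n))))"

definition wint :: "real \<Rightarrow> real \<Rightarrow> (real \<Rightarrow> real) \<Rightarrow> real" where
  "wint l t X = lim (\<lambda>n. wsum l t n X)"

text \<open>Summation by parts.\<close>

lemma wsum_tendsto:
  assumes t: "t \<ge> 0" and X: "continuous_on {0..t} X" and X0: "X 0 = 0"
  shows "(\<lambda>n. wsum l t n X) \<longlonglongrightarrow> X t - l * duhamel l X t"
proof (cases "t = 0")
  case True
  then show ?thesis using X0 by (simp add: wsum_def)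
next
  case False
  then have t: "t > 0" using t by simp
  define h where "h n = t / real (Suc n)" for n
  let ?f = "\<lambda>s. exp (- l * (t - s)) * X s"
  have eq: "wsum l t n X = X t - (1 - exp (- l * h n)) * X t - (1 - exp (- l * h n)) / h n * riemann_sum n ?f t" for n
  proof -
    define a where "a i = t * real i / real (Suc n)" for i
    define F where "F i = exp (- l * (t - a i))" for i
    define g where "g i = F i * X (a i)" for i
    have aS: "a (Suc i) = a i + h n" for i by (simp add: a_def h_def add_divide_distrib algebra_simps)
    \<comment> \<open>Consecutive exponentials have a constant ratio; summation by parts therefore
      leaves a Riemann sum with the factor \<open>(1 - exp (- l * h n)) / h n\<close>, which tends
      to \<open>l\<close>.\<close>
    have FS: "F i = exp (- l * h n) * F (Suc i)" for i
      unfolding F_def aS by (simp add: algebra_simps flip: exp_add)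
    have e: "a 0 = 0" "a (Suc n) = t" "F (Suc n) = 1" by (simp_all add: a_def F_def)
    have summand: "F i * (X (a (Suc i)) - X (a i)) = (g (Suc i) - g i) - (1 - exp (- l * h n)) * g (Suc i)" for i
      unfolding g_def by (simp add: FS[of i] algebra_simps)
    have "wsum l t n X = (\<Sum>i<Suc n. F i * (X (a (Suc i)) - X (a i)))"
      by (simp only: wsum_def F_def a_def)
    also have "\<dots> = (\<Sum>i<Suc n. g (Suc i) - g i) - (1 - exp (- l * h n)) * (\<Sum>i<Suc n. g (Suc i))"
      unfolding summand by (simp only: sum_subtractf sum_distrib_left)
    also have "(\<Sum>i<Suc n. g (Suc i) - g i) = X t" by (subst sum_lessThan_telescope) (simp add: g_def e X0)
    also have "(\<Sum>i<Suc n. g (Suc i)) = (\<Sum>i<Suc n. g i) + X t"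
      using sum_lessThan_telescope[of g "Suc n"] by (simp add: sum_subtractf g_def e X0 del: sum.lessThan_Suc)
    also have "(\<Sum>i<Suc n. g i) = riemann_sum n ?f t / h n"
    proof -
      have "riemann_sum n ?f t = (\<Sum>i<Suc n. g i) * h n"
        by (simp only: riemann_sum_def g_def F_def a_def h_def sum_distrib_right)
      then show ?thesis using t by (simp add: h_def del: sum.lessThan_Suc)
    qed
    finally show ?thesis by (simp add: algebra_simps)
  qed
  have 1: "(\<lambda>n. 1 - exp (- l * h n)) \<longlonglongrightarrow> 0" unfolding h_def by real_asymp
  have 2: "(\<lambda>n. (1 - exp (- l * h n)) / h n) \<longlonglongrightarrow> l"
  proof -
    have hl: "h \<longlonglongrightarrow> 0" unfolding h_def[abs_def] by real_asymp
    have hn: "\<forall>\<^sub>F n in sequentially. h n \<noteq> 0" using t by (intro always_eventually) (simp add: h_def)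
    have "((\<lambda>x. exp (- l * x)) has_real_derivative exp (- l * 0) * (- l)) (at 0)"
      by (auto intro!: derivative_eq_intros)
    then have "((\<lambda>x. (exp (- l * x) - 1) / x) \<longlongrightarrow> - l) (at 0)"
      unfolding has_field_derivative_iff by simp
    from tendsto_compose_eventually[OF tendsto_minus[OF this] hl hn]
    show ?thesis by (simp add: minus_divide_left)
  qed
  have 3: "(\<lambda>n. riemann_sum n ?f t) \<longlonglongrightarrow> duhamel l X t"
    unfolding duhamel_def using t by (intro riemann_sum_tendsto continuous_intros X) auto
  have "(\<lambda>n. X t - (1 - exp (- l * h n)) * X t - (1 - exp (- l * h n)) / h n * riemann_sum n ?f t) \<longlonglongrightarrow> X t - 0 * X t - l * duhamel l X t"
    by (intro tendsto_intros 1 2 3)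
  then show ?thesis unfolding eq by simp
qed

lemma wint_eq:
  assumes "t \<ge> 0" "continuous_on {0..t} X" "X 0 = 0"
  shows "wint l t X = X t - l * duhamel l X t"
  unfolding wint_def by (rule limI[OF wsum_tendsto[OF assms]])

lemma sum_indicator_Ioc:
  fixes \<tau> :: "nat \<Rightarrow> real"
  assumes "mono \<tau>" shows "(\<Sum>i<n. indicator {\<tau> i<..\<tau> (Suc i)} s) = (indicator {\<tau> 0<..\<tau> n} s :: real)"
proof (induction n)
  case (Suc n)
  have "\<tau> 0 \<le> \<tau> n" "\<tau> n \<le> \<tau> (Suc n)" using assms by (auto simp: mono_def)
  then show ?case using Suc by (auto split: split_indicator)
qed simp

context bm
begin

text \<open>\<open>min\<close> keeps the grid at \<open>t\<close> after index \<open>Suc j\<close>,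
  because \<open>wiener_integral\<close> asks for a monotone sequence in \<open>[0,t]\<close> over
  all indices.\<close>

definition grid :: "real \<Rightarrow> nat \<Rightarrow> nat \<Rightarrow> real" where "grid t j i = t * real (min i (Suc j)) / real (Suc j)"

lemma grid:
  assumes "t \<ge> 0"
  shows "mono (grid t j)" "range (grid t j) \<subseteq> {0..t}" "grid t j 0 = 0" "grid t j (Suc j) = t"
    and "grid t j (Suc i) \<le> grid t j i + t / real (Suc j)"
proof -
  show "mono (grid t j)" unfolding mono_def grid_def
    using assms by (auto intro!: divide_right_mono mult_left_mono)
  have "t * real (min i (Suc j)) / real (Suc j) \<le> t" for i
  proof -
    have "t * real (min i (Suc j)) \<le> t * real (Suc j)" using assms by (intro mult_left_mono) auto
    then show ?thesis by (subst pos_divide_le_eq) auto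
  qed
  then show "range (grid t j) \<subseteq> {0..t}" using assms by (auto simp: grid_def)
  show "grid t j 0 = 0" "grid t j (Suc j) = t" by (simp_all add: grid_def)
  have "t * real (min (Suc i) (Suc j)) \<le> t * (real (min i (Suc j)) + 1)" using assms by (intro mult_left_mono) auto
  then have "t * real (min (Suc i) (Suc j)) / real (Suc j) \<le> t * (real (min i (Suc j)) + 1) / real (Suc j)"
    by (intro divide_right_mono) auto
  then show "grid t j (Suc i) \<le> grid t j i + t / real (Suc j)" by (simp add: grid_def add_divide_distrib distrib_left)
qed

abbreviation gstep :: "real \<Rightarrow> real \<Rightarrow> nat \<Rightarrow> real \<Rightarrow> real" where
  "gstep l t j \<equiv> step (Suc j) (grid t j) (\<lambda>i. exp (- l * (t - grid t j i)))"

lemma stepint_grid: "stepint (Suc j) (grid t j) (\<lambda>i. exp (- l * (t - grid t j i))) w = wsum l t j (\<lambda>s. W s w)"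
  unfolding stepint_def wsum_def grid_def by (rule sum.cong) (auto simp: min_def)

text \<open>Exactly one interval of the grid contains \<open>s\<close>, and there the exponent is
  off by at most \<open>l * t / Suc j\<close>. Time 0 is left out because the intervals are open on
  the left.\<close>

lemma gstep_error:
  assumes l: "l \<ge> 0" and t: "t \<ge> 0" and s: "s \<in> {0<..t}"
  shows "\<bar>exp (- l * (t - s)) - gstep l t j s\<bar> \<le> l * t / real (Suc j)"
proof -
  note g = grid[OF t, of j]
  let ?ind = "\<lambda>i. indicator {grid t j i<..grid t j (Suc i)} s :: real"
  have one: "(\<Sum>i<Suc j. ?ind i) = 1"
    using sum_indicator_Ioc[OF g(1), of s "Suc j"] s by (simp only: g(3,4)) simp
  have "\<bar>exp (- l * (t - s)) - gstep l t j s\<bar> = \<bar>\<Sum>i<Suc j. (exp (- l * (t - s)) - exp (- l * (t - grid t j i))) * ?ind i\<bar>"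
    unfolding step_def left_diff_distrib sum_subtractf sum_distrib_left[symmetric] one by simp
  also have "\<dots> \<le> (\<Sum>i<Suc j. l * t / real (Suc j) * ?ind i)"
  proof (rule order_trans[OF sum_abs sum_mono])
    fix i
    show "\<bar>(exp (- l * (t - s)) - exp (- l * (t - grid t j i))) * ?ind i\<bar> \<le> l * t / real (Suc j) * ?ind i"
    proof (cases "s \<in> {grid t j i<..grid t j (Suc i)}")
      case True
      define d where "d = s - grid t j i"
      have d: "0 \<le> d" "d \<le> t / real (Suc j)" using True g(5)[of i] by (auto simp: d_def)
      have ee: "exp (- l * (t - grid t j i)) = exp (- l * (t - s)) * exp (- l * d)"
        by (simp add: d_def algebra_simps flip: exp_add)
      have "1 + - l * d \<le> exp (- l * d)" by (rule exp_ge_add_one_self)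
      then have e: "1 - exp (- l * d) \<le> l * d" by simp
      have e0: "0 \<le> 1 - exp (- l * d)" using l d by simp
      have "\<bar>exp (- l * (t - s)) - exp (- l * (t - grid t j i))\<bar> = exp (- l * (t - s)) * (1 - exp (- l * d))"
        unfolding ee using e0 by (simp add: algebra_simps flip: abs_mult)
      also have "\<dots> \<le> 1 * (l * d)" using l s e e0 by (intro mult_mono) auto
      also have "\<dots> \<le> l * (t / real (Suc j))" using mult_left_mono[OF d(2) l] by simp
      finally show ?thesis using True by simp
    qed simp
  qed
  also have "\<dots> = l * t / real (Suc j)" unfolding sum_distrib_left[symmetric] one by simp
  finally show ?thesis .
qed

lemma nn_integral_Icc_bound:
  assumes t: "t \<ge> 0" and f: "\<And>s. s \<in> {0<..t} \<Longrightarrow> \<bar>f s\<bar> \<le> (c::real)"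
  shows "(\<integral>\<^sup>+s\<in>{0..t}. ennreal ((f s)\<^sup>2) \<partial>lborel) \<le> ennreal (c\<^sup>2 * t)"
proof -
  have "(\<integral>\<^sup>+s\<in>{0..t}. ennreal ((f s)\<^sup>2) \<partial>lborel) \<le> (\<integral>\<^sup>+s. ennreal (c\<^sup>2) * indicator {0..t} s \<partial>lborel)"
  proof (rule nn_integral_mono_AE)
    show "AE s in lborel. ennreal ((f s)\<^sup>2) * indicator {0..t} s \<le> ennreal (c\<^sup>2) * indicator {0..t} s"
      using AE_lborel_singleton[of 0]
    proof eventually_elim
      case (elim s)
      have "(f s)\<^sup>2 \<le> c\<^sup>2" if "s \<in> {0<..t}" using power_mono[OF f[OF that], of 2] by simp
      then show ?case using elim by (auto split: split_indicator intro!: ennreal_leI)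
    qed
  qed
  also have "\<dots> = ennreal (c\<^sup>2) * ennreal t" using t by (simp add: nn_integral_cmult_indicator)
  finally show ?thesis by (simp add: ennreal_mult t)
qed

lemma wsum_measurable: "t \<ge> 0 \<Longrightarrow> (\<lambda>w. wsum l t n (\<lambda>s. W s w)) \<in> borel_measurable M"
  unfolding stepint_grid[symmetric] using stepint_measurable[OF grid(2)] .

lemma wint_measurable: "t \<ge> 0 \<Longrightarrow> (\<lambda>w. wint l t (\<lambda>s. W s w)) \<in> borel_measurable M"
  unfolding wint_def by (intro borel_measurable_lim_metric wsum_measurable)

text \<open>The pathwise limit is also the limit in mean square: Fatou's lemma carries the isometry
  between two grid sums to the limit. The factor 2 in \<open>2 * e j\<close> arises from comparing
  two grids through the exact integrand.\<close>

lemma wiener_integral_exp: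
  assumes l: "l \<ge> 0" and t: "t \<ge> 0"
  shows "wiener_integral M W t (\<lambda>s. exp (- l * (t - s))) (\<lambda>w. wint l t (\<lambda>s. W s w))"
proof -
  let ?I = "\<lambda>w. wint l t (\<lambda>s. W s w)" and ?S = "\<lambda>j w. wsum l t j (\<lambda>s. W s w)"
  define e where "e j = l * t / real (Suc j)" for j
  have e0: "(\<lambda>j. ennreal ((2 * e j)\<^sup>2 * t)) \<longlonglongrightarrow> 0"
  proof -
    have "e \<longlonglongrightarrow> 0" unfolding e_def[abs_def] by real_asymp
    then have "(\<lambda>j. (2 * e j)\<^sup>2 * t) \<longlonglongrightarrow> (2 * 0)\<^sup>2 * t" by (intro tendsto_intros)
    then have "(\<lambda>j. (2 * e j)\<^sup>2 * t) \<longlonglongrightarrow> 0" by simp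
    then show ?thesis using tendsto_ennrealI by fastforce
  qed
  have eb: "e j \<ge> 0" for j using l t by (simp add: e_def)
  have A: "(\<lambda>j. \<integral>\<^sup>+s\<in>{0..t}. ennreal ((exp (- l * (t - s)) - gstep l t j s)\<^sup>2) \<partial>lborel) \<longlonglongrightarrow> 0"
  proof (rule tendsto_sandwich[OF _ _ tendsto_const e0])
    show "\<forall>\<^sub>F j in sequentially. (\<integral>\<^sup>+s\<in>{0..t}. ennreal ((exp (- l * (t - s)) - gstep l t j s)\<^sup>2) \<partial>lborel) \<le> ennreal ((2 * e j)\<^sup>2 * t)"
    proof (intro always_eventually allI nn_integral_Icc_bound[OF t])
      fix j s assume "s \<in> {0<..t}"
      from gstep_error[OF l t this, of j] eb[of j] show "\<bar>exp (- l * (t - s)) - gstep l t j s\<bar> \<le> 2 * e j"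
        unfolding e_def by linarith
    qed
  qed auto
  have ae: "AE w in M. (\<lambda>n. ?S n w) \<longlonglongrightarrow> ?I w"
    using W_0 W_cont
  proof eventually_elim
    case (elim w)
    have "continuous_on {0..t} (\<lambda>s. W s w)" using elim(2) by (rule continuous_on_subset) auto
    from wsum_tendsto[OF t this elim(1), of l] wint_eq[OF t this elim(1), of l] show ?case by simp
  qed
  have B: "(\<lambda>j. \<integral>\<^sup>+w. ennreal ((?I w - ?S j w)\<^sup>2) \<partial>M) \<longlonglongrightarrow> 0"
  proof (rule tendsto_sandwich[OF _ _ tendsto_const e0])
    have "(\<integral>\<^sup>+w. ennreal ((?I w - ?S j w)\<^sup>2) \<partial>M) \<le> ennreal ((2 * e j)\<^sup>2 * t)" for j
    proof -
      have "(\<integral>\<^sup>+w. ennreal ((?I w - ?S j w)\<^sup>2) \<partial>M) = (\<integral>\<^sup>+w. liminf (\<lambda>n. ennreal ((?S n w - ?S j w)\<^sup>2)) \<partial>M)"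
      proof (rule nn_integral_cong_AE)
        show "AE w in M. ennreal ((?I w - ?S j w)\<^sup>2) = liminf (\<lambda>n. ennreal ((?S n w - ?S j w)\<^sup>2))"
          using ae
        proof eventually_elim
          case (elim w)
          then have "(\<lambda>n. ennreal ((?S n w - ?S j w)\<^sup>2)) \<longlonglongrightarrow> ennreal ((?I w - ?S j w)\<^sup>2)" by (intro tendsto_intros)
          then show ?case by (intro lim_imp_Liminf[symmetric]) auto
        qed
      qed
      also have "\<dots> \<le> liminf (\<lambda>n. \<integral>\<^sup>+w. ennreal ((?S n w - ?S j w)\<^sup>2) \<partial>M)"
        using wsum_measurable[OF t] by (intro nn_integral_liminf) measurable
      also have "\<dots> \<le> ennreal ((2 * e j)\<^sup>2 * t)"
      proof (rule Liminf_le)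
        show "\<forall>\<^sub>F n in sequentially. (\<integral>\<^sup>+w. ennreal ((?S n w - ?S j w)\<^sup>2) \<partial>M) \<le> ennreal ((2 * e j)\<^sup>2 * t)"
          unfolding eventually_sequentially
        proof (intro exI allI impI)
          fix n assume n: "j \<le> n"
          have "(\<integral>\<^sup>+w. ennreal ((?S n w - ?S j w)\<^sup>2) \<partial>M) = (\<integral>\<^sup>+s\<in>{0..t}. ennreal ((gstep l t n s - gstep l t j s)\<^sup>2) \<partial>lborel)"
            unfolding stepint_grid[symmetric] by (rule isometry_step_diff) (intro grid t)+
          also have "\<dots> \<le> ennreal ((2 * e j)\<^sup>2 * t)"
          proof (rule nn_integral_Icc_bound[OF t])
            fix s assume s: "s \<in> {0<..t}"
            have "e n \<le> e j" using n l t by (simp add: e_def divide_left_mono)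
            then show "\<bar>gstep l t n s - gstep l t j s\<bar> \<le> 2 * e j"
              using gstep_error[OF l t s, of n] gstep_error[OF l t s, of j] by (simp add: e_def)
          qed
          finally show "(\<integral>\<^sup>+w. ennreal ((?S n w - ?S j w)\<^sup>2) \<partial>M) \<le> ennreal ((2 * e j)\<^sup>2 * t)" .
        qed
      qed simp
      finally show ?thesis .
    qed
    then show "\<forall>\<^sub>F j in sequentially. (\<integral>\<^sup>+w. ennreal ((?I w - ?S j w)\<^sup>2) \<partial>M) \<le> ennreal ((2 * e j)\<^sup>2 * t)"
      by simp
  qed auto
  show ?thesis
    unfolding wiener_integral_def
  proof (intro conjI)
    show "(\<lambda>s. exp (- l * (t - s))) \<in> borel_measurable borel" by measurable
    show "?I \<in> borel_measurable M" by (rule wint_measurable[OF t])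
  qed (rule exI[of _ Suc], rule exI[of _ "grid t"], rule exI[of _ "\<lambda>j i. exp (- l * (t - grid t j i))"],
    intro conjI allI, (rule grid[OF t])+,
    rule A[unfolded step_def], rule B[folded stepint_grid, unfolded stepint_def])
qed

subsection \<open>The maximum of a Brownian path\<close>

text \<open>Chaining over the dyadic grids. An increment is linearised by \<open>a \<le> r + a ^ 4 / r ^ 3\<close>, with
  \<open>r = (9 / 10) ^ p\<close> on level \<open>p\<close>: the expected fourth powers on that level sum to \<open>3 * T\<^sup>2 / 2 ^ p\<close>, and
  \<open>2 * (9 / 10) ^ 3 > 1\<close>.\<close>

definition quart :: "real \<Rightarrow> nat \<Rightarrow> 'a \<Rightarrow> real" where
  "quart T p w = (\<Sum>i<2^p. (W (T * real (Suc i) / 2^p) w - W (T * real i / 2^p) w)^4)"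

definition level :: "real \<Rightarrow> nat \<Rightarrow> 'a \<Rightarrow> real" where
  "level T p w = (9/10)^p + quart T p w / ((9/10)^p)^3"

definition chain :: "real \<Rightarrow> 'a \<Rightarrow> ennreal" where "chain T w = (\<Sum>p. ennreal (level T p w))"

lemma quart_nonneg: "quart T p w \<ge> 0" unfolding quart_def by (intro sum_nonneg) simp

lemma level_nonneg: "level T p w \<ge> 0" unfolding level_def by (simp add: quart_nonneg)

lemma increment_le_level:
  assumes "i < 2^p" shows "\<bar>W (T * real (Suc i) / 2^p) w - W (T * real i / 2^p) w\<bar> \<le> level T p w"
proof -
  define a where "a = \<bar>W (T * real (Suc i) / 2^p) w - W (T * real i / 2^p) w\<bar>"
  define r :: real where "r = (9/10)^p"
  have r: "r > 0" and a: "a \<ge> 0" by (simp_all add: r_def a_def)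
  have "a^4 = (W (T * real (Suc i) / 2^p) w - W (T * real i / 2^p) w)^4" by (simp add: a_def power_even_abs)
  also have "\<dots> \<le> quart T p w" unfolding quart_def using assms
    by (intro member_le_sum[where f="\<lambda>i. (W (T * real (Suc i) / 2^p) w - W (T * real i / 2^p) w)^4"]) auto
  finally have q: "a^4 \<le> quart T p w" .
  have "a \<le> r + a^4 / r^3"
  proof (cases "a \<le> r")
    case False
    then have "r^3 \<le> a^3" using r by (intro power_mono) auto
    then have "a * r^3 \<le> a * a^3" using a by (intro mult_left_mono)
    then have "a \<le> a^4 / r^3" using r by (simp add: le_divide_eq power_numeral_reduce)
    then show ?thesis using r by simp
  qed (use r a in \<open>simp add: add_increasing2\<close>)
  also have "\<dots> \<le> r + quart T p w / r^3" using q r by (intro add_left_mono divide_right_mono) auto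
  finally show ?thesis by (simp add: a_def r_def level_def)
qed

text \<open>An odd point of the finer grid is one increment away from a point of the coarser grid,
  and an even point already belongs to it.\<close>

lemma dyadic_le_levels:
  assumes "W 0 w = 0" shows "i \<le> 2^p \<Longrightarrow> \<bar>W (T * real i / 2^p) w\<bar> \<le> (\<Sum>q\<le>p. level T q w)"
proof (induction p arbitrary: i)
  case 0
  then have "i = 0 \<or> i = 1" by auto
  then show ?case using assms increment_le_level[of 0 0 T w] level_nonneg[of T 0 w] by auto
next
  case (Suc p)
  show ?case
  proof (cases "even i")
    case True
    then obtain j where j: "i = 2 * j" by blast
    have "T * real i / 2 ^ Suc p = T * real j / 2 ^ p" by (simp add: j)
    then show ?thesis using Suc.IH[of j] Suc.prems j level_nonneg[of T "Suc p" w] by simp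
  next
    case False
    then obtain j where j: "i = 2 * j + 1" using oddE by blast
    have e: "T * real (2 * j) / 2 ^ Suc p = T * real j / 2 ^ p" by simp
    have jp: "2 * j < 2 ^ Suc p" using Suc.prems j by simp
    have "\<bar>W (T * real i / 2 ^ Suc p) w\<bar> \<le> \<bar>W (T * real (Suc (2 * j)) / 2 ^ Suc p) w - W (T * real (2 * j) / 2 ^ Suc p) w\<bar> + \<bar>W (T * real j / 2 ^ p) w\<bar>"
      unfolding e by (simp add: j)
    also have "\<dots> \<le> level T (Suc p) w + (\<Sum>q\<le>p. level T q w)"
      using Suc.prems j by (intro add_mono increment_le_level[OF jp] Suc.IH) simp
    finally show ?thesis by simp
  qed
qed

text \<open>Every \<open>s\<close> is a limit of dyadic points, at which the partial sums of levels
  bound the continuous path.\<close>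

lemma path_le_chain:
  assumes W0: "W 0 w = 0" and c: "continuous_on {0..T} (\<lambda>s. W s w)" and s: "s \<in> {0..T}"
  shows "ennreal \<bar>W s w\<bar> \<le> chain T w"
proof (cases "T = 0")
  case True
  then show ?thesis using W0 s by simp
next
  case False
  then have T: "T > 0" using s by simp
  define i where "i p = nat \<lfloor>s * 2^p / T\<rfloor>" for p :: nat
  define x where "x p = T * real (i p) / 2^p" for p
  have fl: "real (i p) \<le> s * 2^p / T" "s * 2^p / T < real (i p) + 1" for p
    using s T by (auto simp: i_def of_nat_nat)
  have x: "x p \<le> s" "s \<le> x p + T / 2^p" "0 \<le> x p" for p
    using fl[of p] T by (auto simp: x_def field_simps)
  have i2: "i p \<le> 2^p" for p
  proof -
    have "s * 2^p / T \<le> 2^p" using s T by (simp add: divide_le_eq)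
    then have "real (i p) \<le> 2^p" using fl(1)[of p] by linarith
    then show ?thesis by (metis of_nat_le_iff of_nat_numeral of_nat_power)
  qed
  have lim: "x \<longlonglongrightarrow> s"
  proof (rule tendsto_sandwich)
    show "(\<lambda>p. s - T / 2^p) \<longlonglongrightarrow> s" by real_asymp
    show "\<forall>\<^sub>F p in sequentially. s - T / 2^p \<le> x p" "\<forall>\<^sub>F p in sequentially. x p \<le> s"
      using x by (auto intro!: always_eventually simp: diff_le_eq)
  qed (rule tendsto_const)
  have xT: "x p \<in> {0..T}" for p using x[of p] s by auto
  have "(\<lambda>p. W (x p) w) \<longlonglongrightarrow> W s w"
    using continuous_on_tendsto_compose[OF c lim s] xT by simp
  then have wl: "(\<lambda>p. ennreal \<bar>W (x p) w\<bar>) \<longlonglongrightarrow> ennreal \<bar>W s w\<bar>" by (intro tendsto_intros)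
  have "ennreal \<bar>W (x p) w\<bar> \<le> chain T w" for p
  proof -
    have "ennreal \<bar>W (x p) w\<bar> \<le> ennreal (\<Sum>q\<le>p. level T q w)"
      unfolding x_def by (intro ennreal_leI dyadic_le_levels W0 i2)
    also have "\<dots> = (\<Sum>q\<le>p. ennreal (level T q w))" by (simp add: sum_ennreal level_nonneg)
    also have "\<dots> \<le> chain T w" unfolding chain_def by (intro sum_le_suminf) auto
    finally show ?thesis .
  qed
  then show ?thesis by (intro LIMSEQ_le_const2[OF wl]) blast
qed

lemma level_measurable:
  assumes "T \<ge> 0" shows "level T p \<in> borel_measurable M"
  unfolding level_def[abs_def] quart_def[abs_def] using assms by (intro borel_measurable_add borel_measurable_divide borel_measurable_sum borel_measurable_power borel_measurable_diff W_measurable borel_measurable_const) auto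

lemma chain_measurable: "T \<ge> 0 \<Longrightarrow> chain T \<in> borel_measurable M"
  unfolding chain_def[abs_def] using level_measurable by measurable

lemma nn_integral_chain:
  assumes T: "T \<ge> 0"
  shows "(\<integral>\<^sup>+w. chain T w \<partial>M) = (\<Sum>p. ennreal ((9/10)^p + 3 * T\<^sup>2 * (500/729)^p))"
proof -
  have "(\<integral>\<^sup>+w. ennreal (level T p w) \<partial>M) = ennreal ((9/10)^p + 3 * T\<^sup>2 * (500/729)^p)" for p
  proof -
    have "0 \<le> T * real i / 2^p \<and> T * real i / 2^p \<le> T * real (Suc i) / 2^p" for i
      using T by (auto intro!: divide_right_mono mult_left_mono)
    note inc = increment_4_integrable[OF conjunct1[OF this] conjunct2[OF this]] increment_4[OF conjunct1[OF this] conjunct2[OF this]]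
    have d: "T * real (Suc i) / 2^p - T * real i / 2^p = T / 2^p" for i by (simp add: field_simps)
    have qi: "integrable M (quart T p)" unfolding quart_def[abs_def] by (intro Bochner_Integration.integrable_sum inc)
    have "(\<integral>w. quart T p w \<partial>M) = (\<Sum>i<(2::nat)^p. 3 * (T / 2^p)\<^sup>2)"
      unfolding quart_def by (subst Bochner_Integration.integral_sum) (use inc in \<open>simp_all only: d\<close>)
    also have "\<dots> = 3 * T\<^sup>2 * (1/2)^p" by (simp add: power_divide power2_eq_square power_mult_distrib)
    finally have qe: "(\<integral>w. quart T p w \<partial>M) = 3 * T\<^sup>2 * (1/2)^p" .
    have li: "integrable M (level T p)" unfolding level_def[abs_def] using qi by simp
    have "(\<integral>w. level T p w \<partial>M) = (9/10)^p + 3 * T\<^sup>2 * ((1/2)^p / ((9/10)^p)^3)"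
      unfolding level_def using qi qe by (simp add: prob_space)
    \<comment> \<open>\<open>500/729\<close> is \<open>(1/2) / (9/10) ^ 3\<close>; as it is less
      than 1, the expected levels are summable.\<close>
    also have "(1/2)^p / ((9/10)^p)^3 = (500/729 :: real)^p"
    proof -
      have "((9/10)^p)^3 = (729/1000 :: real)^p" by (simp add: power3_eq_cube flip: power_mult_distrib)
      then show ?thesis by (simp flip: power_divide)
    qed
    finally show ?thesis using nn_integral_eq_integral[OF li] level_nonneg by simp
  qed
  then show ?thesis unfolding chain_def using level_measurable[OF T] by (subst nn_integral_suminf) auto
qed

lemma nn_integral_chain_finite: "T \<ge> 0 \<Longrightarrow> (\<Sum>p. ennreal ((9/10)^p + 3 * T\<^sup>2 * (500/729)^p)) < \<infinity>"
proof -
  have "summable (\<lambda>p. (9/10)^p + 3 * T\<^sup>2 * (500/729)^p :: real)"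
    by (intro summable_add summable_mult summable_geometric) auto
  then have "(\<Sum>p. ennreal ((9/10)^p + 3 * T\<^sup>2 * (500/729)^p)) = ennreal (\<Sum>p. (9/10)^p + 3 * T\<^sup>2 * (500/729)^p)"
    by (intro suminf_ennreal2) auto
  then show ?thesis by simp
qed

end

section \<open>The stochastic convolution\<close>

text \<open>The kernel \<open>l * exp (- l * (t - s))\<close> has total mass at most 1. The bound is
  uniform in \<open>l\<close>, so the maximum of a Brownian path controls its convolutions at all
  frequencies.\<close>

lemma abs_duhamel_le:
  assumes l: "l \<ge> 0" and t: "t \<ge> 0" and X: "continuous_on {0..t} X" and S: "\<And>s. s \<in> {0..t} \<Longrightarrow> \<bar>X s\<bar> \<le> S"
  shows "\<bar>X t - l * duhamel l X t\<bar> \<le> 2 * S"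
proof -
  have S0: "S \<ge> 0" using S[of 0] t by auto
  have ex: "((\<lambda>s. l * (exp (- l * (t - s)) * S)) has_integral S * exp (- l * (t - t)) - S * exp (- l * (t - 0))) {0..t}"
    by (rule fundamental_theorem_of_calculus[OF t])
      (auto intro!: derivative_eq_intros simp flip: has_real_derivative_iff_has_vector_derivative)
  have "l * duhamel l X t = integral {0..t} (\<lambda>s. l * (exp (- l * (t - s)) * X s))" by (simp add: duhamel_def)
  also have "norm \<dots> \<le> integral {0..t} (\<lambda>s. l * (exp (- l * (t - s)) * S))"
    using l S by (intro integral_norm_bound_integral integrable_continuous_interval continuous_intros X)
      (auto simp: abs_mult intro!: mult_left_mono)
  also have "\<dots> \<le> S" using integral_unique[OF ex] S0 by simp
  finally show ?thesis using S[of t] t by simp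
qed

lemma hnth_Abs_dominated:
  assumes f0: "f 0 = 0" and f: "\<And>k. \<bar>f k\<bar> \<le> \<zeta> k" and z: "\<zeta> summable_on UNIV"
  shows "hnth (Abs_hs f) = f"
proof (rule hnth_Abs)
  fix G :: "int set" assume G: "finite G"
  let ?x = "\<Sum>k\<in>G. f k *\<^sub>R hbas k"
  have x: "hnth ?x j = (if j \<in> G then f j else 0)" for j
  proof -
    have "hnth ?x j = (\<Sum>k\<in>G. if k = j then f j else 0)"
      using f0 by (auto intro!: sum.cong)
    then show ?thesis using G by simp
  qed
  have "\<bar>hnth ?x j\<bar> \<le> \<zeta> j" for j using f[of j] unfolding x by auto
  from norm_le_infsum_abs(1)[OF this z, of G] show "(\<Sum>k\<in>G. (f k)\<^sup>2) \<le> (\<Sum>\<^sub>\<infinity>k. \<zeta> k)\<^sup>2"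
    unfolding x by simp
qed (rule f0)

lemma le_enn2real: "ennreal x \<le> y \<Longrightarrow> y < \<infinity> \<Longrightarrow> x \<le> enn2real y"
  by (cases y) (auto simp: ennreal_le_iff2)

lemma
  shows trig_Hdot: "(\<lambda>x. \<Sum>k\<in>modes N. c k * ebasis k x) \<in> Hdot m"
    and emb_trig: "emb m (\<lambda>x. \<Sum>k\<in>modes N. c k * ebasis k x) = (\<Sum>k\<in>modes N. (\<bar>of_int k\<bar> ^ m * c k) *\<^sub>R hbas k)"
proof -
  have "\<bar>of_int l\<bar> ^ m * coef (\<lambda>x. \<Sum>k\<in>modes N. c k * ebasis k x) l = hnth (\<Sum>k\<in>modes N. (\<bar>of_int k\<bar> ^ m * c k) *\<^sub>R hbas k) l" for l
  proof -
    have "(\<Sum>k\<in>modes N. \<bar>real_of_int k\<bar> ^ m * c k * (if l = k \<and> k \<noteq> 0 then 1 else 0)) = (\<Sum>k\<in>modes N. if k = l then \<bar>of_int l\<bar> ^ m * c l else 0)"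
      by (rule sum.cong) auto
    then show ?thesis by (simp add: coef_trig_poly)
  qed
  from HdotI[OF H_trig_poly[where A="modes N" and c=c] this]
  show "(\<lambda>x. \<Sum>k\<in>modes N. c k * ebasis k x) \<in> Hdot m"
    "emb m (\<lambda>x. \<Sum>k\<in>modes N. c k * ebasis k x) = (\<Sum>k\<in>modes N. (\<bar>of_int k\<bar> ^ m * c k) *\<^sub>R hbas k)" .
qed

lemmas trig_emb = trig_Hdot emb_trig

locale noise =
  fixes M :: "'a measure" and F :: "real \<Rightarrow> 'a measure" and \<beta> :: "int \<Rightarrow> real \<Rightarrow> 'a \<Rightarrow> real"
    and b :: "int \<Rightarrow> real" and \<nu> :: real and m m_star :: nat
  assumes filtration: "filtered_prob_space M F" and beta: "independent_brownian_motions M F \<beta>"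
    and nu: "\<nu> > 0" and m: "m \<ge> 1" and m_star: "m_star > m" and B_noise: "B_noise b m_star < \<infinity>"
begin

lemma bm_beta: "k \<noteq> 0 \<Longrightarrow> bm M (\<beta> k)"
  using filtration beta by (auto simp: filtered_prob_space_def independent_brownian_motions_def Zstar_def bm_def bm_axioms_def)

lemma subalgebra_F: "t \<ge> 0 \<Longrightarrow> subalgebra M (F t)" and subalgebra_F_F: "0 \<le> s \<Longrightarrow> s \<le> t \<Longrightarrow> subalgebra (F t) (F s)"
  using filtration by (auto simp: filtered_prob_space_def subalgebra_def)

lemma beta_measurable_F: "k \<noteq> 0 \<Longrightarrow> 0 \<le> s \<Longrightarrow> s \<le> t \<Longrightarrow> \<beta> k s \<in> borel_measurable (F t)"
  by (rule measurable_from_subalg[OF subalgebra_F_F[of s t]])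
    (use beta in \<open>simp_all add: independent_brownian_motions_def Zstar_def\<close>)

definition amp :: "int \<Rightarrow> real" where "amp k = \<bar>of_int k\<bar> ^ m * b k"

lemma amp_0 [simp]: "amp 0 = 0" using m by (simp add: amp_def power_0_left)

lemma weighted_summable: "(\<lambda>k. (\<bar>of_int k\<bar> ^ Suc m * b k)\<^sup>2) summable_on UNIV"
proof (rule summable_on_bdd(1)[where C="enn2real (B_noise b m_star)"])
  fix G :: "int set" assume G: "finite G"
  let ?f = "\<lambda>k. real_of_int \<bar>k\<bar> ^ (2 * m_star) * (b k)\<^sup>2"
  have "(\<Sum>k\<in>G. (\<bar>real_of_int k\<bar> ^ Suc m * b k)\<^sup>2) = (\<Sum>k\<in>G - {0}. (\<bar>real_of_int k\<bar> ^ Suc m * b k)\<^sup>2)"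
    by (rule sum.mono_neutral_right) (use G in auto)
  also have "\<dots> \<le> (\<Sum>k\<in>G - {0}. ?f k)"
  proof (rule sum_mono)
    fix k :: int assume "k \<in> G - {0}"
    then have "\<bar>real_of_int k\<bar> \<ge> 1" by auto
    then have "\<bar>real_of_int k\<bar> ^ (2 * Suc m) \<le> \<bar>real_of_int k\<bar> ^ (2 * m_star)" using m_star by (intro power_increasing) auto
    then show "(\<bar>real_of_int k\<bar> ^ Suc m * b k)\<^sup>2 \<le> ?f k"
      unfolding power_mult_distrib power_mult[symmetric] of_int_abs
      by (intro mult_right_mono) (auto simp: mult.commute)
  qed
  finally have *: "(\<Sum>k\<in>G. (\<bar>real_of_int k\<bar> ^ Suc m * b k)\<^sup>2) \<le> (\<Sum>k\<in>G - {0}. ?f k)" .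
  have "ennreal (\<Sum>k\<in>G - {0}. ?f k) = (\<Sum>k\<in>G - {0}. ennreal (?f k))" by (intro sum_ennreal[symmetric]) auto
  also have "\<dots> \<le> B_noise b m_star"
    unfolding B_noise_def by (subst nonneg_infsum_complete) (use G in \<open>auto simp: Zstar_def intro!: SUP_upper2[of "G - {0}"]\<close>)
  finally have "ennreal (\<Sum>k\<in>G - {0}. ?f k) \<le> B_noise b m_star" .
  with * le_enn2real[OF this B_noise] show "(\<Sum>k\<in>G. (\<bar>real_of_int k\<bar> ^ Suc m * b k)\<^sup>2) \<le> enn2real (B_noise b m_star)" by simp
qed auto

text \<open>The derivative gained from \<open>m_star > m\<close> makes the series absolutely convergent.\<close>

lemma amp_summable: "(\<lambda>k. \<bar>amp k\<bar>) summable_on UNIV"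
proof -
  have "(\<lambda>k. \<bar>(\<bar>of_int k\<bar> ^ Suc m * b k) * (1 / of_int k)\<bar>) summable_on UNIV"
    by (rule summable_sq_mult(2)[OF weighted_summable]) (use summable_inverse_sq_int in \<open>simp add: power_divide\<close>)
  moreover have "\<bar>(\<bar>of_int k\<bar> ^ Suc m * b k) * (1 / of_int k)\<bar> = \<bar>amp k\<bar>" for k
    using amp_0 by (cases "k = 0") (auto simp: amp_def abs_mult)
  ultimately show ?thesis by simp
qed

abbreviation sint :: "int \<Rightarrow> real \<Rightarrow> 'a \<Rightarrow> real" where
  "sint k t w \<equiv> wint (\<nu> * (of_int k)\<^sup>2) t (\<lambda>s. \<beta> k s w)"

definition nz :: "int \<Rightarrow> real \<Rightarrow> 'a \<Rightarrow> real" where "nz k t w = amp k * sint k t w"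

text \<open>The stochastic convolution in weighted coordinates. As a limit of finite sums, taken for
  every sample, it is adapted, and on \<open>good\<close> samples its coordinates are the
  \<open>nz k\<close>.\<close>

definition zed :: "real \<Rightarrow> 'a \<Rightarrow> hs" where "zed t w = lim (\<lambda>N. \<Sum>k\<in>modes N. nz k t w *\<^sub>R hbas k)"

lemma nz_0 [simp]: "nz 0 t w = 0" by (simp add: nz_def)

text \<open>All sampling times in \<open>wsum\<close> are at most \<open>t\<close>.\<close>

lemma nz_measurable_F:
  assumes "t \<ge> 0" shows "nz k t \<in> borel_measurable (F t)"
proof (cases "k = 0")
  case False
  have "0 \<le> t * real i / real (Suc n) \<and> t * real i / real (Suc n) \<le> t" if "i \<le> Suc n" for i n
  proof -
    have "t * real i \<le> t * real (Suc n)" using assms that by (intro mult_left_mono) auto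
    then show ?thesis using assms by (subst pos_divide_le_eq) auto
  qed
  then have 1: "(\<lambda>w. \<beta> k (t * real i / real (Suc n)) w) \<in> borel_measurable (F t)" if "i \<le> Suc n" for i n
    using beta_measurable_F[OF False] that by blast
  show ?thesis
    unfolding nz_def[abs_def] wint_def wsum_def
    by (intro borel_measurable_times borel_measurable_const borel_measurable_lim_metric borel_measurable_sum borel_measurable_diff 1) auto
qed (simp add: nz_def[abs_def])

lemma zed_measurable_F: "t \<ge> 0 \<Longrightarrow> zed t \<in> borel_measurable (F t)"
  unfolding zed_def[abs_def]
  by (intro borel_measurable_lim_metric borel_measurable_sum borel_measurable_scaleR nz_measurable_F) auto

lemmas nz_measurable = measurable_from_subalg[OF subalgebra_F nz_measurable_F]
lemmas zed_measurable = measurable_from_subalg[OF subalgebra_F zed_measurable_F]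

text \<open>The factor 2 is the one in \<open>abs_duhamel_le\<close>, so \<open>\<zeta>\<close>
  dominates the coordinates of the stochastic convolution itself. Integer horizons keep the number
  of exceptional sets countable.\<close>

definition good :: "'a \<Rightarrow> bool" where
  "good w \<longleftrightarrow> (\<forall>k. k \<noteq> 0 \<longrightarrow> \<beta> k 0 w = 0 \<and> continuous_on {0..} (\<lambda>t. \<beta> k t w)) \<and>
    (\<forall>n::nat. \<exists>\<zeta>. \<zeta> summable_on UNIV \<and> (\<forall>k. \<forall>t\<in>{0..real n}. 2 * \<bar>amp k\<bar> * \<bar>\<beta> k t w\<bar> \<le> \<zeta> k))"

text \<open>All modes share the same finite expected \<open>chain\<close>, and the amplitudes are
  summable, so by Tonelli's theorem the weighted sum of all chains has finite expectation. It is
  therefore finite almost surely, and its terms serve as \<open>\<zeta>\<close>.\<close>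

lemma AE_good: "AE w in M. good w"
proof -
  have 1: "AE w in M. \<forall>k\<in>-{0}. \<beta> k 0 w = 0 \<and> continuous_on {0..} (\<lambda>t. \<beta> k t w)"
    by (rule AE_ball_countable') (use bm.W_0[OF bm_beta] bm.W_cont[OF bm_beta] in \<open>auto simp: countable_def\<close>)
  \<comment> \<open>Modes are enumerated by \<open>int_decode\<close>, which turns sums over all
    integers into series.\<close>
  define A where "A n i w = (let k = int_decode i in if k = 0 then 0 else ennreal (2 * \<bar>amp k\<bar>) * bm.chain (\<beta> k) (real n) w)" for n i w
  have 2: "AE w in M. (\<Sum>i. A n i w) < \<infinity>" for n
  proof -
    define K where "K = (\<Sum>p. ennreal ((9/10)^p + 3 * (real n)\<^sup>2 * (500/729)^p))"
    have K: "K < \<infinity>" unfolding K_def by (rule bm.nn_integral_chain_finite[OF bm_beta[of 1]]) auto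
    have Am: "A n i \<in> borel_measurable M" for i
      unfolding A_def[abs_def] Let_def using bm.chain_measurable[OF bm_beta, of "int_decode i" "real n"]
      by (cases "int_decode i = 0") auto
    have Ai: "(\<integral>\<^sup>+w. A n i w \<partial>M) \<le> ennreal (2 * \<bar>amp (int_decode i)\<bar>) * K" for i
    proof (cases "int_decode i = 0")
      case False
      then show ?thesis
        unfolding A_def Let_def K_def using bm.chain_measurable[OF bm_beta[OF False], of "real n"]
          bm.nn_integral_chain[OF bm_beta[OF False], of "real n"] by (simp add: nn_integral_cmult)
    qed (simp add: A_def)
    have sm: "summable (\<lambda>i. 2 * \<bar>amp (int_decode i)\<bar>)"
    proof (intro summable_mult summable_on_imp_summable)
      have "(\<lambda>k. \<bar>amp k\<bar>) summable_on range int_decode" using amp_summable by (simp add: surj_int_decode)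
      then show "(\<lambda>i. \<bar>amp (int_decode i)\<bar>) summable_on UNIV"
        using summable_on_reindex[of int_decode UNIV "\<lambda>k. \<bar>amp k\<bar>"] inj_int_decode by (simp add: o_def)
    qed
    have "(\<integral>\<^sup>+w. (\<Sum>i. A n i w) \<partial>M) = (\<Sum>i. \<integral>\<^sup>+w. A n i w \<partial>M)" using Am by (rule nn_integral_suminf)
    also have "\<dots> \<le> (\<Sum>i. ennreal (2 * \<bar>amp (int_decode i)\<bar>) * K)" by (intro suminf_le Ai) auto
    also have "\<dots> = ennreal (\<Sum>i. 2 * \<bar>amp (int_decode i)\<bar>) * K"
      unfolding ennreal_suminf_multc by (subst suminf_ennreal2[OF _ sm]) auto
    also have "\<dots> < \<infinity>" using K by (simp add: ennreal_mult_less_top)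
    finally have "(\<integral>\<^sup>+w. (\<Sum>i. A n i w) \<partial>M) \<noteq> \<infinity>" by simp
    then have "AE w in M. (\<Sum>i. A n i w) \<noteq> \<infinity>" using Am by (intro nn_integral_noteq_infinite) auto
    then show ?thesis by eventually_elim (simp add: less_top)
  qed
  then have "AE w in M. \<forall>n. (\<Sum>i. A n i w) < \<infinity>" by (simp add: AE_all_countable)
  with 1 show ?thesis
  proof eventually_elim
    case (elim w)
    have "\<exists>\<zeta>. \<zeta> summable_on UNIV \<and> (\<forall>k. \<forall>t\<in>{0..real n}. 2 * \<bar>amp k\<bar> * \<bar>\<beta> k t w\<bar> \<le> \<zeta> k)" for n
    proof (intro exI[of _ "\<lambda>k. enn2real (A n (int_encode k) w)"] conjI allI ballI)
      have fin: "A n i w < \<infinity>" for i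
      proof -
        have "A n i w \<le> (\<Sum>i. A n i w)" using sum_le_suminf[of "\<lambda>i. A n i w" "{i}"] by simp
        then show ?thesis using elim(2) le_less_trans by blast
      qed
      show "(\<lambda>k. enn2real (A n (int_encode k) w)) summable_on UNIV"
      proof (rule summable_on_bdd(1)[where C="enn2real (\<Sum>i. A n i w)"])
        fix G :: "int set" assume G: "finite G"
        have "ennreal (\<Sum>k\<in>G. enn2real (A n (int_encode k) w)) = (\<Sum>k\<in>G. A n (int_encode k) w)"
          using fin by (subst sum_ennreal[symmetric]) (auto intro!: sum.cong)
        also have "\<dots> = (\<Sum>i\<in>int_encode ` G. A n i w)" by (subst sum.reindex) (auto simp: inj_int_encode)
        also have "\<dots> \<le> (\<Sum>i. A n i w)" using G by (intro sum_le_suminf) auto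
        finally show "(\<Sum>k\<in>G. enn2real (A n (int_encode k) w)) \<le> enn2real (\<Sum>i. A n i w)"
          using elim(2) by (intro le_enn2real) auto
      qed simp
      fix k t assume t: "t \<in> {0..real n}"
      show "2 * \<bar>amp k\<bar> * \<bar>\<beta> k t w\<bar> \<le> enn2real (A n (int_encode k) w)"
      proof (cases "k = 0")
        case False
        have "ennreal (2 * \<bar>amp k\<bar> * \<bar>\<beta> k t w\<bar>) = ennreal (2 * \<bar>amp k\<bar>) * ennreal \<bar>\<beta> k t w\<bar>" by (simp add: ennreal_mult)
        also have "\<dots> \<le> ennreal (2 * \<bar>amp k\<bar>) * bm.chain (\<beta> k) (real n) w"
          using elim(1) False by (intro mult_left_mono bm.path_le_chain[OF bm_beta[OF False] _ _ t])
            (auto intro: continuous_on_subset)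
        also have "\<dots> = A n (int_encode k) w" using False by (simp add: A_def)
        finally have "ennreal (2 * \<bar>amp k\<bar> * \<bar>\<beta> k t w\<bar>) \<le> A n (int_encode k) w" .
        from le_enn2real[OF this fin] show ?thesis .
      qed simp
    qed
    with elim(1) show ?case unfolding good_def by auto
  qed
qed

section \<open>Pathwise properties of the stochastic convolution\<close>

context
  fixes w assumes good: "good w"
begin

lemma path_cont: "k \<noteq> 0 \<Longrightarrow> continuous_on {0..T} (\<lambda>t. \<beta> k t w)"
  using good by (auto simp: good_def intro: continuous_on_subset)

lemma nz_eq:
  assumes "t \<ge> 0" shows "nz k t w = amp k * (\<beta> k t w - \<nu> * (of_int k)\<^sup>2 * duhamel (\<nu> * (of_int k)\<^sup>2) (\<lambda>s. \<beta> k s w) t)"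
proof (cases "k = 0")
  case False
  then show ?thesis unfolding nz_def using good by (subst wint_eq[OF assms path_cont]) (auto simp: good_def)
qed simp

lemma nz_cont: "continuous_on {0..T} (\<lambda>t. nz k t w)"
proof (cases "k = 0")
  case False
  have "continuous_on {0..T} (\<lambda>t. amp k * (\<beta> k t w - \<nu> * (of_int k)\<^sup>2 * duhamel (\<nu> * (of_int k)\<^sup>2) (\<lambda>s. \<beta> k s w) t))"
    by (intro continuous_intros continuous_on_duhamel path_cont False)
  then show ?thesis by (rule continuous_on_eq) (auto simp: nz_eq)
qed simp

lemma nz_dominated:
  "\<exists>\<zeta>. \<zeta> summable_on UNIV \<and> (\<forall>k. \<forall>t\<in>{0..T}. \<bar>nz k t w\<bar> \<le> \<zeta> k)"
proof -
  obtain n :: nat where n: "T \<le> real n" using real_arch_simple by blast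
  obtain \<zeta> where z: "\<zeta> summable_on UNIV" "\<And>k t. t \<in> {0..real n} \<Longrightarrow> 2 * \<bar>amp k\<bar> * \<bar>\<beta> k t w\<bar> \<le> \<zeta> k"
    using good[unfolded good_def, THEN conjunct2, rule_format, of n] by auto
  have "\<bar>nz k t w\<bar> \<le> \<zeta> k" if t: "t \<in> {0..T}" for k t
  proof (cases "amp k = 0")
    case True
    then show ?thesis using z(2)[of t k] t n by (simp add: nz_def)
  next
    case False
    then have k: "k \<noteq> 0" by auto
    have "\<bar>\<beta> k s w\<bar> \<le> \<zeta> k / (2 * \<bar>amp k\<bar>)" if "s \<in> {0..t}" for s
      using z(2)[of s k] that t n False by (simp add: pos_le_divide_eq mult_ac)
    from abs_duhamel_le[OF _ _ path_cont[OF k] this, of "\<nu> * (of_int k)\<^sup>2"] t nu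
    have "\<bar>\<beta> k t w - \<nu> * (of_int k)\<^sup>2 * duhamel (\<nu> * (of_int k)\<^sup>2) (\<lambda>s. \<beta> k s w) t\<bar> \<le> \<zeta> k / \<bar>amp k\<bar>"
      by simp
    then show ?thesis using t False by (subst nz_eq) (auto simp: abs_mult pos_le_divide_eq mult_ac)
  qed
  with z(1) show ?thesis by blast
qed

lemma hnth_zed:
  assumes "t \<ge> 0" shows "hnth (zed t w) k = nz k t w"
proof -
  obtain \<zeta> where z: "\<zeta> summable_on UNIV" "\<And>k. \<bar>nz k t w\<bar> \<le> \<zeta> k"
    using nz_dominated[of t] assms by auto
  define y where "y = Abs_hs (\<lambda>k. nz k t w)"
  have y: "hnth y = (\<lambda>k. nz k t w)" unfolding y_def by (rule hnth_Abs_dominated[OF _ z(2,1)]) simp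
  have "(\<Sum>k\<in>modes N. nz k t w *\<^sub>R hbas k) = hproj N y" for N by (simp add: hproj_def y)
  then have "zed t w = y" unfolding zed_def using hproj_tendsto[of y] by (simp add: limI)
  then show ?thesis by (simp add: y)
qed

text \<open>Continuity passes from the coordinates to \<open>hs\<close> because the tails are
  dominated, uniformly in time, by those of the summable sequence \<open>\<zeta>\<close>.\<close>

lemma zed_cont: "continuous_on {0..T} (\<lambda>t. zed t w)"
proof -
  obtain \<zeta> where z: "\<zeta> summable_on UNIV" "\<And>k t. t \<in> {0..T} \<Longrightarrow> \<bar>nz k t w\<bar> \<le> \<zeta> k"
    using nz_dominated[of T] by blast
  consider "T < 0" | "T \<ge> 0" by linarith
  then show ?thesis
  proof cases
    assume T: "T \<ge> 0"
    show ?thesis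
    proof (rule uniform_limit_hproj_continuous)
      show "continuous_on {0..T} (\<lambda>t. hnth (zed t w) k)" for k
        by (rule continuous_on_eq[OF nz_cont]) (simp add: hnth_zed)
      have z0: "\<zeta> k \<ge> 0" for k using z(2)[of 0 k] T by auto
      define y where "y = Abs_hs (\<lambda>k. if k = 0 then 0 else \<zeta> k)"
      have y: "hnth y = (\<lambda>k. if k = 0 then 0 else \<zeta> k)"
        unfolding y_def by (rule hnth_Abs_dominated[OF _ _ z(1)]) (use z0 in auto)
      show "uniform_limit {0..T} (\<lambda>N t. hproj N (zed t w)) (\<lambda>t. zed t w) sequentially"
      proof (rule uniform_limitI)
        fix e :: real assume "e > 0"
        with hproj_tendsto[of y] have "\<forall>\<^sub>F N in sequentially. dist (hproj N y) y < e" by (rule tendstoD)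
        then show "\<forall>\<^sub>F N in sequentially. \<forall>t\<in>{0..T}. dist (hproj N (zed t w)) (zed t w) < e"
        proof eventually_elim
          case (elim N)
          show ?case
          proof
            fix t assume t: "t \<in> {0..T}"
            have "norm (hproj N (zed t w) - zed t w) \<le> norm (hproj N y - y)"
              using t z(2)[OF t] z0 by (intro norm_hs_coord_mono) (auto simp: hnth_zed y)
            then show "dist (hproj N (zed t w)) (zed t w) < e" using elim by (simp add: dist_norm)
          qed
        qed
      qed
    qed
  qed simp
qed

lemma Hdot_synth_zed_diff:
  assumes t: "t \<ge> 0"
  shows "Hdot_norm m (\<lambda>x. synth m (zed t w) x - (\<Sum>k\<in>modes N. b k * sint k t w * ebasis k x))
    = norm (zed t w - hproj N (zed t w))"
  using trig_emb[where N=N and c="\<lambda>k. b k * sint k t w"]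
  by (subst Hdot_norm_diff) (auto simp: synth_Hdot[OF m] emb_synth[OF m] hproj_def hnth_zed[OF t] nz_def amp_def mult_ac)

end

section \<open>Mean square convergence, and uniqueness of the continuous version\<close>

lemma nn_integral_nz_le:
  assumes t: "t \<ge> 0" shows "(\<integral>\<^sup>+w. ennreal ((nz k t w)\<^sup>2) \<partial>M) \<le> ennreal (16 * t * (amp k)\<^sup>2)"
proof (cases "k = 0")
  case False
  interpret bm M "\<beta> k" by (rule bm_beta[OF False])
  let ?l = "\<nu> * (of_int k)\<^sup>2"
  let ?I = "\<lambda>w. wint ?l t (\<lambda>s. \<beta> k s w)"
  have l: "?l \<ge> 0" using nu by simp
  have "(\<integral>\<^sup>+w. ennreal ((nz k t w)\<^sup>2) \<partial>M) = (\<integral>\<^sup>+w. ennreal ((amp k)\<^sup>2) * ennreal ((?I w)\<^sup>2) \<partial>M)"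
    by (simp add: nz_def power_mult_distrib ennreal_mult)
  also have "\<dots> = ennreal ((amp k)\<^sup>2) * (\<integral>\<^sup>+w. ennreal ((?I w)\<^sup>2) \<partial>M)"
    by (rule nn_integral_cmult) (use wint_measurable[OF t, of ?l] in measurable)
  also have "\<dots> \<le> ennreal ((amp k)\<^sup>2) * (16 * ennreal (1\<^sup>2 * t))"
  proof (intro mult_left_mono)
    have "(\<integral>\<^sup>+w. ennreal ((?I w)\<^sup>2) \<partial>M) \<le> 16 * (\<integral>\<^sup>+s\<in>{0..t}. ennreal ((exp (- ?l * (t - s)))\<^sup>2) \<partial>lborel)"
      by (rule wiener_integral_L2[OF t wiener_integral_exp[OF l t]])
    also have "\<dots> \<le> 16 * ennreal (1\<^sup>2 * t)"
      by (intro mult_left_mono nn_integral_Icc_bound[OF t]) (use l in auto)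
    finally show "(\<integral>\<^sup>+w. ennreal ((?I w)\<^sup>2) \<partial>M) \<le> 16 * ennreal (1\<^sup>2 * t)" .
  qed simp
  also have "\<dots> = ennreal (16 * t * (amp k)\<^sup>2)" using t by (simp add: ennreal_mult mult_ac)
  finally show ?thesis .
qed simp

text \<open>Second moments add up over the modes and are at most \<open>16 * t\<close> times the
  squared amplitudes, so the tail of the amplitude sequence controls everything. Fatou's lemma
  passes from finitely many modes to all.\<close>

lemma zed_tail:
  assumes t: "t \<ge> 0"
  shows "(\<lambda>N. \<integral>\<^sup>+w. ennreal ((norm (zed t w - hproj N (zed t w)))\<^sup>2) \<partial>M) \<longlonglongrightarrow> 0"
proof -
  define y where "y = Abs_hs amp"
  have y: "hnth y = amp" unfolding y_def by (rule hnth_Abs_dominated[OF _ order_refl amp_summable]) simp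
  note [measurable] = zed_measurable[OF t t]
  let ?e = "\<lambda>N. ennreal (16 * t * (norm (y - hproj N y))\<^sup>2)"
  have le: "(\<integral>\<^sup>+w. ennreal ((norm (zed t w - hproj N (zed t w)))\<^sup>2) \<partial>M) \<le> ?e N" for N
  proof -
    let ?d = "\<lambda>w. zed t w - hproj N (zed t w)"
    have "(\<integral>\<^sup>+w. ennreal ((norm (?d w))\<^sup>2) \<partial>M) = (\<integral>\<^sup>+w. liminf (\<lambda>n. ennreal ((norm (hproj n (?d w)))\<^sup>2)) \<partial>M)"
    proof (intro nn_integral_cong lim_imp_Liminf[symmetric])
      show "(\<lambda>n. ennreal ((norm (hproj n (?d w)))\<^sup>2)) \<longlonglongrightarrow> ennreal ((norm (?d w))\<^sup>2)" for w
        by (intro tendsto_intros hproj_tendsto)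
    qed auto
    also have "\<dots> \<le> liminf (\<lambda>n. \<integral>\<^sup>+w. ennreal ((norm (hproj n (?d w)))\<^sup>2) \<partial>M)"
      unfolding norm_hproj_sq hnth_simps hnth_hproj by (intro nn_integral_liminf) measurable
    also have "\<dots> \<le> ?e N"
    proof (rule Liminf_le)
      have "(\<integral>\<^sup>+w. ennreal ((norm (hproj n (?d w)))\<^sup>2) \<partial>M) \<le> ?e N" for n
      proof -
        have eq: "AE w in M. ennreal ((norm (hproj n (?d w)))\<^sup>2) = (\<Sum>k\<in>modes n - modes N. ennreal ((nz k t w)\<^sup>2))"
          using AE_good
        proof eventually_elim
          case (elim w)
          have "(\<Sum>k\<in>modes n. (hnth (?d w) k)\<^sup>2) = (\<Sum>k\<in>modes n - modes N. (nz k t w)\<^sup>2)"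
            by (rule sum.mono_neutral_cong_right) (auto simp: hnth_zed[OF elim t])
          then show ?case unfolding norm_hproj_sq by (subst sum_ennreal) simp_all
        qed
        have "(\<integral>\<^sup>+w. ennreal ((norm (hproj n (?d w)))\<^sup>2) \<partial>M) = (\<Sum>k\<in>modes n - modes N. \<integral>\<^sup>+w. ennreal ((nz k t w)\<^sup>2) \<partial>M)"
          by (subst nn_integral_cong_AE[OF eq], rule nn_integral_sum) (use nz_measurable[OF t t] in measurable)
        also have "\<dots> \<le> (\<Sum>k\<in>modes n - modes N. ennreal (16 * t * (amp k)\<^sup>2))" by (intro sum_mono nn_integral_nz_le t)
        also have "\<dots> = ennreal (\<Sum>k\<in>modes n - modes N. 16 * t * (amp k)\<^sup>2)" using t by (intro sum_ennreal) auto
        also have "(\<Sum>k\<in>modes n - modes N. 16 * t * (amp k)\<^sup>2) = 16 * t * (\<Sum>k\<in>modes n - modes N. (hnth (y - hproj N y) k)\<^sup>2)"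
          unfolding sum_distrib_left by (intro sum.cong) (auto simp: y)
        also have "ennreal \<dots> \<le> ?e N"
          using t by (intro ennreal_leI mult_left_mono sum_hnth_le) auto
        finally show ?thesis .
      qed
      then show "\<forall>\<^sub>F n in sequentially. (\<integral>\<^sup>+w. ennreal ((norm (hproj n (?d w)))\<^sup>2) \<partial>M) \<le> ?e N"
        by simp
    qed simp
    finally show ?thesis .
  qed
  have "?e \<longlonglongrightarrow> ennreal (16 * t * (norm (y - y))\<^sup>2)"
    by (intro tendsto_intros hproj_tendsto)
  then have "?e \<longlonglongrightarrow> 0" by simp
  from tendsto_sandwich[OF _ _ tendsto_const this] le show ?thesis by simp
qed

lemma wiener_integral_wint:
  assumes "k \<noteq> 0" "t \<ge> 0"
  shows "wiener_integral M (\<beta> k) t (\<lambda>s. exp (- \<nu> * (of_int k)\<^sup>2 * (t - s))) (sint k t)"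
  using bm.wiener_integral_exp[OF bm_beta[OF assms(1)] _ assms(2), of "\<nu> * (of_int k)\<^sup>2"] nu by simp

lemma stochastic_convolution_zed: "stochastic_convolution M \<beta> b \<nu> m T (\<lambda>t w. synth m (zed t w))"
  unfolding stochastic_convolution_def
proof (intro conjI ballI)
  fix t assume "t \<in> {0..T}"
  then have t: "t \<ge> 0" by simp
  show "(\<lambda>w. synth m (zed t w)) \<in> measurable M (Hdot_borel m)"
    using zed_measurable[OF t t] by (simp add: measurable_Hdot_borel_iff[OF m] synth_Hdot[OF m] emb_synth[OF m])
  show "\<exists>I. (\<forall>k\<in>Zstar. wiener_integral M (\<beta> k) t (\<lambda>s. exp (- \<nu> * (of_int k)\<^sup>2 * (t - s))) (I k)) \<and>
    (\<lambda>N. \<integral>\<^sup>+w. ennreal ((Hdot_norm m (\<lambda>x. synth m (zed t w) x - (\<Sum>k\<in>modes N. b k * I k w * ebasis k x)))\<^sup>2) \<partial>M) \<longlonglongrightarrow> 0"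
  proof (intro exI[of _ "\<lambda>k. sint k t"] conjI ballI wiener_integral_wint t)
    let ?L = "\<lambda>N. \<integral>\<^sup>+w. ennreal ((Hdot_norm m (\<lambda>x. synth m (zed t w) x - (\<Sum>k\<in>modes N. b k * sint k t w * ebasis k x)))\<^sup>2) \<partial>M"
    have "?L N
      = (\<integral>\<^sup>+w. ennreal ((norm (zed t w - hproj N (zed t w)))\<^sup>2) \<partial>M)" for N
      by (rule nn_integral_cong_AE) (use AE_good in eventually_elim, simp only: Hdot_synth_zed_diff[OF _ t])
    then show "?L \<longlonglongrightarrow> 0"
      using zed_tail[OF t] by simp
  qed (auto simp: Zstar_def)
qed (use AE_good in \<open>eventually_elim, simp add: Hdot_continuous_iff synth_Hdot[OF m] emb_synth[OF m] zed_cont\<close>)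

text \<open>Coordinate \<open>k\<close> of the approximating sum no longer changes once
  \<open>modes N\<close> contains \<open>k\<close>, so convergence in mean square forces the
  coordinate of \<open>Z t\<close> to be that Wiener integral, which is unique almost
  surely.\<close>

lemma stochastic_convolution_unique_at:
  assumes Z: "stochastic_convolution M \<beta> b \<nu> m T Z" and t: "t \<in> {0..T}"
  shows "AE w in M. emb m (Z t w) = zed t w"
proof -
  have t0: "t \<ge> 0" using t by simp
  have Zm: "Z t \<in> measurable M (Hdot_borel m)" using Z t by (simp add: stochastic_convolution_def)
  then have ZH: "\<And>w. w \<in> space M \<Longrightarrow> Z t w \<in> Hdot m" and Zb: "(\<lambda>w. emb m (Z t w)) \<in> borel_measurable M"
    by (simp_all add: measurable_Hdot_borel_iff[OF m])
  obtain I :: "int \<Rightarrow> 'a \<Rightarrow> real" where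
    I: "\<And>k. k \<noteq> 0 \<Longrightarrow> wiener_integral M (\<beta> k) t (\<lambda>s. exp (- \<nu> * (of_int k)\<^sup>2 * (t - s))) (I k)" and
    L: "(\<lambda>N. \<integral>\<^sup>+w. ennreal ((Hdot_norm m (\<lambda>x. Z t w x - (\<Sum>k\<in>modes N. b k * I k w * ebasis k x)))\<^sup>2) \<partial>M) \<longlonglongrightarrow> 0" (is "?L \<longlonglongrightarrow> 0")
    using Z[unfolded stochastic_convolution_def Zstar_def mem_Collect_eq, THEN conjunct2, THEN conjunct2, THEN bspec, OF t]
    by - (elim exE conjE, rule that, blast+)
  have "AE w in M. \<forall>k\<in>-{0}. I k w = sint k t w"
    by (rule AE_ball_countable') (use bm.wiener_integral_unique[OF bm_beta I wiener_integral_wint[OF _ t0]] in auto)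
  then have IW: "AE w in M. \<forall>k. k \<noteq> 0 \<longrightarrow> I k w = sint k t w" by eventually_elim simp
  let ?n = "\<lambda>N w. Hdot_norm m (\<lambda>x. Z t w x - (\<Sum>k\<in>modes N. b k * I k w * ebasis k x))"
  have "AE w in M. hnth (emb m (Z t w)) k = nz k t w" for k
  proof (cases "k = 0")
    case k: False
    obtain N0 where N0: "{k} \<subseteq> modes N0" using finite_subset_modes[of "{k}"] k by auto
    have le: "(\<integral>\<^sup>+w. ennreal ((hnth (emb m (Z t w)) k - nz k t w)\<^sup>2) \<partial>M) \<le> ?L N" if "N \<ge> N0" for N
    proof (rule nn_integral_mono_AE)
      have kN: "k \<in> modes N" using N0 modes_mono[OF that] by auto
      show "AE w in M. ennreal ((hnth (emb m (Z t w)) k - nz k t w)\<^sup>2) \<le> ennreal ((?n N w)\<^sup>2)"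
        using IW AE_space
      proof eventually_elim
        case (elim w)
        note te = trig_emb[where N=N and c="\<lambda>k. b k * I k w"]
        have "hnth (emb m (Z t w)) k - nz k t w = hnth (emb m (Z t w) - emb m (\<lambda>x. \<Sum>k\<in>modes N. b k * I k w * ebasis k x)) k"
          using elim k kN by (simp add: hnth_emb[OF te(1)] coef_trig_poly nz_def amp_def)
        then have "\<bar>hnth (emb m (Z t w)) k - nz k t w\<bar> \<le> ?n N w"
          unfolding Hdot_norm_diff[OF ZH[OF elim(2)] te(1)] by (simp only: abs_hnth_le)
        from power_mono[OF this, of 2] show ?case by (intro ennreal_leI) simp
      qed
    qed
    have "(\<integral>\<^sup>+w. ennreal ((hnth (emb m (Z t w)) k - nz k t w)\<^sup>2) \<partial>M) \<le> 0"
      by (rule LIMSEQ_le_const[OF L]) (use le in blast)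
    then have "AE w in M. ennreal ((hnth (emb m (Z t w)) k - nz k t w)\<^sup>2) = 0"
      using Zb nz_measurable[OF t0 t0] by (subst nn_integral_0_iff_AE[symmetric]) auto
    then show ?thesis by eventually_elim (simp add: ennreal_eq_0_iff)
  qed simp
  then have "AE w in M. \<forall>k. hnth (emb m (Z t w)) k = nz k t w" by (simp add: AE_all_countable)
  with AE_good show ?thesis by eventually_elim (auto intro!: hs_eqI simp: hnth_zed[OF _ t0])
qed

text \<open>Equality at each fixed time holds simultaneously at all rational times in the open
  interval; continuity of both paths extends it to \<open>[0,T]\<close>.\<close>

lemma stochastic_convolution_unique:
  assumes Z: "stochastic_convolution M \<beta> b \<nu> m T Z" and T: "T > 0"
  shows "AE w in M. \<forall>t\<in>{0..T}. Z t w \<in> Hdot m \<and> emb m (Z t w) = zed t w"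
proof -
  have "AE w in M. \<forall>t\<in>{0<..<T} \<inter> \<rat>. emb m (Z t w) = zed t w"
    by (rule AE_ball_countable') (use stochastic_convolution_unique_at[OF Z] countable_rat in \<open>auto intro: countable_Int2\<close>)
  moreover have "AE w in M. Hdot_continuous_on m {0..T} (\<lambda>t. Z t w)" using Z by (simp add: stochastic_convolution_def)
  ultimately show ?thesis using AE_good
  proof eventually_elim
    case (elim w)
    have cl: "closure ({0<..<T} \<inter> \<rat>) = {0..T}"
      using closure_open_Int_superset[of "{0<..<T}" "\<rat>"] closure_greaterThanLessThan[OF T] Rats_closure_real by auto
    have "continuous_on (closure ({0<..<T} \<inter> \<rat>)) (\<lambda>t. emb m (Z t w) - zed t w)"
      unfolding cl using elim(2) by (intro continuous_intros zed_cont elim(3)) (simp add: Hdot_continuous_iff)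
    from continuous_constant_on_closure[OF this, of 0] elim(1) have "\<forall>t\<in>{0..T}. emb m (Z t w) - zed t w = 0"
      unfolding cl by auto
    then show ?case using elim(2) by (simp add: Hdot_continuous_iff)
  qed
qed

end

section \<open>The projected equation\<close>

lemma ebasis_deriv: "(ebasis k has_real_derivative - of_int k * ebasis (- k) x) (at x)"
  unfolding ebasis_def[abs_def] by (cases "k > 0"; cases "k < 0") (auto intro!: derivative_eq_intros simp: frac_eq_eq mult.assoc)

lemma uminus_modes: "bij_betw uminus (modes N) (modes N)"
  by (rule bij_betwI[where g=uminus]) (auto simp: modes_def)

lemma trig_deriv:
  "((\<lambda>x. \<Sum>k\<in>modes N. c k * ebasis k x) has_real_derivative (\<Sum>k\<in>modes N. of_int k * c (- k) * ebasis k x)) (at x)"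
proof -
  have "((\<lambda>x. \<Sum>k\<in>modes N. c k * ebasis k x) has_real_derivative (\<Sum>k\<in>modes N. c k * (- of_int k * ebasis (- k) x))) (at x)"
    by (intro DERIV_sum DERIV_cmult ebasis_deriv)
  also have "(\<Sum>k\<in>modes N. c k * (- of_int k * ebasis (- k) x)) = (\<Sum>k\<in>modes N. of_int k * c (- k) * ebasis k x)"
    by (rule sum.reindex_bij_betw[OF uminus_modes, symmetric, THEN trans]) (simp add: mult_ac)
  finally show ?thesis .
qed

lemma deriv_trig: "deriv (\<lambda>x. \<Sum>k\<in>modes N. c k * ebasis k x) = (\<lambda>x. \<Sum>k\<in>modes N. (of_int k * c (- k)) * ebasis k x)"
  by (rule ext) (rule DERIV_imp_deriv[OF trig_deriv])

lemma deriv2_trig: "deriv (deriv (\<lambda>x. \<Sum>k\<in>modes N. c k * ebasis k x)) = (\<lambda>x. \<Sum>k\<in>modes N. - ((of_int k)\<^sup>2 * c k) * ebasis k x)"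
  unfolding deriv_trig by (simp add: power2_eq_square mult.assoc)

lemma cf_deriv: "cf (\<lambda>k. of_int k * d (- k)) k = \<i> * of_int k * cf d k"
  by (simp add: cf_def complex_eq_iff sgn_if field_simps)

lemma trig_spanE:
  assumes "f \<in> trig_span N"
  shows "f = (\<lambda>x. \<Sum>k\<in>modes N. coef f k * ebasis k x)" and "k \<notin> modes N \<Longrightarrow> coef f k = 0"
proof -
  obtain c where f: "f = (\<lambda>x. \<Sum>k\<in>modes N. c k * ebasis k x)" using assms by (auto simp: trig_span_def)
  have c: "coef f k = (if k \<in> modes N then c k else 0)" for k unfolding f by (rule coef_trig_poly) auto
  show "f = (\<lambda>x. \<Sum>k\<in>modes N. coef f k * ebasis k x)" by (subst f) (simp add: c)
  show "k \<notin> modes N \<Longrightarrow> coef f k = 0" by (simp add: c)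
qed

lemma trig_span_Hdot: "f \<in> trig_span N \<Longrightarrow> f \<in> Hdot m"
  using trig_Hdot[where N=N and c="coef f"] trig_spanE(1)[of f N] by simp

lemma coef_velocity:
  assumes w: "\<omega> \<in> Hdot m" and k: "k \<noteq> 0" shows "coef (velocity \<omega>) k = - coef \<omega> k / \<bar>of_int k\<bar>"
proof -
  have "coef (velocity \<omega>) k = rc (fourier (velocity \<omega>)) k"
    by (rule coef_fourier[OF H_circleD(1)[OF velocity_H[OF w]] k])
  also have "\<dots> = - rc (fourier \<omega>) k / \<bar>of_int k\<bar>"
    using k by (auto simp: rc_def fourier_velocity[OF w] Re_divide_of_real Im_divide_of_real simp flip: of_int_abs)
  also have "rc (fourier \<omega>) k = coef \<omega> k" by (rule coef_fourier[OF HdotD(2)[OF w] k, symmetric])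
  finally show ?thesis .
qed

text \<open>The inner projections act trivially on \<open>trig_span N\<close>. For
  \<open>a = -2\<close> the projected term \<open>v' g + 2 v g'\<close> equals
  \<open>2 (v g)' - v' g\<close>, the nonlinearity of the full equation, and hence has the same
  symbol \<open>csym\<close>.\<close>

lemma galerkin_nonlinearity_eq:
  assumes f: "f \<in> trig_span N"
  shows "galerkin_nonlinearity (-2) N f = (\<lambda>x. \<Sum>k\<in>modes N. rc (conv (coef f) (coef f)) k * ebasis k x)"
proof -
  note fH = trig_span_Hdot[OF f, of 1]
  define c where "c = coef f"
  define d where "d k = (if k \<in> modes N then - c k / \<bar>of_int k\<bar> else 0)" for k
  have c0: "c k = 0" if "k \<notin> modes N" for k using trig_spanE(2)[OF f that] by (simp add: c_def)
  have g: "proj N f = (\<lambda>x. \<Sum>k\<in>modes N. c k * ebasis k x)" by (simp add: proj_def c_def)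
  have gf: "proj N f = f" unfolding g c_def using trig_spanE(1)[OF f] by simp
  have v: "proj N (velocity (proj N f)) = (\<lambda>x. \<Sum>k\<in>modes N. d k * ebasis k x)"
    unfolding gf unfolding proj_def by (intro ext sum.cong refl) (auto simp: coef_velocity[OF fH] d_def c_def modes_def)
  let ?t = "\<lambda>a x. \<Sum>k\<in>modes N. a k * ebasis k x"
  have ct: "coef (?t a) = a" if "\<And>k. k \<notin> modes N \<Longrightarrow> a k = 0" for a
    using that by (auto simp: coef_trig_poly fun_eq_iff)
  have ft: "fourier (?t a) k = cf a k" if "\<And>k. k \<notin> modes N \<Longrightarrow> a k = 0" for a k
  proof -
    have "coef (?t a) = a" by (rule ct) (rule that)
    then show ?thesis by (subst fourier_cf_H[OF H_trig_poly]) simp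
  qed
  have sf: "(\<lambda>j. norm (fourier (?t a) j)) summable_on UNIV" if "\<And>k. k \<notin> modes N \<Longrightarrow> a k = 0" for a
  proof (rule summable_on_cong_neutral[THEN iffD1])
    show "(\<lambda>j. norm (fourier (?t a) j)) summable_on modes N" by (rule summable_on_finite) simp
    have "- k \<notin> modes N" if "k \<notin> modes N" for k using that by (simp add: modes_def)
    then show "norm (fourier (?t a) k) = 0" if "k \<in> UNIV - modes N" for k
      using that \<open>\<And>k. k \<notin> modes N \<Longrightarrow> a k = 0\<close> by (simp add: ft cf_def abs_if complex_eq_iff)
  qed auto
  let ?D = "\<lambda>a k. of_int k * a (- k) :: real"
  have neg: "- k \<in> modes N \<longleftrightarrow> k \<in> modes N" for k by (simp add: modes_def)
  have d0: "d k = 0" if "k \<notin> modes N" for k using that by (simp add: d_def)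
  have Dz: "?D a k = 0" if "\<And>k. k \<notin> modes N \<Longrightarrow> a k = 0" "k \<notin> modes N" for a k using that neg[of k] by simp
  define h where "h = (\<lambda>x. ?t (?D d) x * ?t c x + 2 * (?t d x * ?t (?D c) x))"
  have sD: "(\<lambda>j. norm (fourier (?t (?D d)) j)) summable_on UNIV" by (rule sf) (rule Dz[OF d0])
  have sd: "(\<lambda>j. norm (fourier (?t d) j)) summable_on UNIV" by (rule sf) (rule d0)
  note tL = L2_trig_poly[where A="modes N"]
  have L: "(\<lambda>x. ?t (?D d) x * ?t c x) \<in> L2_circle" "(\<lambda>x. ?t d x * ?t (?D c) x) \<in> L2_circle"
    by (rule L2_product[OF tL sD tL], rule L2_product[OF tL sd tL])
  have hL: "h \<in> L2_circle" unfolding h_def by (rule L2_add[OF L(1) L2_scale[OF L(2)]])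
  have "((\<lambda>j. fourier (?t (?D d)) j * fourier (?t c) (k - j) + 2 * (fourier (?t d) j * fourier (?t (?D c)) (k - j))) has_sum fourier h k) UNIV" for k
  proof -
    have "fourier h k = fourier (\<lambda>x. ?t (?D d) x * ?t c x) k + 2 * fourier (\<lambda>x. ?t d x * ?t (?D c) x) k"
      unfolding h_def fourier_add[OF L(1) L2_scale[OF L(2)]] fourier_scale by simp
    then show ?thesis
      using has_sum_add[OF fourier_product[OF tL sD tL] has_sum_cmult_right[OF fourier_product[OF tL sd tL], of 2]] by simp
  qed
  moreover have "fourier (?t (?D d)) j * fourier (?t c) (k - j) + 2 * (fourier (?t d) j * fourier (?t (?D c)) (k - j)) = csym k j * (cf c j * cf c (k - j))" for k j
  proof -
    have cd: "cf d j = - cf c j / of_int \<bar>j\<bar>"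
    proof -
      have "d i = - c i / \<bar>of_int i\<bar>" for i using c0 by (simp add: d_def)
      then show ?thesis by (simp add: cf_def complex_eq_iff Re_divide_of_real Im_divide_of_real field_simps flip: of_int_abs)
    qed
    show ?thesis
      by (simp add: ft c0 d0 Dz cf_deriv cd csym_def) (simp add: field_simps cf_def)
  qed
  ultimately have "fourier h k = conv c c k" for k unfolding conv_def by (metis (no_types, lifting) has_sum_cong infsumI)
  then have ch: "coef h k = rc (conv c c) k" if "k \<noteq> 0" for k
    using coef_fourier[OF hL that] by (simp add: rc_def)
  have "galerkin_nonlinearity (-2) N f = proj N h"
    unfolding galerkin_nonlinearity_def Let_def v unfolding g deriv_trig h_def by (simp add: mult.assoc)
  also have "\<dots> = (\<lambda>x. \<Sum>k\<in>modes N. rc (conv c c) k * ebasis k x)"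
    unfolding proj_def by (intro ext sum.cong refl) (auto simp: ch modes_def)
  finally show ?thesis by (simp add: c_def)
qed

lemma trig_poly_eq_iff:
  "(\<forall>x. (\<Sum>k\<in>modes N. a k * ebasis k x) = (\<Sum>k\<in>modes N. c k * ebasis k x)) \<longleftrightarrow> (\<forall>k\<in>modes N. a k = c k)"
proof
  assume "\<forall>x. (\<Sum>k\<in>modes N. a k * ebasis k x) = (\<Sum>k\<in>modes N. c k * ebasis k x)"
  then have "(\<lambda>x. \<Sum>k\<in>modes N. a k * ebasis k x) = (\<lambda>x. \<Sum>k\<in>modes N. c k * ebasis k x)" by auto
  then have "coef (\<lambda>x. \<Sum>k\<in>modes N. a k * ebasis k x) l = coef (\<lambda>x. \<Sum>k\<in>modes N. c k * ebasis k x) l" for l by simp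
  then have "(if l \<in> modes N then a l else 0) = (if l \<in> modes N then c l else 0)" for l by (simp add: coef_trig_poly)
  then show "\<forall>k\<in>modes N. a k = c k" by (metis (full_types))
qed auto

abbreviation galerkin_rhs :: "real \<Rightarrow> (int \<Rightarrow> real) \<Rightarrow> nat \<Rightarrow> (real \<Rightarrow> real) \<Rightarrow>
    (int \<Rightarrow> real \<Rightarrow> real) \<Rightarrow> (real \<Rightarrow> real \<Rightarrow> real) \<Rightarrow> real \<Rightarrow> real \<Rightarrow> real" where
  "galerkin_rhs \<nu> b N g X f t x \<equiv> proj N g x
      + (LBINT s:{0..t}. \<nu> * deriv (deriv (f s)) x + galerkin_nonlinearity (-2) N (f s) x)
      + (\<Sum>k\<in>modes N. b k * X k t * ebasis k x)"

text \<open>Mode by mode, subtracting \<open>b k * X k\<close> turns the integrated equation into an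
  ordinary differential equation, to which \<open>integrated_iff_mild\<close> applies. The
  subtracted noise returns as the Wiener integral in its form after integration by parts.\<close>

lemma galerkin_iff_mild:
  fixes f :: "real \<Rightarrow> real \<Rightarrow> real" and X :: "int \<Rightarrow> real \<Rightarrow> real"
  assumes m: "m \<ge> 1" and nu: "\<nu> > 0" and T: "T \<ge> 0"
    and f: "\<And>t. t \<in> {0..T} \<Longrightarrow> f t \<in> trig_span N" and fc: "continuous_on {0..T} (\<lambda>t. emb m (f t))"
    and g: "g \<in> Hdot m" and X: "\<And>k. k \<in> modes N \<Longrightarrow> continuous_on {0..T} (X k)"
    and z: "\<And>k t. k \<in> modes N \<Longrightarrow> t \<in> {0..T} \<Longrightarrow>
      hnth (z t) k = \<bar>of_int k\<bar> ^ m * b k * (X k t - \<nu> * (of_int k)\<^sup>2 * duhamel (\<nu> * (of_int k)\<^sup>2) (X k) t)"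
  shows "(\<forall>t\<in>{0..T}. \<forall>x. f t x = galerkin_rhs \<nu> b N g X f t x)
    \<longleftrightarrow> mild_eq \<nu> (\<lambda>x. hproj N (Q m x x)) (\<lambda>t. hproj N (hheat \<nu> t (emb m g) + z t)) T (\<lambda>t. emb m (f t))"
proof -
  define y where "y t = emb m (f t)" for t
  define c where "c k t = coef (f t) k" for k t
  define R where "R k t = rc (conv (coef (f t)) (coef (f t))) k" for k t
  have fH: "f t \<in> Hdot m" if "t \<in> {0..T}" for t using trig_span_Hdot[OF f[OF that]] .
  have yc: "continuous_on {0..T} y" using fc by (simp add: y_def[abs_def])
  interpret Q: bounded_bilinear "Q m" by (rule bounded_bilinear_Q[OF m])
  have Qc: "continuous_on {0..T} (\<lambda>t. Q m (y t) (y t))" by (intro Q.continuous_on yc)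
  have hy: "hnth (y t) k = \<bar>of_int k\<bar> ^ m * c k t" if "t \<in> {0..T}" for t k
    unfolding y_def c_def by (rule hnth_emb[OF fH[OF that]])
  have hQ: "hnth (Q m (y t) (y t)) k = \<bar>of_int k\<bar> ^ (m - 1) * R k t" if "t \<in> {0..T}" for t k
    unfolding hnth_Q[OF m] Qseq_def R_def y_def coef_emb_fun[OF fH[OF that]] ..
  have cc: "continuous_on {0..T} (c k)" if "k \<in> modes N" for k
    by (rule continuous_on_eq[where f="\<lambda>t. hnth (y t) k / \<bar>of_int k\<bar> ^ m"])
      (use that in \<open>auto simp: hy modes_def intro!: continuous_intros yc\<close>)
  have Rc: "continuous_on {0..T} (R k)" if "k \<in> modes N" for k
    by (rule continuous_on_eq[where f="\<lambda>t. hnth (Q m (y t) (y t)) k / \<bar>of_int k\<bar> ^ (m - 1)"])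
      (use that in \<open>auto simp: hQ modes_def intro!: continuous_intros Qc\<close>)
  let ?M = "\<lambda>t. hproj N (hheat \<nu> t (emb m g) + z t) + Duh \<nu> (\<lambda>s. hproj N (Q m (y s) (y s))) t"
  let ?D = "Duh \<nu> (\<lambda>s. hproj N (Q m (y s) (y s)))"
  let ?l = "\<lambda>k::int. \<nu> * (of_int k)\<^sup>2 :: real"
  have rhs: "galerkin_rhs \<nu> b N g X f t x
    = (\<Sum>k\<in>modes N. (coef g k + integral {0..t} (\<lambda>s. R k s - ?l k * c k s) + b k * X k t) * ebasis k x)" if t: "t \<in> {0..T}" for t x
  proof -
    have sub: "{0..t} \<subseteq> {0..T}" using t by auto
    have int0: "set_integrable lborel {0..t} (\<lambda>s. R k s - ?l k * c k s)" if "k \<in> modes N" for k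
      by (intro borel_integrable_atLeastAtMost' continuous_intros continuous_on_subset[OF Rc sub] continuous_on_subset[OF cc sub] that)
    then have int: "set_integrable lborel {0..t} (\<lambda>s. (R k s - ?l k * c k s) * ebasis k x)" if "k \<in> modes N" for k
      using that by (intro set_integrable_mult_left)
    have eq: "\<nu> * deriv (deriv (f s)) x + galerkin_nonlinearity (-2) N (f s) x = (\<Sum>k\<in>modes N. (R k s - ?l k * c k s) * ebasis k x)" if "s \<in> {0..t}" for s
    proof -
      have s: "s \<in> {0..T}" using that t by auto
      have "deriv (deriv (f s)) x = (\<Sum>k\<in>modes N. - ((of_int k)\<^sup>2 * coef (f s) k) * ebasis k x)"
        by (subst trig_spanE(1)[OF f[OF s]]) (simp only: deriv2_trig)
      then show ?thesis unfolding galerkin_nonlinearity_eq[OF f[OF s]]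
        by (simp add: R_def c_def sum_distrib_left algebra_simps flip: sum.distrib)
    qed
    have "(LBINT s:{0..t}. \<nu> * deriv (deriv (f s)) x + galerkin_nonlinearity (-2) N (f s) x)
      = (LBINT s:{0..t}. \<Sum>k\<in>modes N. (R k s - ?l k * c k s) * ebasis k x)"
      by (rule set_lebesgue_integral_cong) (auto simp: eq)
    also have "\<dots> = (\<Sum>k\<in>modes N. LBINT s:{0..t}. (R k s - ?l k * c k s) * ebasis k x)"
      unfolding set_lebesgue_integral_def scaleR_sum_right
      using int by (intro Bochner_Integration.integral_sum) (simp add: set_integrable_def)
    also have "\<dots> = (\<Sum>k\<in>modes N. integral {0..t} (\<lambda>s. R k s - ?l k * c k s) * ebasis k x)"
      by (intro sum.cong refl) (simp add: set_borel_integral_eq_integral(2)[OF int0])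
    finally show ?thesis unfolding proj_def by (simp add: sum.distrib distrib_right)
  qed
  have "(\<forall>t\<in>{0..T}. \<forall>x. f t x = galerkin_rhs \<nu> b N g X f t x)
    \<longleftrightarrow> (\<forall>t\<in>{0..T}. \<forall>k\<in>modes N. c k t = coef g k + integral {0..t} (\<lambda>s. R k s - ?l k * c k s) + b k * X k t)"
  proof (intro ball_cong refl)
    fix t assume t: "t \<in> {0..T}"
    have "f t x = (\<Sum>k\<in>modes N. c k t * ebasis k x)" for x unfolding c_def by (subst trig_spanE(1)[OF f[OF t]]) simp
    then show "(\<forall>x. f t x = galerkin_rhs \<nu> b N g X f t x) \<longleftrightarrow>
      (\<forall>k\<in>modes N. c k t = coef g k + integral {0..t} (\<lambda>s. R k s - ?l k * c k s) + b k * X k t)"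
      unfolding rhs[OF t] by (simp only: trig_poly_eq_iff)
  qed
  \<comment> \<open>The new unknown is \<open>c k - b k * X k\<close>; rewriting the decay term for
    it leaves \<open>b k * X k\<close> as a source.\<close>
  also have "\<dots> \<longleftrightarrow> (\<forall>k\<in>modes N. \<forall>t\<in>{0..T}. c k t - b k * X k t =
      coef g k + integral {0..t} (\<lambda>s. (R k s - ?l k * (b k * X k s)) - ?l k * (c k s - b k * X k s)))"
    by (auto simp: algebra_simps)
  also have "\<dots> \<longleftrightarrow> (\<forall>k\<in>modes N. \<forall>t\<in>{0..T}. c k t - b k * X k t =
      exp (- ?l k * t) * coef g k + duhamel (?l k) (\<lambda>s. R k s - ?l k * (b k * X k s)) t)"
    by (intro ball_cong refl integrated_iff_mild continuous_intros cc Rc X)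
  also have "\<dots> \<longleftrightarrow> (\<forall>k\<in>modes N. \<forall>t\<in>{0..T}. hnth (y t) k =
      hnth (?M t) k)"
  proof (intro ball_cong refl)
    fix k t assume k: "k \<in> modes N" and t: "t \<in> {0..T}"
    have sub: "{0..t} \<subseteq> {0..T}" using t by auto
    have t0: "t \<ge> 0" using t by simp
    have k0: "\<bar>real_of_int k\<bar> ^ m \<noteq> 0" using k by (simp add: modes_def)
    have dd: "duhamel (?l k) (\<lambda>s. R k s - ?l k * (b k * X k s)) t = duhamel (?l k) (R k) t - ?l k * (b k * duhamel (?l k) (X k) t)"
      using continuous_on_subset[OF Rc[OF k] sub] continuous_on_subset[OF X[OF k] sub]
      by (subst duhamel_diff) (auto intro!: continuous_intros simp: duhamel_mult)
    have "hnth (?D t) k = \<bar>of_int k\<bar> * duhamel (?l k) (\<lambda>s. \<bar>of_int k\<bar> ^ (m - 1) * R k s) t"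
      using k by (subst hproj_Duh[OF nu t0 continuous_on_subset[OF Qc sub]])
        (auto simp: hnth_Duh[OF nu t0 continuous_on_subset[OF Qc sub]] hQ[OF subsetD[OF sub]] intro!: duhamel_cong)
    also have "\<dots> = \<bar>of_int k\<bar> ^ m * duhamel (?l k) (R k) t"
      using m by (cases m) (simp_all add: duhamel_mult)
    finally have D: "hnth (?D t) k = \<bar>of_int k\<bar> ^ m * duhamel (?l k) (R k) t" .
    have RE: "hnth (?M t) k =
      \<bar>of_int k\<bar> ^ m * (exp (- ?l k * t) * coef g k + b k * (X k t - ?l k * duhamel (?l k) (X k) t) + duhamel (?l k) (R k) t)"
      using k by (simp only: hnth_simps hnth_hproj hnth_hheat[OF nu t0] hnth_emb[OF g] D z[OF k t] if_True) (simp add: algebra_simps)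
    show "(c k t - b k * X k t = exp (- ?l k * t) * coef g k + duhamel (?l k) (\<lambda>s. R k s - ?l k * (b k * X k s)) t) \<longleftrightarrow>
      hnth (y t) k = hnth (?M t) k"
      unfolding hy[OF t] dd RE mult_cancel_left using k0 by (auto simp: algebra_simps)
  qed
  also have "\<dots> \<longleftrightarrow> (\<forall>t\<in>{0..T}. y t = ?M t)"
  proof -
    have zero: "hnth (y t) k = 0 \<and> hnth (?M t) k = 0"
      if t: "t \<in> {0..T}" and k: "k \<notin> modes N" for t k
    proof -
      have t0: "t \<ge> 0" and sub: "{0..t} \<subseteq> {0..T}" using t by auto
      show ?thesis
        using k trig_spanE(2)[OF f[OF t] k] by (simp add: hproj_Duh[OF nu t0 continuous_on_subset[OF Qc sub]] hy[OF t] c_def)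
    qed
    have "(\<forall>k\<in>modes N. hnth (y t) k = hnth (?M t) k) \<longleftrightarrow>
      y t = ?M t" if "t \<in> {0..T}" for t
    proof
      assume *: "\<forall>k\<in>modes N. hnth (y t) k = hnth (?M t) k"
      show "y t = ?M t"
      proof (rule hs_eqI)
        fix k
        show "hnth (y t) k = hnth (?M t) k"
          using * zero[OF that, of k] by (cases "k \<in> modes N") auto
      qed
    qed simp
    then show ?thesis by blast
  qed
  finally show ?thesis unfolding mild_eq_def using fc by (simp add: y_def)
qed

section \<open>Existence, uniqueness and convergence\<close>

lemma emb_cong_AE:
  assumes "AE x in lborel. f x = g x" "f \<in> L2_circle" "g \<in> L2_circle"
  shows "emb m f = emb m g"
  unfolding emb_def using coef_cong_AE[OF assms(1) L2_circleD(1)[OF assms(2)] L2_circleD(1)[OF assms(3)]] by simp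

lemma measurable_hheat:
  assumes "\<nu> > 0" "t \<ge> 0" "f \<in> borel_measurable N" shows "(\<lambda>w. hheat \<nu> t (f w)) \<in> borel_measurable N"
  unfolding borel_measurable_hs_iff hnth_hheat[OF assms(1,2)]
  by (intro allI borel_measurable_times borel_measurable_const borel_measurable_hnth assms)

lemma tr_measurable: "f \<in> borel_measurable N \<Longrightarrow> (\<lambda>w. tr n (f w)) \<in> borel_measurable N"
  by (rule borel_measurable_continuous_on[OF linear_continuous_on[OF bounded_linear_tr]])

locale problem = noise M F \<beta> b \<nu> m m_star for M :: "'a measure" and F \<beta> b \<nu> m m_star +
  fixes \<omega>0 :: "'a \<Rightarrow> real \<Rightarrow> real"
  assumes \<omega>0: "\<omega>0 \<in> measurable (F 0) (Hdot_borel m)"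
begin

lemma space_F: "t \<ge> 0 \<Longrightarrow> space (F t) = space M"
  using subalgebra_F by (simp add: subalgebra_def)

lemma \<omega>0_Hdot: "w \<in> space M \<Longrightarrow> \<omega>0 w \<in> Hdot m"
  using \<omega>0 by (simp add: measurable_Hdot_borel_iff[OF m] space_F)

lemma \<omega>0_measurable: "t \<ge> 0 \<Longrightarrow> (\<lambda>w. emb m (\<omega>0 w)) \<in> borel_measurable (F t)"
  using \<omega>0 by (intro measurable_from_subalg[OF subalgebra_F_F[of 0 t]]) (simp_all add: measurable_Hdot_borel_iff[OF m])

definition frc :: "nat option \<Rightarrow> 'a \<Rightarrow> real \<Rightarrow> hs" where
  "frc n w t = tr n (hheat \<nu> t (emb m (\<omega>0 w)) + zed t w)"

abbreviation eqn :: "nat option \<Rightarrow> 'a \<Rightarrow> real \<Rightarrow> (real \<Rightarrow> hs) \<Rightarrow> bool" where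
  "eqn n w T y \<equiv> mild_eq \<nu> (\<lambda>x. tr n (Q m x x)) (frc n w) T y"

abbreviation solves :: "nat option \<Rightarrow> (real \<Rightarrow> 'a \<Rightarrow> real \<Rightarrow> real) \<Rightarrow> 'a \<Rightarrow> bool" where
  "solves n \<omega> w \<equiv> good w \<and> (\<forall>t\<ge>0. \<omega> t w \<in> Hdot m) \<and> (\<forall>T>0. eqn n w T (\<lambda>t. emb m (\<omega> t w)))"

abbreviation drift_integral :: "real \<Rightarrow> (real \<Rightarrow> real \<Rightarrow> real) \<Rightarrow> (real \<Rightarrow> real) \<Rightarrow> bool" where
  "drift_integral t f \<equiv> Hdot_has_integral m {0..<t} (\<lambda>s. heat \<nu> (t - s) (drift (-2) (f s)))"

definition sol :: "nat option \<Rightarrow> real \<Rightarrow> 'a \<Rightarrow> hs" where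
  "sol n t w = lim (\<lambda>R. mild_sol \<nu> (tQ m n (real (Suc R))) (frc n w) t)"

lemma forced:
  assumes "good w" "T \<ge> 0" obtains \<zeta> where "forced \<nu> T m (\<lambda>t. zed t w) \<zeta>"
proof -
  obtain \<zeta> where "\<zeta> summable_on UNIV" "\<forall>k. \<forall>t\<in>{0..T}. \<bar>nz k t w\<bar> \<le> \<zeta> k" using nz_dominated[OF assms(1), of T] by blast
  then have "forced \<nu> T m (\<lambda>t. zed t w) \<zeta>"
    using assms nu m by unfold_locales (auto simp: hnth_zed zed_cont)
  then show thesis by (rule that)
qed

lemma force_eq: "forced \<nu> T m (\<lambda>t. zed t w) \<zeta> \<Longrightarrow> forced.force \<nu> (emb m (\<omega>0 w)) (\<lambda>t. zed t w) n = frc n w"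
  by (rule ext) (simp add: forced.force_def frc_def)

lemma sol_eqn:
  assumes "good w" "T \<ge> 0" shows "eqn n w T (\<lambda>t. sol n t w)"
proof -
  obtain \<zeta> where \<zeta>: "forced \<nu> T m (\<lambda>t. zed t w) \<zeta>" by (rule forced[OF assms])
  from forced.full_solution[OF \<zeta>, where n=n and ?x0.0="emb m (\<omega>0 w)"] show ?thesis unfolding sol_def force_eq[OF \<zeta>] .
qed

lemma eqn_unique:
  assumes "good w" "\<And>T. T > 0 \<Longrightarrow> eqn n w T y" "\<And>T. T > 0 \<Longrightarrow> eqn n w T y'" "t \<ge> 0"
  shows "y t = y' t"
proof -
  \<comment> \<open>The equations are given on intervals of positive length, and \<open>t\<close>
    may be 0.\<close>
  have T: "t + 1 > 0" using assms(4) by simp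
  obtain \<zeta> where \<zeta>: "forced \<nu> (t + 1) m (\<lambda>t. zed t w) \<zeta>" using forced[OF assms(1), of "t + 1"] T by auto
  from forced.full_unique[OF \<zeta>, where ?x0.0="emb m (\<omega>0 w)" and n=n and y=y and y'=y'] show ?thesis
    unfolding force_eq[OF \<zeta>] using assms(2,3)[OF T] assms(4) by auto
qed

lemma tQ_measurable: "R > 0 \<Longrightarrow> tQ m n R \<in> borel_measurable borel"
  using lipschitz_tQ[OF m, of R] lipschitz_continuous by (blast intro: borel_measurable_continuous_onI)

text \<open>Only samples of the path up to time \<open>t\<close> enter, so the value at
  \<open>t\<close> is measurable for \<open>F t\<close> itself rather than for a completion.\<close>

lemma sol_measurable:
  assumes t: "t \<ge> 0" shows "sol n t \<in> borel_measurable (F t)"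
proof -
  have "(\<lambda>w. frc n w s) \<in> borel_measurable (F t)" if s: "s \<in> {0..t}" for s
    unfolding frc_def using s t
    by (intro tr_measurable borel_measurable_add measurable_hheat nu \<omega>0_measurable
        measurable_from_subalg[OF subalgebra_F_F[of s t] zed_measurable_F]) auto
  then show ?thesis
    unfolding sol_def[abs_def] by (intro borel_measurable_lim_metric measurable_mild_sol tQ_measurable t) auto
qed

lemma sol_trig_support:
  assumes "good w" "t \<ge> 0" shows "hproj N (sol (Some N) t w) = sol (Some N) t w"
proof -
  have e: "eqn (Some N) w t (\<lambda>t. sol (Some N) t w)" by (rule sol_eqn[OF assms])
  interpret Q: bounded_bilinear "Q m" by (rule bounded_bilinear_Q[OF m])
  have "continuous_on {0..t} (\<lambda>s. Q m (sol (Some N) s w) (sol (Some N) s w))"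
    using e by (intro Q.continuous_on) (auto simp: mild_eq_def)
  from hproj_Duh[OF nu assms(2) this] have "sol (Some N) t w = hproj N (hheat \<nu> t (emb m (\<omega>0 w)) + zed t w)
    + hproj N (Duh \<nu> (\<lambda>s. Q m (sol (Some N) s w) (sol (Some N) s w)) t)"
    using e assms(2) by (simp add: mild_eq_def frc_def)
  from arg_cong[OF this, of "\<lambda>x. hnth x k" for k] show ?thesis by (intro hs_eqI) (auto split: if_splits)
qed

section \<open>The constructed solutions\<close>

definition SPDE_sol :: "real \<Rightarrow> 'a \<Rightarrow> real \<Rightarrow> real" where "SPDE_sol t w = synth m (sol None t w)"

definition Galerkin_sol :: "nat \<Rightarrow> real \<Rightarrow> 'a \<Rightarrow> real \<Rightarrow> real" where
  "Galerkin_sol N t w = (\<lambda>x. \<Sum>k\<in>modes N. hnth (sol (Some N) t w) k / \<bar>of_int k\<bar> ^ m * ebasis k x)"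

lemma Galerkin_sol_trig: "Galerkin_sol N t w \<in> trig_span N"
  unfolding Galerkin_sol_def trig_span_def by (rule rangeI)

lemma emb_Galerkin_sol: "emb m (Galerkin_sol N t w) = hproj N (sol (Some N) t w)"
  unfolding Galerkin_sol_def emb_trig hproj_def by (rule sum.cong) (auto simp: modes_def)

lemma adapted_SPDE_sol: "adapted F m SPDE_sol"
  using sol_measurable by (auto simp: adapted_def measurable_Hdot_borel_iff[OF m] SPDE_sol_def synth_Hdot[OF m] emb_synth[OF m])

lemma adapted_Galerkin_sol: "adapted F m (Galerkin_sol N)"
  unfolding adapted_def measurable_Hdot_borel_iff[OF m] emb_Galerkin_sol
  using tr_measurable[OF sol_measurable, of _ "Some N"] trig_span_Hdot[OF Galerkin_sol_trig] by auto

lemma eqn_None: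
  "mild_eq \<nu> (\<lambda>x. Q m x x) (frc None w) T y \<longleftrightarrow> continuous_on {0..T} y \<and>
    (\<forall>t\<in>{0..T}. y t = hheat \<nu> t (emb m (\<omega>0 w)) + zed t w + Duh \<nu> (\<lambda>s. Q m (y s) (y s)) t)"
  by (simp add: mild_eq_def frc_def)

text \<open>Takes an arbitrary mild solution, with its own version of the stochastic convolution, to
  the deterministic equation driven by \<open>zed\<close>, for almost every sample.\<close>

lemma mild_solution_imp_eqn:
  assumes "mild_solution M \<beta> b \<nu> (-2) m \<omega>0 \<omega>"
  shows "AE w in M. solves None \<omega> w"
proof -
  have "AE w in M. (\<forall>t\<in>{0..T}. \<omega> t w \<in> Hdot m) \<and> eqn None w T (\<lambda>t. emb m (\<omega> t w))" if T: "T > 0" for T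
  proof -
    obtain Z where c: "AE w in M. Hdot_continuous_on m {0..T} (\<lambda>t. \<omega> t w)" and Z: "stochastic_convolution M \<beta> b \<nu> m T Z"
      and J: "AE w in M. \<forall>t\<in>{0..T}. \<exists>J. drift_integral t (\<lambda>s. \<omega> s w) J \<and>
           (AE x in lborel. \<omega> t w x = heat \<nu> t (\<omega>0 w) x + J x + Z t w x)"
      using assms T unfolding mild_solution_def mild_solution_on_def by blast
    from c J stochastic_convolution_unique[OF Z T] AE_space show ?thesis
    proof eventually_elim
      case (elim w)
      have H: "\<omega> t w \<in> Hdot m" if "t \<in> {0..T}" for t using elim(1) that by (simp add: Hdot_continuous_iff)
      have cont: "continuous_on {0..T} (\<lambda>t. emb m (\<omega> t w))" using elim(1) by (simp add: Hdot_continuous_iff)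
      have "emb m (\<omega> t w) = hheat \<nu> t (emb m (\<omega>0 w)) + zed t w + Duh \<nu> (\<lambda>s. Q m (emb m (\<omega> s w)) (emb m (\<omega> s w))) t"
        if t: "t \<in> {0..T}" for t
      proof -
        have t0: "t \<ge> 0" and sub: "{0..t} \<subseteq> {0..T}" using t by auto
        obtain J where J: "drift_integral t (\<lambda>s. \<omega> s w) J"
          "AE x in lborel. \<omega> t w x = heat \<nu> t (\<omega>0 w) x + J x + Z t w x" using elim(2) t by blast
        have "J \<in> Hdot m \<and> emb m J = Duh \<nu> (\<lambda>s. Q m (emb m (\<omega> s w)) (emb m (\<omega> s w))) t"
          using J(1) sub H continuous_on_subset[OF cont sub] by (subst (asm) Hdot_has_integral_drift_iff[OF m nu t0]) auto
        moreover have "Z t w \<in> Hdot m" "emb m (Z t w) = zed t w" using elim(3) t by auto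
        moreover note h = heat_Hdot[OF nu t0 \<omega>0_Hdot[OF elim(4)]] emb_heat[OF nu t0 \<omega>0_Hdot[OF elim(4)]]
        moreover from calculation have "(\<lambda>x. heat \<nu> t (\<omega>0 w) x + J x + Z t w x) \<in> L2_circle"
          by (intro HdotD(2)[of _ m] Hdot_add) auto
        ultimately show ?thesis
          using emb_cong_AE[OF J(2), of m] HdotD(2)[OF H[OF t]] by (simp add: Hdot_add emb_add add_ac)
      qed
      with H cont show ?case by (auto simp: eqn_None)
    qed
  qed
  \<comment> \<open>The exceptional set depends on \<open>T\<close>; integer horizons suffice
    because a solution restricts to shorter intervals.\<close>
  then have "AE w in M. \<forall>n::nat. (\<forall>t\<in>{0..real (Suc n)}. \<omega> t w \<in> Hdot m) \<and> eqn None w (real (Suc n)) (\<lambda>t. emb m (\<omega> t w))"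
    unfolding AE_all_countable by simp
  with AE_good show ?thesis
  proof eventually_elim
    case (elim w)
    have ex: "\<exists>n. t \<le> real (Suc n)" for t by (meson le_Suc_eq of_nat_le_iff order_trans real_arch_simple le_refl lessI less_imp_le)
    show ?case
    proof (intro conjI allI impI elim)
      fix t :: real assume "t \<ge> 0"
      moreover obtain n where "t \<le> real (Suc n)" using ex by blast
      ultimately show "\<omega> t w \<in> Hdot m" using elim(2) by auto
    next
      fix T :: real
      obtain n where "T \<le> real (Suc n)" using ex by blast
      then show "eqn None w T (\<lambda>t. emb m (\<omega> t w))" using elim(2) mild_eq_subset by blast
    qed
  qed
qed

lemma mild_solution_SPDE_sol: "mild_solution M \<beta> b \<nu> (-2) m \<omega>0 SPDE_sol"
  unfolding mild_solution_def mild_solution_on_def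
proof (intro allI impI conjI exI[of _ "\<lambda>t w. synth m (zed t w)"] stochastic_convolution_zed)
  fix T :: real assume T: "T > 0"
  have E: "AE w in M. eqn None w T (\<lambda>t. sol None t w)" using AE_good by eventually_elim (use T in \<open>simp add: sol_eqn del: tr.simps\<close>)
  then show "AE w in M. Hdot_continuous_on m {0..T} (\<lambda>t. SPDE_sol t w)"
    by eventually_elim (simp add: Hdot_continuous_iff SPDE_sol_def synth_Hdot[OF m] emb_synth[OF m] eqn_None)
  from E AE_space show "AE w in M. \<forall>t\<in>{0..T}. \<exists>J. drift_integral t (\<lambda>s. SPDE_sol s w) J \<and>
    (AE x in lborel. SPDE_sol t w x = heat \<nu> t (\<omega>0 w) x + J x + synth m (zed t w) x)"
  proof eventually_elim
    case (elim w)
    show ?case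
    proof
      fix t assume t: "t \<in> {0..T}"
      then have t0: "t \<ge> 0" and sub: "{0..t} \<subseteq> {0..T}" by auto
      let ?J = "synth m (Duh \<nu> (\<lambda>s. Q m (sol None s w) (sol None s w)) t)"
      have c: "continuous_on {0..t} (\<lambda>s. emb m (SPDE_sol s w))"
        using elim(1) by (intro continuous_on_subset[OF _ sub]) (simp add: SPDE_sol_def emb_synth[OF m] eqn_None)
      have S: "SPDE_sol s w \<in> Hdot m" for s by (simp add: SPDE_sol_def synth_Hdot[OF m])
      note h = heat_Hdot[OF nu t0 \<omega>0_Hdot[OF elim(2)]] emb_heat[OF nu t0 \<omega>0_Hdot[OF elim(2)]]
      have "drift_integral t (\<lambda>s. SPDE_sol s w) ?J"
        by (subst Hdot_has_integral_drift_iff[OF m nu t0 S c]) (simp add: SPDE_sol_def synth_Hdot[OF m] emb_synth[OF m])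
      moreover have "AE x in lborel. SPDE_sol t w x = heat \<nu> t (\<omega>0 w) x + ?J x + synth m (zed t w) x"
      proof (rule Hdot_cong_AE)
        show "emb m (SPDE_sol t w) = emb m (\<lambda>x. heat \<nu> t (\<omega>0 w) x + ?J x + synth m (zed t w) x)"
          using elim(1) t by (simp add: Hdot_add emb_add h synth_Hdot[OF m] emb_synth[OF m] SPDE_sol_def eqn_None)
      qed (auto intro!: Hdot_add h S synth_Hdot[OF m])
      ultimately show "\<exists>J. drift_integral t (\<lambda>s. SPDE_sol s w) J \<and>
        (AE x in lborel. SPDE_sol t w x = heat \<nu> t (\<omega>0 w) x + J x + synth m (zed t w) x)" by blast
    qed
  qed
qed

lemma galerkin_iff_eqn:
  assumes w: "good w" "w \<in> space M" and T: "T \<ge> 0"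
    and f: "\<And>t. t \<in> {0..T} \<Longrightarrow> f t \<in> trig_span N" and fc: "continuous_on {0..T} (\<lambda>t. emb m (f t))"
  shows "(\<forall>t\<in>{0..T}. \<forall>x. f t x = galerkin_rhs \<nu> b N (\<omega>0 w) (\<lambda>k t. \<beta> k t w) f t x)
    \<longleftrightarrow> eqn (Some N) w T (\<lambda>t. emb m (f t))"
proof -
  have z: "hnth (zed t w) k = \<bar>of_int k\<bar> ^ m * b k * (\<beta> k t w - \<nu> * (of_int k)\<^sup>2 * duhamel (\<nu> * (of_int k)\<^sup>2) (\<lambda>s. \<beta> k s w) t)"
    if "t \<in> {0..T}" for k t using that by (simp add: hnth_zed[OF w(1)] nz_eq[OF w(1)] amp_def)
  have frc: "frc (Some N) w = (\<lambda>t. hproj N (hheat \<nu> t (emb m (\<omega>0 w)) + zed t w))" by (simp add: fun_eq_iff frc_def)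
  have k: "k \<in> modes N \<Longrightarrow> k \<noteq> 0" for k by auto
  show ?thesis
    unfolding frc tr.simps by (rule galerkin_iff_mild[OF m nu T f fc \<omega>0_Hdot[OF w(2)] path_cont[OF w(1) k] z])
qed

lemma galerkin_solution_imp_eqn:
  assumes "galerkin_solution M \<beta> b \<nu> (-2) m \<omega>0 N \<omega>"
  shows "AE w in M. solves (Some N) \<omega> w"
  using assms[unfolded galerkin_solution_def] AE_good AE_space
proof eventually_elim
  case (elim w)
  have H: "\<forall>t\<ge>0. \<omega> t w \<in> Hdot m" and c: "continuous_on {0..} (\<lambda>t. emb m (\<omega> t w))"
    using elim(1) by (auto simp: Hdot_continuous_iff)
  have "eqn (Some N) w T (\<lambda>t. emb m (\<omega> t w))" if "T > 0" for T
    using that elim(1) by (intro galerkin_iff_eqn[OF elim(2,3), THEN iffD1] continuous_on_subset[OF c]) auto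
  with H elim(2) show ?case by blast
qed

lemma galerkin_solution_Galerkin_sol: "galerkin_solution M \<beta> b \<nu> (-2) m \<omega>0 N (Galerkin_sol N)"
  unfolding galerkin_solution_def using AE_good AE_space
proof eventually_elim
  case (elim w)
  have e: "emb m (Galerkin_sol N t w) = sol (Some N) t w" if "t \<ge> 0" for t
    using sol_trig_support[OF elim(1) that] by (simp add: emb_Galerkin_sol)
  note s = Galerkin_sol_trig
  have eqn: "eqn (Some N) w T (\<lambda>t. emb m (Galerkin_sol N t w))" if "T \<ge> 0" for T
  proof -
    have "continuous_on {0..T} (\<lambda>t. emb m (Galerkin_sol N t w))"
      by (rule continuous_on_eq[where f="\<lambda>t. sol (Some N) t w"]) (use sol_eqn[OF elim(1) that] e in \<open>auto simp: mild_eq_def\<close>)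
    moreover have "Duh \<nu> (\<lambda>s. hproj N (Q m (emb m (Galerkin_sol N s w)) (emb m (Galerkin_sol N s w)))) t
      = Duh \<nu> (\<lambda>s. hproj N (Q m (sol (Some N) s w) (sol (Some N) s w))) t" if "t \<ge> 0" for t
      by (rule Duh_cong[OF that]) (simp add: e)
    ultimately show ?thesis using sol_eqn[OF elim(1) that, of "Some N"] by (simp add: mild_eq_def e)
  qed
  then have c: "continuous_on {0..T} (\<lambda>t. emb m (Galerkin_sol N t w))" if "T \<ge> 0" for T
    using that by (simp add: mild_eq_def)
  \<comment> \<open>Continuity on the half-line is local: at \<open>t\<close> it can be read off
    \<open>[0, t + 1]\<close>.\<close>
  have cont: "continuous_on {0..} (\<lambda>t. emb m (Galerkin_sol N t w))"
    unfolding continuous_on_eq_continuous_within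
  proof
    fix t :: real assume t: "t \<in> {0..}"
    then have "continuous (at t within {0..t + 1}) (\<lambda>t. emb m (Galerkin_sol N t w))"
      using c[of "t + 1"] by (simp add: continuous_on_eq_continuous_within)
    moreover have "at t within {0..} = at t within {0..t + 1}"
      by (rule at_within_nhd[of t "{..<t + 1}"]) auto
    ultimately show "continuous (at t within {0..}) (\<lambda>t. emb m (Galerkin_sol N t w))" by (simp add: continuous_within)
  qed
  have eqx: "\<forall>t\<ge>0. \<forall>x. Galerkin_sol N t w x = galerkin_rhs \<nu> b N (\<omega>0 w) (\<lambda>k t. \<beta> k t w) (\<lambda>s. Galerkin_sol N s w) t x"
  proof (intro allI impI)
    fix t x :: real assume t: "t \<ge> 0"
    from galerkin_iff_eqn[OF elim t s c[OF t], THEN iffD2, OF eqn[OF t]] t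
    show "Galerkin_sol N t w x = galerkin_rhs \<nu> b N (\<omega>0 w) (\<lambda>k t. \<beta> k t w) (\<lambda>s. Galerkin_sol N s w) t x" by auto
  qed
  show ?case
    unfolding Hdot_continuous_iff using cont eqx s trig_span_Hdot[OF s] by (intro conjI allI impI ballI) blast+
qed

text \<open>Almost surely both paths solve the same deterministic equation on every interval, and
  \<open>emb\<close> is injective up to null sets.\<close>

lemma indistinguishable:
  assumes "AE w in M. solves n \<omega> w"
    and "AE w in M. solves n \<omega>' w"
  shows "indistinguishable M \<omega> \<omega>'"
  unfolding indistinguishable_def using assms
proof eventually_elim
  case (elim w)
  have "emb m (\<omega> t w) = emb m (\<omega>' t w)" if "t \<ge> 0" for t
    by (rule eqn_unique[where y="\<lambda>t. emb m (\<omega> t w)" and y'="\<lambda>t. emb m (\<omega>' t w)"]) (use elim that in auto)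
  then show ?case using elim Hdot_cong_AE by blast
qed

text \<open>Arbitrary solutions are covered because almost surely they solve the deterministic
  equations. The exceptional sets for the countably many \<open>N\<close> are united, and
  \<open>full_convergence\<close> applies path by path.\<close>

lemma convergence:
  assumes w: "mild_solution M \<beta> b \<nu> (-2) m \<omega>0 \<omega>"
    and wN: "\<And>N. N \<ge> 1 \<Longrightarrow> galerkin_solution M \<beta> b \<nu> (-2) m \<omega>0 N (\<omega>N N)" and T: "T > 0"
  shows "AE w in M. (\<lambda>N. X_norm m T (\<lambda>t x. \<omega>N N t w x - \<omega> t w x)) \<longlonglongrightarrow> 0"
proof -
  have "AE w in M. \<forall>N. N \<ge> 1 \<longrightarrow> (\<forall>t\<ge>0. \<omega>N N t w \<in> Hdot m) \<and> eqn (Some N) w T (\<lambda>t. emb m (\<omega>N N t w))"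
    unfolding AE_all_countable
  proof
    fix N :: nat
    show "AE w in M. N \<ge> 1 \<longrightarrow> (\<forall>t\<ge>0. \<omega>N N t w \<in> Hdot m) \<and> eqn (Some N) w T (\<lambda>t. emb m (\<omega>N N t w))"
    proof (cases "N \<ge> 1")
      case True
      from galerkin_solution_imp_eqn[OF wN[OF True]] show ?thesis by eventually_elim (use T in auto)
    qed simp
  qed
  with mild_solution_imp_eqn[OF w] show ?thesis
  proof eventually_elim
    case (elim w)
    obtain \<zeta> where \<zeta>: "forced \<nu> T m (\<lambda>t. zed t w) \<zeta>" using forced[of w T] elim(1) T by auto
    show ?case
    proof (rule tendsto_zero_ennreal)
      fix r :: real assume r: "r > 0"
      have "\<exists>N0. \<forall>N\<ge>N0. \<forall>t\<in>{0..T}. norm (emb m (\<omega>N N t w) - emb m (\<omega> t w)) < r / 2"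
        by (rule forced.full_convergence[OF \<zeta>, where M=1 and ?x0.0="emb m (\<omega>0 w)", unfolded force_eq[OF \<zeta>]]) (use elim T r in auto)
      then obtain N0 where N0: "\<And>N t. N \<ge> N0 \<Longrightarrow> t \<in> {0..T} \<Longrightarrow> norm (emb m (\<omega>N N t w) - emb m (\<omega> t w)) < r / 2" by blast
      have "X_norm m T (\<lambda>t x. \<omega>N N t w x - \<omega> t w x) < ennreal r" if N: "N \<ge> max 1 N0" for N
      proof -
        have "X_norm m T (\<lambda>t x. \<omega>N N t w x - \<omega> t w x) \<le> ennreal (r / 2)"
          unfolding X_norm_def
        proof (rule SUP_least)
          fix t assume t: "t \<in> {0..T}"
          then show "ennreal (Hdot_norm m (\<lambda>x. \<omega>N N t w x - \<omega> t w x)) \<le> ennreal (r / 2)"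
            using elim N N0[of N t] by (subst Hdot_norm_diff) (auto intro!: ennreal_leI)
        qed
        also have "\<dots> < ennreal r" using r by (simp add: ennreal_less_iff)
        finally show ?thesis .
      qed
      then show "\<forall>\<^sub>F N in sequentially. X_norm m T (\<lambda>t x. \<omega>N N t w x - \<omega> t w x) < ennreal r"
        unfolding eventually_sequentially by blast
    qed
  qed
qed

end

theorem theorem2p6:
  fixes M :: "'a measure" and F :: "real \<Rightarrow> 'a measure"
    and \<beta> :: "int \<Rightarrow> real \<Rightarrow> 'a \<Rightarrow> real" and b :: "int \<Rightarrow> real"
    and \<nu> a :: real and m m_star :: nat and \<omega>0 :: "'a \<Rightarrow> real \<Rightarrow> real"
  assumes "filtered_prob_space M F"
    and "independent_brownian_motions M F \<beta>"
    and "\<nu> > 0" and "m \<ge> 1" and "a = -2"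
    and "m_star > m" and "B_noise b m_star < \<infinity>"
    and "\<omega>0 \<in> measurable (F 0) (Hdot_borel m)"
  shows "(\<exists>\<omega>. adapted F m \<omega> \<and> mild_solution M \<beta> b \<nu> a m \<omega>0 \<omega> \<and>
            (\<forall>\<omega>'. adapted F m \<omega>' \<and> mild_solution M \<beta> b \<nu> a m \<omega>0 \<omega>' \<longrightarrow>
               indistinguishable M \<omega>' \<omega>))
       \<and> (\<forall>N\<ge>1. \<exists>\<omega>N. adapted F m \<omega>N \<and> galerkin_solution M \<beta> b \<nu> a m \<omega>0 N \<omega>N \<and>
            (\<forall>\<omega>'. adapted F m \<omega>' \<and> galerkin_solution M \<beta> b \<nu> a m \<omega>0 N \<omega>' \<longrightarrow>
               indistinguishable M \<omega>' \<omega>N))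
       \<and> (\<forall>\<omega> \<omega>N. adapted F m \<omega> \<and> mild_solution M \<beta> b \<nu> a m \<omega>0 \<omega> \<and>
            (\<forall>N\<ge>1. adapted F m (\<omega>N N) \<and> galerkin_solution M \<beta> b \<nu> a m \<omega>0 N (\<omega>N N)) \<longrightarrow>
            (\<forall>T>0. AE w in M.
               (\<lambda>N. X_norm m T (\<lambda>t x. \<omega>N N t w x - \<omega> t w x)) \<longlonglongrightarrow> 0))"
proof -
  interpret problem M F \<beta> b \<nu> m m_star \<omega>0 by unfold_locales (fact assms)+
  show ?thesis
    unfolding \<open>a = -2\<close>
  proof (intro conjI allI impI)
    show "\<exists>\<omega>. adapted F m \<omega> \<and> mild_solution M \<beta> b \<nu> (-2) m \<omega>0 \<omega> \<and>
        (\<forall>\<omega>'. adapted F m \<omega>' \<and> mild_solution M \<beta> b \<nu> (-2) m \<omega>0 \<omega>' \<longrightarrow> indistinguishable M \<omega>' \<omega>)"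
      using adapted_SPDE_sol mild_solution_SPDE_sol indistinguishable[OF mild_solution_imp_eqn mild_solution_imp_eqn] by blast
    show "\<exists>\<omega>N. adapted F m \<omega>N \<and> galerkin_solution M \<beta> b \<nu> (-2) m \<omega>0 N \<omega>N \<and>
        (\<forall>\<omega>'. adapted F m \<omega>' \<and> galerkin_solution M \<beta> b \<nu> (-2) m \<omega>0 N \<omega>' \<longrightarrow> indistinguishable M \<omega>' \<omega>N)" for N
      using adapted_Galerkin_sol galerkin_solution_Galerkin_sol indistinguishable[OF galerkin_solution_imp_eqn galerkin_solution_imp_eqn] by blast
  qed (use convergence in blast)
qed

end
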